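(* Let $\mathrm{AugVirtDblCat}_{\mathrm u}$ be the 2-category of augmented virtual double categories that have all horizontal units, all functors between them and all transformations, and let $\mathrm{VirtDblCat}_{\mathrm u}$ be the 2-category of virtual double categories that have all horizontal units, normal functors and all transformations. The strict 2-functor $U\colon \mathrm{AugVirtDblCat}_{\mathrm u}\to \mathrm{VirtDblCat}_{\mathrm u}$ that maps an augmented virtual double category $\mathcal K$ to the virtual double category $U(\mathcal K)$ of its objects, morphisms and unary cells, together with the assignment $\mathcal K\mapsto N(\mathcal K)$ on objects described in the context, extend to a strict 2-equivalence $\mathrm{AugVirtDblCat}_{\mathrm u}\simeq \mathrm{VirtDblCat}_{\mathrm u}$. That is, $\mathcal K\mapsto N(\mathcal K)$ extends to a strict 2-functor $N\colon \mathrm{VirtDblCat}_{\mathrm u}\to\mathrm{AugVirtDblCat}_{\mathrm u}$ and there are invertible 2-natural transformations $U\circ N\cong \mathrm{id}$ and $\mathrm{id}\cong N\circ U$.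
   Context: **Augmented virtual double categories.** An augmented virtual double category $\mathcal K$ consists of: a class of objects; a category $\mathcal K_{\mathrm v}$ with these objects, whose morphisms $f\colon A\to C$ are called vertical; a directed graph $\mathcal K_{\mathrm h}$ with these objects as vertices, whose edges $J\colon A\nrightarrow B$ are called horizontal morphisms; and a class of cells. Each cell $\phi$ has a horizontal source, which is a (possibly empty) path $\underline J=(J_1,\dots,J_n)\colon A_0\nrightarrow A_n$ of horizontal morphisms; a horizontal target, which is a path $\underline K\colon C\nrightarrow D$ of length $|\underline K|\le 1$; a vertical source $f\colon A_0\to C$; and a vertical target $g\colon A_n\to D$. We write $\phi\colon\underline J\Rightarrow\underline K$. The empty path at $A$ is written $(A)$ (so $\underline K=(C)$ forces $C=D$), and $\frown$ denotes concatenation of paths. For each $n\ge 1$, each path of cells $\phi_i\colon\underline J_i\Rightarrow\underline K_i$ ($1\le i\le n$) with vertical source $f_{i-1}$ and vertical target $f_i$, and each cell $\psi\colon\underline K_1\frown\dots\frown\underline K_n\Rightarrow\underline L$ with vertical source $h$ and target $k$, there is a vertical composite $\psi\circ(\phi_1,\dots,\phi_n)\colon\underline J_1\frown\dots\frown\underline J_n\Rightarrow\underline L$ with vertical source $h\circ f_0$ and target $k\circ f_n$. There are horizontal identity cells $\mathrm{id}_J\colon J\Rightarrow J$ (with identities as vertical source and target) and vertical identity cells $\mathrm{id}_f\colon (A)\Rightarrow(C)$ for $f\colon A\to C$ (with vertical source and target $f$), with $\mathrm{id}_h\circ(\mathrm{id}_f)=\mathrm{id}_{h\circ f}$; write $\mathrm{id}_A:=\mathrm{id}_{\mathrm{id}_A}$.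 Axioms, whenever they make sense (for associativity: whenever both sides make sense): $\chi\circ(\psi_1\circ(\phi_{11},\dots,\phi_{1m_1}),\dots,\psi_n\circ(\phi_{n1},\dots,\phi_{nm_n}))=(\chi\circ(\psi_1,\dots,\psi_n))\circ(\phi_{11},\dots,\phi_{nm_n})$; $\mathrm{id}_C\circ(\phi)=\phi$; $\mathrm{id}_K\circ(\phi)=\phi$; $\phi\circ(\mathrm{id}_A)=\phi$; $\phi\circ(\mathrm{id}_{J_1},\dots,\mathrm{id}_{J_n})=\phi$; and $\psi\circ(\phi_1,\dots,\phi_i,\mathrm{id}_{f_i},\phi_{i+1},\dots,\phi_n)=\psi\circ(\phi_1,\dots,\phi_n)$ for $0\le i\le n$. A cell is unary (resp. nullary) if its horizontal target has length 1 (resp. 0), and horizontal if its vertical source and target are identities. Whiskering: $h\circ(\phi_1,\dots,\phi_n):=\mathrm{id}_h\circ(\phi_1,\dots,\phi_n)$ and $\psi\circ f:=\psi\circ(\mathrm{id}_f)$. **Functors and transformations.** A functor $F\colon\mathcal K\to\mathcal L$ consists of a functor $F\colon\mathcal K_{\mathrm v}\to\mathcal L_{\mathrm v}$ and assignments sending $J\colon A\nrightarrow B$ to $FJ\colon FA\nrightarrow FB$ and each cell $\phi\colon(J_1,\dots,J_n)\Rightarrow\underline K$ with vertical source $f$ and target $g$ to a cell $F\phi\colon(FJ_1,\dots,FJ_n)\Rightarrow F\underline K$ with vertical source $Ff$ and target $Fg$, strictly preserving vertical composition and identity cells. A transformation $\xi\colon F\Rightarrow G$ consists of a natural transformation $\xi\colon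 F_{\mathrm v}\Rightarrow G_{\mathrm v}$ and, for each $J\colon A\nrightarrow B$, a cell $\xi_J\colon FJ\Rightarrow GJ$ with vertical source $\xi_A$ and target $\xi_B$, such that $G\phi\circ\xi_{\underline J}=\xi_{\underline K}\circ F\phi$ for all $\phi\colon\underline J\Rightarrow\underline K$, where $\xi_{\underline J}=(\xi_{J_1},\dots,\xi_{J_n})$ for non-empty paths and $\xi_{(A)}=\mathrm{id}_{\xi_A}$. With the evident compositions these form a 2-category $\mathrm{AugVirtDblCat}$. **Virtual double categories.** A virtual double category is an augmented virtual double category whose only nullary cells are the vertical identity cells $\mathrm{id}_f$ (equivalently: only unary cells are considered). A functor $F\colon\mathcal K\to\mathcal L$ of virtual double categories is a functor between $\mathcal K$ and $\mathcal L$ regarded as augmented virtual double categories, that is, it consists of a functor $F\colon\mathcal K_{\mathrm v}\to\mathcal L_{\mathrm v}$ and assignments sending each $J\colon A\nrightarrow B$ to $FJ\colon FA\nrightarrow FB$ and each cell $\phi\colon(J_1,\dots,J_n)\Rightarrow\underline K$ with vertical source $f$ and target $g$ to a cell $F\phi\colon(FJ_1,\dots,FJ_n)\Rightarrow F\underline K$ with vertical source $Ff$ and target $Fg$, strictly preserving vertical composition and identity cells. A transformation $\xi\colon F\Rightarrow G$ of functors of virtual double categories is a transformation of functors between augmented virtual double categories, that is, it consists of a natural transformation $\xi\colon F_{\mathrm v}\Rightarrow G_{\mathrm v}$ and, for each $J\colon A\nrightarrow B$, a cell $\xi_J\colon FJ\Rightarrow GJ$ with vertical source $\xi_A$ and target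 $\xi_B$, such that $G\phi\circ\xi_{\underline J}=\xi_{\underline K}\circ F\phi$ for all cells $\phi\colon\underline J\Rightarrow\underline K$, where $\xi_{\underline J}=(\xi_{J_1},\dots,\xi_{J_n})$ for non-empty paths and $\xi_{(A)}=\mathrm{id}_{\xi_A}$. **Horizontal units.** In an augmented virtual double category, an object $A$ has a horizontal unit $I_A\colon A\nrightarrow A$ if there is a horizontal cell $\varepsilon\colon I_A\Rightarrow(A)$ that is cartesian: every cell $\chi\colon\underline H\Rightarrow(A)$, with $\underline H\colon X_0\nrightarrow X_n$ and with vertical source $h\colon X_0\to A$ and target $k\colon X_n\to A$, factors as $\chi=\varepsilon\circ\phi$ for a unique cell $\phi\colon\underline H\Rightarrow I_A$ with vertical source $h$ and target $k$. In a virtual double category, $A$ has a horizontal unit $I_A\colon A\nrightarrow A$ if there is a horizontal cell $\eta_A\colon(A)\Rightarrow I_A$ that is cocartesian: every unary cell $\phi\colon\underline J\frown\underline H\Rightarrow K$, where $\underline J$ is a path ending at $A$ and $\underline H$ a path starting at $A$, factors as $\phi=\phi'\circ(\mathrm{id},\dots,\mathrm{id},\eta_A,\mathrm{id},\dots,\mathrm{id})$ for a unique cell $\phi'\colon\underline J\frown(I_A)\frown\underline H\Rightarrow K$ with the same vertical source and target as $\phi$. A functor of virtual double categories is normal if it preserves the cocartesian cells that define horizontal units. **The assignment $N$.** Let $\mathcal K$ be a virtual double category with all horizontal units, and choose a cocartesian cell $\eta_A\colon(A)\Rightarrow I_A$ for each object $A$. $N(\mathcal K)$ has the objects, vertical and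 horizontal morphisms and unary cells of $\mathcal K$; its nullary cells $\underline J\Rightarrow(C)$ with vertical source $f$ and target $g$ are the cells $\underline J\Rightarrow I_C$ of $\mathcal K$ with vertical source $f$ and target $g$. The composite $\psi\circ(\phi_1,\dots,\phi_n)$ in $N(\mathcal K)$, where $\phi_i\colon\underline J_i\Rightarrow\underline K_i$ and $\underline K_i\colon C_{i-1}\nrightarrow C_i$, is the composite $\psi'\circ(\phi_1,\dots,\phi_n)$ in $\mathcal K$, where $\psi'$ is the unique factorisation in $\psi=\psi'\circ(\eta_{\phi_1},\dots,\eta_{\phi_n})$ with $\eta_{\phi_i}:=\eta_{C_{i-1}}$ if $\phi_i$ is nullary with horizontal target $(C_{i-1})$, and $\eta_{\phi_i}:=\mathrm{id}_{K_i}$ if $\phi_i$ is unary with horizontal target $K_i$. Horizontal identity cells of $N(\mathcal K)$ are those of $\mathcal K$; the vertical identity cell of $f\colon A\to C$ in $N(\mathcal K)$ is $\eta_C\circ f$. *)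

theory Defs
  imports "HOL-Library.FuncSet"
begin

record ('o, 'm, 't) two_cat =
  Ob :: "'o set"
  Arr :: "'m set"
  Two :: "'t set"
  src1 :: "'m \<Rightarrow> 'o"
  trg1 :: "'m \<Rightarrow> 'o"
  src2 :: "'t \<Rightarrow> 'm"
  trg2 :: "'t \<Rightarrow> 'm"
  id1 :: "'o \<Rightarrow> 'm"
  comp1 :: "'m \<Rightarrow> 'm \<Rightarrow> 'm"
  id2 :: "'m \<Rightarrow> 't"
  vcomp2 :: "'t \<Rightarrow> 't \<Rightarrow> 't"
  hcomp2 :: "'t \<Rightarrow> 't \<Rightarrow> 't"

text \<open>All compositions are written in applicative order: \<^term>\<open>comp1 C g f\<close> is \<open>g\<close> after \<open>f\<close>,
  and likewise for \<^const>\<open>vcomp2\<close> and \<^const>\<open>hcomp2\<close>.\<close>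

locale two_category =
  fixes C :: "('o, 'm, 't) two_cat"
  assumes arr_ends: "f \<in> Arr C \<Longrightarrow> src1 C f \<in> Ob C \<and> trg1 C f \<in> Ob C"
    and id1_arr: "A \<in> Ob C \<Longrightarrow> id1 C A \<in> Arr C \<and> src1 C (id1 C A) = A \<and> trg1 C (id1 C A) = A"
    and comp1_arr: "\<lbrakk>f \<in> Arr C; g \<in> Arr C; trg1 C f = src1 C g\<rbrakk> \<Longrightarrow>
      comp1 C g f \<in> Arr C \<and> src1 C (comp1 C g f) = src1 C f \<and> trg1 C (comp1 C g f) = trg1 C g"
    and comp1_assoc: "\<lbrakk>f \<in> Arr C; g \<in> Arr C; h \<in> Arr C; trg1 C f = src1 C g; trg1 C g = src1 C h\<rbrakk> \<Longrightarrow>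
      comp1 C h (comp1 C g f) = comp1 C (comp1 C h g) f"
    and comp1_id: "f \<in> Arr C \<Longrightarrow>
      comp1 C f (id1 C (src1 C f)) = f \<and> comp1 C (id1 C (trg1 C f)) f = f"
    and two_ends: "a \<in> Two C \<Longrightarrow> src2 C a \<in> Arr C \<and> trg2 C a \<in> Arr C \<and>
      src1 C (src2 C a) = src1 C (trg2 C a) \<and> trg1 C (src2 C a) = trg1 C (trg2 C a)"
    and id2_two: "f \<in> Arr C \<Longrightarrow> id2 C f \<in> Two C \<and> src2 C (id2 C f) = f \<and> trg2 C (id2 C f) = f"
    and vcomp2_two: "\<lbrakk>a \<in> Two C; b \<in> Two C; trg2 C a = src2 C b\<rbrakk> \<Longrightarrow>
      vcomp2 C b a \<in> Two C \<and> src2 C (vcomp2 C b a) = src2 C a \<and> trg2 C (vcomp2 C b a) = trg2 C b"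
    and vcomp2_assoc: "\<lbrakk>a \<in> Two C; b \<in> Two C; c \<in> Two C; trg2 C a = src2 C b; trg2 C b = src2 C c\<rbrakk> \<Longrightarrow>
      vcomp2 C c (vcomp2 C b a) = vcomp2 C (vcomp2 C c b) a"
    and vcomp2_id: "a \<in> Two C \<Longrightarrow>
      vcomp2 C a (id2 C (src2 C a)) = a \<and> vcomp2 C (id2 C (trg2 C a)) a = a"
    and hcomp2_two: "\<lbrakk>a \<in> Two C; b \<in> Two C; trg1 C (src2 C a) = src1 C (src2 C b)\<rbrakk> \<Longrightarrow>
      hcomp2 C b a \<in> Two C \<and> src2 C (hcomp2 C b a) = comp1 C (src2 C b) (src2 C a) \<and>
      trg2 C (hcomp2 C b a) = comp1 C (trg2 C b) (trg2 C a)"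
    and hcomp2_assoc: "\<lbrakk>a \<in> Two C; b \<in> Two C; c \<in> Two C;
        trg1 C (src2 C a) = src1 C (src2 C b); trg1 C (src2 C b) = src1 C (src2 C c)\<rbrakk> \<Longrightarrow>
      hcomp2 C c (hcomp2 C b a) = hcomp2 C (hcomp2 C c b) a"
    and hcomp2_id: "a \<in> Two C \<Longrightarrow>
      hcomp2 C a (id2 C (id1 C (src1 C (src2 C a)))) = a \<and>
      hcomp2 C (id2 C (id1 C (trg1 C (src2 C a)))) a = a"
    and hcomp2_id2: "\<lbrakk>f \<in> Arr C; g \<in> Arr C; trg1 C f = src1 C g\<rbrakk> \<Longrightarrow>
      hcomp2 C (id2 C g) (id2 C f) = id2 C (comp1 C g f)"
    and interchange: "\<lbrakk>a \<in> Two C; a' \<in> Two C; b \<in> Two C; b' \<in> Two C;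
        trg2 C a = src2 C a'; trg2 C b = src2 C b'; trg1 C (src2 C a) = src1 C (src2 C b)\<rbrakk> \<Longrightarrow>
      hcomp2 C (vcomp2 C b' b) (vcomp2 C a' a) = vcomp2 C (hcomp2 C b' a') (hcomp2 C b a)"

record ('o, 'm, 't, 'p, 'n, 's) two_fun =
  on0 :: "'o \<Rightarrow> 'p"
  on1 :: "'m \<Rightarrow> 'n"
  on2 :: "'t \<Rightarrow> 's"

locale two_functor = C: two_category C + D: two_category D
  for C :: "('o, 'm, 't) two_cat" and D :: "('p, 'n, 's) two_cat" +
  fixes F :: "('o, 'm, 't, 'p, 'n, 's) two_fun"
  assumes on0_ob: "A \<in> Ob C \<Longrightarrow> on0 F A \<in> Ob D"
    and on1_arr: "f \<in> Arr C \<Longrightarrow> on1 F f \<in> Arr D \<and>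
      src1 D (on1 F f) = on0 F (src1 C f) \<and> trg1 D (on1 F f) = on0 F (trg1 C f)"
    and on2_two: "a \<in> Two C \<Longrightarrow> on2 F a \<in> Two D \<and>
      src2 D (on2 F a) = on1 F (src2 C a) \<and> trg2 D (on2 F a) = on1 F (trg2 C a)"
    and on1_id: "A \<in> Ob C \<Longrightarrow> on1 F (id1 C A) = id1 D (on0 F A)"
    and on1_comp: "\<lbrakk>f \<in> Arr C; g \<in> Arr C; trg1 C f = src1 C g\<rbrakk> \<Longrightarrow>
      on1 F (comp1 C g f) = comp1 D (on1 F g) (on1 F f)"
    and on2_id: "f \<in> Arr C \<Longrightarrow> on2 F (id2 C f) = id2 D (on1 F f)"
    and on2_vcomp: "\<lbrakk>a \<in> Two C; b \<in> Two C; trg2 C a = src2 C b\<rbrakk> \<Longrightarrow>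
      on2 F (vcomp2 C b a) = vcomp2 D (on2 F b) (on2 F a)"
    and on2_hcomp: "\<lbrakk>a \<in> Two C; b \<in> Two C; trg1 C (src2 C a) = src1 C (src2 C b)\<rbrakk> \<Longrightarrow>
      on2 F (hcomp2 C b a) = hcomp2 D (on2 F b) (on2 F a)"

definition id_two_fun :: "('o, 'm, 't, 'o, 'm, 't) two_fun" where
  "id_two_fun = \<lparr>on0 = (\<lambda>A. A), on1 = (\<lambda>f. f), on2 = (\<lambda>a. a)\<rparr>"

definition comp_two_fun ::
  "('p, 'n, 's, 'q, 'l, 'r) two_fun \<Rightarrow> ('o, 'm, 't, 'p, 'n, 's) two_fun
    \<Rightarrow> ('o, 'm, 't, 'q, 'l, 'r) two_fun" where
  "comp_two_fun G F = \<lparr>on0 = on0 G \<circ> on0 F, on1 = on1 G \<circ> on1 F, on2 = on2 G \<circ> on2 F\<rparr>"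

locale two_nat_trans = F: two_functor C D F + G: two_functor C D G
  for C :: "('o, 'm, 't) two_cat" and D :: "('p, 'n, 's) two_cat"
    and F :: "('o, 'm, 't, 'p, 'n, 's) two_fun" and G :: "('o, 'm, 't, 'p, 'n, 's) two_fun" +
  fixes \<sigma> :: "'o \<Rightarrow> 'n"
  assumes component: "A \<in> Ob C \<Longrightarrow>
      \<sigma> A \<in> Arr D \<and> src1 D (\<sigma> A) = on0 F A \<and> trg1 D (\<sigma> A) = on0 G A"
    and natural1: "f \<in> Arr C \<Longrightarrow>
      comp1 D (on1 G f) (\<sigma> (src1 C f)) = comp1 D (\<sigma> (trg1 C f)) (on1 F f)"
    and natural2: "a \<in> Two C \<Longrightarrow>
      hcomp2 D (on2 G a) (id2 D (\<sigma> (src1 C (src2 C a)))) =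
      hcomp2 D (id2 D (\<sigma> (trg1 C (src2 C a)))) (on2 F a)"

definition invertible_two_nat_trans ::
  "('o, 'm, 't) two_cat \<Rightarrow> ('p, 'n, 's) two_cat \<Rightarrow> ('o, 'm, 't, 'p, 'n, 's) two_fun
    \<Rightarrow> ('o, 'm, 't, 'p, 'n, 's) two_fun \<Rightarrow> ('o \<Rightarrow> 'n) \<Rightarrow> bool" where
  "invertible_two_nat_trans C D F G \<sigma> \<longleftrightarrow> two_nat_trans C D F G \<sigma> \<and>
    (\<exists>\<tau>. two_nat_trans C D G F \<tau> \<and>
      (\<forall>A\<in>Ob C. comp1 D (\<tau> A) (\<sigma> A) = id1 D (on0 F A) \<and> comp1 D (\<sigma> A) (\<tau> A) = id1 D (on0 G A)))"

text \<open>A path is given by its initial vertex and the list of its edges, so that \<open>(A, [])\<close> is the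
  empty path at \<open>A\<close>.\<close>

type_synonym ('o, 'h) path = "'o \<times> 'h list"

text \<open>A cell carries its boundary, and the remaining datum \<open>label\<close> tells cells with the same
  boundary apart. Cells with different boundaries are thus different even if their labels coincide,
  as is the case for the nullary cells \<open>J \<Rightarrow> (C)\<close> of \<open>N(K)\<close> and the cells \<open>J \<Rightarrow> I\<^sub>C\<close> of \<open>K\<close>.\<close>

record ('o, 'v, 'h, 'c) cell =
  hsrc :: "('o, 'h) path"
  htgt :: "('o, 'h) path"
  vsrc :: 'v
  vtgt :: 'v
  label :: 'c

record ('o, 'v, 'h, 'c) avdc =
  obj :: "'o set"
  vmor :: "'v set"
  vdom :: "'v \<Rightarrow> 'o"
  vcod :: "'v \<Rightarrow> 'o"
  vid :: "'o \<Rightarrow> 'v"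
  vcmp :: "'v \<Rightarrow> 'v \<Rightarrow> 'v"
  hmor :: "'h set"
  hdom :: "'h \<Rightarrow> 'o"
  hcod :: "'h \<Rightarrow> 'o"
  cells :: "('o, 'v, 'h, 'c) cell set"
  cmp :: "('o, 'v, 'h, 'c) cell \<Rightarrow> ('o, 'v, 'h, 'c) cell list \<Rightarrow> ('o, 'v, 'h, 'c) cell"
  hidc :: "'h \<Rightarrow> ('o, 'v, 'h, 'c) cell"
  vidc :: "'v \<Rightarrow> ('o, 'v, 'h, 'c) cell"

definition vhom :: "('o, 'v, 'h, 'c) avdc \<Rightarrow> 'o \<Rightarrow> 'o \<Rightarrow> 'v set" where
  "vhom K A C = {f \<in> vmor K. vdom K f = A \<and> vcod K f = C}"

fun hpath :: "('o, 'v, 'h, 'c) avdc \<Rightarrow> 'o \<Rightarrow> 'h list \<Rightarrow> 'o \<Rightarrow> bool" where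
  "hpath K A [] B \<longleftrightarrow> A \<in> obj K \<and> A = B"
| "hpath K A (J # Js) B \<longleftrightarrow> J \<in> hmor K \<and> hdom K J = A \<and> hpath K (hcod K J) Js B"

definition unary :: "('o, 'v, 'h, 'c) cell \<Rightarrow> bool" where
  "unary \<phi> \<longleftrightarrow> length (snd (htgt \<phi>)) = 1"

definition nullary :: "('o, 'v, 'h, 'c) cell \<Rightarrow> bool" where
  "nullary \<phi> \<longleftrightarrow> length (snd (htgt \<phi>)) = 0"

definition cell_path :: "('o, 'v, 'h, 'c) cell list \<Rightarrow> bool" where
  "cell_path \<phi>s \<longleftrightarrow> (\<forall>i. Suc i < length \<phi>s \<longrightarrow> vtgt (\<phi>s ! i) = vsrc (\<phi>s ! Suc i))"

definition concat_hsrc :: "('o, 'v, 'h, 'c) cell list \<Rightarrow> ('o, 'h) path" where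
  "concat_hsrc \<phi>s = (fst (hsrc (hd \<phi>s)), concat (map (snd \<circ> hsrc) \<phi>s))"

definition concat_htgt :: "('o, 'v, 'h, 'c) cell list \<Rightarrow> ('o, 'h) path" where
  "concat_htgt \<phi>s = (fst (htgt (hd \<phi>s)), concat (map (snd \<circ> htgt) \<phi>s))"

definition composable ::
  "('o, 'v, 'h, 'c) avdc \<Rightarrow> ('o, 'v, 'h, 'c) cell \<Rightarrow> ('o, 'v, 'h, 'c) cell list \<Rightarrow> bool" where
  "composable K \<psi> \<phi>s \<longleftrightarrow> \<psi> \<in> cells K \<and> set \<phi>s \<subseteq> cells K \<and> \<phi>s \<noteq> [] \<and> cell_path \<phi>s \<and>
    hsrc \<psi> = concat_htgt \<phi>s"

text \<open>In \<open>cmp_insert\<close> composability of the two lists forces \<open>f\<close> to be the vertical morphism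
  at which the identity cell is inserted. In \<open>cmp_assoc\<close> the premises say that both sides
  make sense.\<close>

locale avdc =
  fixes K :: "('o, 'v, 'h, 'c) avdc"
  assumes vmor_ends: "f \<in> vmor K \<Longrightarrow> vdom K f \<in> obj K \<and> vcod K f \<in> obj K"
    and vid_hom: "A \<in> obj K \<Longrightarrow> vid K A \<in> vhom K A A"
    and vcmp_hom: "\<lbrakk>f \<in> vhom K A B; g \<in> vhom K B C\<rbrakk> \<Longrightarrow> vcmp K g f \<in> vhom K A C"
    and vcmp_assoc: "\<lbrakk>f \<in> vhom K A B; g \<in> vhom K B C; h \<in> vhom K C D\<rbrakk> \<Longrightarrow>
      vcmp K h (vcmp K g f) = vcmp K (vcmp K h g) f"
    and vcmp_id: "f \<in> vhom K A B \<Longrightarrow> vcmp K f (vid K A) = f \<and> vcmp K (vid K B) f = f"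
    and hmor_ends: "J \<in> hmor K \<Longrightarrow> hdom K J \<in> obj K \<and> hcod K J \<in> obj K"
    and cell_boundary: "\<phi> \<in> cells K \<Longrightarrow> \<exists>A Js B C Ks D.
      hsrc \<phi> = (A, Js) \<and> hpath K A Js B \<and> htgt \<phi> = (C, Ks) \<and> hpath K C Ks D \<and> length Ks \<le> 1 \<and>
      vsrc \<phi> \<in> vhom K A C \<and> vtgt \<phi> \<in> vhom K B D"
    and cmp_cell: "composable K \<psi> \<phi>s \<Longrightarrow> cmp K \<psi> \<phi>s \<in> cells K \<and>
      hsrc (cmp K \<psi> \<phi>s) = concat_hsrc \<phi>s \<and> htgt (cmp K \<psi> \<phi>s) = htgt \<psi> \<and>
      vsrc (cmp K \<psi> \<phi>s) = vcmp K (vsrc \<psi>) (vsrc (hd \<phi>s)) \<and>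
      vtgt (cmp K \<psi> \<phi>s) = vcmp K (vtgt \<psi>) (vtgt (last \<phi>s))"
    and hidc_cell: "J \<in> hmor K \<Longrightarrow> hidc K J \<in> cells K \<and>
      hsrc (hidc K J) = (hdom K J, [J]) \<and> htgt (hidc K J) = (hdom K J, [J]) \<and>
      vsrc (hidc K J) = vid K (hdom K J) \<and> vtgt (hidc K J) = vid K (hcod K J)"
    and vidc_cell: "f \<in> vmor K \<Longrightarrow> vidc K f \<in> cells K \<and>
      hsrc (vidc K f) = (vdom K f, []) \<and> htgt (vidc K f) = (vcod K f, []) \<and>
      vsrc (vidc K f) = f \<and> vtgt (vidc K f) = f"
    and cmp_vidc: "\<lbrakk>f \<in> vhom K A B; h \<in> vhom K B C\<rbrakk> \<Longrightarrow>
      cmp K (vidc K h) [vidc K f] = vidc K (vcmp K h f)"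
    and cmp_assoc: "\<lbrakk>composable K \<chi> \<psi>s; list_all2 (composable K) \<psi>s \<phi>ss; cell_path (concat \<phi>ss)\<rbrakk> \<Longrightarrow>
      cmp K \<chi> (map2 (cmp K) \<psi>s \<phi>ss) = cmp K (cmp K \<chi> \<psi>s) (concat \<phi>ss)"
    and vidc_cmp: "\<lbrakk>\<phi> \<in> cells K; htgt \<phi> = (C, [])\<rbrakk> \<Longrightarrow> cmp K (vidc K (vid K C)) [\<phi>] = \<phi>"
    and hidc_cmp: "\<lbrakk>\<phi> \<in> cells K; htgt \<phi> = (C, [H])\<rbrakk> \<Longrightarrow> cmp K (hidc K H) [\<phi>] = \<phi>"
    and cmp_vidc_id: "\<lbrakk>\<phi> \<in> cells K; hsrc \<phi> = (A, [])\<rbrakk> \<Longrightarrow> cmp K \<phi> [vidc K (vid K A)] = \<phi>"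
    and cmp_hidc_id: "\<lbrakk>\<phi> \<in> cells K; hsrc \<phi> = (A, Js); Js \<noteq> []\<rbrakk> \<Longrightarrow> cmp K \<phi> (map (hidc K) Js) = \<phi>"
    and cmp_insert: "\<lbrakk>f \<in> vmor K; composable K \<psi> (xs @ ys); composable K \<psi> (xs @ vidc K f # ys)\<rbrakk> \<Longrightarrow>
      cmp K \<psi> (xs @ vidc K f # ys) = cmp K \<psi> (xs @ ys)"

locale vdc = avdc +
  assumes nullary_vidc: "\<lbrakk>\<phi> \<in> cells K; nullary \<phi>\<rbrakk> \<Longrightarrow> \<phi> \<in> vidc K ` vmor K"

text \<open>The maps of functors and transformations are required to be \<^const>\<open>undefined\<close> outside their
  domains, so that equality of records is equality of functors and of transformations.\<close>

record ('o, 'v, 'h, 'c) avfun =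
  fdom :: "('o, 'v, 'h, 'c) avdc"
  fcod :: "('o, 'v, 'h, 'c) avdc"
  fobj :: "'o \<Rightarrow> 'o"
  fver :: "'v \<Rightarrow> 'v"
  fhor :: "'h \<Rightarrow> 'h"
  fcell :: "('o, 'v, 'h, 'c) cell \<Rightarrow> ('o, 'v, 'h, 'c) cell"

definition fpath :: "('o, 'v, 'h, 'c) avfun \<Rightarrow> ('o, 'h) path \<Rightarrow> ('o, 'h) path" where
  "fpath F p = (fobj F (fst p), map (fhor F) (snd p))"

locale avfunctor =
  fixes F :: "('o, 'v, 'h, 'c) avfun"
  assumes fdom_avdc: "avdc (fdom F)"
    and fcod_avdc: "avdc (fcod F)"
    and fobj_obj: "A \<in> obj (fdom F) \<Longrightarrow> fobj F A \<in> obj (fcod F)"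
    and fver_hom: "f \<in> vhom (fdom F) A C \<Longrightarrow> fver F f \<in> vhom (fcod F) (fobj F A) (fobj F C)"
    and fver_id: "A \<in> obj (fdom F) \<Longrightarrow> fver F (vid (fdom F) A) = vid (fcod F) (fobj F A)"
    and fver_cmp: "\<lbrakk>f \<in> vhom (fdom F) A B; g \<in> vhom (fdom F) B C\<rbrakk> \<Longrightarrow>
      fver F (vcmp (fdom F) g f) = vcmp (fcod F) (fver F g) (fver F f)"
    and fhor_hom: "J \<in> hmor (fdom F) \<Longrightarrow> fhor F J \<in> hmor (fcod F) \<and>
      hdom (fcod F) (fhor F J) = fobj F (hdom (fdom F) J) \<and>
      hcod (fcod F) (fhor F J) = fobj F (hcod (fdom F) J)"
    and fcell_cell: "\<phi> \<in> cells (fdom F) \<Longrightarrow> fcell F \<phi> \<in> cells (fcod F) \<and>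
      hsrc (fcell F \<phi>) = fpath F (hsrc \<phi>) \<and> htgt (fcell F \<phi>) = fpath F (htgt \<phi>) \<and>
      vsrc (fcell F \<phi>) = fver F (vsrc \<phi>) \<and> vtgt (fcell F \<phi>) = fver F (vtgt \<phi>)"
    and fcell_cmp: "composable (fdom F) \<psi> \<phi>s \<Longrightarrow>
      fcell F (cmp (fdom F) \<psi> \<phi>s) = cmp (fcod F) (fcell F \<psi>) (map (fcell F) \<phi>s)"
    and fcell_hidc: "J \<in> hmor (fdom F) \<Longrightarrow> fcell F (hidc (fdom F) J) = hidc (fcod F) (fhor F J)"
    and fcell_vidc: "f \<in> vmor (fdom F) \<Longrightarrow> fcell F (vidc (fdom F) f) = vidc (fcod F) (fver F f)"
    and fobj_ext: "fobj F \<in> extensional (obj (fdom F))"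
    and fver_ext: "fver F \<in> extensional (vmor (fdom F))"
    and fhor_ext: "fhor F \<in> extensional (hmor (fdom F))"
    and fcell_ext: "fcell F \<in> extensional (cells (fdom F))"

definition id_avfun :: "('o, 'v, 'h, 'c) avdc \<Rightarrow> ('o, 'v, 'h, 'c) avfun" where
  "id_avfun K = \<lparr>fdom = K, fcod = K, fobj = (\<lambda>A\<in>obj K. A), fver = (\<lambda>f\<in>vmor K. f),
    fhor = (\<lambda>J\<in>hmor K. J), fcell = (\<lambda>\<phi>\<in>cells K. \<phi>)\<rparr>"

definition comp_avfun ::
  "('o, 'v, 'h, 'c) avfun \<Rightarrow> ('o, 'v, 'h, 'c) avfun \<Rightarrow> ('o, 'v, 'h, 'c) avfun" where
  "comp_avfun G F = \<lparr>fdom = fdom F, fcod = fcod G,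
    fobj = (\<lambda>A\<in>obj (fdom F). fobj G (fobj F A)),
    fver = (\<lambda>f\<in>vmor (fdom F). fver G (fver F f)),
    fhor = (\<lambda>J\<in>hmor (fdom F). fhor G (fhor F J)),
    fcell = (\<lambda>\<phi>\<in>cells (fdom F). fcell G (fcell F \<phi>))\<rparr>"

record ('o, 'v, 'h, 'c) avtrans =
  tsrc :: "('o, 'v, 'h, 'c) avfun"
  ttgt :: "('o, 'v, 'h, 'c) avfun"
  tobj :: "'o \<Rightarrow> 'v"
  thor :: "'h \<Rightarrow> ('o, 'v, 'h, 'c) cell"

definition tpath ::
  "('o, 'v, 'h, 'c) avtrans \<Rightarrow> ('o, 'h) path \<Rightarrow> ('o, 'v, 'h, 'c) cell list" where
  "tpath \<xi> p = (if snd p = [] then [vidc (fcod (tsrc \<xi>)) (tobj \<xi> (fst p))]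
    else map (thor \<xi>) (snd p))"

text \<open>Horizontal targets have length at most 1, so that \<^term>\<open>tpath \<xi> (htgt \<phi>)\<close> consists of a
  single cell.\<close>

locale avtransformation =
  fixes \<xi> :: "('o, 'v, 'h, 'c) avtrans"
  assumes tsrc_functor: "avfunctor (tsrc \<xi>)"
    and ttgt_functor: "avfunctor (ttgt \<xi>)"
    and parallel: "fdom (tsrc \<xi>) = fdom (ttgt \<xi>) \<and> fcod (tsrc \<xi>) = fcod (ttgt \<xi>)"
    and tobj_hom: "A \<in> obj (fdom (tsrc \<xi>)) \<Longrightarrow>
      tobj \<xi> A \<in> vhom (fcod (tsrc \<xi>)) (fobj (tsrc \<xi>) A) (fobj (ttgt \<xi>) A)"
    and tobj_natural: "f \<in> vhom (fdom (tsrc \<xi>)) A C \<Longrightarrow>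
      vcmp (fcod (tsrc \<xi>)) (fver (ttgt \<xi>) f) (tobj \<xi> A) =
      vcmp (fcod (tsrc \<xi>)) (tobj \<xi> C) (fver (tsrc \<xi>) f)"
    and thor_cell: "J \<in> hmor (fdom (tsrc \<xi>)) \<Longrightarrow> thor \<xi> J \<in> cells (fcod (tsrc \<xi>)) \<and>
      hsrc (thor \<xi> J) = fpath (tsrc \<xi>) (hdom (fdom (tsrc \<xi>)) J, [J]) \<and>
      htgt (thor \<xi> J) = fpath (ttgt \<xi>) (hdom (fdom (tsrc \<xi>)) J, [J]) \<and>
      vsrc (thor \<xi> J) = tobj \<xi> (hdom (fdom (tsrc \<xi>)) J) \<and>
      vtgt (thor \<xi> J) = tobj \<xi> (hcod (fdom (tsrc \<xi>)) J)"
    and thor_natural: "\<phi> \<in> cells (fdom (tsrc \<xi>)) \<Longrightarrow>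
      cmp (fcod (tsrc \<xi>)) (fcell (ttgt \<xi>) \<phi>) (tpath \<xi> (hsrc \<phi>)) =
      cmp (fcod (tsrc \<xi>)) (hd (tpath \<xi> (htgt \<phi>))) [fcell (tsrc \<xi>) \<phi>]"
    and tobj_ext: "tobj \<xi> \<in> extensional (obj (fdom (tsrc \<xi>)))"
    and thor_ext: "thor \<xi> \<in> extensional (hmor (fdom (tsrc \<xi>)))"

definition id_avtrans :: "('o, 'v, 'h, 'c) avfun \<Rightarrow> ('o, 'v, 'h, 'c) avtrans" where
  "id_avtrans F = \<lparr>tsrc = F, ttgt = F,
    tobj = (\<lambda>A\<in>obj (fdom F). vid (fcod F) (fobj F A)),
    thor = (\<lambda>J\<in>hmor (fdom F). hidc (fcod F) (fhor F J))\<rparr>"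

definition vcomp_avtrans ::
  "('o, 'v, 'h, 'c) avtrans \<Rightarrow> ('o, 'v, 'h, 'c) avtrans \<Rightarrow> ('o, 'v, 'h, 'c) avtrans" where
  "vcomp_avtrans \<zeta> \<xi> = \<lparr>tsrc = tsrc \<xi>, ttgt = ttgt \<zeta>,
    tobj = (\<lambda>A\<in>obj (fdom (tsrc \<xi>)). vcmp (fcod (tsrc \<xi>)) (tobj \<zeta> A) (tobj \<xi> A)),
    thor = (\<lambda>J\<in>hmor (fdom (tsrc \<xi>)). cmp (fcod (tsrc \<xi>)) (thor \<zeta> J) [thor \<xi> J])\<rparr>"

text \<open>For \<open>\<xi> : F \<Rightarrow> G\<close> and \<open>\<zeta> : H \<Rightarrow> M\<close> the horizontal composite is \<open>\<zeta>G \<circ> H\<xi> : HF \<Rightarrow> MG\<close>.\<close>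

definition hcomp_avtrans ::
  "('o, 'v, 'h, 'c) avtrans \<Rightarrow> ('o, 'v, 'h, 'c) avtrans \<Rightarrow> ('o, 'v, 'h, 'c) avtrans" where
  "hcomp_avtrans \<zeta> \<xi> = \<lparr>tsrc = comp_avfun (tsrc \<zeta>) (tsrc \<xi>), ttgt = comp_avfun (ttgt \<zeta>) (ttgt \<xi>),
    tobj = (\<lambda>A\<in>obj (fdom (tsrc \<xi>)).
      vcmp (fcod (tsrc \<zeta>)) (tobj \<zeta> (fobj (ttgt \<xi>) A)) (fver (tsrc \<zeta>) (tobj \<xi> A))),
    thor = (\<lambda>J\<in>hmor (fdom (tsrc \<xi>)).
      cmp (fcod (tsrc \<zeta>)) (thor \<zeta> (fhor (ttgt \<xi>) J)) [fcell (tsrc \<zeta>) (thor \<xi> J)])\<rparr>"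

definition horizontal_cell :: "('o, 'v, 'h, 'c) avdc \<Rightarrow> ('o, 'v, 'h, 'c) cell \<Rightarrow> bool" where
  "horizontal_cell K \<phi> \<longleftrightarrow> (\<exists>A\<in>obj K. vsrc \<phi> = vid K A) \<and> (\<exists>B\<in>obj K. vtgt \<phi> = vid K B)"

definition cartesian_unit_cell ::
  "('o, 'v, 'h, 'c) avdc \<Rightarrow> 'o \<Rightarrow> 'h \<Rightarrow> ('o, 'v, 'h, 'c) cell \<Rightarrow> bool" where
  "cartesian_unit_cell K A I \<epsilon> \<longleftrightarrow> I \<in> hmor K \<and> hdom K I = A \<and> hcod K I = A \<and>
    \<epsilon> \<in> cells K \<and> horizontal_cell K \<epsilon> \<and> hsrc \<epsilon> = (A, [I]) \<and> htgt \<epsilon> = (A, []) \<and>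
    (\<forall>\<chi>\<in>cells K. htgt \<chi> = (A, []) \<longrightarrow>
      (\<exists>!\<phi>. \<phi> \<in> cells K \<and> hsrc \<phi> = hsrc \<chi> \<and> htgt \<phi> = (A, [I]) \<and>
        vsrc \<phi> = vsrc \<chi> \<and> vtgt \<phi> = vtgt \<chi> \<and> \<chi> = cmp K \<epsilon> [\<phi>]))"

definition cocartesian_unit_cell ::
  "('o, 'v, 'h, 'c) avdc \<Rightarrow> 'o \<Rightarrow> 'h \<Rightarrow> ('o, 'v, 'h, 'c) cell \<Rightarrow> bool" where
  "cocartesian_unit_cell K A I \<eta> \<longleftrightarrow> I \<in> hmor K \<and> hdom K I = A \<and> hcod K I = A \<and>
    \<eta> \<in> cells K \<and> horizontal_cell K \<eta> \<and> hsrc \<eta> = (A, []) \<and> htgt \<eta> = (A, [I]) \<and>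
    (\<forall>\<phi>\<in>cells K. \<forall>X Js Hs Y.
      unary \<phi> \<and> hpath K X Js A \<and> hpath K A Hs Y \<and> hsrc \<phi> = (X, Js @ Hs) \<longrightarrow>
      (\<exists>!\<phi>'. \<phi>' \<in> cells K \<and> hsrc \<phi>' = (X, Js @ [I] @ Hs) \<and> htgt \<phi>' = htgt \<phi> \<and>
        vsrc \<phi>' = vsrc \<phi> \<and> vtgt \<phi>' = vtgt \<phi> \<and>
        \<phi> = cmp K \<phi>' (map (hidc K) Js @ [\<eta>] @ map (hidc K) Hs)))"

definition has_units_aug :: "('o, 'v, 'h, 'c) avdc \<Rightarrow> bool" where
  "has_units_aug K \<longleftrightarrow> (\<forall>A\<in>obj K. \<exists>I \<epsilon>. cartesian_unit_cell K A I \<epsilon>)"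

definition has_units_virt :: "('o, 'v, 'h, 'c) avdc \<Rightarrow> bool" where
  "has_units_virt K \<longleftrightarrow> (\<forall>A\<in>obj K. \<exists>I \<eta>. cocartesian_unit_cell K A I \<eta>)"

definition normal :: "('o, 'v, 'h, 'c) avfun \<Rightarrow> bool" where
  "normal F \<longleftrightarrow> (\<forall>A\<in>obj (fdom F). \<forall>I \<eta>. cocartesian_unit_cell (fdom F) A I \<eta> \<longrightarrow>
    cocartesian_unit_cell (fcod F) (fobj F A) (fhor F I) (fcell F \<eta>))"

type_synonym ('o, 'v, 'h, 'c) avdc_two_cat =
  "(('o, 'v, 'h, 'c) avdc, ('o, 'v, 'h, 'c) avfun, ('o, 'v, 'h, 'c) avtrans) two_cat"

type_synonym ('o, 'v, 'h, 'c) avdc_two_fun =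
  "(('o, 'v, 'h, 'c) avdc, ('o, 'v, 'h, 'c) avfun, ('o, 'v, 'h, 'c) avtrans,
    ('o, 'v, 'h, 'c) avdc, ('o, 'v, 'h, 'c) avfun, ('o, 'v, 'h, 'c) avtrans) two_fun"

text \<open>The type variables bound the size of the structures and play the role of universes: the objects
  of the 2-categories below are the structures whose constituents have the given types.\<close>

definition AugVirtDblCat_on ::
  "('o, 'v, 'h, 'c) avdc set \<Rightarrow> ('o, 'v, 'h, 'c) avfun set \<Rightarrow> ('o, 'v, 'h, 'c) avdc_two_cat" where
  "AugVirtDblCat_on Obs Arrs = \<lparr>Ob = Obs, Arr = Arrs,
    Two = {\<xi>. avtransformation \<xi> \<and> tsrc \<xi> \<in> Arrs \<and> ttgt \<xi> \<in> Arrs},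
    src1 = fdom, trg1 = fcod, src2 = tsrc, trg2 = ttgt,
    id1 = id_avfun, comp1 = comp_avfun,
    id2 = id_avtrans, vcomp2 = vcomp_avtrans, hcomp2 = hcomp_avtrans\<rparr>"

definition AugVirtDblCat_u :: "('o, 'v, 'h, 'c) avdc_two_cat" where
  "AugVirtDblCat_u = AugVirtDblCat_on
    {K. avdc K \<and> has_units_aug K}
    {F. avfunctor F \<and> has_units_aug (fdom F) \<and> has_units_aug (fcod F)}"

definition VirtDblCat_u :: "('o, 'v, 'h, 'c) avdc_two_cat" where
  "VirtDblCat_u = AugVirtDblCat_on
    {K. vdc K \<and> has_units_virt K}
    {F. avfunctor F \<and> vdc (fdom F) \<and> vdc (fcod F) \<and>
      has_units_virt (fdom F) \<and> has_units_virt (fcod F) \<and> normal F}"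

definition U_obj :: "('o, 'v, 'h, 'c) avdc \<Rightarrow> ('o, 'v, 'h, 'c) avdc" where
  "U_obj K = K\<lparr>cells := {\<phi> \<in> cells K. unary \<phi>} \<union> vidc K ` vmor K\<rparr>"

definition U_arr :: "('o, 'v, 'h, 'c) avfun \<Rightarrow> ('o, 'v, 'h, 'c) avfun" where
  "U_arr F = F\<lparr>fdom := U_obj (fdom F), fcod := U_obj (fcod F),
    fcell := restrict (fcell F) (cells (U_obj (fdom F)))\<rparr>"

definition U_two :: "('o, 'v, 'h, 'c) avtrans \<Rightarrow> ('o, 'v, 'h, 'c) avtrans" where
  "U_two \<xi> = \<xi>\<lparr>tsrc := U_arr (tsrc \<xi>), ttgt := U_arr (ttgt \<xi>)\<rparr>"

definition U_fun :: "('o, 'v, 'h, 'c) avdc_two_fun" where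
  "U_fun = \<lparr>on0 = U_obj, on1 = U_arr, on2 = U_two\<rparr>"

text \<open>Throughout, \<open>\<eta>\<close> is a choice of a cocartesian cell \<open>\<eta> A : (A) \<Rightarrow> I\<^sub>A\<close> for each object \<open>A\<close>.
  The function \<open>to_unit\<close> reads a nullary cell \<open>J \<Rightarrow> (C)\<close> of \<open>N(K)\<close> as the cell \<open>J \<Rightarrow> I\<^sub>C\<close> of \<open>K\<close>
  with the same label, and \<open>unit_factor\<close> gives the cell usually written \<open>\<eta>\<^sub>\<phi>\<close>.\<close>

definition unit_choice ::
  "('o, 'v, 'h, 'c) avdc \<Rightarrow> ('o \<Rightarrow> ('o, 'v, 'h, 'c) cell) \<Rightarrow> bool" where
  "unit_choice K \<eta> \<longleftrightarrow> (\<forall>A\<in>obj K. \<exists>I. cocartesian_unit_cell K A I (\<eta> A))"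

definition to_unit ::
  "('o \<Rightarrow> ('o, 'v, 'h, 'c) cell) \<Rightarrow> ('o, 'v, 'h, 'c) cell \<Rightarrow> ('o, 'v, 'h, 'c) cell" where
  "to_unit \<eta> \<phi> = (if nullary \<phi> then \<phi>\<lparr>htgt := htgt (\<eta> (fst (htgt \<phi>)))\<rparr> else \<phi>)"

definition unit_factor ::
  "('o, 'v, 'h, 'c) avdc \<Rightarrow> ('o \<Rightarrow> ('o, 'v, 'h, 'c) cell) \<Rightarrow> ('o, 'v, 'h, 'c) cell
    \<Rightarrow> ('o, 'v, 'h, 'c) cell" where
  "unit_factor K \<eta> \<phi> =
    (if nullary \<phi> then \<eta> (fst (htgt \<phi>)) else hidc K (hd (snd (htgt \<phi>))))"

definition N_obj ::
  "('o \<Rightarrow> ('o, 'v, 'h, 'c) cell) \<Rightarrow> ('o, 'v, 'h, 'c) avdc \<Rightarrow> ('o, 'v, 'h, 'c) avdc" where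
  "N_obj \<eta> K = K\<lparr>
    cells := {\<phi> \<in> cells K. unary \<phi>} \<union>
      {\<phi>\<lparr>htgt := (C, [])\<rparr> | \<phi> C. \<phi> \<in> cells K \<and> C \<in> obj K \<and> htgt \<phi> = htgt (\<eta> C)},
    cmp := (\<lambda>\<psi> \<phi>s.
      let \<psi>' = (THE \<psi>'. composable K \<psi>' (map (unit_factor K \<eta>) \<phi>s) \<and>
            to_unit \<eta> \<psi> = cmp K \<psi>' (map (unit_factor K \<eta>) \<phi>s))
      in (cmp K \<psi>' (map (to_unit \<eta>) \<phi>s))\<lparr>htgt := htgt \<psi>\<rparr>),
    vidc := (\<lambda>f. (cmp K (\<eta> (vcod K f)) [vidc K f])\<lparr>htgt := (vcod K f, [])\<rparr>)\<rparr>"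

end

(* In an augmented virtual double category a cartesian cell I => (A) has an inverse (A) => I, and this
   inverse is cocartesian among the unary cells; conversely every cocartesian unit cell of U(K) is
   invertible in K. Invertibility is equational, so U preserves units and all functors U(F) are normal.

   Nullary cells of N(K) are cells of K into chosen units, and composites in N(K) are computed by
   factoring through paths of chosen cocartesian cells. The factorisation through such a path exists
   and is unique, and this uniqueness yields associativity in N(K), and with the comparison cells
   t : F I => I' given by t o (F eta) = eta' also the functoriality of N(F) and the naturality of N(xi).

   The cells of U(N(K)) are those of K except that the vertical identities are relabelled, and
   K is isomorphic to N(U(K)) by sending a nullary cell phi with target (C) to eta_C o phi, the inverse
   being composition with the inverse of eta_C. *)

theory Submission
  imports Defs
begin

section \<open>Paths of cells and composition\<close>

text \<open>Composites exist only over non-empty rows of cells, and the axiom on vertical identities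
  removes them one at a time from a row that stays non-empty. This shapes most calculations: an
  empty horizontal source needs its own unit law, and a vertical identity is dropped only where
  another cell remains. Factoring through several units at once rests on this bookkeeping: while one
  unit is split off, the others are written as themselves after the identities on their sources, and
  the vertical ones among these are dropped. A nullary cell of \<open>N(K)\<close> differs from a
  cell of \<open>K\<close> only in its recorded target; \<open>hat\<close> restores that cell, and a
  cell of \<open>N(K)\<close> is determined by its \<open>hat\<close> and its target. Equations in
  \<open>N(K)\<close> thus become equations in \<open>K\<close>, in which uniqueness allows any
  factor that can be exhibited to be used. Functors need not send chosen units to chosen units, so
  strict functoriality of \<open>N\<close> comes down to a cocycle identity for comparison cells.
  Both isomorphisms fix objects and morphisms, hence their 2-naturality is a statement about
  cells.\<close>

text \<open>A path of cells with its outer vertical morphisms; these make sense for the empty path too.\<close>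

primrec cell_run ::
  "('o, 'v, 'h, 'c) avdc \<Rightarrow> 'v \<Rightarrow> ('o, 'v, 'h, 'c) cell list \<Rightarrow> 'v \<Rightarrow> bool" where
  "cell_run K f [] g \<longleftrightarrow> f \<in> vmor K \<and> f = g"
| "cell_run K f (\<phi> # \<phi>s) g \<longleftrightarrow> \<phi> \<in> cells K \<and> vsrc \<phi> = f \<and> cell_run K (vtgt \<phi>) \<phi>s g"

abbreviation hsrcs :: "('o, 'v, 'h, 'c) cell list \<Rightarrow> 'h list" where
  "hsrcs \<phi>s \<equiv> concat (map (\<lambda>\<phi>. snd (hsrc \<phi>)) \<phi>s)"

abbreviation htgts :: "('o, 'v, 'h, 'c) cell list \<Rightarrow> 'h list" where
  "htgts \<phi>s \<equiv> concat (map (\<lambda>\<phi>. snd (htgt \<phi>)) \<phi>s)"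

lemma vhom_iff: "f \<in> vhom K A B \<longleftrightarrow> f \<in> vmor K \<and> vdom K f = A \<and> vcod K f = B"
  by (simp add: vhom_def)

text \<open>The side condition serves an empty \<open>xs\<close>: the empty run asks for its
  vertical morphism to be in \<open>vmor K\<close>, and this has to be read off the first cell of
  \<open>ys\<close>.\<close>

lemma cell_run_append:
  "cell_run K f (xs @ ys) g \<longleftrightarrow> (\<exists>m. cell_run K f xs m \<and> cell_run K m ys g)"
  if "\<And>\<phi>. \<phi> \<in> cells K \<Longrightarrow> vsrc \<phi> \<in> vmor K"
  by (induction xs arbitrary: f)
    (use that in \<open>(cases ys; auto)+\<close>)

lemma cell_path_Cons:
  "cell_path (\<phi> # \<phi>s) \<longleftrightarrow> (\<phi>s \<noteq> [] \<longrightarrow> vtgt \<phi> = vsrc (hd \<phi>s)) \<and> cell_path \<phi>s"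
  by (cases \<phi>s) (auto simp: cell_path_def nth_Cons split: nat.splits)

lemma cell_path_Nil [simp]: "cell_path []"
  by (simp add: cell_path_def)

lemma hpath_append:
  "hpath K A (xs @ ys) B \<longleftrightarrow> (\<exists>C. hpath K A xs C \<and> hpath K C ys B)"
  if "\<And>J. J \<in> hmor K \<Longrightarrow> hdom K J \<in> obj K"
  by (induction xs arbitrary: A) (use that in \<open>(cases ys; auto)+\<close>)

lemma hpath_unique: "hpath K A Js B \<Longrightarrow> hpath K A Js B' \<Longrightarrow> B = B'"
  by (induction Js arbitrary: A) auto

lemma cell_run_cells: "cell_run K f \<phi>s g \<Longrightarrow> set \<phi>s \<subseteq> cells K"
  by (induction \<phi>s arbitrary: f) auto

lemma cell_run_hd: "cell_run K f \<phi>s g \<Longrightarrow> \<phi>s \<noteq> [] \<Longrightarrow> vsrc (hd \<phi>s) = f"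
  by (cases \<phi>s) auto

lemma cell_run_last: "cell_run K f \<phi>s g \<Longrightarrow> \<phi>s \<noteq> [] \<Longrightarrow> vtgt (last \<phi>s) = g"
  by (induction \<phi>s arbitrary: f) auto

lemma cell_run_cell_path: "cell_run K f \<phi>s g \<Longrightarrow> cell_path \<phi>s"
proof (induction \<phi>s arbitrary: f)
  case (Cons \<phi> \<phi>s)
  then show ?case by (cases \<phi>s) (auto simp: cell_path_Cons)
qed simp

section \<open>Boundaries of cells, runs and composites\<close>

context avdc
begin

text \<open>All objects in the boundary are values of \<open>vdom\<close> and \<open>vcod\<close> at
  the two vertical morphisms of the cell. In this form the boundary is used by rewriting, without
  eliminating the existential quantifiers of \<open>cell_boundary\<close>.\<close>

lemma cell_ends:
  assumes "\<phi> \<in> cells K"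
  shows "vsrc \<phi> \<in> vmor K" "vtgt \<phi> \<in> vmor K"
    "fst (hsrc \<phi>) = vdom K (vsrc \<phi>)" "fst (htgt \<phi>) = vcod K (vsrc \<phi>)"
    "hpath K (vdom K (vsrc \<phi>)) (snd (hsrc \<phi>)) (vdom K (vtgt \<phi>))"
    "hpath K (vcod K (vsrc \<phi>)) (snd (htgt \<phi>)) (vcod K (vtgt \<phi>))"
    "length (snd (htgt \<phi>)) \<le> 1"
  using cell_boundary[OF assms] by (auto simp: vhom_iff)

lemma run_append:
  "cell_run K f (xs @ ys) g \<longleftrightarrow> (\<exists>m. cell_run K f xs m \<and> cell_run K m ys g)"
  by (rule cell_run_append) (rule cell_ends)

lemma path_append: "hpath K A (xs @ ys) B \<longleftrightarrow> (\<exists>C. hpath K A xs C \<and> hpath K C ys B)"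
  by (rule hpath_append) (use hmor_ends in auto)

lemma path_ends: "hpath K A Js B \<Longrightarrow> A \<in> obj K \<and> B \<in> obj K"
  by (induction Js arbitrary: A) (use hmor_ends in auto)

lemma vcmp_ends:
  assumes "f \<in> vmor K" "g \<in> vmor K" "vcod K f = vdom K g"
  shows "vcmp K g f \<in> vmor K" "vdom K (vcmp K g f) = vdom K f" "vcod K (vcmp K g f) = vcod K g"
  using vcmp_hom[of f "vdom K f" "vcod K f" g "vcod K g"] assms by (auto simp: vhom_iff)

lemma vid_ends:
  assumes "A \<in> obj K"
  shows "vid K A \<in> vmor K" "vdom K (vid K A) = A" "vcod K (vid K A) = A"
  using vid_hom[OF assms] by (auto simp: vhom_iff)

lemma vid_neutral:
  "f \<in> vmor K \<Longrightarrow> vcmp K f (vid K (vdom K f)) = f"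
  "f \<in> vmor K \<Longrightarrow> vcmp K (vid K (vcod K f)) f = f"
  using vcmp_id[of f "vdom K f" "vcod K f"] by (auto simp: vhom_iff)

lemma run_ends: "cell_run K f \<phi>s g \<Longrightarrow> f \<in> vmor K \<and> g \<in> vmor K"
  by (induction \<phi>s arbitrary: f) (auto simp: cell_ends)

lemma run_paths:
  "cell_run K f \<phi>s g \<Longrightarrow>
    hpath K (vdom K f) (hsrcs \<phi>s) (vdom K g) \<and> hpath K (vcod K f) (htgts \<phi>s) (vcod K g)"
proof (induction \<phi>s arbitrary: f)
  case Nil
  then show ?case using vmor_ends by auto
next
  case (Cons \<phi> \<phi>s)
  then show ?case using cell_ends[of \<phi>] by (auto simp: path_append)
qed

lemma cell_path_run:
  "cell_path \<phi>s \<Longrightarrow> set \<phi>s \<subseteq> cells K \<Longrightarrow> \<phi>s \<noteq> [] \<Longrightarrow> cell_run K (vsrc (hd \<phi>s)) \<phi>s (vtgt (last \<phi>s))"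
proof (induction \<phi>s)
  case (Cons \<phi> \<phi>s)
  then show ?case using cell_ends[of \<phi>] by (cases \<phi>s) (auto simp: cell_path_Cons)
qed simp

text \<open>\<open>composable\<close> speaks of adjacent cells and of the target path, but not of
  the outer vertical morphisms of the row. A run names them and can be split and joined like a path,
  which is what inductions over rows need.\<close>

lemma composable_iff:
  "composable K \<psi> \<phi>s \<longleftrightarrow> \<psi> \<in> cells K \<and> \<phi>s \<noteq> [] \<and>
    (\<exists>f g. cell_run K f \<phi>s g \<and> vcod K f = vdom K (vsrc \<psi>)) \<and> snd (hsrc \<psi>) = htgts \<phi>s"
proof
  assume "composable K \<psi> \<phi>s"
  then show "\<psi> \<in> cells K \<and> \<phi>s \<noteq> [] \<and>
      (\<exists>f g. cell_run K f \<phi>s g \<and> vcod K f = vdom K (vsrc \<psi>)) \<and> snd (hsrc \<psi>) = htgts \<phi>s"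
    using cell_path_run[of \<phi>s] cell_ends[of "hd \<phi>s"] cell_ends[of \<psi>]
    by (auto simp: composable_def concat_htgt_def o_def subset_iff)
next
  assume R: "\<psi> \<in> cells K \<and> \<phi>s \<noteq> [] \<and>
      (\<exists>f g. cell_run K f \<phi>s g \<and> vcod K f = vdom K (vsrc \<psi>)) \<and> snd (hsrc \<psi>) = htgts \<phi>s"
  then obtain f g where run: "cell_run K f \<phi>s g" "vcod K f = vdom K (vsrc \<psi>)" by blast
  have "hd \<phi>s \<in> cells K" using cell_run_cells[OF run(1)] R by auto
  then have "fst (htgt (hd \<phi>s)) = fst (hsrc \<psi>)"
    using cell_ends cell_run_hd[OF run(1)] R run(2) by metis
  then show "composable K \<psi> \<phi>s"
    using R cell_run_cells[OF run(1)] cell_run_cell_path[OF run(1)]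
    by (auto simp: composable_def concat_htgt_def o_def prod_eq_iff)
qed

lemma composableI:
  assumes "\<psi> \<in> cells K" "\<phi>s \<noteq> []" "cell_run K f \<phi>s g" "vcod K f = vdom K (vsrc \<psi>)"
    "snd (hsrc \<psi>) = htgts \<phi>s"
  shows "composable K \<psi> \<phi>s"
  using assms composable_iff by blast

lemma composable_run:
  assumes "composable K \<psi> \<phi>s" "cell_run K f \<phi>s g"
  shows "\<psi> \<in> cells K" "\<phi>s \<noteq> []" "vcod K f = vdom K (vsrc \<psi>)" "snd (hsrc \<psi>) = htgts \<phi>s"
    "vcod K g = vdom K (vtgt \<psi>)"
proof -
  show *: "\<psi> \<in> cells K" "\<phi>s \<noteq> []" "snd (hsrc \<psi>) = htgts \<phi>s"
    using assms composable_iff by blast+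
  show **: "vcod K f = vdom K (vsrc \<psi>)"
    using assms composable_iff cell_run_hd by metis
  \<comment> \<open>Both objects are reached by following the same edges from the same
    object.\<close>
  show "vcod K g = vdom K (vtgt \<psi>)"
    using run_paths[OF assms(2)] cell_ends[OF *(1)] ** *(3) by (auto intro: hpath_unique)
qed

lemma composableE:
  assumes "composable K \<psi> \<phi>s"
  obtains f g where "cell_run K f \<phi>s g" "\<psi> \<in> cells K" "\<phi>s \<noteq> []" "vcod K f = vdom K (vsrc \<psi>)"
    "vcod K g = vdom K (vtgt \<psi>)" "snd (hsrc \<psi>) = htgts \<phi>s"
proof -
  from assms obtain f g where "cell_run K f \<phi>s g" using composable_iff by blast
  with composable_run[OF assms this] that show thesis by blast
qed

lemma cmp_run:
  assumes "composable K \<psi> \<phi>s" "cell_run K f \<phi>s g"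
  shows "cmp K \<psi> \<phi>s \<in> cells K" "hsrc (cmp K \<psi> \<phi>s) = (vdom K f, hsrcs \<phi>s)"
    "htgt (cmp K \<psi> \<phi>s) = htgt \<psi>" "vsrc (cmp K \<psi> \<phi>s) = vcmp K (vsrc \<psi>) f"
    "vtgt (cmp K \<psi> \<phi>s) = vcmp K (vtgt \<psi>) g"
proof -
  note ne = composable_run(2)[OF assms]
  have "hd \<phi>s \<in> cells K" using cell_run_cells[OF assms(2)] ne by auto
  then have "fst (hsrc (hd \<phi>s)) = vdom K f"
    using cell_ends(3) cell_run_hd[OF assms(2) ne] by auto
  then show "cmp K \<psi> \<phi>s \<in> cells K" "hsrc (cmp K \<psi> \<phi>s) = (vdom K f, hsrcs \<phi>s)"
    "htgt (cmp K \<psi> \<phi>s) = htgt \<psi>" "vsrc (cmp K \<psi> \<phi>s) = vcmp K (vsrc \<psi>) f"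
    "vtgt (cmp K \<psi> \<phi>s) = vcmp K (vtgt \<psi>) g"
    using cmp_cell[OF assms(1)] cell_run_hd[OF assms(2) ne] cell_run_last[OF assms(2) ne]
    by (auto simp: concat_hsrc_def o_def)
qed

lemma composable_single:
  "composable K \<psi> [\<phi>] \<longleftrightarrow> \<psi> \<in> cells K \<and> \<phi> \<in> cells K \<and> hsrc \<psi> = htgt \<phi>"
  by (auto simp: composable_def cell_path_def concat_htgt_def prod_eq_iff)

lemma cmp_single:
  assumes "\<psi> \<in> cells K" "\<phi> \<in> cells K" "hsrc \<psi> = htgt \<phi>"
  shows "cmp K \<psi> [\<phi>] \<in> cells K" "hsrc (cmp K \<psi> [\<phi>]) = hsrc \<phi>"
    "htgt (cmp K \<psi> [\<phi>]) = htgt \<psi>" "vsrc (cmp K \<psi> [\<phi>]) = vcmp K (vsrc \<psi>) (vsrc \<phi>)"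
    "vtgt (cmp K \<psi> [\<phi>]) = vcmp K (vtgt \<psi>) (vtgt \<phi>)"
  using cmp_cell[of \<psi> "[\<phi>]"] assms by (auto simp: composable_single concat_hsrc_def)

text \<open>The composed cells meet because adjacent rows of \<open>\<phi>ss\<close> share a
  vertical morphism, as do adjacent cells of \<open>\<psi>s\<close>. The two path equations are what
  composability of the two sides of \<open>cmp_assoc\<close> rests on.\<close>

lemma comp_run:
  assumes "list_all2 (composable K) \<psi>s \<phi>ss" "cell_run K f \<psi>s g" "cell_run K f' (concat \<phi>ss) g'"
    "vcod K f' = vdom K f"
  shows "cell_run K (vcmp K f f') (map2 (cmp K) \<psi>s \<phi>ss) (vcmp K g g')
    \<and> htgts (map2 (cmp K) \<psi>s \<phi>ss) = htgts \<psi>s \<and> hsrcs \<psi>s = htgts (concat \<phi>ss)"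
  using assms
proof (induction \<psi>s \<phi>ss arbitrary: f f' rule: list_all2_induct)
  case Nil
  then show ?case using vcmp_ends by auto
next
  case (Cons \<psi> \<psi>s \<phi>s \<phi>ss)
  then obtain m where m: "cell_run K f' \<phi>s m" "cell_run K m (concat \<phi>ss) g'"
    by (auto simp: run_append)
  note c = composable_run[OF Cons.hyps(1) m(1)] and r = cmp_run[OF Cons.hyps(1) m(1)]
  have "cell_run K (vcmp K (vtgt \<psi>) m) (map2 (cmp K) \<psi>s \<phi>ss) (vcmp K g g')
    \<and> htgts (map2 (cmp K) \<psi>s \<phi>ss) = htgts \<psi>s \<and> hsrcs \<psi>s = htgts (concat \<phi>ss)"
    using Cons.prems m c by (intro Cons.IH) auto
  then show ?case using Cons.prems c r by auto
qed

text \<open>Inside a larger composite \<open>cmp_assoc\<close> can be used only when the boundaries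
  of its sides are known; the same premises yield that both sides are composites.\<close>

lemma composable_assoc:
  assumes "composable K \<chi> \<psi>s" "list_all2 (composable K) \<psi>s \<phi>ss" "cell_path (concat \<phi>ss)"
  shows "composable K (cmp K \<chi> \<psi>s) (concat \<phi>ss)" "composable K \<chi> (map2 (cmp K) \<psi>s \<phi>ss)"
proof -
  obtain f g where fg: "cell_run K f \<psi>s g" "\<chi> \<in> cells K" "\<psi>s \<noteq> []" "vcod K f = vdom K (vsrc \<chi>)"
    "snd (hsrc \<chi>) = htgts \<psi>s"
    using composableE[OF assms(1)] by metis
  from assms(2) fg(3) obtain \<psi> \<psi>s' \<phi>s \<phi>ss' where 
    eq: "\<psi>s = \<psi> # \<psi>s'" "\<phi>ss = \<phi>s # \<phi>ss'" and c0: "composable K \<psi> \<phi>s"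
    by (cases \<psi>s; cases \<phi>ss) auto
  have c0': "\<phi>s \<noteq> []" using c0 by (simp add: composable_def)
  have "\<And>\<phi>s. \<phi>s \<in> set \<phi>ss \<Longrightarrow> set \<phi>s \<subseteq> cells K"
    using assms(2) by (auto simp: list_all2_conv_all_nth in_set_conv_nth composable_def)
  then have sub: "set (concat \<phi>ss) \<subseteq> cells K" by auto
  have ne: "concat \<phi>ss \<noteq> []" using c0' eq by auto
  obtain f' g' where r': "cell_run K f' (concat \<phi>ss) g'"
    using cell_path_run[OF assms(3) sub ne] by blast
  then obtain m where "cell_run K f' \<phi>s m" using eq by (auto simp: run_append)
  then have v: "vcod K f' = vdom K f"
    using composable_run(3)[OF c0] fg(1) eq by auto
  note C = comp_run[OF assms(2) fg(1) r' v]
  have ff: "f \<in> vmor K" "f' \<in> vmor K" using run_ends fg r' by blast+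
  have "vsrc \<chi> \<in> vmor K" using cell_ends fg by blast
  note R = cmp_run[OF assms(1) fg(1)]
  show "composable K (cmp K \<chi> \<psi>s) (concat \<phi>ss)"
    by (rule composableI[OF _ ne r'])
      (use C R v fg ff vcmp_ends[of f "vsrc \<chi>"] cell_ends[OF fg(2)] in \<open>simp_all add: o_def\<close>)
  show "composable K \<chi> (map2 (cmp K) \<psi>s \<phi>ss)"
    by (rule composableI[OF fg(2) _ conjunct1[OF C]])
      (use C fg eq v vcmp_ends[of f' f] ff in auto)
qed

text \<open>Associativity in the case where every cell of the middle row sits on a single cell; most
  calculations below are arranged in such columns.\<close>

lemma cmp_cols:
  assumes "composable K \<chi> zs" "list_all2 (\<lambda>z x. composable K z [x]) zs xs" "cell_path xs"
  shows "cmp K \<chi> (map2 (\<lambda>z x. cmp K z [x]) zs xs) = cmp K (cmp K \<chi> zs) xs"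
    "composable K (cmp K \<chi> zs) xs" "composable K \<chi> (map2 (\<lambda>z x. cmp K z [x]) zs xs)"
proof -
  let ?xss = "map (\<lambda>x. [x]) xs"
  have 1: "list_all2 (composable K) zs ?xss"
    using assms(2) by (simp add: list_all2_map2)
  have 2: "map2 (cmp K) zs ?xss = map2 (\<lambda>z x. cmp K z [x]) zs xs"
    by (simp add: zip_map2 o_def case_prod_unfold)
  have 3: "concat ?xss = xs" by (induction xs) auto
  show "cmp K \<chi> (map2 (\<lambda>z x. cmp K z [x]) zs xs) = cmp K (cmp K \<chi> zs) xs"
    "composable K (cmp K \<chi> zs) xs" "composable K \<chi> (map2 (\<lambda>z x. cmp K z [x]) zs xs)"
    using cmp_assoc[OF assms(1) 1] composable_assoc[OF assms(1) 1] assms(3) by (simp_all add: 2 3)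
qed

lemma cmp_single_assoc:
  assumes "composable K \<chi> [\<psi>]" "composable K \<psi> \<phi>s"
  shows "cmp K \<chi> [cmp K \<psi> \<phi>s] = cmp K (cmp K \<chi> [\<psi>]) \<phi>s" "composable K (cmp K \<chi> [\<psi>]) \<phi>s"
    "composable K \<chi> [cmp K \<psi> \<phi>s]"
  using cmp_assoc[OF assms(1), of "[\<phi>s]"] composable_assoc[OF assms(1), of "[\<phi>s]"] assms(2)
  by (auto simp: composable_def[of K \<psi>])

lemma single_assoc:
  assumes "\<chi> \<in> cells K" "\<psi> \<in> cells K" "\<phi> \<in> cells K" "hsrc \<chi> = htgt \<psi>" "hsrc \<psi> = htgt \<phi>"
  shows "cmp K \<chi> [cmp K \<psi> [\<phi>]] = cmp K (cmp K \<chi> [\<psi>]) [\<phi>]"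
  using cmp_single_assoc[of \<chi> \<psi> "[\<phi>]"] assms by (simp add: composable_single)

section \<open>Identity cells and the removal of vertical identities\<close>

lemma vidc_ends:
  assumes "f \<in> vmor K"
  shows "vidc K f \<in> cells K" "hsrc (vidc K f) = (vdom K f, [])" "htgt (vidc K f) = (vcod K f, [])"
    "vsrc (vidc K f) = f" "vtgt (vidc K f) = f"
  using vidc_cell[OF assms] by auto

lemma hidc_ends:
  assumes "J \<in> hmor K"
  shows "hidc K J \<in> cells K" "hsrc (hidc K J) = (hdom K J, [J])" "htgt (hidc K J) = (hdom K J, [J])"
    "vsrc (hidc K J) = vid K (hdom K J)" "vtgt (hidc K J) = vid K (hcod K J)"
  using hidc_cell[OF assms] by auto

text \<open>A vertical identity has empty horizontal target and equal vertical source and target, so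
  the shorter row is again a run with the same targets. \<open>cmp_insert\<close> takes
  composability of both rows as premises; here the longer row supplies that of the shorter one, as
  long as a cell remains.\<close>

lemma composable_drop_vidc:
  assumes "composable K \<psi> (xs @ vidc K f # ys)" "f \<in> vmor K" "xs @ ys \<noteq> []"
  shows "composable K \<psi> (xs @ ys)" "cmp K \<psi> (xs @ vidc K f # ys) = cmp K \<psi> (xs @ ys)"
proof -
  obtain a b where ab: "cell_run K a (xs @ vidc K f # ys) b" "\<psi> \<in> cells K"
    "vcod K a = vdom K (vsrc \<psi>)" "snd (hsrc \<psi>) = htgts (xs @ vidc K f # ys)"
    using composableE[OF assms(1)] by metis
  have "cell_run K a (xs @ ys) b"
    using ab(1) vidc_ends[OF assms(2)] by (auto simp: run_append)
  then show "composable K \<psi> (xs @ ys)"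
    by (rule composableI[OF ab(2) assms(3)]) (use ab vidc_ends[OF assms(2)] in auto)
  then show "cmp K \<psi> (xs @ vidc K f # ys) = cmp K \<psi> (xs @ ys)"
    using cmp_insert[OF assms(2)] assms(1) by blast
qed

text \<open>The prefix \<open>xs\<close> is left untouched, so that the induction over
  \<open>ys\<close> can move surviving cells into it. It also lets a caller retain a chosen cell and
  thereby keep the row non-empty.\<close>

lemma drop_vidcs:
  assumes "composable K \<psi> (xs @ ys)" "xs @ filter (\<lambda>\<phi>. \<phi> \<notin> vidc K ` vmor K) ys \<noteq> []"
  shows "composable K \<psi> (xs @ filter (\<lambda>\<phi>. \<phi> \<notin> vidc K ` vmor K) ys) \<and>
    cmp K \<psi> (xs @ ys) = cmp K \<psi> (xs @ filter (\<lambda>\<phi>. \<phi> \<notin> vidc K ` vmor K) ys)"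
  using assms
proof (induction ys arbitrary: xs)
  case (Cons y ys)
  show ?case
  proof (cases "y \<in> vidc K ` vmor K")
    case True
    then obtain f where f: "f \<in> vmor K" "y = vidc K f" by blast
    have "xs @ ys \<noteq> []" using Cons.prems(2) True by auto
    then show ?thesis
      using composable_drop_vidc[of \<psi> xs f ys] Cons.prems True f Cons.IH[of xs] by auto
  next
    case False
    then show ?thesis using Cons.IH[of "xs @ [y]"] Cons.prems by auto
  qed
qed simp

lemma run_hidcs:
  "hpath K A Js B \<Longrightarrow> cell_run K (vid K A) (map (hidc K) Js) (vid K B)"
  by (induction Js arbitrary: A) (auto simp: vid_ends hidc_ends)

lemma hsrcs_hidcs: "set Js \<subseteq> hmor K \<Longrightarrow> hsrcs (map (hidc K) Js) = Js"
  by (induction Js) (auto simp: hidc_ends)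

lemma htgts_hidcs: "set Js \<subseteq> hmor K \<Longrightarrow> htgts (map (hidc K) Js) = Js"
  by (induction Js) (auto simp: hidc_ends)

lemma path_hmor: "hpath K A Js B \<Longrightarrow> set Js \<subseteq> hmor K"
  by (induction Js arbitrary: A) auto

lemma hidc_comp:
  "\<phi> \<in> cells K \<Longrightarrow> snd (htgt \<phi>) = [H] \<Longrightarrow> cmp K (hidc K H) [\<phi>] = \<phi>"
  using hidc_cmp[of \<phi> "fst (htgt \<phi>)" H] by (simp add: prod_eq_iff)

lemma composable_hidc:
  assumes "\<phi> \<in> cells K" "snd (htgt \<phi>) = [H]"
  shows "composable K (hidc K H) [\<phi>]"
  using cell_ends[OF assms(1)] assms hidc_ends[of H] by (auto simp: composable_single prod_eq_iff)

end

section \<open>The 2-category of augmented virtual double categories\<close>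

lemma avfun_eqI:
  assumes "avfunctor F" "avfunctor G" "fdom F = fdom G" "fcod F = fcod G"
    "\<And>A. A \<in> obj (fdom F) \<Longrightarrow> fobj F A = fobj G A"
    "\<And>f. f \<in> vmor (fdom F) \<Longrightarrow> fver F f = fver G f"
    "\<And>J. J \<in> hmor (fdom F) \<Longrightarrow> fhor F J = fhor G J"
    "\<And>\<phi>. \<phi> \<in> cells (fdom F) \<Longrightarrow> fcell F \<phi> = fcell G \<phi>"
  shows "F = G"
proof -
  interpret F: avfunctor F by fact
  interpret G: avfunctor G by fact
  have "fobj F = fobj G" "fver F = fver G" "fhor F = fhor G" "fcell F = fcell G"
    using assms(3-) F.fobj_ext G.fobj_ext F.fver_ext G.fver_ext F.fhor_ext G.fhor_ext
      F.fcell_ext G.fcell_ext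
    by (auto intro: extensionalityI)
  then show ?thesis using assms(3,4) by (intro avfun.equality) auto
qed

lemma avtrans_eqI:
  assumes "avtransformation \<xi>" "avtransformation \<zeta>" "tsrc \<xi> = tsrc \<zeta>" "ttgt \<xi> = ttgt \<zeta>"
    "\<And>A. A \<in> obj (fdom (tsrc \<xi>)) \<Longrightarrow> tobj \<xi> A = tobj \<zeta> A"
    "\<And>J. J \<in> hmor (fdom (tsrc \<xi>)) \<Longrightarrow> thor \<xi> J = thor \<zeta> J"
  shows "\<xi> = \<zeta>"
proof -
  interpret \<xi>: avtransformation \<xi> by fact
  interpret \<zeta>: avtransformation \<zeta> by fact
  have "tobj \<xi> = tobj \<zeta>" "thor \<xi> = thor \<zeta>"
    using assms(3-) \<xi>.tobj_ext \<zeta>.tobj_ext \<xi>.thor_ext \<zeta>.thor_ext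
    by (auto intro: extensionalityI)
  then show ?thesis using assms(3,4) by (intro avtrans.equality) auto
qed

context avfunctor
begin

sublocale dom: avdc "fdom F" by (rule fdom_avdc)
sublocale cod: avdc "fcod F" by (rule fcod_avdc)

lemma fver_ends:
  assumes "f \<in> vmor (fdom F)"
  shows "fver F f \<in> vmor (fcod F)" "vdom (fcod F) (fver F f) = fobj F (vdom (fdom F) f)"
    "vcod (fcod F) (fver F f) = fobj F (vcod (fdom F) f)"
  using fver_hom[of f "vdom (fdom F) f" "vcod (fdom F) f"] assms by (auto simp: vhom_iff)

lemma fver_vcmp:
  assumes "f \<in> vmor (fdom F)" "g \<in> vmor (fdom F)" "vcod (fdom F) f = vdom (fdom F) g"
  shows "fver F (vcmp (fdom F) g f) = vcmp (fcod F) (fver F g) (fver F f)"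
  using fver_cmp[of f "vdom (fdom F) f" "vcod (fdom F) f" g "vcod (fdom F) g"] assms
  by (auto simp: vhom_iff)

lemma fcell_ends:
  assumes "\<phi> \<in> cells (fdom F)"
  shows "fcell F \<phi> \<in> cells (fcod F)"
    "hsrc (fcell F \<phi>) = fpath F (hsrc \<phi>)" "htgt (fcell F \<phi>) = fpath F (htgt \<phi>)"
    "vsrc (fcell F \<phi>) = fver F (vsrc \<phi>)" "vtgt (fcell F \<phi>) = fver F (vtgt \<phi>)"
  using fcell_cell[OF assms] by auto

lemma fcell_run:
  "cell_run (fdom F) f \<phi>s g \<Longrightarrow> cell_run (fcod F) (fver F f) (map (fcell F) \<phi>s) (fver F g)"
  by (induction \<phi>s arbitrary: f) (auto simp: fcell_ends fver_ends)

lemma fcell_htgts: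
  "set \<phi>s \<subseteq> cells (fdom F) \<Longrightarrow> htgts (map (fcell F) \<phi>s) = map (fhor F) (htgts \<phi>s)"
  by (induction \<phi>s) (auto simp: fcell_ends fpath_def)

lemma fhor_path:
  "hpath (fdom F) A Js B \<Longrightarrow> hpath (fcod F) (fobj F A) (map (fhor F) Js) (fobj F B)"
  by (induction Js arbitrary: A) (auto simp: fobj_obj fhor_hom)

lemma fcell_composable:
  assumes "composable (fdom F) \<psi> \<phi>s"
  shows "composable (fcod F) (fcell F \<psi>) (map (fcell F) \<phi>s)"
proof -
  obtain f g where r: "cell_run (fdom F) f \<phi>s g" "\<psi> \<in> cells (fdom F)" "\<phi>s \<noteq> []"
    "vcod (fdom F) f = vdom (fdom F) (vsrc \<psi>)" "snd (hsrc \<psi>) = htgts \<phi>s"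
    using dom.composableE[OF assms] by metis
  show ?thesis
    using r fcell_ends[OF r(2)] dom.run_ends[OF r(1)] fver_ends dom.cell_ends(1)[OF r(2)]
      fcell_htgts[OF cell_run_cells[OF r(1)]]
    by (intro cod.composableI[OF _ _ fcell_run[OF r(1)]]) (auto simp: fpath_def)
qed

end

lemma id_avfun_simps [simp]:
  "fdom (id_avfun K) = K" "fcod (id_avfun K) = K"
  "A \<in> obj K \<Longrightarrow> fobj (id_avfun K) A = A" "f \<in> vmor K \<Longrightarrow> fver (id_avfun K) f = f"
  "J \<in> hmor K \<Longrightarrow> fhor (id_avfun K) J = J" "\<phi> \<in> cells K \<Longrightarrow> fcell (id_avfun K) \<phi> = \<phi>"
  by (auto simp: id_avfun_def)

lemma comp_avfun_simps [simp]:
  "fdom (comp_avfun G F) = fdom F" "fcod (comp_avfun G F) = fcod G"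
  "A \<in> obj (fdom F) \<Longrightarrow> fobj (comp_avfun G F) A = fobj G (fobj F A)"
  "f \<in> vmor (fdom F) \<Longrightarrow> fver (comp_avfun G F) f = fver G (fver F f)"
  "J \<in> hmor (fdom F) \<Longrightarrow> fhor (comp_avfun G F) J = fhor G (fhor F J)"
  "\<phi> \<in> cells (fdom F) \<Longrightarrow> fcell (comp_avfun G F) \<phi> = fcell G (fcell F \<phi>)"
  by (auto simp: comp_avfun_def)

lemma (in avdc) id_avfun_functor: "avfunctor (id_avfun K)"
proof (rule avfunctor.intro)
  fix \<phi> assume \<phi>: "\<phi> \<in> cells (fdom (id_avfun K))"
  then have c: "\<phi> \<in> cells K" by simp
  have "fpath (id_avfun K) p = p" if "hpath K (fst p) (snd p) B" for p B
    using path_hmor[OF that] path_ends[OF that] 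
    by (auto simp: fpath_def prod_eq_iff intro!: map_idI)
  then show "fcell (id_avfun K) \<phi> \<in> cells (fcod (id_avfun K)) \<and>
      hsrc (fcell (id_avfun K) \<phi>) = fpath (id_avfun K) (hsrc \<phi>) \<and>
      htgt (fcell (id_avfun K) \<phi>) = fpath (id_avfun K) (htgt \<phi>) \<and>
      vsrc (fcell (id_avfun K) \<phi>) = fver (id_avfun K) (vsrc \<phi>) \<and>
      vtgt (fcell (id_avfun K) \<phi>) = fver (id_avfun K) (vtgt \<phi>)"
    using c cell_ends[OF c] by simp
next
  fix \<psi> \<phi>s assume "composable (fdom (id_avfun K)) \<psi> \<phi>s"
  then have c: "composable K \<psi> \<phi>s" by simp
  then have "map (fcell (id_avfun K)) \<phi>s = \<phi>s" "\<psi> \<in> cells K" "cmp K \<psi> \<phi>s \<in> cells K"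
    using cmp_cell[OF c] by (auto simp: composable_def intro!: map_idI)
  then show "fcell (id_avfun K) (cmp (fdom (id_avfun K)) \<psi> \<phi>s) =
      cmp (fcod (id_avfun K)) (fcell (id_avfun K) \<psi>) (map (fcell (id_avfun K)) \<phi>s)"
    by simp
qed (use avdc_axioms vmor_ends hmor_ends vid_ends vcmp_ends hidc_ends vidc_ends in
    \<open>auto simp: vhom_iff id_avfun_def\<close>)

lemma comp_avfun_functor:
  assumes "avfunctor F" "avfunctor G" "fcod F = fdom G"
  shows "avfunctor (comp_avfun G F)"
proof -
  interpret F: avfunctor F by fact
  interpret G: avfunctor G by fact
  note [simp] = assms(3)
  note [simp] = F.fobj_obj[unfolded assms(3)] F.fver_ends[unfolded assms(3)]
    F.fhor_hom[unfolded assms(3)] F.fcell_ends[unfolded assms(3)]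
    G.fobj_obj[simp] G.fver_ends[simp] G.fhor_hom[simp] G.fcell_ends[simp]
  \<comment> \<open>The maps of the composite are \<open>undefined\<close> off their domains, so the
    two path maps are compared on paths of the domain.\<close>
  have 1: "fpath (comp_avfun G F) p = fpath G (fpath F p)" if "hpath (fdom F) (fst p) (snd p) B" for p B
    using F.dom.path_hmor[OF that] F.dom.path_ends[OF that] by (auto simp: fpath_def prod_eq_iff)
  show ?thesis
  proof (rule avfunctor.intro)
    fix \<psi> \<phi>s assume "composable (fdom (comp_avfun G F)) \<psi> \<phi>s"
    then have c: "composable (fdom F) \<psi> \<phi>s" by simp
    then have m: "map (fcell (comp_avfun G F)) \<phi>s = map (fcell G) (map (fcell F) \<phi>s)"
      and "\<psi> \<in> cells (fdom F)" "cmp (fdom F) \<psi> \<phi>s \<in> cells (fdom F)"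
      using F.dom.cmp_cell[OF c] by (auto simp: composable_def)
    then show "fcell (comp_avfun G F) (cmp (fdom (comp_avfun G F)) \<psi> \<phi>s) =
      cmp (fcod (comp_avfun G F)) (fcell (comp_avfun G F) \<psi>) (map (fcell (comp_avfun G F)) \<phi>s)"
      unfolding m using F.fcell_cmp[OF c] G.fcell_cmp F.fcell_composable[OF c] by simp
  next
    fix \<phi> assume "\<phi> \<in> cells (fdom (comp_avfun G F))"
    then have "\<phi> \<in> cells (fdom F)" by simp
    with F.dom.cell_ends[OF this]
    show "fcell (comp_avfun G F) \<phi> \<in> cells (fcod (comp_avfun G F)) \<and>
      hsrc (fcell (comp_avfun G F) \<phi>) = fpath (comp_avfun G F) (hsrc \<phi>) \<and>
      htgt (fcell (comp_avfun G F) \<phi>) = fpath (comp_avfun G F) (htgt \<phi>) \<and>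
      vsrc (fcell (comp_avfun G F) \<phi>) = fver (comp_avfun G F) (vsrc \<phi>) \<and>
      vtgt (fcell (comp_avfun G F) \<phi>) = fver (comp_avfun G F) (vtgt \<phi>)"
      by (simp add: 1)
  next
    show "avdc (fdom (comp_avfun G F))" "avdc (fcod (comp_avfun G F))"
      using F.fdom_avdc G.fcod_avdc by auto
  next
    fix f g A B C
    assume "f \<in> vhom (fdom (comp_avfun G F)) A B" "g \<in> vhom (fdom (comp_avfun G F)) B C"
    then have "f \<in> vmor (fdom F)" "g \<in> vmor (fdom F)" "vcod (fdom F) f = vdom (fdom F) g"
      by (auto simp: vhom_iff)
    then show "fver (comp_avfun G F) (vcmp (fdom (comp_avfun G F)) g f) =
      vcmp (fcod (comp_avfun G F)) (fver (comp_avfun G F) g) (fver (comp_avfun G F) f)"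
      using G.fver_vcmp[of "fver F f" "fver F g"]
      by (simp add: F.dom.vcmp_ends F.fver_vcmp)
  next
    fix A assume "A \<in> obj (fdom (comp_avfun G F))"
    then show "fver (comp_avfun G F) (vid (fdom (comp_avfun G F)) A) =
      vid (fcod (comp_avfun G F)) (fobj (comp_avfun G F) A)"
      using F.fobj_obj[of A] G.fver_id by (simp add: F.dom.vid_ends F.fver_id)
  next
    fix J assume "J \<in> hmor (fdom (comp_avfun G F))"
    then show "fcell (comp_avfun G F) (hidc (fdom (comp_avfun G F)) J) =
      hidc (fcod (comp_avfun G F)) (fhor (comp_avfun G F) J)"
      using F.fhor_hom[of J] G.fcell_hidc by (simp add: F.dom.hidc_ends F.fcell_hidc)
  next
    fix f assume "f \<in> vmor (fdom (comp_avfun G F))"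
    then show "fcell (comp_avfun G F) (vidc (fdom (comp_avfun G F)) f) =
      vidc (fcod (comp_avfun G F)) (fver (comp_avfun G F) f)"
      using F.fver_ends[of f] G.fcell_vidc by (simp add: F.dom.vidc_ends F.fcell_vidc)
  next
    fix A assume "A \<in> obj (fdom (comp_avfun G F))"
    then show "fobj (comp_avfun G F) A \<in> obj (fcod (comp_avfun G F))"
      using F.fobj_obj[of A] by simp
  next
    fix f A C assume "f \<in> vhom (fdom (comp_avfun G F)) A C"
    then show "fver (comp_avfun G F) f \<in>
      vhom (fcod (comp_avfun G F)) (fobj (comp_avfun G F) A) (fobj (comp_avfun G F) C)"
      using F.fver_ends[of f] F.dom.vmor_ends[of f] by (auto simp: vhom_iff)
  next
    fix J assume "J \<in> hmor (fdom (comp_avfun G F))"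
    then show "fhor (comp_avfun G F) J \<in> hmor (fcod (comp_avfun G F)) \<and>
      hdom (fcod (comp_avfun G F)) (fhor (comp_avfun G F) J) = fobj (comp_avfun G F) (hdom (fdom (comp_avfun G F)) J) \<and>
      hcod (fcod (comp_avfun G F)) (fhor (comp_avfun G F) J) = fobj (comp_avfun G F) (hcod (fdom (comp_avfun G F)) J)"
      using F.fhor_hom[of J] F.dom.hmor_ends[of J] by auto
  qed (auto simp: comp_avfun_def)
qed

section \<open>Transformations and their composites\<close>

context avtransformation
begin

sublocale F: avfunctor "tsrc \<xi>" by (rule tsrc_functor)
sublocale G: avfunctor "ttgt \<xi>" by (rule ttgt_functor)

abbreviation "L \<equiv> fcod (tsrc \<xi>)"
abbreviation "D \<equiv> fdom (tsrc \<xi>)"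

lemma tgt_ends [simp]: "fdom (ttgt \<xi>) = D" "fcod (ttgt \<xi>) = L"
  using parallel by auto

lemma tobj_ends:
  assumes "A \<in> obj D"
  shows "tobj \<xi> A \<in> vmor L" "vdom L (tobj \<xi> A) = fobj (tsrc \<xi>) A"
    "vcod L (tobj \<xi> A) = fobj (ttgt \<xi>) A"
  using tobj_hom[OF assms] by (auto simp: vhom_iff)

lemma thor_ends:
  assumes "J \<in> hmor D"
  shows "thor \<xi> J \<in> cells L" "hsrc (thor \<xi> J) = (fobj (tsrc \<xi>) (hdom D J), [fhor (tsrc \<xi>) J])"
    "htgt (thor \<xi> J) = (fobj (ttgt \<xi>) (hdom D J), [fhor (ttgt \<xi>) J])"
    "vsrc (thor \<xi> J) = tobj \<xi> (hdom D J)" "vtgt (thor \<xi> J) = tobj \<xi> (hcod D J)"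
  using thor_cell[OF assms] by (auto simp: fpath_def)

lemma tobj_nat:
  assumes "f \<in> vmor D"
  shows "vcmp L (fver (ttgt \<xi>) f) (tobj \<xi> (vdom D f)) = vcmp L (tobj \<xi> (vcod D f)) (fver (tsrc \<xi>) f)"
  using tobj_natural[of f "vdom D f" "vcod D f"] assms by (auto simp: vhom_iff)

lemma thors_run:
  "hpath D A Js B \<Longrightarrow> cell_run L (tobj \<xi> A) (map (thor \<xi>) Js) (tobj \<xi> B)"
  by (induction Js arbitrary: A) (auto simp: thor_ends tobj_ends)

lemma tpath_run:
  assumes "hpath D A Js B"
  shows "cell_run L (tobj \<xi> A) (tpath \<xi> (A, Js)) (tobj \<xi> B)"
  using thors_run[OF assms] assms
  by (auto simp: tpath_def tobj_ends F.cod.vidc_ends)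

lemma tpath_htgts:
  assumes "hpath D A Js B"
  shows "htgts (tpath \<xi> (A, Js)) = map (fhor (ttgt \<xi>)) Js"
    "hsrcs (tpath \<xi> (A, Js)) = map (fhor (tsrc \<xi>)) Js"
proof -
  have "htgts (map (thor \<xi>) Js) = map (fhor (ttgt \<xi>)) Js"
    "hsrcs (map (thor \<xi>) Js) = map (fhor (tsrc \<xi>)) Js"
    using F.dom.path_hmor[OF assms] by (induction Js) (auto simp: thor_ends)
  then show "htgts (tpath \<xi> (A, Js)) = map (fhor (ttgt \<xi>)) Js"
    "hsrcs (tpath \<xi> (A, Js)) = map (fhor (tsrc \<xi>)) Js"
    using F.dom.path_ends[OF assms] by (auto simp: tpath_def tobj_ends F.cod.vidc_ends)
qed

lemma tpath_composable:
  assumes "\<phi> \<in> cells D"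
  shows "composable L (fcell (ttgt \<xi>) \<phi>) (tpath \<xi> (hsrc \<phi>))"
proof -
  note e = F.dom.cell_ends[OF assms]
  have eq: "(vdom D (vsrc \<phi>), snd (hsrc \<phi>)) = hsrc \<phi>" using e by (auto simp: prod_eq_iff)
  note r = tpath_run[OF e(5), unfolded eq] and t = tpath_htgts[OF e(5), unfolded eq]
  show ?thesis
    using r t G.fcell_ends[of \<phi>] assms F.dom.path_ends[OF e(5)] e G.fver_ends[of "vsrc \<phi>"]
    by (intro F.cod.composableI[OF _ _ r]) (auto simp: tpath_def tobj_ends fpath_def)
qed

text \<open>The component at a horizontal target: on paths of length at most one,
  \<open>tpath\<close> is the list with this single entry.\<close>

definition tcell where "tcell p = hd (tpath \<xi> p)"

lemma tcell_ends:
  assumes "hpath D A Js B" "length Js \<le> 1"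
  shows "tpath \<xi> (A, Js) = [tcell (A, Js)]" "tcell (A, Js) \<in> cells L"
    "hsrc (tcell (A, Js)) = fpath (tsrc \<xi>) (A, Js)" "htgt (tcell (A, Js)) = fpath (ttgt \<xi>) (A, Js)"
  using assms by (auto simp: tcell_def tpath_def F.cod.vidc_ends tobj_ends thor_ends fpath_def
      neq_Nil_conv le_Suc_eq length_Suc_conv)

lemma tgt_tcell:
  assumes "\<phi> \<in> cells D"
  shows "tpath \<xi> (htgt \<phi>) = [tcell (htgt \<phi>)]" "tcell (htgt \<phi>) \<in> cells L"
    "hsrc (tcell (htgt \<phi>)) = fpath (tsrc \<xi>) (htgt \<phi>)" "htgt (tcell (htgt \<phi>)) = fpath (ttgt \<xi>) (htgt \<phi>)"
proof -
  note e = F.dom.cell_ends[OF assms]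
  have [simp]: "(vcod D (vsrc \<phi>), snd (htgt \<phi>)) = htgt \<phi>" using e by (auto simp: prod_eq_iff)
  show "tpath \<xi> (htgt \<phi>) = [tcell (htgt \<phi>)]" "tcell (htgt \<phi>) \<in> cells L"
    "hsrc (tcell (htgt \<phi>)) = fpath (tsrc \<xi>) (htgt \<phi>)" "htgt (tcell (htgt \<phi>)) = fpath (ttgt \<xi>) (htgt \<phi>)"
    using tcell_ends[OF e(6,7)] by auto
qed

lemma tcell_nat:
  assumes "\<phi> \<in> cells D"
  shows "cmp L (fcell (ttgt \<xi>) \<phi>) (tpath \<xi> (hsrc \<phi>)) = cmp L (tcell (htgt \<phi>)) [fcell (tsrc \<xi>) \<phi>]"
  using thor_natural[OF assms] by (simp add: tcell_def)

text \<open>Naturality in the shape that the interchange law needs, where \<open>\<phi>\<close> is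
  itself a component of another transformation.\<close>

lemma thor_nat1:
  assumes "\<phi> \<in> cells D" "hsrc \<phi> = (A, [J])" "htgt \<phi> = (B, [H])"
  shows "cmp L (fcell (ttgt \<xi>) \<phi>) [thor \<xi> J] = cmp L (thor \<xi> H) [fcell (tsrc \<xi>) \<phi>]"
  using tcell_nat[OF assms(1)] assms by (simp add: tcell_def tpath_def)

end


lemma (in avfunctor) id_avtrans_transformation: "avtransformation (id_avtrans F)"
proof (rule avtransformation.intro)
  fix J assume "J \<in> hmor (fdom (tsrc (id_avtrans F)))"
  then show "thor (id_avtrans F) J \<in> cells (fcod (tsrc (id_avtrans F))) \<and>
      hsrc (thor (id_avtrans F) J) = fpath (tsrc (id_avtrans F)) (hdom (fdom (tsrc (id_avtrans F))) J, [J]) \<and>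
      htgt (thor (id_avtrans F) J) = fpath (ttgt (id_avtrans F)) (hdom (fdom (tsrc (id_avtrans F))) J, [J]) \<and>
      vsrc (thor (id_avtrans F) J) = tobj (id_avtrans F) (hdom (fdom (tsrc (id_avtrans F))) J) \<and>
      vtgt (thor (id_avtrans F) J) = tobj (id_avtrans F) (hcod (fdom (tsrc (id_avtrans F))) J)"
    using fhor_hom[of J] dom.hmor_ends[of J]
    by (simp add: id_avtrans_def cod.hidc_ends fpath_def)
next
  fix \<phi> assume "\<phi> \<in> cells (fdom (tsrc (id_avtrans F)))"
  then have c: "\<phi> \<in> cells (fdom F)" by (simp add: id_avtrans_def)
  note e = dom.cell_ends[OF c] and f = fcell_ends[OF c]
  have p: "tpath (id_avtrans F) (A, Js) = (if Js = [] then [vidc (fcod F) (vid (fcod F) (fobj F A))]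
      else map (hidc (fcod F)) (map (fhor F) Js))" if "hpath (fdom F) A Js B" for A Js B
    using dom.path_hmor[OF that] dom.path_ends[OF that]
    by (auto simp: tpath_def id_avtrans_def)
  obtain A Js C Ks where st: "hsrc \<phi> = (A, Js)" "htgt \<phi> = (C, Ks)" by fastforce
  have "cmp (fcod F) (fcell F \<phi>) (tpath (id_avtrans F) (hsrc \<phi>)) = fcell F \<phi>"
    using p[of A Js] e st f cod.cmp_vidc_id[OF f(1)] cod.cmp_hidc_id[OF f(1)]
    by (auto simp: fpath_def)
  moreover have "cmp (fcod F) (hd (tpath (id_avtrans F) (htgt \<phi>))) [fcell F \<phi>] = fcell F \<phi>"
    using p[of C Ks] e st f cod.vidc_cmp[OF f(1)] cod.hidc_cmp[OF f(1)]
    by (cases Ks) (auto simp: fpath_def)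
  ultimately show "cmp (fcod (tsrc (id_avtrans F))) (fcell (ttgt (id_avtrans F)) \<phi>)
      (tpath (id_avtrans F) (hsrc \<phi>)) = cmp (fcod (tsrc (id_avtrans F)))
      (hd (tpath (id_avtrans F) (htgt \<phi>))) [fcell (tsrc (id_avtrans F)) \<phi>]"
    by (simp add: id_avtrans_def)
next
  fix f A C assume "f \<in> vhom (fdom (tsrc (id_avtrans F))) A C"
  then show "vcmp (fcod (tsrc (id_avtrans F))) (fver (ttgt (id_avtrans F)) f) (tobj (id_avtrans F) A) =
      vcmp (fcod (tsrc (id_avtrans F))) (tobj (id_avtrans F) C) (fver (tsrc (id_avtrans F)) f)"
    using fver_ends[of f] dom.vmor_ends[of f] cod.vid_neutral[of "fver F f"]
    by (auto simp: id_avtrans_def vhom_iff)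
qed (use avfunctor_axioms fobj_obj cod.vid_ends in \<open>auto simp: id_avtrans_def vhom_iff\<close>)

lemma vcomp_avtrans_simps [simp]:
  "tsrc (vcomp_avtrans \<zeta> \<xi>) = tsrc \<xi>" "ttgt (vcomp_avtrans \<zeta> \<xi>) = ttgt \<zeta>"
  "A \<in> obj (fdom (tsrc \<xi>)) \<Longrightarrow>
    tobj (vcomp_avtrans \<zeta> \<xi>) A = vcmp (fcod (tsrc \<xi>)) (tobj \<zeta> A) (tobj \<xi> A)"
  "J \<in> hmor (fdom (tsrc \<xi>)) \<Longrightarrow>
    thor (vcomp_avtrans \<zeta> \<xi>) J = cmp (fcod (tsrc \<xi>)) (thor \<zeta> J) [thor \<xi> J]"
  by (auto simp: vcomp_avtrans_def)

lemma hcomp_avtrans_simps [simp]: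
  "tsrc (hcomp_avtrans \<zeta> \<xi>) = comp_avfun (tsrc \<zeta>) (tsrc \<xi>)"
  "ttgt (hcomp_avtrans \<zeta> \<xi>) = comp_avfun (ttgt \<zeta>) (ttgt \<xi>)"
  "A \<in> obj (fdom (tsrc \<xi>)) \<Longrightarrow> tobj (hcomp_avtrans \<zeta> \<xi>) A =
    vcmp (fcod (tsrc \<zeta>)) (tobj \<zeta> (fobj (ttgt \<xi>) A)) (fver (tsrc \<zeta>) (tobj \<xi> A))"
  "J \<in> hmor (fdom (tsrc \<xi>)) \<Longrightarrow> thor (hcomp_avtrans \<zeta> \<xi>) J =
    cmp (fcod (tsrc \<zeta>)) (thor \<zeta> (fhor (ttgt \<xi>) J)) [fcell (tsrc \<zeta>) (thor \<xi> J)]"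
  by (auto simp: hcomp_avtrans_def)

lemma id_avtrans_simps [simp]:
  "tsrc (id_avtrans F) = F" "ttgt (id_avtrans F) = F"
  "A \<in> obj (fdom F) \<Longrightarrow> tobj (id_avtrans F) A = vid (fcod F) (fobj F A)"
  "J \<in> hmor (fdom F) \<Longrightarrow> thor (id_avtrans F) J = hidc (fcod F) (fhor F J)"
  by (auto simp: id_avtrans_def)

text \<open>The row of components of the composite is the columnwise composite of the two rows of
  components; at an empty path this is the composition of vertical identities. By associativity,
  naturality of the composite is then the pasting of the two naturality equations.\<close>

lemma vcomp_avtrans_transformation:
  assumes "avtransformation \<xi>" "avtransformation \<zeta>" "ttgt \<xi> = tsrc \<zeta>"
  shows "avtransformation (vcomp_avtrans \<zeta> \<xi>)"
proof -
  interpret x: avtransformation \<xi> by fact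
  interpret z: avtransformation \<zeta> by fact
  let ?v = "vcomp_avtrans \<zeta> \<xi>" and ?D = "fdom (tsrc \<xi>)" and ?L = "fcod (tsrc \<xi>)"
  have p [simp]: "fdom (tsrc \<zeta>) = ?D" "fcod (tsrc \<zeta>) = ?L"
    "fdom (ttgt \<zeta>) = ?D" "fcod (ttgt \<zeta>) = ?L" and tz: "tsrc \<zeta> = ttgt \<xi>"
    using assms(3) x.tgt_ends z.tgt_ends by metis+
  note [simp] = x.tobj_ends z.tobj_ends[unfolded p]
  note [simp] = x.thor_ends z.thor_ends[unfolded p]
  have path: "tpath ?v (A, Js) = map2 (\<lambda>z x. cmp ?L z [x]) (tpath \<zeta> (A, Js)) (tpath \<xi> (A, Js))"
    "list_all2 (\<lambda>z x. composable ?L z [x]) (tpath \<zeta> (A, Js)) (tpath \<xi> (A, Js))"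
    if "hpath ?D A Js B" for A Js B
  proof -
    have 1: "map (thor ?v) Js = map2 (\<lambda>z x. cmp ?L z [x]) (map (thor \<zeta>) Js) (map (thor \<xi>) Js)"
      "list_all2 (\<lambda>z x. composable ?L z [x]) (map (thor \<zeta>) Js) (map (thor \<xi>) Js)"
      using x.F.dom.path_hmor[OF that]
      by (induction Js) (auto simp: x.F.cod.composable_single tz)
    have A: "A \<in> obj ?D" using x.F.dom.path_ends[OF that] by blast
    then have "cmp ?L (vidc ?L (tobj \<zeta> A)) [vidc ?L (tobj \<xi> A)] = vidc ?L (tobj ?v A)"
      using x.F.cod.cmp_vidc[of "tobj \<xi> A" _ _ "tobj \<zeta> A"]
      by (simp add: vhom_iff tz)
    then show "tpath ?v (A, Js) = map2 (\<lambda>z x. cmp ?L z [x]) (tpath \<zeta> (A, Js)) (tpath \<xi> (A, Js))"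
      "list_all2 (\<lambda>z x. composable ?L z [x]) (tpath \<zeta> (A, Js)) (tpath \<xi> (A, Js))"
      using 1 A by (auto simp: tpath_def x.F.cod.composable_single x.F.cod.vidc_ends tz)
  qed
  show ?thesis
  proof (rule avtransformation.intro)
    fix \<phi> assume "\<phi> \<in> cells (fdom (tsrc ?v))"
    then have c: "\<phi> \<in> cells ?D" by simp
    note e = x.F.dom.cell_ends[OF c]
    have eq: "(vdom ?D (vsrc \<phi>), snd (hsrc \<phi>)) = hsrc \<phi>" "(vcod ?D (vsrc \<phi>), snd (htgt \<phi>)) = htgt \<phi>"
      using e by (auto simp: prod_eq_iff)
    note s = path[OF e(5), unfolded eq] and t = path[OF e(6), unfolded eq]
    note cx = x.tpath_composable[OF c] and cz = z.tpath_composable[unfolded p, OF c]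
    let ?Z = "z.tcell (htgt \<phi>)" and ?X = "x.tcell (htgt \<phi>)"
    note Z = z.tgt_tcell[unfolded p, OF c] and X = x.tgt_tcell[OF c]
    have hd: "hd (tpath ?v (htgt \<phi>)) = cmp ?L ?Z [?X]" using t(1) X(1) Z(1) by simp
    have F: "fcell (tsrc \<xi>) \<phi> \<in> cells ?L" "htgt (fcell (tsrc \<xi>) \<phi>) = hsrc ?X"
      "fcell (ttgt \<xi>) \<phi> \<in> cells ?L" "htgt (fcell (ttgt \<xi>) \<phi>) = hsrc ?Z"
      using c X Z x.F.fcell_ends x.G.fcell_ends tz by auto
    have "cmp ?L (fcell (ttgt ?v) \<phi>) (tpath ?v (hsrc \<phi>)) =
        cmp ?L (cmp ?L (fcell (ttgt \<zeta>) \<phi>) (tpath \<zeta> (hsrc \<phi>))) (tpath \<xi> (hsrc \<phi>))"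
      using s cx by (simp add: x.F.cod.cmp_cols(1)[OF cz] composable_def)
    also have "\<dots> = cmp ?L (cmp ?L ?Z [fcell (ttgt \<xi>) \<phi>]) (tpath \<xi> (hsrc \<phi>))"
      using z.tcell_nat c tz by simp
    also have "\<dots> = cmp ?L ?Z [cmp ?L (fcell (ttgt \<xi>) \<phi>) (tpath \<xi> (hsrc \<phi>))]"
      using x.F.cod.cmp_single_assoc(1)[OF _ cx] F Z by (simp add: x.F.cod.composable_single)
    also have "\<dots> = cmp ?L ?Z [cmp ?L ?X [fcell (tsrc \<xi>) \<phi>]]"
      using x.tcell_nat[OF c] by simp
    also have "\<dots> = cmp ?L (cmp ?L ?Z [?X]) [fcell (tsrc \<xi>) \<phi>]"
      using F X Z tz by (intro x.F.cod.single_assoc) auto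
    finally show "cmp (fcod (tsrc ?v)) (fcell (ttgt ?v) \<phi>) (tpath ?v (hsrc \<phi>)) =
        cmp (fcod (tsrc ?v)) (hd (tpath ?v (htgt \<phi>))) [fcell (tsrc ?v) \<phi>]"
      by (simp add: hd)
  next
    fix f A C assume "f \<in> vhom (fdom (tsrc ?v)) A C"
    then have f: "f \<in> vmor ?D" "A = vdom ?D f" "C = vcod ?D f" "A \<in> obj ?D" "C \<in> obj ?D"
      using x.F.dom.vmor_ends by (auto simp: vhom_iff)
    have hom: "f \<in> vhom ?D A C" using f by (simp add: vhom_iff)
    note hz' = x.tobj_hom[OF f(4)] x.tobj_hom[OF f(5)] z.tobj_hom[unfolded tz x.tgt_ends, OF f(4)]
      z.tobj_hom[unfolded tz x.tgt_ends, OF f(5)] x.F.fver_hom[OF hom]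
      z.F.fver_hom[unfolded tz x.tgt_ends, OF hom] z.G.fver_hom[unfolded p, OF hom]
    have "vcmp ?L (fver (ttgt \<zeta>) f) (vcmp ?L (tobj \<zeta> A) (tobj \<xi> A)) =
      vcmp ?L (vcmp ?L (tobj \<zeta> C) (fver (ttgt \<xi>) f)) (tobj \<xi> A)"
      using x.F.cod.vcmp_assoc[OF hz'(1) hz'(3) hz'(7)] z.tobj_nat[of f] f tz by simp
    also have "\<dots> = vcmp ?L (vcmp ?L (tobj \<zeta> C) (tobj \<xi> C)) (fver (tsrc \<xi>) f)"
      using x.F.cod.vcmp_assoc[OF hz'(1) hz'(6) hz'(4)] x.F.cod.vcmp_assoc[OF hz'(5) hz'(2) hz'(4)]
        x.tobj_nat[of f] f by simp
    finally show "vcmp (fcod (tsrc ?v)) (fver (ttgt ?v) f) (tobj ?v A) =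
        vcmp (fcod (tsrc ?v)) (tobj ?v C) (fver (tsrc ?v) f)"
      using f by simp
  next
    fix J assume "J \<in> hmor (fdom (tsrc ?v))"
    then show "thor ?v J \<in> cells (fcod (tsrc ?v)) \<and>
      hsrc (thor ?v J) = fpath (tsrc ?v) (hdom (fdom (tsrc ?v)) J, [J]) \<and>
      htgt (thor ?v J) = fpath (ttgt ?v) (hdom (fdom (tsrc ?v)) J, [J]) \<and>
      vsrc (thor ?v J) = tobj ?v (hdom (fdom (tsrc ?v)) J) \<and>
      vtgt (thor ?v J) = tobj ?v (hcod (fdom (tsrc ?v)) J)"
      using x.F.cod.cmp_single[of "thor \<zeta> J" "thor \<xi> J"] x.F.dom.hmor_ends[of J] tz
      by (simp add: fpath_def)
  next
    fix A assume "A \<in> obj (fdom (tsrc ?v))"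
    then show "tobj ?v A \<in> vhom (fcod (tsrc ?v)) (fobj (tsrc ?v) A) (fobj (ttgt ?v) A)"
      by (simp add: vhom_iff x.F.cod.vcmp_ends tz)
  qed (use x.F.avfunctor_axioms z.G.avfunctor_axioms in \<open>auto simp: vcomp_avtrans_def\<close>)
qed


text \<open>Each component is a component of \<open>\<zeta>\<close> at an image under
  \<open>ttgt \<xi>\<close>, after the image under \<open>tsrc \<zeta>\<close> of a component of
  \<open>\<xi>\<close>. Naturality at \<open>\<phi>\<close> combines naturality of
  \<open>\<zeta>\<close> at the cell \<open>fcell (ttgt \<xi>) \<phi>\<close> with the image under
  \<open>tsrc \<zeta>\<close> of naturality of \<open>\<xi>\<close> at
  \<open>\<phi>\<close>.\<close>

lemma hcomp_avtrans_transformation: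
  assumes "avtransformation \<xi>" "avtransformation \<zeta>" "fcod (tsrc \<xi>) = fdom (tsrc \<zeta>)"
  shows "avtransformation (hcomp_avtrans \<zeta> \<xi>)"
proof -
  interpret x: avtransformation \<xi> by fact
  interpret z: avtransformation \<zeta> by fact
  let ?v = "hcomp_avtrans \<zeta> \<xi>" and ?D = "fdom (tsrc \<xi>)" and ?L = "fcod (tsrc \<xi>)"
    and ?P = "fcod (tsrc \<zeta>)" and ?H = "tsrc \<zeta>"
  have p: "fdom (tsrc \<zeta>) = ?L" "fdom (ttgt \<zeta>) = ?L" using assms(3) by auto
  note [simp] = x.tobj_ends z.tobj_ends[unfolded p]
  note [simp] = x.thor_ends z.thor_ends[unfolded p]
  note [simp] = x.F.fobj_obj x.F.fver_ends x.F.fhor_hom x.F.fcell_ends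
    x.G.fobj_obj[unfolded x.tgt_ends] x.G.fver_ends[unfolded x.tgt_ends]
    x.G.fhor_hom[unfolded x.tgt_ends] x.G.fcell_ends[unfolded x.tgt_ends]
    z.F.fobj_obj[unfolded p] z.F.fver_ends[unfolded p] z.F.fhor_hom[unfolded p] z.F.fcell_ends[unfolded p]
    z.G.fobj_obj[unfolded z.tgt_ends p] z.G.fver_ends[unfolded z.tgt_ends p]
    z.G.fhor_hom[unfolded z.tgt_ends p] z.G.fcell_ends[unfolded z.tgt_ends p]
  note [simp] = p
  have path: "tpath ?v (A, Js) = map2 (\<lambda>z x. cmp ?P z [x])
      (tpath \<zeta> (fpath (ttgt \<xi>) (A, Js))) (map (fcell ?H) (tpath \<xi> (A, Js)))"
    "list_all2 (\<lambda>z x. composable ?P z [x]) (tpath \<zeta> (fpath (ttgt \<xi>) (A, Js)))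
      (map (fcell ?H) (tpath \<xi> (A, Js)))"
    if "hpath ?D A Js B" for A Js B
  proof -
    have 1: "map (thor ?v) Js = map2 (\<lambda>z x. cmp ?P z [x]) (map (thor \<zeta>) (map (fhor (ttgt \<xi>)) Js))
        (map (fcell ?H) (map (thor \<xi>) Js))"
      "list_all2 (\<lambda>z x. composable ?P z [x]) (map (thor \<zeta>) (map (fhor (ttgt \<xi>)) Js))
        (map (fcell ?H) (map (thor \<xi>) Js))"
      using x.F.dom.path_hmor[OF that]
      by (induction Js) (auto simp: z.F.cod.composable_single fpath_def)
    have A: "A \<in> obj ?D" using x.F.dom.path_ends[OF that] by blast
    then have c: "cmp ?P (vidc ?P (tobj \<zeta> (fobj (ttgt \<xi>) A))) [vidc ?P (fver ?H (tobj \<xi> A))] =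
        vidc ?P (tobj ?v A)"
      using z.F.cod.cmp_vidc[of "fver ?H (tobj \<xi> A)" _ _ "tobj \<zeta> (fobj (ttgt \<xi>) A)"]
      by (simp add: vhom_iff)
    have d: "fcell ?H (vidc ?L (tobj \<xi> A)) = vidc ?P (fver ?H (tobj \<xi> A))"
      using z.F.fcell_vidc[of "tobj \<xi> A"] A by simp
    show "tpath ?v (A, Js) = map2 (\<lambda>z x. cmp ?P z [x])
      (tpath \<zeta> (fpath (ttgt \<xi>) (A, Js))) (map (fcell ?H) (tpath \<xi> (A, Js)))"
    "list_all2 (\<lambda>z x. composable ?P z [x]) (tpath \<zeta> (fpath (ttgt \<xi>) (A, Js)))
      (map (fcell ?H) (tpath \<xi> (A, Js)))"
      using 1 A c d
      by (auto simp: tpath_def fpath_def z.F.cod.composable_single z.F.cod.vidc_ends)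
  qed
  show ?thesis
  proof (rule avtransformation.intro)
    fix \<phi> assume "\<phi> \<in> cells (fdom (tsrc ?v))"
    then have c: "\<phi> \<in> cells ?D" by simp
    note e = x.F.dom.cell_ends[OF c]
    have eq: "(vdom ?D (vsrc \<phi>), snd (hsrc \<phi>)) = hsrc \<phi>" "(vcod ?D (vsrc \<phi>), snd (htgt \<phi>)) = htgt \<phi>"
      using e by (auto simp: prod_eq_iff)
    note s = path[OF e(5), unfolded eq] and t = path[OF e(6), unfolded eq]
    let ?G = "fcell (ttgt \<xi>) \<phi>" and ?F = "fcell (tsrc \<xi>) \<phi>"
    have G: "?G \<in> cells ?L" "hsrc ?G = fpath (ttgt \<xi>) (hsrc \<phi>)" "htgt ?G = fpath (ttgt \<xi>) (htgt \<phi>)"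
      and F: "?F \<in> cells ?L" "hsrc ?F = fpath (tsrc \<xi>) (hsrc \<phi>)" "htgt ?F = fpath (tsrc \<xi>) (htgt \<phi>)"
      using c by auto
    let ?Z = "z.tcell (htgt ?G)" and ?X = "x.tcell (htgt \<phi>)"
    note cx = x.tpath_composable[OF c] and cz = z.tpath_composable[unfolded p, OF G(1)]
    note Z = z.tgt_tcell[unfolded p, OF G(1)] and X = x.tgt_tcell[OF c]
    have HX: "hsrc (fcell ?H ?X) = htgt (fcell ?H ?F)" "htgt (fcell ?H ?X) = htgt (fcell ?H ?G)"
      "hsrc ?Z = htgt (fcell ?H ?G)"
      using X Z G F by simp_all
    have hd: "hd (tpath ?v (htgt \<phi>)) = cmp ?P ?Z [fcell ?H ?X]" using t(1) X(1) Z(1) G by simp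
    have cpH: "cell_path (map (fcell ?H) (tpath \<xi> (hsrc \<phi>)))"
      using z.F.fcell_composable[unfolded p, OF cx] by (simp add: composable_def)
    have "cmp ?P (fcell (ttgt ?v) \<phi>) (tpath ?v (hsrc \<phi>)) =
        cmp ?P (cmp ?P (fcell (ttgt \<zeta>) ?G) (tpath \<zeta> (hsrc ?G))) (map (fcell ?H) (tpath \<xi> (hsrc \<phi>)))"
      using s z.F.cod.cmp_cols(1)[OF cz _ cpH] c G by simp
    also have "\<dots> = cmp ?P (cmp ?P ?Z [fcell ?H ?G]) (map (fcell ?H) (tpath \<xi> (hsrc \<phi>)))"
      using z.tcell_nat[unfolded p, OF G(1)] by simp
    also have "\<dots> = cmp ?P ?Z [cmp ?P (fcell ?H ?G) (map (fcell ?H) (tpath \<xi> (hsrc \<phi>)))]"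
      using z.F.cod.cmp_single_assoc(1)[OF _ z.F.fcell_composable[unfolded p, OF cx]] HX Z G
      by (simp add: z.F.cod.composable_single)
    also have "\<dots> = cmp ?P ?Z [fcell ?H (cmp ?L ?X [?F])]"
      using z.F.fcell_cmp[unfolded p, OF cx] x.tcell_nat[OF c] by simp
    also have "fcell ?H (cmp ?L ?X [?F]) = cmp ?P (fcell ?H ?X) [fcell ?H ?F]"
      using z.F.fcell_cmp[unfolded p, of ?X "[?F]"] X F by (simp add: x.F.cod.composable_single)
    also have "cmp ?P ?Z [cmp ?P (fcell ?H ?X) [fcell ?H ?F]] =
        cmp ?P (cmp ?P ?Z [fcell ?H ?X]) [fcell ?H ?F]"
      using F X Z HX by (intro z.F.cod.single_assoc) simp_all
    finally show "cmp (fcod (tsrc ?v)) (fcell (ttgt ?v) \<phi>) (tpath ?v (hsrc \<phi>)) =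
        cmp (fcod (tsrc ?v)) (hd (tpath ?v (htgt \<phi>))) [fcell (tsrc ?v) \<phi>]"
      using c by (simp add: hd)
  next
    fix f A C assume "f \<in> vhom (fdom (tsrc ?v)) A C"
    then have f: "f \<in> vmor ?D" "vdom ?D f = A" "vcod ?D f = C" "A \<in> obj ?D" "C \<in> obj ?D"
      using x.F.dom.vmor_ends by (auto simp: vhom_iff)
    let ?Gf = "fver (ttgt \<xi>) f" and ?Ff = "fver (tsrc \<xi>) f"
      and ?zA = "tobj \<zeta> (fobj (ttgt \<xi>) A)" and ?zC = "tobj \<zeta> (fobj (ttgt \<xi>) C)"
    have "vcmp ?P (fver (ttgt \<zeta>) ?Gf) (vcmp ?P ?zA (fver ?H (tobj \<xi> A))) =
      vcmp ?P (vcmp ?P (fver (ttgt \<zeta>) ?Gf) ?zA) (fver ?H (tobj \<xi> A))"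
      using f by (intro z.F.cod.vcmp_assoc) (auto simp: vhom_iff)
    also have "vcmp ?P (fver (ttgt \<zeta>) ?Gf) ?zA = vcmp ?P ?zC (fver ?H ?Gf)"
      using z.tobj_nat[of ?Gf] f by simp
    also have "vcmp ?P \<dots> (fver ?H (tobj \<xi> A)) = vcmp ?P ?zC (vcmp ?P (fver ?H ?Gf) (fver ?H (tobj \<xi> A)))"
      using f by (intro z.F.cod.vcmp_assoc[symmetric]) (auto simp: vhom_iff)
    also have "vcmp ?P (fver ?H ?Gf) (fver ?H (tobj \<xi> A)) = fver ?H (vcmp ?L (tobj \<xi> C) ?Ff)"
      using z.F.fver_vcmp[of "tobj \<xi> A" ?Gf] x.tobj_nat[of f] f by simp
    also have "\<dots> = vcmp ?P (fver ?H (tobj \<xi> C)) (fver ?H ?Ff)"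
      using z.F.fver_vcmp[of ?Ff "tobj \<xi> C"] f by simp
    also have "vcmp ?P ?zC \<dots> = vcmp ?P (vcmp ?P ?zC (fver ?H (tobj \<xi> C))) (fver ?H ?Ff)"
      using f by (intro z.F.cod.vcmp_assoc) (auto simp: vhom_iff)
    finally show "vcmp (fcod (tsrc ?v)) (fver (ttgt ?v) f) (tobj ?v A) =
        vcmp (fcod (tsrc ?v)) (tobj ?v C) (fver (tsrc ?v) f)"
      using f by simp
  next
    fix J assume "J \<in> hmor (fdom (tsrc ?v))"
    then show "thor ?v J \<in> cells (fcod (tsrc ?v)) \<and>
      hsrc (thor ?v J) = fpath (tsrc ?v) (hdom (fdom (tsrc ?v)) J, [J]) \<and>
      htgt (thor ?v J) = fpath (ttgt ?v) (hdom (fdom (tsrc ?v)) J, [J]) \<and>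
      vsrc (thor ?v J) = tobj ?v (hdom (fdom (tsrc ?v)) J) \<and>
      vtgt (thor ?v J) = tobj ?v (hcod (fdom (tsrc ?v)) J)"
      using z.F.cod.cmp_single[of "thor \<zeta> (fhor (ttgt \<xi>) J)" "fcell ?H (thor \<xi> J)"]
        x.F.dom.hmor_ends[of J]
      by (simp add: fpath_def)
  next
    fix A assume "A \<in> obj (fdom (tsrc ?v))"
    then show "tobj ?v A \<in> vhom (fcod (tsrc ?v)) (fobj (tsrc ?v) A) (fobj (ttgt ?v) A)"
      by (simp add: vhom_iff z.F.cod.vcmp_ends)
  next
    show "avfunctor (tsrc ?v)" "avfunctor (ttgt ?v)"
      using comp_avfun_functor[OF x.F.avfunctor_axioms z.F.avfunctor_axioms]
        comp_avfun_functor[OF x.G.avfunctor_axioms z.G.avfunctor_axioms] by simp_all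
  qed (auto simp: hcomp_avtrans_def)
qed

section \<open>The axioms of a 2-category\<close>

lemma AugVirtDblCat_on_simps [simp]:
  "Ob (AugVirtDblCat_on Obs Arrs) = Obs" "Arr (AugVirtDblCat_on Obs Arrs) = Arrs"
  "Two (AugVirtDblCat_on Obs Arrs) = {\<xi>. avtransformation \<xi> \<and> tsrc \<xi> \<in> Arrs \<and> ttgt \<xi> \<in> Arrs}"
  "src1 (AugVirtDblCat_on Obs Arrs) = fdom" "trg1 (AugVirtDblCat_on Obs Arrs) = fcod"
  "src2 (AugVirtDblCat_on Obs Arrs) = tsrc" "trg2 (AugVirtDblCat_on Obs Arrs) = ttgt"
  "id1 (AugVirtDblCat_on Obs Arrs) = id_avfun" "comp1 (AugVirtDblCat_on Obs Arrs) = comp_avfun"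
  "id2 (AugVirtDblCat_on Obs Arrs) = id_avtrans" "vcomp2 (AugVirtDblCat_on Obs Arrs) = vcomp_avtrans"
  "hcomp2 (AugVirtDblCat_on Obs Arrs) = hcomp_avtrans"
  by (simp_all add: AugVirtDblCat_on_def)

lemma comp_avfun_id:
  assumes "avfunctor F"
  shows "comp_avfun F (id_avfun (fdom F)) = F" "comp_avfun (id_avfun (fcod F)) F = F"
proof -
  interpret avfunctor F by fact
  show "comp_avfun F (id_avfun (fdom F)) = F"
    by (rule avfun_eqI) (simp_all add: comp_avfun_functor assms dom.id_avfun_functor)
  show "comp_avfun (id_avfun (fcod F)) F = F"
    by (rule avfun_eqI)
      (simp_all add: comp_avfun_functor assms cod.id_avfun_functor fobj_obj fver_ends fhor_hom fcell_ends)
qed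

lemma comp_avfun_assoc:
  assumes "avfunctor F" "avfunctor G" "avfunctor H" "fcod F = fdom G" "fcod G = fdom H"
  shows "comp_avfun H (comp_avfun G F) = comp_avfun (comp_avfun H G) F"
proof -
  interpret F: avfunctor F by fact
  note [simp] = F.fobj_obj[unfolded assms] F.fver_ends[unfolded assms] F.fhor_hom[unfolded assms]
    F.fcell_ends[unfolded assms]
  show ?thesis
    by (rule avfun_eqI) (simp_all add: comp_avfun_functor assms)
qed

lemma vcomp_avtrans_assoc:
  assumes "avtransformation \<xi>" "avtransformation \<zeta>" "avtransformation \<theta>"
    "ttgt \<xi> = tsrc \<zeta>" "ttgt \<zeta> = tsrc \<theta>"
  shows "vcomp_avtrans \<theta> (vcomp_avtrans \<zeta> \<xi>) = vcomp_avtrans (vcomp_avtrans \<theta> \<zeta>) \<xi>"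
proof -
  interpret x: avtransformation \<xi> by fact
  interpret z: avtransformation \<zeta> by fact
  interpret t: avtransformation \<theta> by fact
  have [simp]: "fdom (tsrc \<zeta>) = x.D" "fcod (tsrc \<zeta>) = x.L" "fdom (tsrc \<theta>) = x.D" "fcod (tsrc \<theta>) = x.L"
    using assms(4,5) x.tgt_ends z.tgt_ends by metis+
  show ?thesis
  proof (rule avtrans_eqI)
    fix A assume "A \<in> obj (fdom (tsrc (vcomp_avtrans \<theta> (vcomp_avtrans \<zeta> \<xi>))))"
    then show "tobj (vcomp_avtrans \<theta> (vcomp_avtrans \<zeta> \<xi>)) A = tobj (vcomp_avtrans (vcomp_avtrans \<theta> \<zeta>) \<xi>) A"
      using x.tobj_hom[of A] z.tobj_hom[of A] t.tobj_hom[of A] assms(4,5)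
      by (simp add: x.F.cod.vcmp_assoc)
  next
    fix J assume "J \<in> hmor (fdom (tsrc (vcomp_avtrans \<theta> (vcomp_avtrans \<zeta> \<xi>))))"
    then show "thor (vcomp_avtrans \<theta> (vcomp_avtrans \<zeta> \<xi>)) J = thor (vcomp_avtrans (vcomp_avtrans \<theta> \<zeta>) \<xi>) J"
      using x.thor_ends[of J] z.thor_ends[of J] t.thor_ends[of J] assms(4,5)
      by (simp add: x.F.cod.single_assoc)
  qed (simp_all add: vcomp_avtrans_transformation assms)
qed

lemma vcomp_avtrans_id:
  assumes "avtransformation \<xi>"
  shows "vcomp_avtrans \<xi> (id_avtrans (tsrc \<xi>)) = \<xi>" "vcomp_avtrans (id_avtrans (ttgt \<xi>)) \<xi> = \<xi>"
proof -
  interpret x: avtransformation \<xi> by fact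
  note tr = vcomp_avtrans_transformation x.F.id_avtrans_transformation
    x.G.id_avtrans_transformation assms
  have v: "vcmp x.L (tobj \<xi> A) (vid x.L (fobj (tsrc \<xi>) A)) = tobj \<xi> A"
    "vcmp x.L (vid x.L (fobj (ttgt \<xi>) A)) (tobj \<xi> A) = tobj \<xi> A" if "A \<in> obj x.D" for A
    using x.F.cod.vid_neutral[of "tobj \<xi> A"] that by (simp_all add: x.tobj_ends)
  have h: "cmp x.L (thor \<xi> J) [hidc x.L (fhor (tsrc \<xi>) J)] = thor \<xi> J"
    "cmp x.L (hidc x.L (fhor (ttgt \<xi>) J)) [thor \<xi> J] = thor \<xi> J" if "J \<in> hmor x.D" for J
    using x.F.cod.cmp_hidc_id[of "thor \<xi> J" _ "[fhor (tsrc \<xi>) J]"] x.F.cod.hidc_comp[of "thor \<xi> J"]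
      x.thor_ends[OF that] by simp_all
  show "vcomp_avtrans \<xi> (id_avtrans (tsrc \<xi>)) = \<xi>"
    by (rule avtrans_eqI) (simp_all add: tr v h)
  show "vcomp_avtrans (id_avtrans (ttgt \<xi>)) \<xi> = \<xi>"
    by (rule avtrans_eqI) (simp_all add: tr v h)
qed


lemma hcomp_avtrans_assoc:
  assumes "avtransformation \<xi>" "avtransformation \<zeta>" "avtransformation \<theta>"
    "fcod (tsrc \<xi>) = fdom (tsrc \<zeta>)" "fcod (tsrc \<zeta>) = fdom (tsrc \<theta>)"
  shows "hcomp_avtrans \<theta> (hcomp_avtrans \<zeta> \<xi>) = hcomp_avtrans (hcomp_avtrans \<theta> \<zeta>) \<xi>"
proof -
  interpret x: avtransformation \<xi> by fact
  interpret z: avtransformation \<zeta> by fact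
  interpret t: avtransformation \<theta> by fact
  have p: "fdom (tsrc \<zeta>) = x.L" "fdom (ttgt \<zeta>) = x.L" and q: "fdom (tsrc \<theta>) = z.L" "fdom (ttgt \<theta>) = z.L"
    using assms(4,5) by auto
  note fs = x.F.avfunctor_axioms z.F.avfunctor_axioms t.F.avfunctor_axioms
    x.G.avfunctor_axioms z.G.avfunctor_axioms t.G.avfunctor_axioms
  show ?thesis
  proof (rule avtrans_eqI)
    show "avtransformation (hcomp_avtrans \<theta> (hcomp_avtrans \<zeta> \<xi>))"
      "avtransformation (hcomp_avtrans (hcomp_avtrans \<theta> \<zeta>) \<xi>)"
      using assms by (simp_all add: hcomp_avtrans_transformation)
    show "tsrc (hcomp_avtrans \<theta> (hcomp_avtrans \<zeta> \<xi>)) = tsrc (hcomp_avtrans (hcomp_avtrans \<theta> \<zeta>) \<xi>)"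
      "ttgt (hcomp_avtrans \<theta> (hcomp_avtrans \<zeta> \<xi>)) = ttgt (hcomp_avtrans (hcomp_avtrans \<theta> \<zeta>) \<xi>)"
      using fs p q by (simp_all add: comp_avfun_assoc)
  next
    fix A assume "A \<in> obj (fdom (tsrc (hcomp_avtrans \<theta> (hcomp_avtrans \<zeta> \<xi>))))"
    then have A: "A \<in> obj x.D" by simp
    note a = x.tobj_ends[OF A] 
    have B: "fobj (ttgt \<xi>) A \<in> obj x.L" "fobj (tsrc \<xi>) A \<in> obj x.L"
      using x.G.fobj_obj[of A] x.F.fobj_obj[of A] A by simp_all
    note b = z.tobj_ends[unfolded p, OF B(1)]
    have C: "fobj (ttgt \<zeta>) (fobj (ttgt \<xi>) A) \<in> obj z.L"
      using z.G.fobj_obj[of "fobj (ttgt \<xi>) A"] B(1) p by simp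
    note c = t.tobj_ends[unfolded q, OF C]
    note d = z.F.fver_ends[unfolded p, OF a(1)]
    note Tb = t.F.fver_ends[unfolded q, OF b(1)] and Td = t.F.fver_ends[unfolded q, OF d(1)]
    show "tobj (hcomp_avtrans \<theta> (hcomp_avtrans \<zeta> \<xi>)) A = tobj (hcomp_avtrans (hcomp_avtrans \<theta> \<zeta>) \<xi>) A"
      using A B C a b c d Tb Td p q t.F.fver_vcmp[unfolded q, OF d(1) b(1)]
      by (simp, intro t.F.cod.vcmp_assoc) (auto simp: vhom_iff)
  next
    fix J assume "J \<in> hmor (fdom (tsrc (hcomp_avtrans \<theta> (hcomp_avtrans \<zeta> \<xi>))))"
    then have J: "J \<in> hmor x.D" by simp
    note a = x.thor_ends[OF J] 
    have B: "fhor (ttgt \<xi>) J \<in> hmor x.L"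
      using x.G.fhor_hom[of J] J by simp
    note b = z.thor_ends[unfolded p, OF B(1)]
    have C: "fhor (ttgt \<zeta>) (fhor (ttgt \<xi>) J) \<in> hmor z.L"
      using z.G.fhor_hom[of "fhor (ttgt \<xi>) J"] B(1) p by simp
    note c = t.thor_ends[unfolded q, OF C]
    note d = z.F.fcell_ends[unfolded p, OF a(1)]
    note Tb = t.F.fcell_ends[unfolded q, OF b(1)] and Td = t.F.fcell_ends[unfolded q, OF d(1)]
    have e: "hdom z.L (fhor (ttgt \<zeta>) (fhor (ttgt \<xi>) J)) = fobj (ttgt \<zeta>) (hdom x.L (fhor (ttgt \<xi>) J))"
      using z.G.fhor_hom[of "fhor (ttgt \<xi>) J"] B(1) p by simp
    have e': "hdom x.L (fhor (ttgt \<xi>) J) = fobj (ttgt \<xi>) (hdom x.D J)"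
      using x.G.fhor_hom[of J] J by simp
    have "fcell (tsrc \<theta>) (cmp z.L (thor \<zeta> (fhor (ttgt \<xi>) J)) [fcell (tsrc \<zeta>) (thor \<xi> J)]) =
      cmp t.L (fcell (tsrc \<theta>) (thor \<zeta> (fhor (ttgt \<xi>) J))) [fcell (tsrc \<theta>) (fcell (tsrc \<zeta>) (thor \<xi> J))]"
      using t.F.fcell_cmp[unfolded q, of "thor \<zeta> (fhor (ttgt \<xi>) J)" "[fcell (tsrc \<zeta>) (thor \<xi> J)]"]
        b d a e' by (simp add: z.F.cod.composable_single fpath_def)
    then show "thor (hcomp_avtrans \<theta> (hcomp_avtrans \<zeta> \<xi>)) J = thor (hcomp_avtrans (hcomp_avtrans \<theta> \<zeta>) \<xi>) J"
      using J B C a b c d Tb Td p q e e'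
      by (simp, intro t.F.cod.single_assoc) (simp_all add: fpath_def)
  qed
qed

lemma hcomp_avtrans_id:
  assumes "avtransformation \<xi>"
  shows "hcomp_avtrans \<xi> (id_avtrans (id_avfun (fdom (tsrc \<xi>)))) = \<xi>"
    "hcomp_avtrans (id_avtrans (id_avfun (fcod (tsrc \<xi>)))) \<xi> = \<xi>"
proof -
  interpret x: avtransformation \<xi> by fact
  note idt = avfunctor.id_avtrans_transformation[OF x.F.dom.id_avfun_functor]
    avfunctor.id_avtrans_transformation[OF x.F.cod.id_avfun_functor]
  have tr: "avtransformation (hcomp_avtrans \<xi> (id_avtrans (id_avfun x.D)))"
    "avtransformation (hcomp_avtrans (id_avtrans (id_avfun x.L)) \<xi>)"
    using hcomp_avtrans_transformation[OF idt(1) assms] hcomp_avtrans_transformation[OF assms idt(2)]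
    by simp_all
  have v: "vcmp x.L (tobj \<xi> A) (vid x.L (fobj (tsrc \<xi>) A)) = tobj \<xi> A"
    "vcmp x.L (vid x.L (fobj (ttgt \<xi>) A)) (tobj \<xi> A) = tobj \<xi> A" if "A \<in> obj x.D" for A
    using x.F.cod.vid_neutral[of "tobj \<xi> A"] that by (simp_all add: x.tobj_ends)
  have h: "cmp x.L (thor \<xi> J) [hidc x.L (fhor (tsrc \<xi>) J)] = thor \<xi> J"
    "cmp x.L (hidc x.L (fhor (ttgt \<xi>) J)) [thor \<xi> J] = thor \<xi> J" if "J \<in> hmor x.D" for J
    using x.F.cod.cmp_hidc_id[of "thor \<xi> J" _ "[fhor (tsrc \<xi>) J]"] x.F.cod.hidc_comp[of "thor \<xi> J"]
      x.thor_ends[OF that] by simp_all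
  have o: "fobj (ttgt \<xi>) A \<in> obj x.L" if "A \<in> obj x.D" for A using x.G.fobj_obj that by simp
  have j: "fhor (ttgt \<xi>) J \<in> hmor x.L" if "J \<in> hmor x.D" for J using x.G.fhor_hom that by simp
  show "hcomp_avtrans \<xi> (id_avtrans (id_avfun x.D)) = \<xi>"
    using comp_avfun_id[OF x.F.avfunctor_axioms] comp_avfun_id[OF x.G.avfunctor_axioms]
    by (intro avtrans_eqI) (simp_all add: tr assms x.F.dom.vid_ends x.F.dom.hidc_ends
        x.F.fver_id x.F.fcell_hidc v h)
  show "hcomp_avtrans (id_avtrans (id_avfun x.L)) \<xi> = \<xi>"
    using comp_avfun_id[OF x.F.avfunctor_axioms] comp_avfun_id[OF x.G.avfunctor_axioms]
    by (intro avtrans_eqI) (simp_all add: tr assms v h o j x.tobj_ends x.thor_ends)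
qed

lemma hcomp_avtrans_id2:
  assumes "avfunctor F" "avfunctor G" "fcod F = fdom G"
  shows "hcomp_avtrans (id_avtrans G) (id_avtrans F) = id_avtrans (comp_avfun G F)"
proof -
  interpret F: avfunctor F by fact
  interpret G: avfunctor G by fact
  have o: "fobj F A \<in> obj (fdom G)" if "A \<in> obj (fdom F)" for A using F.fobj_obj that assms by simp
  have j: "fhor F J \<in> hmor (fdom G)" if "J \<in> hmor (fdom F)" for J using F.fhor_hom that assms by simp
  have h: "cmp (fcod G) (hidc (fcod G) H) [hidc (fcod G) H] = hidc (fcod G) H" if "H \<in> hmor (fcod G)" for H
    using G.cod.hidc_comp[of "hidc (fcod G) H"] G.cod.hidc_ends[OF that] by simp
  have v: "vcmp (fcod G) (vid (fcod G) A) (vid (fcod G) A) = vid (fcod G) A" if "A \<in> obj (fcod G)" for A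
    using G.cod.vid_neutral[of "vid (fcod G) A"] G.cod.vid_ends[OF that] by simp
  show ?thesis
  proof (rule avtrans_eqI)
    show "avtransformation (hcomp_avtrans (id_avtrans G) (id_avtrans F))"
      by (intro hcomp_avtrans_transformation F.id_avtrans_transformation G.id_avtrans_transformation)
        (simp add: assms)
    show "avtransformation (id_avtrans (comp_avfun G F))"
      by (intro avfunctor.id_avtrans_transformation comp_avfun_functor assms)
  qed (use o j G.fobj_obj G.fhor_hom in
      \<open>simp_all add: assms G.fver_id G.fcell_hidc v h G.cod.vid_ends\<close>)
qed

text \<open>Up to bracketing, the two sides differ by exchanging a component of
  \<open>\<zeta>\<close> with one of \<open>\<xi>'\<close>, which is naturality of
  \<open>\<zeta>\<close> at the component of \<open>\<xi>'\<close>.\<close>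

lemma interchange_avtrans:
  assumes "avtransformation \<xi>" "avtransformation \<xi>'" "avtransformation \<zeta>" "avtransformation \<zeta>'"
    "ttgt \<xi> = tsrc \<xi>'" "ttgt \<zeta> = tsrc \<zeta>'" "fcod (tsrc \<xi>) = fdom (tsrc \<zeta>)"
  shows "hcomp_avtrans (vcomp_avtrans \<zeta>' \<zeta>) (vcomp_avtrans \<xi>' \<xi>) =
    vcomp_avtrans (hcomp_avtrans \<zeta>' \<xi>') (hcomp_avtrans \<zeta> \<xi>)"
proof -
  interpret x: avtransformation \<xi> by fact
  interpret y: avtransformation \<xi>' by fact
  interpret z: avtransformation \<zeta> by fact
  interpret w: avtransformation \<zeta>' by fact
  let ?L = "fcod (tsrc \<xi>)" and ?P = "fcod (tsrc \<zeta>)" and ?D = "fdom (tsrc \<xi>)"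
  have p: "fdom (tsrc \<zeta>) = ?L" "fdom (ttgt \<zeta>) = ?L" "fdom (tsrc \<zeta>') = ?L"
    "fdom (tsrc \<xi>') = ?D" "fcod (tsrc \<xi>') = ?L" "fdom (ttgt \<xi>') = ?D" "fcod (ttgt \<xi>') = ?L"
    "fcod (tsrc \<zeta>') = ?P"
    using assms(5-7) x.tgt_ends y.tgt_ends z.tgt_ends by metis+
  note t = assms(5,6)[symmetric]
  show ?thesis
  proof (rule avtrans_eqI)
    show "avtransformation (hcomp_avtrans (vcomp_avtrans \<zeta>' \<zeta>) (vcomp_avtrans \<xi>' \<xi>))"
      using assms by (simp add: vcomp_avtrans_transformation hcomp_avtrans_transformation)
    show "avtransformation (vcomp_avtrans (hcomp_avtrans \<zeta>' \<xi>') (hcomp_avtrans \<zeta> \<xi>))"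
      using assms(1-6) p by (intro vcomp_avtrans_transformation hcomp_avtrans_transformation) simp_all
  next
    fix A assume "A \<in> obj (fdom (tsrc (hcomp_avtrans (vcomp_avtrans \<zeta>' \<zeta>) (vcomp_avtrans \<xi>' \<xi>))))"
    then have A: "A \<in> obj ?D" by simp
    let ?GA = "fobj (ttgt \<xi>) A" and ?GA' = "fobj (ttgt \<xi>') A"
    have G: "?GA \<in> obj ?L" "?GA' \<in> obj ?L"
      using x.G.fobj_obj[of A] y.G.fobj_obj[of A] A p by simp_all
    note a = x.tobj_ends[OF A] and a' = y.tobj_ends[unfolded p, OF A]
    note b = z.tobj_ends[unfolded p, OF G(1)] z.tobj_ends[unfolded p, OF G(2)]
    note b' = w.tobj_ends[unfolded p, OF G(2)]
    note Ha = z.F.fver_ends[unfolded p, OF a(1)] and Ha' = z.F.fver_ends[unfolded p, OF a'(1)]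
      and Ma' = w.F.fver_ends[unfolded p, OF a'(1)]
    let ?v = "vcmp ?P" and ?H = "fver (tsrc \<zeta>)"
    have "?v (?v (tobj \<zeta>' ?GA') (tobj \<zeta> ?GA')) (?v (?H (tobj \<xi>' A)) (?H (tobj \<xi> A)))
        = ?v (tobj \<zeta>' ?GA') (?v (tobj \<zeta> ?GA') (?v (?H (tobj \<xi>' A)) (?H (tobj \<xi> A))))"
      using b b' a a' Ha Ha' G t
      by (intro z.F.cod.vcmp_assoc[symmetric]) (auto simp: vhom_iff z.F.cod.vcmp_ends)
    also have "?v (tobj \<zeta> ?GA') (?v (?H (tobj \<xi>' A)) (?H (tobj \<xi> A))) =
        ?v (?v (tobj \<zeta> ?GA') (?H (tobj \<xi>' A))) (?H (tobj \<xi> A))"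
      using b b' a a' Ha Ha' G t by (intro z.F.cod.vcmp_assoc) (auto simp: vhom_iff)
    also have "?v (tobj \<zeta> ?GA') (?H (tobj \<xi>' A)) = ?v (fver (ttgt \<zeta>) (tobj \<xi>' A)) (tobj \<zeta> ?GA)"
      using z.tobj_nat[unfolded p, OF a'(1)] a' t by simp
    also have "?v \<dots> (?H (tobj \<xi> A)) = ?v (fver (ttgt \<zeta>) (tobj \<xi>' A)) (?v (tobj \<zeta> ?GA) (?H (tobj \<xi> A)))"
      using b b' a a' Ha Ha' Ma' G t by (intro z.F.cod.vcmp_assoc[symmetric]) (auto simp: vhom_iff)
    also have "?v (tobj \<zeta>' ?GA') \<dots> =
        ?v (?v (tobj \<zeta>' ?GA') (fver (ttgt \<zeta>) (tobj \<xi>' A))) (?v (tobj \<zeta> ?GA) (?H (tobj \<xi> A)))"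
      using b b' a a' Ha Ha' Ma' G t
      by (intro z.F.cod.vcmp_assoc) (auto simp: vhom_iff z.F.cod.vcmp_ends)
    finally show "tobj (hcomp_avtrans (vcomp_avtrans \<zeta>' \<zeta>) (vcomp_avtrans \<xi>' \<xi>)) A =
        tobj (vcomp_avtrans (hcomp_avtrans \<zeta>' \<xi>') (hcomp_avtrans \<zeta> \<xi>)) A"
      using A G p a a' z.F.fver_vcmp[unfolded p, OF a(1) a'(1)] t by simp
  next
    fix J assume "J \<in> hmor (fdom (tsrc (hcomp_avtrans (vcomp_avtrans \<zeta>' \<zeta>) (vcomp_avtrans \<xi>' \<xi>))))"
    then have J: "J \<in> hmor ?D" by simp
    let ?GJ = "fhor (ttgt \<xi>) J" and ?GJ' = "fhor (ttgt \<xi>') J"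
    have G: "?GJ \<in> hmor ?L" "?GJ' \<in> hmor ?L" 
      "hdom ?L ?GJ = fobj (ttgt \<xi>) (hdom ?D J)" "hdom ?L ?GJ' = fobj (ttgt \<xi>') (hdom ?D J)"
      using x.G.fhor_hom[of J] y.G.fhor_hom[of J] J p by simp_all
    note a = x.thor_ends[OF J] and a' = y.thor_ends[unfolded p, OF J]
    note b = z.thor_ends[unfolded p, OF G(1)] z.thor_ends[unfolded p, OF G(2)]
    note b' = w.thor_ends[unfolded p, OF G(2)]
    note Ha = z.F.fcell_ends[unfolded p, OF a(1)] and Ha' = z.F.fcell_ends[unfolded p, OF a'(1)]
      and Ma' = w.F.fcell_ends[unfolded p, OF a'(1)]
    let ?v = "\<lambda>\<psi> \<phi>. cmp ?P \<psi> [\<phi>]" and ?H = "fcell (tsrc \<zeta>)"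
    note ends = a a' b b' Ha Ha' Ma'[unfolded t] G t fpath_def z.F.cod.cmp_single
    have "?v (?v (thor \<zeta>' ?GJ') (thor \<zeta> ?GJ')) (?v (?H (thor \<xi>' J)) (?H (thor \<xi> J)))
        = ?v (thor \<zeta>' ?GJ') (?v (thor \<zeta> ?GJ') (?v (?H (thor \<xi>' J)) (?H (thor \<xi> J))))"
      by (intro z.F.cod.single_assoc[symmetric]) (simp_all add: ends p)
    also have "?v (thor \<zeta> ?GJ') (?v (?H (thor \<xi>' J)) (?H (thor \<xi> J))) =
        ?v (?v (thor \<zeta> ?GJ') (?H (thor \<xi>' J))) (?H (thor \<xi> J))"
      by (intro z.F.cod.single_assoc) (simp_all add: ends p)
    also have "?v (thor \<zeta> ?GJ') (?H (thor \<xi>' J)) = ?v (fcell (ttgt \<zeta>) (thor \<xi>' J)) (thor \<zeta> ?GJ)"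
      using z.thor_nat1[unfolded p, OF a'(1), of _ ?GJ _ ?GJ'] a' t by simp
    also have "?v \<dots> (?H (thor \<xi> J)) = ?v (fcell (ttgt \<zeta>) (thor \<xi>' J)) (?v (thor \<zeta> ?GJ) (?H (thor \<xi> J)))"
      by (intro z.F.cod.single_assoc[symmetric]) (simp_all add: ends p)
    also have "?v (thor \<zeta>' ?GJ') \<dots> =
        ?v (?v (thor \<zeta>' ?GJ') (fcell (ttgt \<zeta>) (thor \<xi>' J))) (?v (thor \<zeta> ?GJ) (?H (thor \<xi> J)))"
      by (intro z.F.cod.single_assoc) (simp_all add: ends p)
    finally show "thor (hcomp_avtrans (vcomp_avtrans \<zeta>' \<zeta>) (vcomp_avtrans \<xi>' \<xi>)) J =
        thor (vcomp_avtrans (hcomp_avtrans \<zeta>' \<xi>') (hcomp_avtrans \<zeta> \<xi>)) J"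
      using J G p a a' z.F.fcell_cmp[unfolded p, of "thor \<xi>' J" "[thor \<xi> J]"] t
      by (simp add: x.F.cod.composable_single)
  qed (simp_all add: t)
qed


lemma two_category_on:
  assumes "\<And>K. K \<in> Obs \<Longrightarrow> id_avfun K \<in> Arrs"
    "\<And>F. F \<in> Arrs \<Longrightarrow> avfunctor F \<and> fdom F \<in> Obs \<and> fcod F \<in> Obs"
    "\<And>F G. F \<in> Arrs \<Longrightarrow> G \<in> Arrs \<Longrightarrow> fcod F = fdom G \<Longrightarrow> comp_avfun G F \<in> Arrs"
  shows "two_category (AugVirtDblCat_on Obs Arrs)"
  by (rule two_category.intro)
    (use assms in \<open>auto simp: comp_avfun_assoc comp_avfun_id avfunctor.id_avtrans_transformation
      vcomp_avtrans_transformation vcomp_avtrans_assoc vcomp_avtrans_id hcomp_avtrans_transformation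
      hcomp_avtrans_assoc hcomp_avtrans_id hcomp_avtrans_id2 interchange_avtrans
      avtransformation.tgt_ends\<close>)

section \<open>Horizontal units and the 2-functor \<open>U\<close>\<close>

lemma hpath_cong:
  assumes "obj K = obj L" "hmor K = hmor L" "hdom K = hdom L" "hcod K = hcod L"
  shows "hpath K = hpath L"
proof (intro ext)
  fix A Js B
  show "hpath K A Js B = hpath L A Js B"
    using assms by (induction Js arbitrary: A) auto
qed

section \<open>Whiskering with horizontal identities\<close>

context avdc
begin

abbreviation whisk where
  "whisk Js c Hs \<equiv> map (hidc K) Js @ [c] @ map (hidc K) Hs"

lemma whisk_run:
  assumes "hpath K X Js A" "hpath K A Hs Y" "c \<in> cells K" "vsrc c = vid K A" "vtgt c = vid K A"
  shows "cell_run K (vid K X) (whisk Js c Hs) (vid K Y)"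
  using run_hidcs[OF assms(1)] run_hidcs[OF assms(2)] assms(3-5) by (auto simp: run_append)

lemma whisk_paths:
  assumes "set Js \<subseteq> hmor K" "set Hs \<subseteq> hmor K"
  shows "htgts (whisk Js c Hs) = Js @ snd (htgt c) @ Hs" "hsrcs (whisk Js c Hs) = Js @ snd (hsrc c) @ Hs"
  using hsrcs_hidcs[OF assms(1)] htgts_hidcs[OF assms(1)] hsrcs_hidcs[OF assms(2)] htgts_hidcs[OF assms(2)]
  by auto

lemma hidcs_cols:
  assumes "set Js \<subseteq> hmor K"
  shows "map2 (\<lambda>z x. cmp K z [x]) (map (hidc K) Js) (map (hidc K) Js) = map (hidc K) Js"
    "list_all2 (\<lambda>z x. composable K z [x]) (map (hidc K) Js) (map (hidc K) Js)"
  using assms by (induction Js) (auto simp: hidc_ends hidc_comp composable_single)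

lemma whisk_cols:
  assumes "set Js \<subseteq> hmor K" "set Hs \<subseteq> hmor K" "composable K c [d]"
  shows "map2 (\<lambda>z x. cmp K z [x]) (whisk Js c Hs) (whisk Js d Hs) = whisk Js (cmp K c [d]) Hs"
    "list_all2 (\<lambda>z x. composable K z [x]) (whisk Js c Hs) (whisk Js d Hs)"
  using hidcs_cols[OF assms(1)] hidcs_cols[OF assms(2)] assms(3)
  by (auto simp: list_all2_append)

lemma whisk_composable:
  assumes "hpath K X Js A" "hpath K A Hs Y" "c \<in> cells K" "vsrc c = vid K A" "vtgt c = vid K A"
    "\<phi> \<in> cells K" "hsrc \<phi> = (X, Js @ snd (htgt c) @ Hs)"
  shows "composable K \<phi> (whisk Js c Hs)" "hsrc (cmp K \<phi> (whisk Js c Hs)) = (X, Js @ snd (hsrc c) @ Hs)"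
    "cmp K \<phi> (whisk Js c Hs) \<in> cells K" "htgt (cmp K \<phi> (whisk Js c Hs)) = htgt \<phi>"
    "vsrc (cmp K \<phi> (whisk Js c Hs)) = vsrc \<phi>" "vtgt (cmp K \<phi> (whisk Js c Hs)) = vtgt \<phi>"
proof -
  note s = path_hmor[OF assms(1)] path_hmor[OF assms(2)] and r = whisk_run[OF assms(1-5)]
  note w = whisk_paths[OF s] and XY = path_ends[OF assms(1)] path_ends[OF assms(2)]
  note e = cell_ends[OF assms(6)]
  show c: "composable K \<phi> (whisk Js c Hs)"
    using assms(6,7) w XY e by (intro composableI[OF _ _ r]) (auto simp: vid_ends)
  note R = cmp_run[OF c r] composable_run[OF c r]
  then show "hsrc (cmp K \<phi> (whisk Js c Hs)) = (X, Js @ snd (hsrc c) @ Hs)"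
    "cmp K \<phi> (whisk Js c Hs) \<in> cells K" "htgt (cmp K \<phi> (whisk Js c Hs)) = htgt \<phi>"
    using w XY by (auto simp: vid_ends)
  show "vsrc (cmp K \<phi> (whisk Js c Hs)) = vsrc \<phi>" "vtgt (cmp K \<phi> (whisk Js c Hs)) = vtgt \<phi>"
    using R XY e vid_neutral[of "vsrc \<phi>"] vid_neutral[of "vtgt \<phi>"] by (auto simp: vid_ends)
qed

lemma whisk_vidc:
  assumes "hpath K X Js A" "hpath K A Hs Y" "\<phi> \<in> cells K" "hsrc \<phi> = (X, Js @ Hs)"
  shows "cmp K \<phi> (whisk Js (vidc K (vid K A)) Hs) = \<phi>"
proof (cases "Js @ Hs = []")
  case True
  then show ?thesis using assms cmp_vidc_id by auto
next
  case False
  have A: "A \<in> obj K" using path_ends assms by blast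
  have "composable K \<phi> (whisk Js (vidc K (vid K A)) Hs)"
    using assms A by (intro whisk_composable) (auto simp: vid_ends vidc_ends)
  then have "cmp K \<phi> (whisk Js (vidc K (vid K A)) Hs) = cmp K \<phi> (map (hidc K) (Js @ Hs))"
    using composable_drop_vidc[of \<phi> "map (hidc K) Js" "vid K A" "map (hidc K) Hs"] False A
    by (simp add: vid_ends)
  then show ?thesis using cmp_hidc_id[of \<phi> X "Js @ Hs"] assms False by simp
qed

end

text \<open>In an augmented virtual double category a horizontal unit amounts to a horizontal morphism
  isomorphic to the empty path; this description is equational, hence preserved by all functors.\<close>

definition unit_pair ::
  "('o, 'v, 'h, 'c) avdc \<Rightarrow> 'o \<Rightarrow> 'h \<Rightarrow> ('o, 'v, 'h, 'c) cell \<Rightarrow> ('o, 'v, 'h, 'c) cell \<Rightarrow> bool" where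
  "unit_pair K A I \<eta> \<epsilon> \<longleftrightarrow> A \<in> obj K \<and> I \<in> hmor K \<and> hdom K I = A \<and> hcod K I = A \<and>
    \<eta> \<in> cells K \<and> hsrc \<eta> = (A, []) \<and> htgt \<eta> = (A, [I]) \<and> vsrc \<eta> = vid K A \<and> vtgt \<eta> = vid K A \<and>
    \<epsilon> \<in> cells K \<and> hsrc \<epsilon> = (A, [I]) \<and> htgt \<epsilon> = (A, []) \<and> vsrc \<epsilon> = vid K A \<and> vtgt \<epsilon> = vid K A \<and>
    cmp K \<epsilon> [\<eta>] = vidc K (vid K A) \<and> cmp K \<eta> [\<epsilon>] = hidc K I"

section \<open>Units as invertible cells\<close>

lemma (in avdc) horizontal_cell_ends:
  assumes "\<phi> \<in> cells K" "horizontal_cell K \<phi>"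
  shows "vsrc \<phi> = vid K (fst (hsrc \<phi>))" "vtgt \<phi> = vid K (vcod K (vtgt \<phi>))"
  using assms cell_ends[OF assms(1)] by (auto simp: horizontal_cell_def vid_ends)

text \<open>\<open>\<eta>\<close> is the factorisation of the vertical identity of \<open>A\<close>
  through \<open>\<epsilon>\<close>, which is one of the two equations. For the other, both
  \<open>\<eta>\<close> after \<open>\<epsilon>\<close> and the identity of \<open>I\<close> factor
  \<open>\<epsilon>\<close> through itself, hence coincide.\<close>

lemma (in avdc) cartesian_unit_pair:
  assumes "cartesian_unit_cell K A I \<epsilon>"
  obtains \<eta> where "unit_pair K A I \<eta> \<epsilon>"
proof -
  note c = assms[unfolded cartesian_unit_cell_def]
  have A: "A \<in> obj K" using c hmor_ends by blast
  have e: "vsrc \<epsilon> = vid K A" "vtgt \<epsilon> = vid K A"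
    using c cell_ends[of \<epsilon>] horizontal_cell_ends[of \<epsilon>] A by (auto simp: vid_ends)
  have "vidc K (vid K A) \<in> cells K" "htgt (vidc K (vid K A)) = (A, [])"
    using A by (auto simp: vidc_ends vid_ends)
  then obtain \<eta> where h: "\<eta> \<in> cells K" "hsrc \<eta> = (A, [])" "htgt \<eta> = (A, [I])"
    "vsrc \<eta> = vid K A" "vtgt \<eta> = vid K A" "vidc K (vid K A) = cmp K \<epsilon> [\<eta>]"
    using c A vidc_ends[of "vid K A"] vid_ends[of A] by metis
  have vv: "vcmp K (vid K A) (vid K A) = vid K A"
    using A vid_neutral[of "vid K A"] by (simp add: vid_ends)
  have uniq: "\<phi> = \<psi>" if "\<phi> \<in> cells K" "\<psi> \<in> cells K" "hsrc \<phi> = (A, [I])" "htgt \<phi> = (A, [I])"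
    "vsrc \<phi> = vid K A" "vtgt \<phi> = vid K A" "cmp K \<epsilon> [\<phi>] = \<epsilon>" 
    "hsrc \<psi> = (A, [I])" "htgt \<psi> = (A, [I])" "vsrc \<psi> = vid K A" "vtgt \<psi> = vid K A" "cmp K \<epsilon> [\<psi>] = \<epsilon>" 
    for \<phi> \<psi>
    using c that e by metis
  have "cmp K \<epsilon> [cmp K \<eta> [\<epsilon>]] = cmp K (vidc K (vid K A)) [\<epsilon>]"
    using single_assoc[of \<epsilon> \<eta> \<epsilon>] c h by simp
  also have "\<dots> = \<epsilon>" using vidc_cmp[of \<epsilon> A] c by simp
  finally have 1: "cmp K \<epsilon> [cmp K \<eta> [\<epsilon>]] = \<epsilon>" .
  have 2: "cmp K \<epsilon> [hidc K I] = \<epsilon>" using cmp_hidc_id[of \<epsilon> A "[I]"] c by simp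
  have "cmp K \<eta> [\<epsilon>] = hidc K I"
    by (rule uniq) (use 1 2 c h e vv in \<open>auto simp: cmp_single hidc_ends\<close>)
  then have "unit_pair K A I \<eta> \<epsilon>" using c h e A by (auto simp: unit_pair_def)
  then show thesis by (rule that)
qed

lemma ex1_unique: "\<exists>!x. P x \<Longrightarrow> P x \<Longrightarrow> P y \<Longrightarrow> x = y"
  by blast

lemma cocartesian_factor:
  assumes "cocartesian_unit_cell K A I \<eta>" "\<phi> \<in> cells K" "unary \<phi>" "hpath K X Js A" "hpath K A Hs Y"
    "hsrc \<phi> = (X, Js @ Hs)"
  shows "\<exists>!\<phi>'. \<phi>' \<in> cells K \<and> hsrc \<phi>' = (X, Js @ [I] @ Hs) \<and> htgt \<phi>' = htgt \<phi> \<and>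
    vsrc \<phi>' = vsrc \<phi> \<and> vtgt \<phi>' = vtgt \<phi> \<and>
    \<phi> = cmp K \<phi>' (map (hidc K) Js @ [\<eta>] @ map (hidc K) Hs)"
  using assms unfolding cocartesian_unit_cell_def by blast

lemma cocartesian_ends:
  assumes "cocartesian_unit_cell K A I \<eta>"
  shows "I \<in> hmor K" "hdom K I = A" "hcod K I = A" "\<eta> \<in> cells K" "horizontal_cell K \<eta>"
    "hsrc \<eta> = (A, [])" "htgt \<eta> = (A, [I])"
  using assms unfolding cocartesian_unit_cell_def by blast+

section \<open>The virtual double category of unary cells and its units\<close>

lemma U_obj_simps [simp]:
  "obj (U_obj K) = obj K" "vmor (U_obj K) = vmor K" "vdom (U_obj K) = vdom K" "vcod (U_obj K) = vcod K"
  "vid (U_obj K) = vid K" "vcmp (U_obj K) = vcmp K" "hmor (U_obj K) = hmor K" "hdom (U_obj K) = hdom K"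
  "hcod (U_obj K) = hcod K" "cells (U_obj K) = {\<phi> \<in> cells K. unary \<phi>} \<union> vidc K ` vmor K"
  "cmp (U_obj K) = cmp K" "hidc (U_obj K) = hidc K" "vidc (U_obj K) = vidc K"
  by (simp_all add: U_obj_def)

lemma U_obj_hpath [simp]: "hpath (U_obj K) = hpath K"
  by (rule hpath_cong) simp_all

lemma U_obj_vhom [simp]: "vhom (U_obj K) = vhom K"
  by (intro ext) (simp add: vhom_def)

lemma composable_U:
  "composable (U_obj K) \<psi> \<phi>s \<Longrightarrow> (\<And>f. f \<in> vmor K \<Longrightarrow> vidc K f \<in> cells K) \<Longrightarrow> composable K \<psi> \<phi>s"
  by (auto simp: composable_def)

context avdc
begin

lemma U_cells: "\<phi> \<in> cells (U_obj K) \<Longrightarrow> \<phi> \<in> cells K"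
  by (auto simp: vidc_ends)

lemma U_composable: "composable (U_obj K) \<psi> \<phi>s \<Longrightarrow> composable K \<psi> \<phi>s"
  by (rule composable_U) (auto simp: vidc_ends)

lemma U_cmp_cell:
  assumes "composable (U_obj K) \<psi> \<phi>s"
  shows "cmp K \<psi> \<phi>s \<in> cells (U_obj K)"
proof -
  note c = U_composable[OF assms]
  then obtain f g where run: "cell_run K f \<phi>s g" "\<psi> \<in> cells K" "\<phi>s \<noteq> []" "snd (hsrc \<psi>) = htgts \<phi>s"
    by (metis composableE)
  from assms have "\<psi> \<in> cells (U_obj K)" and sub: "set \<phi>s \<subseteq> cells (U_obj K)"
    by (auto simp: composable_def)
  then consider "unary \<psi>" | h where "h \<in> vmor K" "\<psi> = vidc K h" by auto
  then show ?thesis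
  proof cases
    case 1
    then show ?thesis using cmp_run[OF c run(1)] by (simp add: unary_def)
  next
    case 2
    then have "\<And>\<phi>. \<phi> \<in> set \<phi>s \<Longrightarrow> snd (htgt \<phi>) = []" using run(4) by (simp add: vidc_ends)
    then have v: "set \<phi>s \<subseteq> vidc K ` vmor K" using sub by (auto simp: unary_def)
    then obtain f' \<phi>s' where f': "\<phi>s = vidc K f' # \<phi>s'" "f' \<in> vmor K" using run(3) by (cases \<phi>s) auto
    have "filter (\<lambda>\<phi>. \<phi> \<notin> vidc K ` vmor K) \<phi>s' = []" using v f' by (auto simp: filter_empty_conv)
    then have "composable K \<psi> [vidc K f']" "cmp K \<psi> \<phi>s = cmp K \<psi> [vidc K f']"
      using drop_vidcs[of \<psi> "[vidc K f']" \<phi>s'] c f' by auto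
    then have "cmp K \<psi> \<phi>s = vidc K (vcmp K h f')" "vcmp K h f' \<in> vmor K"
      using cmp_vidc[of f' _ _ h] vcmp_ends[of f' h] 2 f'
      by (auto simp: composable_single vidc_ends vhom_iff)
    then show ?thesis by simp
  qed
qed

lemma U_avdc: "avdc (U_obj K)"
proof (rule avdc.intro)
  fix \<psi> \<phi>s assume c: "composable (U_obj K) \<psi> \<phi>s"
  show "cmp (U_obj K) \<psi> \<phi>s \<in> cells (U_obj K) \<and>
      hsrc (cmp (U_obj K) \<psi> \<phi>s) = concat_hsrc \<phi>s \<and> htgt (cmp (U_obj K) \<psi> \<phi>s) = htgt \<psi> \<and>
      vsrc (cmp (U_obj K) \<psi> \<phi>s) = vcmp (U_obj K) (vsrc \<psi>) (vsrc (hd \<phi>s)) \<and>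
      vtgt (cmp (U_obj K) \<psi> \<phi>s) = vcmp (U_obj K) (vtgt \<psi>) (vtgt (last \<phi>s))"
    using cmp_cell[OF U_composable[OF c]] U_cmp_cell[OF c] by (simp del: U_obj_simps(10))
next
  fix \<chi> \<psi>s \<phi>ss
  assume "composable (U_obj K) \<chi> \<psi>s" "list_all2 (composable (U_obj K)) \<psi>s \<phi>ss" "cell_path (concat \<phi>ss)"
  then show "cmp (U_obj K) \<chi> (map2 (cmp (U_obj K)) \<psi>s \<phi>ss) = cmp (U_obj K) (cmp (U_obj K) \<chi> \<psi>s) (concat \<phi>ss)"
    using cmp_assoc[OF U_composable list_all2_mono[OF _ U_composable]] by simp
next
  fix f \<psi> xs ys
  assume "f \<in> vmor (U_obj K)" "composable (U_obj K) \<psi> (xs @ ys)" "composable (U_obj K) \<psi> (xs @ vidc (U_obj K) f # ys)"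
  then show "cmp (U_obj K) \<psi> (xs @ vidc (U_obj K) f # ys) = cmp (U_obj K) \<psi> (xs @ ys)"
    using cmp_insert U_composable by (auto simp del: U_obj_simps(10))
next
  fix \<phi> assume "\<phi> \<in> cells (U_obj K)"
  then show "\<exists>A Js B C Ks D. hsrc \<phi> = (A, Js) \<and> hpath (U_obj K) A Js B \<and> htgt \<phi> = (C, Ks) \<and>
      hpath (U_obj K) C Ks D \<and> length Ks \<le> 1 \<and> vsrc \<phi> \<in> vhom (U_obj K) A C \<and> vtgt \<phi> \<in> vhom (U_obj K) B D"
    using cell_boundary[OF U_cells] by simp
next
  fix \<phi> C assume "\<phi> \<in> cells (U_obj K)" "htgt \<phi> = (C, [])"
  then show "cmp (U_obj K) (vidc (U_obj K) (vid (U_obj K) C)) [\<phi>] = \<phi>"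
    using vidc_cmp[OF U_cells] by simp
next
  fix \<phi> C H assume "\<phi> \<in> cells (U_obj K)" "htgt \<phi> = (C, [H])"
  then show "cmp (U_obj K) (hidc (U_obj K) H) [\<phi>] = \<phi>"
    using hidc_cmp[OF U_cells] by simp
next
  fix \<phi> A assume "\<phi> \<in> cells (U_obj K)" "hsrc \<phi> = (A, [])"
  then show "cmp (U_obj K) \<phi> [vidc (U_obj K) (vid (U_obj K) A)] = \<phi>"
    using cmp_vidc_id[OF U_cells] by simp
next
  fix \<phi> A Js assume "\<phi> \<in> cells (U_obj K)" "hsrc \<phi> = (A, Js)" "Js \<noteq> []"
  then show "cmp (U_obj K) \<phi> (map (hidc (U_obj K)) Js) = \<phi>"
    using cmp_hidc_id[OF U_cells] by simp
qed (use vmor_ends vid_hom vcmp_hom vcmp_assoc vcmp_id hmor_ends hidc_ends vidc_ends cmp_vidc in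
    \<open>simp_all add: unary_def\<close>)

lemma U_vdc: "vdc (U_obj K)"
  by (rule vdc.intro[OF U_avdc]) (auto simp: vdc_axioms_def unary_def nullary_def)

text \<open>Composing with the whiskered \<open>\<epsilon>\<close> is inverse to composing with the
  whiskered \<open>\<eta>\<close>: that \<open>\<epsilon>\<close> after \<open>\<eta>\<close> is an
  identity gives existence of the factorisation, and that \<open>\<eta>\<close> after
  \<open>\<epsilon>\<close> is an identity gives uniqueness.\<close>

lemma unit_pair_cocartesian:
  assumes "unit_pair K A I \<eta> \<epsilon>"
  shows "cocartesian_unit_cell (U_obj K) A I \<eta>"
proof -
  note p = assms[unfolded unit_pair_def]
  have "\<exists>!\<phi>'. \<phi>' \<in> cells (U_obj K) \<and> hsrc \<phi>' = (X, Js @ [I] @ Hs) \<and> htgt \<phi>' = htgt \<phi> \<and>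
      vsrc \<phi>' = vsrc \<phi> \<and> vtgt \<phi>' = vtgt \<phi> \<and> \<phi> = cmp K \<phi>' (whisk Js \<eta> Hs)"
    if a: "\<phi> \<in> cells (U_obj K)" "unary \<phi>" "hpath K X Js A" "hpath K A Hs Y" "hsrc \<phi> = (X, Js @ Hs)"
    for \<phi> X Js Hs Y
  proof -
    have f: "\<phi> \<in> cells K" using U_cells[OF a(1)] .
    note s = path_hmor[OF a(3)] path_hmor[OF a(4)]
    have ce: "composable K \<epsilon> [\<eta>]" "composable K \<eta> [\<epsilon>]" using p by (auto simp: composable_single)
    let ?\<phi>' = "cmp K \<phi> (whisk Js \<epsilon> Hs)"
    have w: "composable K \<phi> (whisk Js \<epsilon> Hs)" "hsrc ?\<phi>' = (X, Js @ [I] @ Hs)" "?\<phi>' \<in> cells K"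
      "htgt ?\<phi>' = htgt \<phi>" "vsrc ?\<phi>' = vsrc \<phi>" "vtgt ?\<phi>' = vtgt \<phi>"
      using whisk_composable[OF a(3,4), of \<epsilon> \<phi>] p f a(5) by auto
    have cp: "cell_path (whisk Js \<eta> Hs)" "cell_path (whisk Js \<epsilon> Hs)"
      using whisk_run[OF a(3,4)] p by (blast intro: cell_run_cell_path)+
    have "cmp K ?\<phi>' (whisk Js \<eta> Hs) = cmp K \<phi> (whisk Js (vidc K (vid K A)) Hs)"
      using cmp_cols(1)[OF w(1) whisk_cols(2)[OF s ce(1)] cp(1)] whisk_cols(1)[OF s ce(1)] p by simp
    also have "\<dots> = \<phi>" using whisk_vidc a f by blast
    finally have 1: "\<phi> = cmp K ?\<phi>' (whisk Js \<eta> Hs)" by simp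
    show ?thesis
    proof (rule ex1I[of _ ?\<phi>'])
      show "?\<phi>' \<in> cells (U_obj K) \<and> hsrc ?\<phi>' = (X, Js @ [I] @ Hs) \<and> htgt ?\<phi>' = htgt \<phi> \<and>
        vsrc ?\<phi>' = vsrc \<phi> \<and> vtgt ?\<phi>' = vtgt \<phi> \<and> \<phi> = cmp K ?\<phi>' (whisk Js \<eta> Hs)"
        using w 1 a(2) by (simp add: unary_def)
    next
      fix \<chi> assume c: "\<chi> \<in> cells (U_obj K) \<and> hsrc \<chi> = (X, Js @ [I] @ Hs) \<and> htgt \<chi> = htgt \<phi> \<and>
        vsrc \<chi> = vsrc \<phi> \<and> vtgt \<chi> = vtgt \<phi> \<and> \<phi> = cmp K \<chi> (whisk Js \<eta> Hs)"
      then have k: "\<chi> \<in> cells K" using U_cells by blast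
      have "composable K \<chi> (whisk Js \<eta> Hs)"
        using whisk_composable(1)[OF a(3,4), of \<eta> \<chi>] p k c by simp
      then have "?\<phi>' = cmp K \<chi> (whisk Js (hidc K I) Hs)"
        using cmp_cols(1)[OF _ whisk_cols(2)[OF s ce(2)] cp(2)] whisk_cols(1)[OF s ce(2)] p c by simp
      also have "\<dots> = \<chi>" using cmp_hidc_id[OF k, of X "Js @ [I] @ Hs"] c by simp
      finally show "\<chi> = ?\<phi>'" by simp
    qed
  qed
  then show ?thesis
    using p unfolding cocartesian_unit_cell_def horizontal_cell_def by (simp add: unary_def) blast
qed

text \<open>The invertible unit \<open>\<eta>0\<close> factors as \<open>a\<close> after
  \<open>\<eta>\<close>, and \<open>\<epsilon>0\<close> after \<open>a\<close> is a left inverse of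
  \<open>\<eta>\<close>. It is also a right inverse, because \<open>\<eta>\<close> after it and the
  identity of \<open>I\<close> are both factorisations of \<open>\<eta>\<close> through
  \<open>\<eta>\<close>, and these are unique. The factorisations take place among unary cells,
  although the inverse is nullary.\<close>

lemma cocartesian_unit_pair:
  assumes "cocartesian_unit_cell (U_obj K) A I \<eta>" "unit_pair K A I0 \<eta>0 \<epsilon>0"
  obtains \<epsilon> where "unit_pair K A I \<eta> \<epsilon>"
proof -
  note c = cocartesian_ends[OF assms(1)] and p = assms(2)[unfolded unit_pair_def]
  have A: "A \<in> obj K" using p by blast
  have I: "I \<in> hmor K" "hdom K I = A" "hcod K I = A" using c by simp_all
  have h: "\<eta> \<in> cells K" "hsrc \<eta> = (A, [])" "htgt \<eta> = (A, [I])" "horizontal_cell K \<eta>"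
    using c U_cells[OF c(4)] by (simp_all add: horizontal_cell_def)
  then have hv: "vsrc \<eta> = vid K A" "vtgt \<eta> = vid K A"
    using cell_ends[of \<eta>] horizontal_cell_ends[of \<eta>] A I by (auto simp: vid_ends)
  have ex: "\<exists>!\<phi>'. \<phi>' \<in> cells (U_obj K) \<and> hsrc \<phi>' = (A, [I]) \<and> htgt \<phi>' = htgt \<phi> \<and>
      vsrc \<phi>' = vsrc \<phi> \<and> vtgt \<phi>' = vtgt \<phi> \<and> \<phi> = cmp K \<phi>' [\<eta>]"
    if "\<phi> \<in> cells K" "unary \<phi>" "hsrc \<phi> = (A, [])" for \<phi>
  proof -
    have "\<phi> \<in> cells (U_obj K)" "hpath (U_obj K) A [] A" "hsrc \<phi> = (A, [] @ [])" using that A by auto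
    from cocartesian_factor[OF assms(1) this(1) that(2) this(2,2,3)] show ?thesis by simp
  qed
  have "\<eta>0 \<in> cells K" "unary \<eta>0" "hsrc \<eta>0 = (A, [])" using p by (auto simp: unary_def)
  from ex1_implies_ex[OF ex[OF this]] obtain a where
    a': "a \<in> cells (U_obj K)" "hsrc a = (A, [I])" "htgt a = (A, [I0])" "vsrc a = vid K A"
      "vtgt a = vid K A" "\<eta>0 = cmp K a [\<eta>]"
    using p by (auto simp del: U_obj_simps(10))
  note a = U_cells[OF a'(1)] a'(2-)
  have vv: "vcmp K (vid K A) (vid K A) = vid K A"
    using A vid_neutral[of "vid K A"] by (simp add: vid_ends)
  let ?e = "cmp K \<epsilon>0 [a]"
  have e: "?e \<in> cells K" "hsrc ?e = (A, [I])" "htgt ?e = (A, [])" "vsrc ?e = vid K A" "vtgt ?e = vid K A"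
    using cmp_single[of \<epsilon>0 a] p a vv by auto
  have ee: "cmp K ?e [\<eta>] = vidc K (vid K A)"
    using single_assoc[of \<epsilon>0 a \<eta>] a p h by simp
  have he: "cmp K \<eta> [?e] \<in> cells K" "hsrc (cmp K \<eta> [?e]) = (A, [I])" "htgt (cmp K \<eta> [?e]) = (A, [I])"
    "vsrc (cmp K \<eta> [?e]) = vid K A" "vtgt (cmp K \<eta> [?e]) = vid K A"
    using cmp_single[of \<eta> ?e] e h hv vv by auto
  have "cmp K (cmp K \<eta> [?e]) [\<eta>] = cmp K \<eta> [vidc K (vid K A)]"
    using single_assoc[of \<eta> ?e \<eta>] e h ee by simp
  also have "\<dots> = \<eta>" using cmp_vidc_id h by blast
  finally have 1: "cmp K (cmp K \<eta> [?e]) [\<eta>] = \<eta>" .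
  have 2: "cmp K (hidc K I) [\<eta>] = \<eta>" using hidc_comp h by simp
  have u: "unary \<eta>" using h by (simp add: unary_def)
  have U: "cmp K \<eta> [?e] \<in> cells (U_obj K)" "hidc K I \<in> cells (U_obj K)"
    using he hidc_ends[OF I(1)] by (auto simp: unary_def)
  have "cmp K \<eta> [?e] = hidc K I"
    by (rule ex1_unique[OF ex[OF h(1) u h(2)]])
      (use 1 2 U he h hv I hidc_ends[OF I(1)] in \<open>simp_all del: U_obj_simps(10)\<close>)
  then have "unit_pair K A I \<eta> ?e" using e ee h hv A I by (simp add: unit_pair_def)
  then show thesis by (rule that)
qed

end

lemma (in avfunctor) unit_pair_image:
  assumes "unit_pair (fdom F) A I \<eta> \<epsilon>"
  shows "unit_pair (fcod F) (fobj F A) (fhor F I) (fcell F \<eta>) (fcell F \<epsilon>)"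
  using assms fcell_cmp[of \<eta> "[\<epsilon>]"] fcell_cmp[of \<epsilon> "[\<eta>]"] fhor_hom[of I]
  by (auto simp: unit_pair_def fobj_obj fcell_ends fpath_def fver_id dom.composable_single
      dom.vid_ends fcell_vidc fcell_hidc)

lemma (in avdc) U_has_units:
  assumes "has_units_aug K"
  shows "has_units_virt (U_obj K)"
  unfolding has_units_virt_def
proof
  fix A assume "A \<in> obj (U_obj K)"
  then obtain I \<epsilon> where "cartesian_unit_cell K A I \<epsilon>"
    using assms by (auto simp: has_units_aug_def)
  then obtain \<eta> where "unit_pair K A I \<eta> \<epsilon>" by (rule cartesian_unit_pair)
  from unit_pair_cocartesian[OF this] show "\<exists>I \<eta>. cocartesian_unit_cell (U_obj K) A I \<eta>" by blast
qed

section \<open>The action of \<open>U\<close> on functors and transformations\<close>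

lemma U_arr_simps [simp]:
  "fdom (U_arr F) = U_obj (fdom F)" "fcod (U_arr F) = U_obj (fcod F)" "fobj (U_arr F) = fobj F"
  "fver (U_arr F) = fver F" "fhor (U_arr F) = fhor F"
  "\<phi> \<in> cells (U_obj (fdom F)) \<Longrightarrow> fcell (U_arr F) \<phi> = fcell F \<phi>"
  by (simp_all add: U_arr_def)

lemma U_arr_fpath [simp]: "fpath (U_arr F) = fpath F"
  by (intro ext) (simp add: fpath_def)

context avfunctor
begin

lemma U_arr_cell:
  assumes "\<phi> \<in> cells (U_obj (fdom F))"
  shows "fcell F \<phi> \<in> cells (U_obj (fcod F))"
  using assms fcell_ends[of \<phi>] fver_ends by (auto simp: unary_def fpath_def fcell_vidc)

lemma U_arr_functor: "avfunctor (U_arr F)"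
proof (rule avfunctor.intro)
  fix \<psi> \<phi>s assume c: "composable (fdom (U_arr F)) \<psi> \<phi>s"
  then have c': "composable (U_obj (fdom F)) \<psi> \<phi>s" by simp
  have m: "map (fcell (U_arr F)) \<phi>s = map (fcell F) \<phi>s" "fcell (U_arr F) \<psi> = fcell F \<psi>"
    using c' by (auto simp: composable_def subset_iff simp del: U_obj_simps(10))
  show "fcell (U_arr F) (cmp (fdom (U_arr F)) \<psi> \<phi>s) =
      cmp (fcod (U_arr F)) (fcell (U_arr F) \<psi>) (map (fcell (U_arr F)) \<phi>s)"
    unfolding m using fcell_cmp[OF dom.U_composable[OF c']] dom.U_cmp_cell[OF c']
    by (simp del: U_obj_simps(10))
next
  fix \<phi> assume "\<phi> \<in> cells (fdom (U_arr F))"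
  then have U: "\<phi> \<in> cells (U_obj (fdom F))" by (simp del: U_obj_simps(10))
  then show "fcell (U_arr F) \<phi> \<in> cells (fcod (U_arr F)) \<and>
      hsrc (fcell (U_arr F) \<phi>) = fpath (U_arr F) (hsrc \<phi>) \<and> htgt (fcell (U_arr F) \<phi>) = fpath (U_arr F) (htgt \<phi>) \<and>
      vsrc (fcell (U_arr F) \<phi>) = fver (U_arr F) (vsrc \<phi>) \<and> vtgt (fcell (U_arr F) \<phi>) = fver (U_arr F) (vtgt \<phi>)"
    using fcell_ends[OF dom.U_cells[OF U]] U_arr_cell[OF U] by (simp del: U_obj_simps(10))
next
  show "avdc (fdom (U_arr F))" "avdc (fcod (U_arr F))" by (simp_all add: dom.U_avdc cod.U_avdc)
qed (use fobj_obj fver_hom fver_id fver_cmp fhor_hom fcell_hidc dom.hidc_ends fcell_vidc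
    fobj_ext fver_ext fhor_ext in \<open>auto simp: unary_def U_arr_def\<close>)

lemma U_arr_normal:
  assumes "has_units_aug (fdom F)"
  shows "normal (U_arr F)"
  unfolding normal_def
proof (intro ballI allI impI)
  fix A I \<eta> assume A: "A \<in> obj (fdom (U_arr F))" and c: "cocartesian_unit_cell (fdom (U_arr F)) A I \<eta>"
  then obtain I0 \<epsilon>0 where "cartesian_unit_cell (fdom F) A I0 \<epsilon>0"
    using assms by (auto simp: has_units_aug_def)
  then obtain \<eta>0 where p0: "unit_pair (fdom F) A I0 \<eta>0 \<epsilon>0" by (rule dom.cartesian_unit_pair)
  have c': "cocartesian_unit_cell (U_obj (fdom F)) A I \<eta>" using c by simp
  \<comment> \<open>Normality speaks of every cocartesian unit cell, not just of one obtained from a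
    cartesian cell. One invertible unit at \<open>A\<close> forces the given one to be invertible,
    and then \<open>F\<close> preserves it.\<close>
  from dom.cocartesian_unit_pair[OF this p0]
  obtain \<epsilon> where "unit_pair (fdom F) A I \<eta> \<epsilon>" .
  from cod.unit_pair_cocartesian[OF unit_pair_image[OF this]] cocartesian_ends(4)[OF c']
  show "cocartesian_unit_cell (fcod (U_arr F)) (fobj (U_arr F) A) (fhor (U_arr F) I) (fcell (U_arr F) \<eta>)"
    by (simp del: U_obj_simps(10))
qed

end

lemma U_two_simps [simp]:
  "tsrc (U_two \<xi>) = U_arr (tsrc \<xi>)" "ttgt (U_two \<xi>) = U_arr (ttgt \<xi>)" "tobj (U_two \<xi>) = tobj \<xi>"
  "thor (U_two \<xi>) = thor \<xi>"
  by (simp_all add: U_two_def)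

lemma (in avtransformation) U_two_transformation: "avtransformation (U_two \<xi>)"
proof (rule avtransformation.intro)
  fix \<phi> assume "\<phi> \<in> cells (fdom (tsrc (U_two \<xi>)))"
  then have U: "\<phi> \<in> cells (U_obj D)" by (simp del: U_obj_simps(10))
  from thor_natural[OF F.dom.U_cells[OF U]] have "cmp L (fcell (ttgt \<xi>) \<phi>) (tpath \<xi> (hsrc \<phi>)) =
      cmp L (hd (tpath \<xi> (htgt \<phi>))) [fcell (tsrc \<xi>) \<phi>]" .
  moreover have "tpath (U_two \<xi>) = tpath \<xi>" by (intro ext) (simp add: tpath_def)
  ultimately show "cmp (fcod (tsrc (U_two \<xi>))) (fcell (ttgt (U_two \<xi>)) \<phi>) (tpath (U_two \<xi>) (hsrc \<phi>)) =
      cmp (fcod (tsrc (U_two \<xi>))) (hd (tpath (U_two \<xi>) (htgt \<phi>))) [fcell (tsrc (U_two \<xi>)) \<phi>]"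
    using U by (simp del: U_obj_simps(10))
next
  fix J assume "J \<in> hmor (fdom (tsrc (U_two \<xi>)))"
  then show "thor (U_two \<xi>) J \<in> cells (fcod (tsrc (U_two \<xi>))) \<and>
      hsrc (thor (U_two \<xi>) J) = fpath (tsrc (U_two \<xi>)) (hdom (fdom (tsrc (U_two \<xi>))) J, [J]) \<and>
      htgt (thor (U_two \<xi>) J) = fpath (ttgt (U_two \<xi>)) (hdom (fdom (tsrc (U_two \<xi>))) J, [J]) \<and>
      vsrc (thor (U_two \<xi>) J) = tobj (U_two \<xi>) (hdom (fdom (tsrc (U_two \<xi>))) J) \<and>
      vtgt (thor (U_two \<xi>) J) = tobj (U_two \<xi>) (hcod (fdom (tsrc (U_two \<xi>))) J)"
    using thor_cell[of J] by (simp add: unary_def fpath_def)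
qed (use F.U_arr_functor G.U_arr_functor tobj_hom tobj_natural tobj_ext thor_ext in auto)

lemma two_category_aug: "two_category AugVirtDblCat_u"
  unfolding AugVirtDblCat_u_def
  by (rule two_category_on)
    (auto simp: avdc.id_avfun_functor comp_avfun_functor avfunctor.fdom_avdc avfunctor.fcod_avdc)

lemma normal_comp:
  assumes "avfunctor F" "normal F" "normal G" "fcod F = fdom G"
  shows "normal (comp_avfun G F)"
proof -
  interpret F: avfunctor F by fact
  show ?thesis
    unfolding normal_def
  proof (intro ballI allI impI)
    fix A I \<eta> assume A: "A \<in> obj (fdom (comp_avfun G F))"
      and c: "cocartesian_unit_cell (fdom (comp_avfun G F)) A I \<eta>"
    then have "I \<in> hmor (fdom F)" "\<eta> \<in> cells (fdom F)" by (auto simp: cocartesian_unit_cell_def)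
    with A c assms F.fobj_obj show "cocartesian_unit_cell (fcod (comp_avfun G F)) (fobj (comp_avfun G F) A)
        (fhor (comp_avfun G F) I) (fcell (comp_avfun G F) \<eta>)"
      by (simp add: normal_def)
  qed
qed

lemma normal_id: "normal (id_avfun K)"
  by (auto simp: normal_def cocartesian_unit_cell_def)

lemma two_category_virt: "two_category VirtDblCat_u"
  unfolding VirtDblCat_u_def
  by (rule two_category_on)
    (auto simp: avdc.id_avfun_functor comp_avfun_functor normal_comp normal_id vdc.axioms(1))

lemma U_arr_comp:
  assumes "avfunctor F" "avfunctor G" "fcod F = fdom G"
  shows "U_arr (comp_avfun G F) = comp_avfun (U_arr G) (U_arr F)"
proof -
  interpret F: avfunctor F by fact
  interpret G: avfunctor G by fact
  interpret GF: avfunctor "comp_avfun G F" by (rule comp_avfun_functor[OF assms])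
  show ?thesis
  proof (rule avfun_eqI)
    fix \<phi> assume "\<phi> \<in> cells (fdom (U_arr (comp_avfun G F)))"
    then have "\<phi> \<in> cells (U_obj (fdom F))" by simp
    then show "fcell (U_arr (comp_avfun G F)) \<phi> = fcell (comp_avfun (U_arr G) (U_arr F)) \<phi>"
      using F.U_arr_cell[of \<phi>] F.dom.U_cells[of \<phi>] assms(3) by (simp del: U_obj_simps(10))
  qed (simp_all add: GF.U_arr_functor comp_avfun_functor F.U_arr_functor G.U_arr_functor assms)
qed

lemma (in avdc) U_arr_id: "U_arr (id_avfun K) = id_avfun (U_obj K)"
proof (rule avfun_eqI)
  show "avfunctor (U_arr (id_avfun K))" by (rule avfunctor.U_arr_functor[OF id_avfun_functor])
  show "avfunctor (id_avfun (U_obj K))" by (rule avdc.id_avfun_functor[OF U_avdc])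
  fix \<phi> assume "\<phi> \<in> cells (fdom (U_arr (id_avfun K)))"
  then have "\<phi> \<in> cells (U_obj K)" by simp
  then show "fcell (U_arr (id_avfun K)) \<phi> = fcell (id_avfun (U_obj K)) \<phi>"
    using U_cells[of \<phi>] by (simp del: U_obj_simps(10))
qed simp_all

lemma U_two_id:
  assumes "avfunctor F"
  shows "U_two (id_avtrans F) = id_avtrans (U_arr F)"
proof -
  interpret avfunctor F by fact
  show ?thesis
    by (rule avtrans_eqI)
      (simp_all add: avtransformation.U_two_transformation id_avtrans_transformation
        avfunctor.id_avtrans_transformation[OF U_arr_functor])
qed

lemma U_two_vcomp:
  assumes "avtransformation \<xi>" "avtransformation \<zeta>" "ttgt \<xi> = tsrc \<zeta>"
  shows "U_two (vcomp_avtrans \<zeta> \<xi>) = vcomp_avtrans (U_two \<zeta>) (U_two \<xi>)"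
  using avtransformation.U_two_transformation[OF vcomp_avtrans_transformation[OF assms]]
    vcomp_avtrans_transformation[OF assms(1,2)[THEN avtransformation.U_two_transformation]] assms(3)
  by (intro avtrans_eqI) simp_all

lemma U_two_hcomp:
  assumes "avtransformation \<xi>" "avtransformation \<zeta>" "fcod (tsrc \<xi>) = fdom (tsrc \<zeta>)"
  shows "U_two (hcomp_avtrans \<zeta> \<xi>) = hcomp_avtrans (U_two \<zeta>) (U_two \<xi>)"
proof -
  interpret x: avtransformation \<xi> by fact
  interpret z: avtransformation \<zeta> by fact
  have p: "fcod (ttgt \<xi>) = fdom (ttgt \<zeta>)" using assms(3) by simp
  show ?thesis
  proof (rule avtrans_eqI)
    show "avtransformation (U_two (hcomp_avtrans \<zeta> \<xi>))"
      by (rule avtransformation.U_two_transformation[OF hcomp_avtrans_transformation[OF assms]])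
    show "avtransformation (hcomp_avtrans (U_two \<zeta>) (U_two \<xi>))"
      using assms(3)
      by (intro hcomp_avtrans_transformation x.U_two_transformation z.U_two_transformation) simp
    show "tsrc (U_two (hcomp_avtrans \<zeta> \<xi>)) = tsrc (hcomp_avtrans (U_two \<zeta>) (U_two \<xi>))"
      "ttgt (U_two (hcomp_avtrans \<zeta> \<xi>)) = ttgt (hcomp_avtrans (U_two \<zeta>) (U_two \<xi>))"
      using U_arr_comp[OF x.F.avfunctor_axioms z.F.avfunctor_axioms assms(3)]
        U_arr_comp[OF x.G.avfunctor_axioms z.G.avfunctor_axioms p] by simp_all
  next
    fix J assume "J \<in> hmor (fdom (tsrc (U_two (hcomp_avtrans \<zeta> \<xi>))))"
    then have J: "J \<in> hmor x.D" by simp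
    \<comment> \<open>The cell map of \<open>U_arr\<close> is restricted to the cells of
      \<open>U(K)\<close>; the components are unary and thus in its domain.\<close>
    have "thor \<xi> J \<in> cells (U_obj (fdom (tsrc \<zeta>)))"
      using x.thor_ends[OF J] assms(3) by (simp add: unary_def)
    then show "thor (U_two (hcomp_avtrans \<zeta> \<xi>)) J = thor (hcomp_avtrans (U_two \<zeta>) (U_two \<xi>)) J"
      using J by (simp del: U_obj_simps(10))
  qed simp_all
qed

theorem U_two_functor: "two_functor AugVirtDblCat_u VirtDblCat_u U_fun"
proof (intro two_functor.intro two_category_aug two_category_virt two_functor_axioms.intro;
    unfold AugVirtDblCat_u_def VirtDblCat_u_def U_fun_def)
qed (auto simp: avdc.U_vdc avdc.U_has_units avfunctor.U_arr_functor avfunctor.U_arr_normal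
      avfunctor.fdom_avdc avfunctor.fcod_avdc avdc.U_arr_id U_arr_comp U_two_id U_two_vcomp U_two_hcomp
      avtransformation.U_two_transformation)

section \<open>Factorisation through paths of units\<close>

lemma (in avdc) cocartesian_vends:
  assumes "cocartesian_unit_cell K A I \<eta>"
  shows "A \<in> obj K" "vsrc \<eta> = vid K A" "vtgt \<eta> = vid K A"
proof -
  note c = cocartesian_ends[OF assms]
  show A: "A \<in> obj K" using hmor_ends[OF c(1)] c(2) by simp
  show "vsrc \<eta> = vid K A" using horizontal_cell_ends[OF c(4,5)] c(6) by simp
  have "vcod K (vtgt \<eta>) = A" using cell_ends(6)[OF c(4)] c(3,7) by auto
  then show "vtgt \<eta> = vid K A" using horizontal_cell_ends[OF c(4,5)] by simp
qed

definition unit_like :: "('o, 'v, 'h, 'c) avdc \<Rightarrow> ('o, 'v, 'h, 'c) cell \<Rightarrow> bool" where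
  "unit_like K u \<longleftrightarrow> (\<exists>J\<in>hmor K. u = hidc K J) \<or> (\<exists>A I. cocartesian_unit_cell K A I u)"

text \<open>For a unit-like \<open>u\<close> this is the identity on its source, vertical if the
  source is empty, so that \<open>u\<close> after it is \<open>u\<close>.\<close>

definition source_id :: "('o, 'v, 'h, 'c) avdc \<Rightarrow> ('o, 'v, 'h, 'c) cell \<Rightarrow> ('o, 'v, 'h, 'c) cell" where
  "source_id K u = (if snd (hsrc u) = [] then vidc K (vid K (fst (hsrc u))) else hidc K (hd (snd (hsrc u))))"

context avdc
begin

lemma hidc_not_vidc: "J \<in> hmor K \<Longrightarrow> hidc K J \<notin> vidc K ` vmor K"
  using hidc_ends vidc_ends by fastforce

lemma cmp_vid_run:
  assumes "composable K \<psi> us" "cell_run K (vid K A) us (vid K B)" "A \<in> obj K" "B \<in> obj K"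
  shows "vsrc (cmp K \<psi> us) = vsrc \<psi>" "vtgt (cmp K \<psi> us) = vtgt \<psi>"
  using cmp_run[OF assms(1,2)] composable_run[OF assms(1,2)] cell_ends[of \<psi>] assms(3,4)
    vid_neutral[of "vsrc \<psi>"] vid_neutral[of "vtgt \<psi>"]
  by (auto simp: vid_ends)

lemma vid_inject: "A \<in> obj K \<Longrightarrow> B \<in> obj K \<Longrightarrow> vid K A = vid K B \<Longrightarrow> A = B"
  using vid_ends by metis

text \<open>A row of units is rewritten as itself after a row of identities. The units can then stay
  in the upper row while one further unit is split off below, where they leave nothing but
  identities; the last clause tells what survives the removal of the vertical ones.\<close>

lemma unit_like_source_id:
  assumes "\<forall>u\<in>set us. unit_like K u" "cell_run K (vid K A) us (vid K B)" "A \<in> obj K"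
  shows "cell_run K (vid K A) (map (source_id K) us) (vid K B)"
    "map2 (\<lambda>z x. cmp K z [x]) us (map (source_id K) us) = us"
    "list_all2 (\<lambda>z x. composable K z [x]) us (map (source_id K) us)"
    "filter (\<lambda>\<phi>. \<phi> \<notin> vidc K ` vmor K) (map (source_id K) us) = map (hidc K) (hsrcs us)"
proof -
  have "cell_run K (vid K A) (map (source_id K) us) (vid K B) \<and>
      map2 (\<lambda>z x. cmp K z [x]) us (map (source_id K) us) = us \<and>
      list_all2 (\<lambda>z x. composable K z [x]) us (map (source_id K) us) \<and>
      filter (\<lambda>\<phi>. \<phi> \<notin> vidc K ` vmor K) (map (source_id K) us) = map (hidc K) (hsrcs us)"
    using assms
  proof (induction us arbitrary: A)
    case Nil
    then show ?case by auto
  next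
    case (Cons u us)
    from Cons.prems consider J where "J \<in> hmor K" "u = hidc K J"
      | C I where "cocartesian_unit_cell K C I u" by (auto simp: unit_like_def)
    then show ?case
    proof cases
      case 1
      note h = hidc_ends[OF 1(1)]
      have J: "hdom K J = A" "hcod K J \<in> obj K" "vsrc u = vid K A" "vtgt u = vid K (hcod K J)"
        using Cons.prems 1 h hmor_ends[OF 1(1)] vid_inject by auto
      have s: "source_id K u = u" using 1 h by (simp add: source_id_def)
      have "cmp K u [u] = u" "composable K u [u]" 
        using 1 h hidc_comp[OF h(1)] by (auto simp: composable_single)
      moreover have "u \<notin> vidc K ` vmor K" using 1(2) hidc_not_vidc[OF 1(1)] by simp
      ultimately show ?thesis
        using Cons.IH[of "hcod K J"] Cons.prems J s 1 h by (simp add: o_def)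
    next
      case 2
      note c = cocartesian_ends[OF 2] and v = cocartesian_vends[OF 2]
      have A: "C = A" "vid K A \<in> vmor K" using Cons.prems v vid_inject by (auto simp: vid_ends)
      have s: "source_id K u = vidc K (vid K A)" using A c by (simp add: source_id_def)
      have "cmp K u [vidc K (vid K A)] = u" "composable K u [vidc K (vid K A)]"
        using cmp_vidc_id[OF c(4,6)] c A Cons.prems by (auto simp: composable_single vidc_ends vid_ends)
      then show ?thesis
        using Cons.IH[of A] Cons.prems A c v s by (simp add: vidc_ends)
    qed
  qed
  then show "cell_run K (vid K A) (map (source_id K) us) (vid K B)"
    "map2 (\<lambda>z x. cmp K z [x]) us (map (source_id K) us) = us"
    "list_all2 (\<lambda>z x. composable K z [x]) us (map (source_id K) us)"
    "filter (\<lambda>\<phi>. \<phi> \<notin> vidc K ` vmor K) (map (source_id K) us) = map (hidc K) (hsrcs us)"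
    by blast+
qed

text \<open>Factoring through a path of units proceeds from left to right. The units that remain enter the
  factorisation through the leftmost one by their horizontal sources only, that is as horizontal
  identities and as vertical identities, and the latter may be dropped.\<close>

lemma factor_units_step:
  assumes "cocartesian_unit_cell K A I \<eta>" "hpath K X Js A" "cell_run K (vid K A) us (vid K B)" "B \<in> obj K"
    "\<forall>u\<in>set us. unit_like K u"
  shows "composable K \<psi> (map (hidc K) (Js @ [I]) @ us) \<longleftrightarrow> composable K \<psi> (map (hidc K) Js @ \<eta> # us)"
    "composable K \<psi> (map (hidc K) (Js @ [I]) @ us) \<Longrightarrow>
      cmp K \<psi> (map (hidc K) Js @ \<eta> # us) = cmp K (cmp K \<psi> (map (hidc K) (Js @ [I]) @ us)) (whisk Js \<eta> (hsrcs us))"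
    "cell_run K (vid K X) (map (hidc K) (Js @ [I]) @ us) (vid K B)"
    "hsrcs (map (hidc K) (Js @ [I]) @ us) = Js @ [I] @ hsrcs us"
proof -
  note c = cocartesian_ends[OF assms(1)] and v = cocartesian_vends[OF assms(1)]
  note h = hidc_ends[OF c(1)]
  note J = path_hmor[OF assms(2)] run_hidcs[OF assms(2)] path_ends[OF assms(2)]
  show r: "cell_run K (vid K X) (map (hidc K) (Js @ [I]) @ us) (vid K B)"
    using J assms(3) c h by (auto simp: run_append)
  have r': "cell_run K (vid K X) (map (hidc K) Js @ \<eta> # us) (vid K B)"
    using J assms(3) c v by (auto simp: run_append)
  show "hsrcs (map (hidc K) (Js @ [I]) @ us) = Js @ [I] @ hsrcs us"
    using hsrcs_hidcs[OF J(1)] h by (simp add: o_def)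
  show eq: "composable K \<psi> (map (hidc K) (Js @ [I]) @ us) \<longleftrightarrow> composable K \<psi> (map (hidc K) Js @ \<eta> # us)"
  proof -
    have "htgts (map (hidc K) (Js @ [I]) @ us) = htgts (map (hidc K) Js @ \<eta> # us)"
      using h c by simp
    then show ?thesis using composableI[OF _ _ r, of \<psi>] composableI[OF _ _ r', of \<psi>]
        composable_run[OF _ r, of \<psi>] composable_run[OF _ r', of \<psi>]
      by (metis Nil_is_append_conv list.distinct(1) list.map_disc_iff)
  qed
  assume comp: "composable K \<psi> (map (hidc K) (Js @ [I]) @ us)"
  note s = unit_like_source_id[OF assms(5,3) v(1)]
  \<comment> \<open>Two rows whose columnwise composite is the given row: \<open>?zs\<close> has the
    identity of \<open>I\<close> in place of \<open>\<eta>\<close> and keeps the other units, while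
    \<open>?xs\<close> has \<open>\<eta>\<close> and identities elsewhere.\<close>
  let ?zs = "map (hidc K) Js @ hidc K I # us" and ?xs = "map (hidc K) Js @ \<eta> # map (source_id K) us"
  have z: "map (hidc K) (Js @ [I]) @ us = ?zs" by simp
  note comp' = comp[unfolded z]
  have cols: "map2 (\<lambda>z x. cmp K z [x]) ?zs ?xs = map (hidc K) Js @ \<eta> # us"
    "list_all2 (\<lambda>z x. composable K z [x]) ?zs ?xs"
    using s hidcs_cols[OF J(1)] hidc_comp[OF c(4)] c h
    by (auto simp: list_all2_append composable_single)
  have "cell_run K (vid K X) ?xs (vid K B)" using J s(1) c v by (auto simp: run_append)
  note C = cmp_cols[OF comp' cols(2) cell_run_cell_path[OF this]]
  \<comment> \<open>The retained prefix contains \<open>\<eta>\<close>, so the row cannot become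
    empty when the vertical identities to its right are dropped.\<close>
  have "cmp K (cmp K \<psi> ?zs) ((map (hidc K) Js @ [\<eta>]) @ map (source_id K) us) =
      cmp K (cmp K \<psi> ?zs) ((map (hidc K) Js @ [\<eta>]) @ map (hidc K) (hsrcs us))"
    using drop_vidcs[of "cmp K \<psi> ?zs" "map (hidc K) Js @ [\<eta>]" "map (source_id K) us", unfolded s(4)] C(2)
    by simp
  then show "cmp K \<psi> (map (hidc K) Js @ \<eta> # us) =
      cmp K (cmp K \<psi> (map (hidc K) (Js @ [I]) @ us)) (whisk Js \<eta> (hsrcs us))"
    using C(1) unfolding cols(1) z by simp
qed

text \<open>\<open>Js\<close> collects the horizontal morphisms already dealt with: an identity of
  \<open>J\<close> moves \<open>J\<close> into it, and a unit of \<open>A\<close> with target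
  \<open>I\<close> is factored through and contributes \<open>I\<close>. Existence and uniqueness
  are passed along together, and a non-empty row keeps the composite meaningful when
  \<open>us\<close> is exhausted.\<close>

lemma factor_units_aux:
  assumes "hpath K X Js A" "cell_run K (vid K A) us (vid K B)" "\<forall>u\<in>set us. unit_like K u" "B \<in> obj K"
    "map (hidc K) Js @ us \<noteq> []" "\<phi> \<in> cells K" "unary \<phi>" "hsrc \<phi> = (X, Js @ hsrcs us)"
  shows "\<exists>!\<psi>. composable K \<psi> (map (hidc K) Js @ us) \<and> \<phi> = cmp K \<psi> (map (hidc K) Js @ us)"
  using assms
proof (induction us arbitrary: Js A \<phi>)
  case Nil
  have ne: "Js \<noteq> []" using Nil.prems by simp
  note J = path_hmor[OF Nil.prems(1)] path_ends[OF Nil.prems(1)]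
  have e: "cmp K \<psi> (map (hidc K) Js) = \<psi>" if "composable K \<psi> (map (hidc K) Js)" for \<psi>
    using composable_run(1,4)[OF that run_hidcs[OF Nil.prems(1)]] htgts_hidcs[OF J(1)]
      cmp_hidc_id[of \<psi> "fst (hsrc \<psi>)" Js] ne
    by (metis prod.collapse)
  have "composable K \<phi> (map (hidc K) Js)"
    by (rule composableI[OF _ _ run_hidcs[OF Nil.prems(1)]])
      (use Nil.prems ne J htgts_hidcs[OF J(1)] cell_ends[of \<phi>] in \<open>auto simp: vid_ends\<close>)
  then show ?case using e by (auto intro: ex1I[of _ \<phi>])
next
  case (Cons u us)
  from Cons.prems consider J where "J \<in> hmor K" "u = hidc K J"
    | C I where "cocartesian_unit_cell K C I u" by (auto simp: unit_like_def)
  then show ?case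
  proof cases
    case 1
    note h = hidc_ends[OF 1(1)] and A = path_ends[OF Cons.prems(1)]
    have J: "hdom K J = A" "hcod K J \<in> obj K"
      using Cons.prems 1 h A hmor_ends[OF 1(1)] vid_inject by auto
    have "hpath K X (Js @ [J]) (hcod K J)" using Cons.prems(1) 1 J by (auto simp: path_append)
    from Cons.IH[OF this, of \<phi>] show ?thesis using Cons.prems 1 h J by simp
  next
    case 2
    note c = cocartesian_ends[OF 2] and v = cocartesian_vends[OF 2] and A = path_ends[OF Cons.prems(1)]
    have CA: "C = A" using Cons.prems(2) v A vid_inject by auto
    note 2 = 2[unfolded CA]
    have run: "cell_run K (vid K A) us (vid K B)" using Cons.prems v CA by simp
    have us: "\<forall>u\<in>set us. unit_like K u" using Cons.prems by simp
    note step = factor_units_step[OF 2 Cons.prems(1) run Cons.prems(4) us]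
    have p: "hpath K A (hsrcs us) B" using run_paths[OF run] A Cons.prems(4) by (simp add: vid_ends)
    have src: "hsrc \<phi> = (X, Js @ hsrcs us)" using Cons.prems c by simp
    let ?zs = "map (hidc K) (Js @ [I]) @ us"
    from cocartesian_factor[OF 2 Cons.prems(6,7,1) p src] obtain \<phi>1 where
      f: "\<phi>1 \<in> cells K" "hsrc \<phi>1 = (X, Js @ [I] @ hsrcs us)" "htgt \<phi>1 = htgt \<phi>" "vsrc \<phi>1 = vsrc \<phi>"
        "vtgt \<phi>1 = vtgt \<phi>" "\<phi> = cmp K \<phi>1 (whisk Js u (hsrcs us))" 
      and u: "\<And>\<chi>. \<chi> \<in> cells K \<Longrightarrow> hsrc \<chi> = (X, Js @ [I] @ hsrcs us) \<Longrightarrow> htgt \<chi> = htgt \<phi> \<Longrightarrow> vsrc \<chi> = vsrc \<phi> \<Longrightarrow>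
        vtgt \<chi> = vtgt \<phi> \<Longrightarrow> \<phi> = cmp K \<chi> (whisk Js u (hsrcs us)) \<Longrightarrow> \<chi> = \<phi>1"
      by (elim ex1E) blast
    have "hpath K X (Js @ [I]) A" using Cons.prems(1) c CA v by (auto simp: path_append)
    from Cons.IH[OF this run us Cons.prems(4), of \<phi>1] f Cons.prems(7)
    have ih: "\<exists>!\<psi>. composable K \<psi> ?zs \<and> \<phi>1 = cmp K \<psi> ?zs"
      by (simp add: unary_def)
    show ?thesis
    proof (rule ex_ex1I)
      show "\<exists>\<psi>. composable K \<psi> (map (hidc K) Js @ u # us) \<and> \<phi> = cmp K \<psi> (map (hidc K) Js @ u # us)"
        using ex1_implies_ex[OF ih] step(1,2) f(6) by metis
    next
      \<comment> \<open>A factor \<open>\<psi>\<close> for the whole row also yields a factorisation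
        of \<open>\<phi>\<close> through the leftmost unit alone, namely its composite with
        \<open>?zs\<close>; by the cocartesian property this is \<open>\<phi>1\<close>, so the
        induction hypothesis determines \<open>\<psi>\<close>. The vertical boundaries agree because
        all units are horizontal.\<close>
      have "\<phi>1 = cmp K \<psi> ?zs \<and> composable K \<psi> ?zs"
        if q: "composable K \<psi> (map (hidc K) Js @ u # us)" "\<phi> = cmp K \<psi> (map (hidc K) Js @ u # us)" for \<psi>
      proof -
        have z: "composable K \<psi> ?zs" using q step(1) by blast
        have r': "cell_run K (vid K X) (map (hidc K) Js @ u # us) (vid K B)"
          using run_hidcs[OF Cons.prems(1)] Cons.prems(2) by (auto simp: run_append)
        note R = cmp_run[OF z step(3)] cmp_vid_run[OF z step(3)]
          cmp_run[OF q(1) r'] cmp_vid_run[OF q(1) r']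
        have "cmp K \<psi> ?zs = \<phi>1"
          using q(2)[unfolded step(2)[OF z]] R A Cons.prems(4) step(4) q(2)
          by (intro u) (simp_all add: vid_ends)
        then show ?thesis using z by simp
      qed
      then show "\<psi> = \<psi>'" if "composable K \<psi> (map (hidc K) Js @ u # us) \<and> \<phi> = cmp K \<psi> (map (hidc K) Js @ u # us)"
        "composable K \<psi>' (map (hidc K) Js @ u # us) \<and> \<phi> = cmp K \<psi>' (map (hidc K) Js @ u # us)" for \<psi> \<psi>'
        using ih that by blast
    qed
  qed
qed

lemma factor_units:
  assumes "cell_run K (vid K A) us (vid K B)" "A \<in> obj K" "B \<in> obj K" "us \<noteq> []" "\<forall>u\<in>set us. unit_like K u"
    "\<phi> \<in> cells K" "unary \<phi>" "hsrc \<phi> = (A, hsrcs us)"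
  shows "\<exists>!\<psi>. composable K \<psi> us \<and> \<phi> = cmp K \<psi> us"
  using factor_units_aux[of A "[]" A us B \<phi>] assms by simp

lemma factor_units_unique:
  assumes "cell_run K (vid K A) us (vid K B)" "A \<in> obj K" "B \<in> obj K" "\<forall>u\<in>set us. unit_like K u"
    "composable K \<psi> us" "composable K \<chi> us" "cmp K \<psi> us = cmp K \<chi> us" "unary \<psi>"
  shows "\<psi> = \<chi>"
proof -
  note r = cmp_run[OF assms(5,1)] composable_run(2)[OF assms(5,1)]
  have "\<exists>!\<psi>'. composable K \<psi>' us \<and> cmp K \<psi> us = cmp K \<psi>' us"
    using r assms by (intro factor_units[OF assms(1-3)]) (auto simp: unary_def vid_ends)
  then show ?thesis using assms by blast
qed

end

section \<open>The augmented virtual double category \<open>N(K)\<close>\<close>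

lemma N_obj_fields [simp]:
  "obj (N_obj e K) = obj K" "vmor (N_obj e K) = vmor K" "vdom (N_obj e K) = vdom K" "vcod (N_obj e K) = vcod K"
  "vid (N_obj e K) = vid K" "vcmp (N_obj e K) = vcmp K" "hmor (N_obj e K) = hmor K"
  "hdom (N_obj e K) = hdom K" "hcod (N_obj e K) = hcod K" "hidc (N_obj e K) = hidc K"
  by (simp_all add: N_obj_def)

lemma N_obj_hpath [simp]: "hpath (N_obj e K) = hpath K"
  by (rule hpath_cong) simp_all

lemma N_obj_vhom [simp]: "vhom (N_obj e K) = vhom K"
  by (intro ext) (simp add: vhom_def)

section \<open>Cells of \<open>N(K)\<close> and the underlying cells of \<open>K\<close>\<close>

locale unital_vdc = vdc K for K :: "('o, 'v, 'h, 'c) avdc" +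
  fixes \<eta> :: "'o \<Rightarrow> ('o, 'v, 'h, 'c) cell"
  assumes unit_choice: "unit_choice K \<eta>"
begin

abbreviation "N \<equiv> N_obj \<eta> K"
abbreviation "hat \<equiv> to_unit \<eta>"
abbreviation "uf \<equiv> unit_factor K \<eta>"
text \<open>This is \<open>I\<^sub>A\<close>; the choice \<open>\<eta>\<close> records a cell only,
  so its unit is recovered from the target.\<close>

definition "unit_mor A = hd (snd (htgt (\<eta> A)))"

text \<open>The effect of \<open>hat\<close> on horizontal targets.\<close>

definition unit_tgt :: "('o, 'h) path \<Rightarrow> ('o, 'h) path" where
  "unit_tgt T = (if snd T = [] then htgt (\<eta> (fst T)) else T)"

lemma eta_cocartesian:
  assumes "A \<in> obj K"
  shows "cocartesian_unit_cell K A (unit_mor A) (\<eta> A)"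
proof -
  obtain I where "cocartesian_unit_cell K A I (\<eta> A)" using unit_choice assms by (auto simp: unit_choice_def)
  moreover from cocartesian_ends(7)[OF this] have "unit_mor A = I" by (simp add: unit_mor_def)
  ultimately show ?thesis by simp
qed

lemma eta_ends:
  assumes "A \<in> obj K"
  shows "unit_mor A \<in> hmor K" "hdom K (unit_mor A) = A" "hcod K (unit_mor A) = A" "\<eta> A \<in> cells K"
    "hsrc (\<eta> A) = (A, [])" "htgt (\<eta> A) = (A, [unit_mor A])" "vsrc (\<eta> A) = vid K A" "vtgt (\<eta> A) = vid K A"
  using cocartesian_ends[OF eta_cocartesian[OF assms]] cocartesian_vends[OF eta_cocartesian[OF assms]] by auto

lemma hat_simps [simp]:
  "hsrc (hat \<phi>) = hsrc \<phi>" "vsrc (hat \<phi>) = vsrc \<phi>" "vtgt (hat \<phi>) = vtgt \<phi>" "label (hat \<phi>) = label \<phi>"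
  by (simp_all add: to_unit_def)

lemma hat_unary: "unary \<phi> \<Longrightarrow> hat \<phi> = \<phi>"
  by (simp add: to_unit_def unary_def nullary_def)

lemma htgt_hat: "htgt (hat \<phi>) = unit_tgt (htgt \<phi>)"
  by (simp add: to_unit_def unit_tgt_def nullary_def)

text \<open>\<open>hat\<close> keeps the sources, the vertical target and the label, so only the
  horizontal target is lost. This reduces equations of cells of \<open>N(K)\<close> to equations in
  \<open>K\<close>.\<close>

lemma N_eqI:
  assumes "hat \<phi> = hat \<psi>" "htgt \<phi> = htgt \<psi>"
  shows "\<phi> = \<psi>"
proof (rule cell.equality)
  show "hsrc \<phi> = hsrc \<psi>" "vsrc \<phi> = vsrc \<psi>" "vtgt \<phi> = vtgt \<psi>" "label \<phi> = label \<psi>"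
    using assms(1) hat_simps by metis+
qed (use assms in simp_all)

lemma hat_update:
  assumes "htgt \<chi> = unit_tgt T"
  shows "hat (\<chi>\<lparr>htgt := T\<rparr>) = \<chi>"
  using assms by (auto simp: to_unit_def unit_tgt_def nullary_def)

text \<open>A nullary cell is recovered from its \<open>hat\<close> by resetting the target, so
  membership can be read off the \<open>hat\<close>. Unary and nullary cells are thereby treated
  alike in what follows.\<close>

lemma N_cell_iff:
  "\<phi> \<in> cells N \<longleftrightarrow> hat \<phi> \<in> cells K \<and> fst (htgt \<phi>) \<in> obj K \<and> length (snd (htgt \<phi>)) \<le> 1"
proof
  assume "\<phi> \<in> cells N"
  then consider "\<phi> \<in> cells K" "unary \<phi>"
    | \<chi> C where "\<phi> = \<chi>\<lparr>htgt := (C, [])\<rparr>" "\<chi> \<in> cells K" "C \<in> obj K" "htgt \<chi> = htgt (\<eta> C)"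
    unfolding N_obj_def by simp blast
  then show "hat \<phi> \<in> cells K \<and> fst (htgt \<phi>) \<in> obj K \<and> length (snd (htgt \<phi>)) \<le> 1"
  proof cases
    case 1
    then show ?thesis using hat_unary[OF 1(2)] cell_ends[OF 1(1)] path_ends[OF cell_ends(6)[OF 1(1)]] by simp
  next
    case 2
    then show ?thesis using hat_update[of \<chi> "(C, [])"] by (simp add: unit_tgt_def)
  qed
next
  assume a: "hat \<phi> \<in> cells K \<and> fst (htgt \<phi>) \<in> obj K \<and> length (snd (htgt \<phi>)) \<le> 1"
  show "\<phi> \<in> cells N"
  proof (cases "unary \<phi>")
    case True
    then show ?thesis using a hat_unary[OF True] by (simp add: N_obj_def)
  next
    case False
    then have T: "snd (htgt \<phi>) = []" "nullary \<phi>"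
      using a by (auto simp: unary_def nullary_def le_Suc_eq)
    then have "hat \<phi> = \<phi>\<lparr>htgt := htgt (\<eta> (fst (htgt \<phi>)))\<rparr>" by (simp add: to_unit_def)
    moreover have "(fst (htgt \<phi>), []) = htgt \<phi>" using T(1) by (metis prod.collapse)
    ultimately have eq: "\<phi> = (hat \<phi>)\<lparr>htgt := (fst (htgt \<phi>), [])\<rparr>" by simp
    have t: "htgt (hat \<phi>) = htgt (\<eta> (fst (htgt \<phi>)))" using T(1) by (simp add: htgt_hat unit_tgt_def)
    have "\<phi> \<in> {\<chi>\<lparr>htgt := (C, [])\<rparr> | \<chi> C. \<chi> \<in> cells K \<and> C \<in> obj K \<and> htgt \<chi> = htgt (\<eta> C)}"
      by (rule CollectI, intro exI conjI, rule eq) (use a t in blast)+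
    then show ?thesis by (simp add: N_obj_def)
  qed
qed

lemma unit_tgt_ends:
  assumes "fst T \<in> obj K" "length (snd T) \<le> 1"
  shows "fst (unit_tgt T) = fst T" "length (snd (unit_tgt T)) = 1"
  using assms eta_ends(6)[OF assms(1)] by (cases "snd T"; simp add: unit_tgt_def)+

lemma N_ends:
  assumes "\<phi> \<in> cells N"
  shows "hat \<phi> \<in> cells K" "unary (hat \<phi>)" "fst (htgt \<phi>) \<in> obj K" "length (snd (htgt \<phi>)) \<le> 1"
    "htgt (hat \<phi>) = unit_tgt (htgt \<phi>)" "fst (htgt \<phi>) = vcod K (vsrc \<phi>)"
    "hpath K (vcod K (vsrc \<phi>)) (snd (htgt \<phi>)) (vcod K (vtgt \<phi>))"
proof -
  show *: "hat \<phi> \<in> cells K" "fst (htgt \<phi>) \<in> obj K" "length (snd (htgt \<phi>)) \<le> 1" "htgt (hat \<phi>) = unit_tgt (htgt \<phi>)"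
    using assms N_cell_iff htgt_hat by auto
  show "unary (hat \<phi>)" using unit_tgt_ends[OF *(2,3)] *(4) by (simp add: unary_def)
  note e = cell_ends[OF *(1)]
  show f: "fst (htgt \<phi>) = vcod K (vsrc \<phi>)" using unit_tgt_ends[OF *(2,3)] *(4) e by simp
  show "hpath K (vcod K (vsrc \<phi>)) (snd (htgt \<phi>)) (vcod K (vtgt \<phi>))"
    using e(6) *(4) f eta_ends[OF *(2)] *(2) by (auto simp: unit_tgt_def split: if_splits)
qed

lemma N_update:
  assumes "\<chi> \<in> cells K" "htgt \<chi> = unit_tgt T" "fst T \<in> obj K" "length (snd T) \<le> 1"
  shows "\<chi>\<lparr>htgt := T\<rparr> \<in> cells N" "hat (\<chi>\<lparr>htgt := T\<rparr>) = \<chi>"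
  using hat_update[OF assms(2)] assms N_cell_iff by auto

lemma unary_N: "\<phi> \<in> cells K \<Longrightarrow> unary \<phi> \<Longrightarrow> \<phi> \<in> cells N"
  by (simp add: N_obj_def)

lemma uf_ends:
  assumes "\<phi> \<in> cells N"
  shows "uf \<phi> \<in> cells K" "hsrc (uf \<phi>) = htgt \<phi>" "htgt (uf \<phi>) = htgt (hat \<phi>)"
    "vsrc (uf \<phi>) = vid K (vcod K (vsrc \<phi>))" "vtgt (uf \<phi>) = vid K (vcod K (vtgt \<phi>))" "unit_like K (uf \<phi>)"
proof -
  note e = N_ends[OF assms]
  have "uf \<phi> \<in> cells K \<and> hsrc (uf \<phi>) = htgt \<phi> \<and> htgt (uf \<phi>) = htgt (hat \<phi>) \<and>
    vsrc (uf \<phi>) = vid K (vcod K (vsrc \<phi>)) \<and> vtgt (uf \<phi>) = vid K (vcod K (vtgt \<phi>)) \<and> unit_like K (uf \<phi>)"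
  proof (cases "snd (htgt \<phi>)")
    case Nil
    then show ?thesis
      using e eta_ends[OF e(3)] eta_cocartesian[OF e(3)]
      by (auto simp: unit_factor_def nullary_def unit_tgt_def unit_like_def prod_eq_iff)
  next
    case (Cons J Js)
    then have J: "htgt \<phi> = (vcod K (vsrc \<phi>), [J])" using e by (simp add: prod_eq_iff)
    then have "J \<in> hmor K" "hdom K J = vcod K (vsrc \<phi>)" "hcod K J = vcod K (vtgt \<phi>)" using e(7) by auto
    then show ?thesis
      using e hidc_ends[of J] J
      by (auto simp: unit_factor_def nullary_def unit_tgt_def unit_like_def)
  qed
  then show "uf \<phi> \<in> cells K" "hsrc (uf \<phi>) = htgt \<phi>" "htgt (uf \<phi>) = htgt (hat \<phi>)"
    "vsrc (uf \<phi>) = vid K (vcod K (vsrc \<phi>))" "vtgt (uf \<phi>) = vid K (vcod K (vtgt \<phi>))" "unit_like K (uf \<phi>)"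
    by blast+
qed

lemma N_run_iff: "cell_run N f \<phi>s g \<longleftrightarrow> set \<phi>s \<subseteq> cells N \<and> cell_run K f (map hat \<phi>s) g"
  by (induction \<phi>s arbitrary: f) (auto simp: N_ends)

lemma uf_run:
  assumes "cell_run N f \<phi>s g"
  shows "cell_run K (vid K (vcod K f)) (map uf \<phi>s) (vid K (vcod K g))"
    "hsrcs (map uf \<phi>s) = htgts \<phi>s" "htgts (map uf \<phi>s) = htgts (map hat \<phi>s)"
    "\<forall>u\<in>set (map uf \<phi>s). unit_like K u"
  using assms by (induction \<phi>s arbitrary: f) (auto simp: uf_ends vmor_ends vid_ends)

lemma N_composable_run:
  assumes "composable N \<psi> \<phi>s"
  obtains f g where "\<psi> \<in> cells N" "\<phi>s \<noteq> []" "cell_run N f \<phi>s g" "vcod K f = vdom K (vsrc \<psi>)"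
    "snd (hsrc \<psi>) = htgts \<phi>s" "f \<in> vmor K" "g \<in> vmor K"
proof -
  have c: "\<psi> \<in> cells N" "\<phi>s \<noteq> []" "set \<phi>s \<subseteq> cells N" "cell_path \<phi>s" "hsrc \<psi> = concat_htgt \<phi>s"
    using assms by (auto simp: composable_def)
  let ?f = "vsrc (hd \<phi>s)" and ?g = "vtgt (last \<phi>s)"
  have hs: "set (map hat \<phi>s) \<subseteq> cells K" using c N_ends by auto
  have "cell_path (map hat \<phi>s)" using c(4) by (simp add: cell_path_def)
  from cell_path_run[OF this hs] have "cell_run K ?f (map hat \<phi>s) ?g"
    using c(2) by (simp add: hd_map last_map)
  then have r: "cell_run N ?f \<phi>s ?g" using c(3) N_run_iff by blast
  have "hd \<phi>s \<in> cells N" using c by auto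
  then have "vcod K ?f = vdom K (vsrc \<psi>)" 
    using N_ends(6)[of "hd \<phi>s"] c(5) cell_ends(3)[OF N_ends(1)[OF c(1)]]
    by (simp add: concat_htgt_def)
  moreover have "snd (hsrc \<psi>) = htgts \<phi>s" using c(5) by (simp add: concat_htgt_def o_def)
  moreover have "?f \<in> vmor K" "?g \<in> vmor K" using run_ends r N_run_iff by blast+
  ultimately show thesis using that c r by blast
qed

text \<open>\<open>uf \<phi>\<close> and \<open>hat \<phi>\<close> have the same horizontal target,
  so a cell that sits on the unit factors also sits on the hats.\<close>

lemma hats_composable:
  assumes "composable K X (map uf \<phi>s)" "cell_run N f \<phi>s g"
  shows "composable K X (map hat \<phi>s)"
proof -
  note u = uf_run[OF assms(2)]
  have k: "cell_run K f (map hat \<phi>s) g" using assms(2) N_run_iff by blast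
  have "vcod K f \<in> obj K" using run_ends[OF k] vmor_ends by blast
  then show ?thesis using composable_run[OF assms(1) u(1)] u(3)
    by (intro composableI[OF _ _ k]) (auto simp: vid_ends)
qed

text \<open>Here factorisation through a whole path of units is used: the sources of the unit
  factors concatenate to the targets of \<open>\<phi>s\<close>, which is the source of the unary
  cell \<open>hat \<psi>\<close>.\<close>

lemma N_ext:
  assumes "composable N \<psi> \<phi>s"
  obtains X where "composable K X (map uf \<phi>s)" "hat \<psi> = cmp K X (map uf \<phi>s)"
proof -
  obtain f g where r: "\<psi> \<in> cells N" "\<phi>s \<noteq> []" "cell_run N f \<phi>s g" "vcod K f = vdom K (vsrc \<psi>)"
    "snd (hsrc \<psi>) = htgts \<phi>s" "f \<in> vmor K" "g \<in> vmor K" using N_composable_run[OF assms] .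
  note u = uf_run[OF r(3)]
  have "\<exists>!X. composable K X (map uf \<phi>s) \<and> hat \<psi> = cmp K X (map uf \<phi>s)"
    by (rule factor_units[OF u(1)])
      (use r u vmor_ends N_ends[OF r(1)] cell_ends[OF N_ends(1)[OF r(1)]] in \<open>auto simp: prod_eq_iff\<close>)
  then show thesis using that by blast
qed

text \<open>Uniqueness of factorisation resolves the definite description in the composition of
  \<open>N(K)\<close>: whichever factor \<open>X\<close> has been found, it computes the composite.
  Later identities in \<open>N(K)\<close> are proved by exhibiting a suitable factor.\<close>

lemma N_cmp:
  assumes "cell_run N f \<phi>s g" "\<psi> \<in> cells N" "composable K X (map uf \<phi>s)" "hat \<psi> = cmp K X (map uf \<phi>s)"
  shows "cmp N \<psi> \<phi>s = (cmp K X (map hat \<phi>s))\<lparr>htgt := htgt \<psi>\<rparr>"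
    "hat (cmp N \<psi> \<phi>s) = cmp K X (map hat \<phi>s)" "cmp N \<psi> \<phi>s \<in> cells N"
    "hsrc (cmp N \<psi> \<phi>s) = (vdom K f, hsrcs \<phi>s)" "htgt (cmp N \<psi> \<phi>s) = htgt \<psi>"
    "vsrc (cmp N \<psi> \<phi>s) = vcmp K (vsrc \<psi>) f" "vtgt (cmp N \<psi> \<phi>s) = vcmp K (vtgt \<psi>) g"
    "vsrc X = vsrc \<psi>" "vtgt X = vtgt \<psi>" "htgt X = htgt (hat \<psi>)" "X \<in> cells K"
proof -
  note u = uf_run[OF assms(1)]
  have k: "cell_run K f (map hat \<phi>s) g" using assms(1) N_run_iff by blast
  have fg: "vcod K f \<in> obj K" "vcod K g \<in> obj K" using run_ends[OF k] vmor_ends by blast+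
  note R = cmp_run[OF assms(3) u(1)] cmp_vid_run[OF assms(3) u(1) fg]
  have un: "unary X" using N_ends(2)[OF assms(2)] assms(4) R by (simp add: unary_def)
  have the: "(THE \<psi>'. composable K \<psi>' (map uf \<phi>s) \<and> hat \<psi> = cmp K \<psi>' (map uf \<phi>s)) = X"
    using assms(3,4) factor_units_unique[OF u(1) fg u(4) assms(3) _ _ un, symmetric] by (intro the_equality) auto
  show eq: "cmp N \<psi> \<phi>s = (cmp K X (map hat \<phi>s))\<lparr>htgt := htgt \<psi>\<rparr>"
    by (simp add: N_obj_def the Let_def)
  note C = cmp_run[OF hats_composable[OF assms(3,1)] k]
  show X: "vsrc X = vsrc \<psi>" "vtgt X = vtgt \<psi>" "htgt X = htgt (hat \<psi>)" "X \<in> cells K"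
    using R assms(4) composable_run[OF assms(3) u(1)] hat_simps by metis+
  have t: "htgt (cmp K X (map hat \<phi>s)) = unit_tgt (htgt \<psi>)" using C X N_ends[OF assms(2)] by simp
  show "hat (cmp N \<psi> \<phi>s) = cmp K X (map hat \<phi>s)" "cmp N \<psi> \<phi>s \<in> cells N"
    unfolding eq using N_update[OF C(1) t] N_ends[OF assms(2)] by auto
  show "hsrc (cmp N \<psi> \<phi>s) = (vdom K f, hsrcs \<phi>s)" "htgt (cmp N \<psi> \<phi>s) = htgt \<psi>"
    "vsrc (cmp N \<psi> \<phi>s) = vcmp K (vsrc \<psi>) f" "vtgt (cmp N \<psi> \<phi>s) = vcmp K (vtgt \<psi>) g"
    unfolding eq using C X by (simp_all add: o_def)
qed

end

section \<open>The axioms for \<open>N(K)\<close> and its units\<close>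

context unital_vdc
begin

lemma N_cmpE:
  assumes "composable N \<psi> \<phi>s" "cell_run N f \<phi>s g"
  obtains X where "composable K X (map uf \<phi>s)" "hat \<psi> = cmp K X (map uf \<phi>s)" "\<psi> \<in> cells N"
    "cmp N \<psi> \<phi>s = (cmp K X (map hat \<phi>s))\<lparr>htgt := htgt \<psi>\<rparr>" "hat (cmp N \<psi> \<phi>s) = cmp K X (map hat \<phi>s)"
    "composable K X (map hat \<phi>s)"
  using N_ext[OF assms(1)] N_cmp[OF assms(2)] hats_composable[OF _ assms(2)] assms(1)
  unfolding composable_def[of N] by metis

lemma N_vidc:
  assumes "f \<in> vmor K"
  shows "vidc N f \<in> cells N" "hsrc (vidc N f) = (vdom K f, [])" "htgt (vidc N f) = (vcod K f, [])"
    "vsrc (vidc N f) = f" "vtgt (vidc N f) = f" "hat (vidc N f) = cmp K (\<eta> (vcod K f)) [vidc K f]"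
    "uf (vidc N f) = \<eta> (vcod K f)" "composable K (\<eta> (vcod K f)) [vidc K f]"
    "vidc N f = (cmp K (\<eta> (vcod K f)) [vidc K f])\<lparr>htgt := (vcod K f, [])\<rparr>"
proof -
  have C: "vcod K f \<in> obj K" using vmor_ends assms by blast
  note e = eta_ends[OF C] and v = vidc_ends[OF assms]
  show c: "composable K (\<eta> (vcod K f)) [vidc K f]" using e v by (simp add: composable_single)
  note s = cmp_single[of "\<eta> (vcod K f)" "vidc K f"]
  show d: "vidc N f = (cmp K (\<eta> (vcod K f)) [vidc K f])\<lparr>htgt := (vcod K f, [])\<rparr>"
    by (simp add: N_obj_def)
  note u = N_update[of "cmp K (\<eta> (vcod K f)) [vidc K f]" "(vcod K f, [])"]
  show "vidc N f \<in> cells N" "hat (vidc N f) = cmp K (\<eta> (vcod K f)) [vidc K f]"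
    unfolding d using u s e v C by (simp_all add: unit_tgt_def)
  show "hsrc (vidc N f) = (vdom K f, [])" "htgt (vidc N f) = (vcod K f, [])"
    "vsrc (vidc N f) = f" "vtgt (vidc N f) = f" "uf (vidc N f) = \<eta> (vcod K f)"
    unfolding d using s e v vid_neutral[OF assms] by (simp_all add: unit_factor_def nullary_def)
qed

lemma N_hidc:
  assumes "J \<in> hmor K"
  shows "hidc K J \<in> cells N" "hat (hidc K J) = hidc K J" "uf (hidc K J) = hidc K J"
  using hidc_ends[OF assms] by (auto simp: unary_N unary_def unit_factor_def nullary_def to_unit_def)

text \<open>All unit factors are horizontal identities, so \<open>hat \<psi>\<close> serves as its
  own factor.\<close>

lemma N_cmp_unaries:
  assumes "\<psi> \<in> cells N" "composable K (hat \<psi>) \<phi>s" "\<forall>\<phi>\<in>set \<phi>s. unary \<phi>"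
  shows "cmp N \<psi> \<phi>s = (cmp K (hat \<psi>) \<phi>s)\<lparr>htgt := htgt \<psi>\<rparr>" "hat (cmp N \<psi> \<phi>s) = cmp K (hat \<psi>) \<phi>s"
proof -
  obtain f g where r: "cell_run K f \<phi>s g" "\<phi>s \<noteq> []" "vcod K f = vdom K (vsrc \<psi>)" "snd (hsrc \<psi>) = htgts \<phi>s"
    using composableE[OF assms(2)] by (metis hat_simps(1,2))
  have m: "map hat \<phi>s = \<phi>s" using assms(3) hat_unary by (simp add: map_idI)
  have sub: "set \<phi>s \<subseteq> cells N" using cell_run_cells[OF r(1)] assms(3) unary_N by blast
  have Nr: "cell_run N f \<phi>s g" using r(1) m sub N_run_iff by simp
  have u: "map uf \<phi>s = map (hidc K) (htgts \<phi>s)"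
    using assms(3) by (induction \<phi>s) (auto simp: unit_factor_def unary_def nullary_def length_Suc_conv)
  have ne: "htgts \<phi>s \<noteq> []" using assms(3) r(2) by (cases \<phi>s) (auto simp: unary_def)
  have h: "hat \<psi> \<in> cells K" "hsrc (hat \<psi>) = (fst (hsrc \<psi>), htgts \<phi>s)"
    using N_ends(1)[OF assms(1)] r(4) by (auto simp: prod_eq_iff)
  have fo: "vdom K (vsrc \<psi>) \<in> obj K" using vmor_ends run_ends[OF r(1)] r(3) by metis
  have "hat \<psi> = cmp K (hat \<psi>) (map uf \<phi>s)" unfolding u using cmp_hidc_id[OF h ne] by simp
  moreover have "composable K (hat \<psi>) (map uf \<phi>s)"
    using uf_run[OF Nr] r(2,3,4) h(1) m fo
    by (intro composableI[OF _ _ uf_run(1)[OF Nr]]) (auto simp: vid_ends)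
  ultimately show "cmp N \<psi> \<phi>s = (cmp K (hat \<psi>) \<phi>s)\<lparr>htgt := htgt \<psi>\<rparr>" "hat (cmp N \<psi> \<phi>s) = cmp K (hat \<psi>) \<phi>s"
    using N_cmp(1,2)[OF Nr assms(1)] m by simp_all
qed

text \<open>The vertical identity of \<open>N(K)\<close> at \<open>f\<close> is the chosen unit
  whiskered with \<open>f\<close>, and its unit factor is that unit. Reassociating puts the factor
  back together with the unit, which gives \<open>hat \<psi>\<close>.\<close>

lemma N_cmp_vidc:
  assumes "\<psi> \<in> cells N" "f \<in> vmor K" "hsrc \<psi> = (vcod K f, [])"
  shows "cmp N \<psi> [vidc N f] = (cmp K (hat \<psi>) [vidc K f])\<lparr>htgt := htgt \<psi>\<rparr>"
    "hat (cmp N \<psi> [vidc N f]) = cmp K (hat \<psi>) [vidc K f]"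
proof -
  note v = N_vidc[OF assms(2)]
  have r: "cell_run N f [vidc N f] f" using v assms(2) by simp
  have "composable N \<psi> [vidc N f]"
    using v assms by (simp add: composable_def cell_path_def concat_htgt_def)
  from N_cmpE[OF this r] obtain X where X: "composable K X [\<eta> (vcod K f)]" "hat \<psi> = cmp K X [\<eta> (vcod K f)]"
    "cmp N \<psi> [vidc N f] = (cmp K X [cmp K (\<eta> (vcod K f)) [vidc K f]])\<lparr>htgt := htgt \<psi>\<rparr>"
    "hat (cmp N \<psi> [vidc N f]) = cmp K X [cmp K (\<eta> (vcod K f)) [vidc K f]]"
    using v by auto
  have "cmp K X [cmp K (\<eta> (vcod K f)) [vidc K f]] = cmp K (hat \<psi>) [vidc K f]"
    using cmp_single_assoc(1)[OF X(1) v(8)] X(2) by simp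
  then show "cmp N \<psi> [vidc N f] = (cmp K (hat \<psi>) [vidc K f])\<lparr>htgt := htgt \<psi>\<rparr>"
    "hat (cmp N \<psi> [vidc N f]) = cmp K (hat \<psi>) [vidc K f]"
    using X by simp_all
qed

lemma run_transfer:
  assumes "cell_run K a xs b" "map vsrc ys = map vsrc xs" "map vtgt ys = map vtgt xs" "set ys \<subseteq> cells K"
  shows "cell_run K a ys b"
  using assms
proof (induction ys arbitrary: xs a)
  case (Cons y ys)
  then obtain x xs' where x: "xs = x # xs'" by (cases xs) auto
  then show ?case using Cons.IH[of "vtgt x" xs'] Cons.prems by simp
qed simp

text \<open>Let \<open>X\<close> factor \<open>hat \<chi>\<close> through the unit factors of
  \<open>\<psi>s\<close>, and let \<open>Y\<^sub>i\<close> factor the hat of the i-th cell of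
  \<open>\<psi>s\<close> through those of its row. By associativity in \<open>K\<close>, the
  composite of \<open>X\<close> with the \<open>Y\<^sub>i\<close> factors the hat of
  \<open>\<chi>\<close> after \<open>\<psi>s\<close> through all unit factors of the lowest row.
  Hence both sides are computed by \<open>X\<close> after the \<open>Y\<^sub>i\<close> after the
  hats of the lowest row.\<close>

lemma N_assoc:
  assumes "composable N \<chi> \<psi>s" "list_all2 (composable N) \<psi>s \<phi>ss" "cell_path (concat \<phi>ss)"
  shows "cmp N \<chi> (map2 (cmp N) \<psi>s \<phi>ss) = cmp N (cmp N \<chi> \<psi>s) (concat \<phi>ss)"
proof -
  obtain f g where r: "\<chi> \<in> cells N" "\<psi>s \<noteq> []" "cell_run N f \<psi>s g" "vcod K f = vdom K (vsrc \<chi>)"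
    "snd (hsrc \<chi>) = htgts \<psi>s" using N_composable_run[OF assms(1)] by metis
  obtain X where X: "composable K X (map uf \<psi>s)" "hat \<chi> = cmp K X (map uf \<psi>s)"
    "cmp N \<chi> \<psi>s = (cmp K X (map hat \<psi>s))\<lparr>htgt := htgt \<chi>\<rparr>" "hat (cmp N \<chi> \<psi>s) = cmp K X (map hat \<psi>s)"
    "composable K X (map hat \<psi>s)" using N_cmpE[OF assms(1) r(3)] by metis
  \<comment> \<open>All facts about the factor of one column are bundled, so that a single induction
    produces the list of factors, which is then read off entry by entry.\<close>
  let ?R = "\<lambda>Y (\<psi>, \<phi>s). composable K Y (map uf \<phi>s) \<and> composable K Y (map hat \<phi>s) \<and>
      hat \<psi> = cmp K Y (map uf \<phi>s) \<and> hat (cmp N \<psi> \<phi>s) = cmp K Y (map hat \<phi>s) \<and> cmp N \<psi> \<phi>s \<in> cells N \<and>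
      htgt (cmp N \<psi> \<phi>s) = htgt \<psi> \<and> vsrc Y = vsrc \<psi> \<and> vtgt Y = vtgt \<psi> \<and> htgt Y = htgt (hat \<psi>) \<and> Y \<in> cells K \<and>
      set \<phi>s \<subseteq> cells N \<and> \<psi> \<in> cells N"
  have "\<exists>Ys. list_all2 ?R Ys (zip \<psi>s \<phi>ss)"
    using assms(2)
  proof (induction \<psi>s \<phi>ss rule: list_all2_induct)
    case (Cons \<psi> \<psi>s \<phi>s \<phi>ss)
    then obtain Ys where Ys: "list_all2 ?R Ys (zip \<psi>s \<phi>ss)" by blast
    obtain f g where r: "cell_run N f \<phi>s g" "\<psi> \<in> cells N" using N_composable_run[OF Cons.hyps(1)] by metis
    obtain Y where Y: "composable K Y (map uf \<phi>s)" "hat \<psi> = cmp K Y (map uf \<phi>s)"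
      using N_ext[OF Cons.hyps(1)] .
    note c = N_cmp[OF r Y] hats_composable[OF Y(1) r(1)]
    have "set \<phi>s \<subseteq> cells N" using r(1) N_run_iff by blast
    then show ?case using Ys Y c r(2)
      by (intro exI[of _ "Y # Ys"]) simp
  qed simp
  then obtain Ys where Ys: "list_all2 ?R Ys (zip \<psi>s \<phi>ss)" by blast
  have len: "length \<psi>s = length \<phi>ss" using assms(2) by (rule list_all2_lengthD)
  have Y1: "length Ys = length \<psi>s" using list_all2_lengthD[OF Ys] len by simp
  have Y2: "composable K (Ys ! i) (map uf (\<phi>ss ! i)) \<and> composable K (Ys ! i) (map hat (\<phi>ss ! i)) \<and>
      hat (\<psi>s ! i) = cmp K (Ys ! i) (map uf (\<phi>ss ! i)) \<and>
      hat (cmp N (\<psi>s ! i) (\<phi>ss ! i)) = cmp K (Ys ! i) (map hat (\<phi>ss ! i)) \<and> cmp N (\<psi>s ! i) (\<phi>ss ! i) \<in> cells N \<and>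
      htgt (cmp N (\<psi>s ! i) (\<phi>ss ! i)) = htgt (\<psi>s ! i) \<and> vsrc (Ys ! i) = vsrc (\<psi>s ! i) \<and>
      vtgt (Ys ! i) = vtgt (\<psi>s ! i) \<and> htgt (Ys ! i) = htgt (hat (\<psi>s ! i)) \<and> Ys ! i \<in> cells K \<and>
      set (\<phi>ss ! i) \<subseteq> cells N"
    if "i < length \<psi>s" for i
    using list_all2_nthD[OF Ys, of i] Y1 len that by simp
  note Y = Y1 Y2
  \<comment> \<open>Each factor has the vertical boundary of its cell in \<open>\<psi>s\<close> and
    the horizontal target of the hat of that cell, so it can replace that hat below
    \<open>X\<close>.\<close>
  have XY: "composable K X Ys"
  proof -
    have k: "cell_run K f (map hat \<psi>s) g" using r(3) N_run_iff by blast
    have "map vsrc Ys = map vsrc \<psi>s" "map vtgt Ys = map vtgt \<psi>s"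
      by (rule nth_equalityI; simp only: length_map Y1 nth_map Y2)+
    then have t: "map vsrc Ys = map vsrc (map hat \<psi>s)" "map vtgt Ys = map vtgt (map hat \<psi>s)"
      by (simp_all add: o_def)
    have t': "map htgt Ys = map htgt (map hat \<psi>s)"
      by (rule nth_equalityI) (simp_all only: length_map Y1 nth_map Y2)
    have t'': "set Ys \<subseteq> cells K"
      using Y2 Y1 by (metis in_set_conv_nth subsetI)
    have "htgts ys = concat (map snd (map htgt ys))" for ys :: "('o, 'v, 'h, 'c) cell list"
      by (simp add: o_def)
    with t' have "htgts Ys = htgts (map hat \<psi>s)" by metis
    note * = run_transfer[OF k t t''] this
    show ?thesis using composable_run[OF X(5) k] * Y(1) by (intro composableI[OF _ _ *(1)]) auto
  qed
  let ?Z = "cmp K X Ys"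
  have ufs: "list_all2 (composable K) Ys (map (map uf) \<phi>ss)" "list_all2 (composable K) Ys (map (map hat) \<phi>ss)"
    by (simp_all add: list_all2_conv_all_nth Y1 len[symmetric] Y2)
  have uf_cong: "uf a = uf b" if "htgt a = htgt b" for a b
    using that by (simp add: unit_factor_def nullary_def)
  have maps1: "map2 (cmp K) Ys (map (map uf) \<phi>ss) = map hat \<psi>s"
    by (rule nth_equalityI) (simp_all add: Y1 len[symmetric] Y2)
  have maps2: "map2 (cmp K) Ys (map (map hat) \<phi>ss) = map hat (map2 (cmp N) \<psi>s \<phi>ss)"
    by (rule nth_equalityI) (simp_all add: Y1 len[symmetric] Y2)
  \<comment> \<open>Unit factors depend on horizontal targets alone, and composing with cells below
    does not change these; hence \<open>X\<close> also computes the composite on the left.\<close>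
  have maps3: "map uf (map2 (cmp N) \<psi>s \<phi>ss) = map uf \<psi>s"
    by (rule nth_equalityI) (simp_all add: len[symmetric] uf_cong[OF Y2[THEN conjunct2, THEN conjunct2, THEN conjunct2, THEN conjunct2, THEN conjunct2, THEN conjunct1]])
  note maps = maps1 maps2 maps3
  have "set \<phi>s \<subseteq> cells N" if "\<phi>s \<in> set \<phi>ss" for \<phi>s
    using that Y2 len by (metis in_set_conv_nth)
  then have sub: "set (concat \<phi>ss) \<subseteq> cells N" by auto
  have ne: "concat \<phi>ss \<noteq> []" 
  proof -
    have "0 < length \<psi>s" using r(2) by simp
    from Y2[OF this] this len have "\<phi>ss ! 0 \<noteq> []" "0 < length \<phi>ss" by (auto simp: composable_def)
    then show ?thesis by (cases \<phi>ss) auto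
  qed
  have hp: "cell_path (map hat (concat \<phi>ss))" using assms(3) by (simp add: cell_path_def)
  have "set (map hat (concat \<phi>ss)) \<subseteq> cells K" using sub N_ends by auto
  from cell_path_run[OF hp this] obtain a b where ab: "cell_run K a (map hat (concat \<phi>ss)) b" using ne by auto
  then have Nab: "cell_run N a (concat \<phi>ss) b" using sub N_run_iff by blast
  have up: "cell_path (concat (map (map uf) \<phi>ss))" "cell_path (concat (map (map hat) \<phi>ss))"
    using cell_run_cell_path[OF uf_run(1)[OF Nab]] hp by (simp_all add: map_concat)
  have "composable K ?Z (map uf (concat \<phi>ss))" "hat (cmp N \<chi> \<psi>s) = cmp K ?Z (map uf (concat \<phi>ss))"
    using cmp_assoc[OF XY ufs(1) up(1)] composable_assoc[OF XY ufs(1) up(1)] maps X(4)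
    by (simp_all add: map_concat)
  from N_cmp[OF Nab _ this] N_cmp[OF r(3,1) X(1,2)]
  have R: "cmp N (cmp N \<chi> \<psi>s) (concat \<phi>ss) = (cmp K ?Z (map hat (concat \<phi>ss)))\<lparr>htgt := htgt \<chi>\<rparr>" by simp
  have ca: "composable K X (map2 (cmp K) Ys (map (map hat) \<phi>ss))"
    "cmp K X (map2 (cmp K) Ys (map (map hat) \<phi>ss)) = cmp K ?Z (map hat (concat \<phi>ss))"
    using composable_assoc(2)[OF XY ufs(2) up(2)] cmp_assoc[OF XY ufs(2) up(2)] by (simp_all add: map_concat)
  have csub: "set (map2 (cmp N) \<psi>s \<phi>ss) \<subseteq> cells N"
    by (auto simp: in_set_conv_nth len[symmetric] Y2)
  obtain c d where "cell_run K c (map2 (cmp K) Ys (map (map hat) \<phi>ss)) d" using composableE[OF ca(1)] by metis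
  then have "cell_run N c (map2 (cmp N) \<psi>s \<phi>ss) d" using csub maps(2) N_run_iff by simp
  from N_cmp(1)[OF this r(1)] X(1,2) maps(2,3)
  have "cmp N \<chi> (map2 (cmp N) \<psi>s \<phi>ss) = (cmp K X (map2 (cmp K) Ys (map (map hat) \<phi>ss)))\<lparr>htgt := htgt \<chi>\<rparr>"
    by simp
  then show ?thesis using R ca(2) by simp
qed

lemma N_insert:
  assumes "f \<in> vmor K" "composable N \<psi> (xs @ ys)" "composable N \<psi> (xs @ vidc N f # ys)"
  shows "cmp N \<psi> (xs @ vidc N f # ys) = cmp N \<psi> (xs @ ys)"
proof -
  note v = N_vidc[OF assms(1)]
  let ?C = "vcod K f"
  have C: "?C \<in> obj K" using vmor_ends assms(1) by blast
  obtain a b where r: "cell_run N a (xs @ ys) b" "xs @ ys \<noteq> []" "\<psi> \<in> cells N"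
    using N_composable_run[OF assms(2)] by metis
  obtain a' b' where r': "cell_run N a' (xs @ vidc N f # ys) b'"
    using N_composable_run[OF assms(3)] by metis
  obtain X where X: "composable K X (map uf (xs @ vidc N f # ys))" "hat \<psi> = cmp K X (map uf (xs @ vidc N f # ys))"
    "cmp N \<psi> (xs @ vidc N f # ys) = (cmp K X (map hat (xs @ vidc N f # ys)))\<lparr>htgt := htgt \<psi>\<rparr>"
    using N_cmpE[OF assms(3) r'] by metis
  have sub: "set xs \<subseteq> cells N" "set ys \<subseteq> cells N" using r(1) N_run_iff by auto
  \<comment> \<open>The identity on the target of \<open>hat u\<close>; for nullary \<open>u\<close>
    it is the identity of a chosen unit.\<close>
  let ?t = "\<lambda>u. hidc K (hd (snd (htgt (hat u))))"
  let ?zs = "map ?t xs @ \<eta> ?C # map ?t ys"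
  have t: "hat u \<in> cells K" "uf u \<in> cells K" "?t u \<in> cells K" "snd (htgt (?t u)) = snd (htgt (hat u))"
    "composable K (?t u) [hat u]" "composable K (?t u) [uf u]" "cmp K (?t u) [hat u] = hat u" "cmp K (?t u) [uf u] = uf u"
    "vsrc (?t u) = vid K (vcod K (vsrc u))" "vtgt (?t u) = vid K (vcod K (vtgt u))"
    if "u \<in> cells N" for u
  proof -
    note e = N_ends[OF that] and w = uf_ends[OF that] and k = cell_ends[OF N_ends(1)[OF that]]
    obtain J where J: "snd (htgt (hat u)) = [J]" using e(2) by (auto simp: unary_def length_Suc_conv)
    have h: "J \<in> hmor K" "hdom K J = vcod K (vsrc u)" "hcod K J = vcod K (vtgt u)" using k(6) J by auto
    show "hat u \<in> cells K" "uf u \<in> cells K" "?t u \<in> cells K" "snd (htgt (?t u)) = snd (htgt (hat u))"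
      "composable K (?t u) [hat u]" "composable K (?t u) [uf u]" "cmp K (?t u) [hat u] = hat u" "cmp K (?t u) [uf u] = uf u"
      "vsrc (?t u) = vid K (vcod K (vsrc u))" "vtgt (?t u) = vid K (vcod K (vtgt u))"
      using e(1) w J hidc_ends[OF h(1)] h composable_hidc hidc_comp by auto
  qed
  have cols: "map2 (\<lambda>z x. cmp K z [x]) (map ?t us) (map uf us) = map uf us"
    "map2 (\<lambda>z x. cmp K z [x]) (map ?t us) (map hat us) = map hat us"
    "list_all2 (\<lambda>z x. composable K z [x]) (map ?t us) (map uf us)"
    "list_all2 (\<lambda>z x. composable K z [x]) (map ?t us) (map hat us)"
    "htgts (map ?t us) = htgts (map uf us)"
    if "set us \<subseteq> cells N" for us
    using that by (induction us) (auto simp: t uf_ends)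
  have trun: "cell_run K (vid K (vcod K c)) (map ?t us) (vid K (vcod K d))" if "cell_run N c us d" for c us d
    using that by (induction us arbitrary: c) (auto simp: t vmor_ends vid_ends)
  note e = eta_ends[OF C] and vC = vidc_ends[OF vid_ends(1)[OF C]] vid_ends[OF C]
  have app: "cell_run N p (us @ ws) q \<longleftrightarrow> (\<exists>m. cell_run N p us m \<and> cell_run N m ws q)" for p q us ws
    by (rule cell_run_append) (metis N_ends(1) cell_ends(1) hat_simps(2) N_obj_fields(2))
  have m: "cell_run N a' xs f" "cell_run N f ys b'"
    using r'[unfolded app] v by auto
  have zrun: "cell_run K (vid K (vcod K a')) ?zs (vid K (vcod K b'))"
    using trun[OF m(1)] trun[OF m(2)] e by (auto simp: run_append)
  note ur = uf_run[OF r']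
  have "a' \<in> vmor K" using r' N_run_iff run_ends by blast
  then have Xz: "composable K X ?zs"
    using composable_run[OF X(1) ur(1)] cols(5)[OF sub(1)] cols(5)[OF sub(2)] v
    by (intro composableI[OF _ _ zrun]) (auto simp: o_def)
  \<comment> \<open>The rows below \<open>?zs\<close> for the unit factors and for the hats; they
    differ from the rows of the shorter list by one vertical identity of \<open>K\<close>
    each.\<close>
  let ?x1 = "map uf xs @ vidc K (vid K ?C) # map uf ys" and ?x2 = "map hat xs @ vidc K f # map hat ys"
  have c1: "map2 (\<lambda>z x. cmp K z [x]) ?zs ?x1 = map uf (xs @ vidc N f # ys)"
    "list_all2 (\<lambda>z x. composable K z [x]) ?zs ?x1"
    using cols[OF sub(1)] cols[OF sub(2)] v(7) cmp_vidc_id[OF e(4,5)] e vC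
    by (auto simp: list_all2_append composable_single)
  have c2: "map2 (\<lambda>z x. cmp K z [x]) ?zs ?x2 = map hat (xs @ vidc N f # ys)"
    "list_all2 (\<lambda>z x. composable K z [x]) ?zs ?x2"
    using cols[OF sub(1)] cols[OF sub(2)] v by (auto simp: list_all2_append)
  have run1: "cell_run K (vid K (vcod K a')) ?x1 (vid K (vcod K b'))"
    using uf_run(1)[OF m(1)] uf_run(1)[OF m(2)] vC by (auto simp: run_append)
  have run2: "cell_run K a' ?x2 b'"
    using m vidc_ends[OF assms(1)] by (auto simp: run_append N_run_iff)
  note C1 = cmp_cols[OF Xz c1(2) cell_run_cell_path[OF run1]]
    and C2 = cmp_cols[OF Xz c2(2) cell_run_cell_path[OF run2]]
  have ne: "map uf xs @ map uf ys \<noteq> []" "map hat xs @ map hat ys \<noteq> []" using r(2) by auto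
  note D1 = composable_drop_vidc[OF C1(2) vC(6) ne(1)]
    and D2 = composable_drop_vidc[OF C2(2) assms(1) ne(2)]
  have "cmp N \<psi> (xs @ ys) = (cmp K (cmp K X ?zs) (map hat (xs @ ys)))\<lparr>htgt := htgt \<psi>\<rparr>"
    by (rule N_cmp(1)[OF r(1,3)]) (use D1 C1(1) c1(1) X(2) in auto)
  then show ?thesis using X(3) D2 C2(1) c2(1) by simp
qed

lemma hat_back: "(hat \<phi>)\<lparr>htgt := htgt \<phi>\<rparr> = \<phi>"
  by (simp add: to_unit_def)

lemma composable_hidcs:
  assumes "\<phi> \<in> cells K" "hsrc \<phi> = (A, Js)" "Js \<noteq> []"
  shows "composable K \<phi> (map (hidc K) Js)"
proof -
  note e = cell_ends[OF assms(1)]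
  have p: "hpath K A Js (vdom K (vtgt \<phi>))" using e assms(2) by simp
  show ?thesis
    by (rule composableI[OF _ _ run_hidcs[OF p]])
      (use assms e path_ends[OF p] htgts_hidcs[OF path_hmor[OF p]] in \<open>simp_all add: vid_ends\<close>)
qed

lemma N_avdc: "avdc N"
proof (rule avdc.intro)
  fix \<psi> \<phi>s assume c: "composable N \<psi> \<phi>s"
  obtain f g where r: "\<psi> \<in> cells N" "\<phi>s \<noteq> []" "cell_run N f \<phi>s g" using N_composable_run[OF c] by metis
  obtain X where X: "composable K X (map uf \<phi>s)" "hat \<psi> = cmp K X (map uf \<phi>s)" using N_ext[OF c] .
  note R = N_cmp[OF r(3,1) X]
  have "hd \<phi>s \<in> cells N" using r(2) c by (auto simp: composable_def)
  then have "fst (hsrc (hd \<phi>s)) = vdom K f"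
    using cell_ends(3)[OF N_ends(1)] cell_run_hd[OF r(3,2)] by simp
  then show "cmp N \<psi> \<phi>s \<in> cells N \<and> hsrc (cmp N \<psi> \<phi>s) = concat_hsrc \<phi>s \<and> htgt (cmp N \<psi> \<phi>s) = htgt \<psi> \<and>
      vsrc (cmp N \<psi> \<phi>s) = vcmp N (vsrc \<psi>) (vsrc (hd \<phi>s)) \<and> vtgt (cmp N \<psi> \<phi>s) = vcmp N (vtgt \<psi>) (vtgt (last \<phi>s))"
    using R cell_run_hd[OF r(3,2)] cell_run_last[OF r(3,2)] by (simp add: concat_hsrc_def o_def)
next
  fix f h A B C assume "f \<in> vhom N A B" "h \<in> vhom N B C"
  then have f: "f \<in> vmor K" "h \<in> vmor K" "vcod K f = vdom K h" "f \<in> vhom K A B" "h \<in> vhom K B C"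
    by (auto simp: vhom_iff)
  note v = N_vidc[OF f(1)] and w = N_vidc[OF f(2)] and c = vcmp_ends[OF f(1-3)]
  have "cmp N (vidc N h) [vidc N f] =
      (cmp K (cmp K (\<eta> (vcod K h)) [vidc K h]) [vidc K f])\<lparr>htgt := (vcod K h, [])\<rparr>"
    using N_cmp_vidc(1)[OF w(1) f(1)] w f(3) by simp
  also have "cmp K (cmp K (\<eta> (vcod K h)) [vidc K h]) [vidc K f] = cmp K (\<eta> (vcod K h)) [vidc K (vcmp K h f)]"
    using single_assoc[of "\<eta> (vcod K h)" "vidc K h" "vidc K f"] cmp_vidc[OF f(4,5)] f
      vidc_ends[OF f(1)] vidc_ends[OF f(2)] eta_ends[of "vcod K h"] vmor_ends[OF f(2)] by simp
  also have "\<dots>\<lparr>htgt := (vcod K h, [])\<rparr> = vidc N (vcmp N h f)"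
    using N_vidc(9)[OF c(1)] c(3) by simp
  finally show "cmp N (vidc N h) [vidc N f] = vidc N (vcmp N h f)" .
next
  fix \<phi> C assume p: "\<phi> \<in> cells N" "htgt \<phi> = (C, [])"
  note e = N_ends[OF p(1)]
  have C: "C \<in> obj K" using e p(2) by simp
  note t = eta_ends[OF C] and v = N_vidc[OF vid_ends(1)[OF C]] and vC = vid_ends[OF C]
  have u: "uf \<phi> = \<eta> C" using p(2) by (simp add: unit_factor_def nullary_def)
  have hv: "hat (vidc N (vid K C)) = \<eta> C" using v(6) cmp_vidc_id[OF t(4,5)] vC by simp
  \<comment> \<open>For the vertical identity of \<open>C\<close> the factor is the identity of the
    unit, since its hat is the unit factor \<open>\<eta> C\<close> itself.\<close>
  have X: "composable K (hidc K (unit_mor C)) (map uf [\<phi>])"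
    "hat (vidc N (vid K C)) = cmp K (hidc K (unit_mor C)) (map uf [\<phi>])"
    using composable_hidc[OF t(4)] hidc_comp[OF t(4)] t(6) u hv by simp_all
  have "cell_run N (vsrc \<phi>) [\<phi>] (vtgt \<phi>)" using p(1) cell_ends[OF e(1)] by simp
  from N_cmp(1)[OF this v(1) X]
  have "cmp N (vidc N (vid K C)) [\<phi>] = (cmp K (hidc K (unit_mor C)) [hat \<phi>])\<lparr>htgt := (C, [])\<rparr>"
    using v(3) vC by simp
  also have "cmp K (hidc K (unit_mor C)) [hat \<phi>] = hat \<phi>"
    using hidc_comp[OF e(1)] e(5) p(2) t(6) by (simp add: unit_tgt_def)
  finally show "cmp N (vidc N (vid N C)) [\<phi>] = \<phi>" using hat_back[of \<phi>] p(2) by simp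
next
  fix \<phi> C H assume p: "\<phi> \<in> cells N" "htgt \<phi> = (C, [H])"
  note e = N_ends[OF p(1)]
  have u: "unary \<phi>" "hat \<phi> = \<phi>" using p(2) hat_unary by (simp_all add: unary_def)
  have H: "H \<in> hmor K" "hdom K H = C" using e(6,7) p(2) by auto
  note h = N_hidc[OF H(1)]
  have "composable K (hidc K H) [\<phi>]" "cmp K (hidc K H) [\<phi>] = \<phi>"
    using composable_hidc[of \<phi>] hidc_comp[of \<phi>] e(1) u(2) p(2) by simp_all
  then have "cmp N (hidc K H) [\<phi>] = \<phi>\<lparr>htgt := (C, [H])\<rparr>"
    using N_cmp_unaries(1)[OF h(1), of "[\<phi>]"] h(2) u(1) hidc_ends[OF H(1)] H(2) by simp
  also have "\<dots> = \<phi>" using p(2) by (cases \<phi>) simp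
  finally show "cmp N (hidc N H) [\<phi>] = \<phi>" by simp
next
  fix \<phi> A assume p: "\<phi> \<in> cells N" "hsrc \<phi> = (A, [])"
  note e = N_ends[OF p(1)]
  have A: "A \<in> obj K" using cell_ends(1,3)[OF e(1)] p(2) vmor_ends by auto
  have "cmp N \<phi> [vidc N (vid K A)] = (cmp K (hat \<phi>) [vidc K (vid K A)])\<lparr>htgt := htgt \<phi>\<rparr>"
    using N_cmp_vidc(1)[OF p(1) vid_ends(1)[OF A]] p(2) vid_ends[OF A] by simp
  also have "\<dots> = \<phi>" using cmp_vidc_id[OF e(1)] p(2) hat_back by simp
  finally show "cmp N \<phi> [vidc N (vid N A)] = \<phi>" by simp
next
  fix \<phi> A Js assume p: "\<phi> \<in> cells N" "hsrc \<phi> = (A, Js)" "Js \<noteq> []"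
  note e = N_ends[OF p(1)]
  have h: "hsrc (hat \<phi>) = (A, Js)" using p(2) by simp
  have "set Js \<subseteq> hmor K" using path_hmor[OF cell_ends(5)[OF e(1)]] p(2) by simp
  then have un: "\<forall>\<phi>\<in>set (map (hidc K) Js). unary \<phi>" by (auto simp: unary_def hidc_ends)
  have "cmp N \<phi> (map (hidc K) Js) = (cmp K (hat \<phi>) (map (hidc K) Js))\<lparr>htgt := htgt \<phi>\<rparr>"
    using N_cmp_unaries(1)[OF p(1) composable_hidcs[OF e(1) h p(3)] un] .
  also have "\<dots> = \<phi>" using cmp_hidc_id[OF e(1) h p(3)] hat_back by simp
  finally show "cmp N \<phi> (map (hidc N) Js) = \<phi>" by simp
next
  fix \<phi> assume p: "\<phi> \<in> cells N"
  note e = N_ends[OF p] and k = cell_ends[OF N_ends(1)[OF p]]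
  show "\<exists>A Js B C Ks D. hsrc \<phi> = (A, Js) \<and> hpath N A Js B \<and> htgt \<phi> = (C, Ks) \<and> hpath N C Ks D \<and>
      length Ks \<le> 1 \<and> vsrc \<phi> \<in> vhom N A C \<and> vtgt \<phi> \<in> vhom N B D"
    by (rule exI[of _ "fst (hsrc \<phi>)"], rule exI[of _ "snd (hsrc \<phi>)"], rule exI[of _ "vdom K (vtgt \<phi>)"],
      rule exI[of _ "fst (htgt \<phi>)"], rule exI[of _ "snd (htgt \<phi>)"], rule exI[of _ "vcod K (vtgt \<phi>)"])
      (use e k in \<open>simp add: vhom_iff prod_eq_iff\<close>)
next
  fix J assume "J \<in> hmor N"
  then show "hidc N J \<in> cells N \<and> hsrc (hidc N J) = (hdom N J, [J]) \<and> htgt (hidc N J) = (hdom N J, [J]) \<and>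
      vsrc (hidc N J) = vid N (hdom N J) \<and> vtgt (hidc N J) = vid N (hcod N J)"
    using N_hidc hidc_ends by simp
next
  fix f assume "f \<in> vmor N"
  then show "vidc N f \<in> cells N \<and> hsrc (vidc N f) = (vdom N f, []) \<and> htgt (vidc N f) = (vcod N f, []) \<and>
      vsrc (vidc N f) = f \<and> vtgt (vidc N f) = f"
    using N_vidc by simp
next
  fix \<chi> \<psi>s \<phi>ss assume "composable N \<chi> \<psi>s" "list_all2 (composable N) \<psi>s \<phi>ss" "cell_path (concat \<phi>ss)"
  then show "cmp N \<chi> (map2 (cmp N) \<psi>s \<phi>ss) = cmp N (cmp N \<chi> \<psi>s) (concat \<phi>ss)" by (rule N_assoc)
next
  fix f \<psi> xs ys assume "f \<in> vmor N" "composable N \<psi> (xs @ ys)" "composable N \<psi> (xs @ vidc N f # ys)"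
  then show "cmp N \<psi> (xs @ vidc N f # ys) = cmp N \<psi> (xs @ ys)" using N_insert by simp
qed (simp_all add: vmor_ends vid_hom vcmp_hom vcmp_assoc vcmp_id hmor_ends)

sublocale N: avdc N by (rule N_avdc)

text \<open>The identity of the chosen unit, relabelled as a cell with target
  \<open>(A, [])\<close>, is cartesian: composing with it changes nothing but the target, so the
  factorisation of \<open>\<chi>\<close> is \<open>hat \<chi>\<close>.\<close>

lemma N_has_units: "has_units_aug N"
  unfolding has_units_aug_def
proof
  fix A assume "A \<in> obj N"
  then have A: "A \<in> obj K" by simp
  note t = eta_ends[OF A] and h = hidc_ends[OF eta_ends(1)[OF A]]
  let ?e = "(hidc K (unit_mor A))\<lparr>htgt := (A, [])\<rparr>"
  have e: "?e \<in> cells N" "hat ?e = hidc K (unit_mor A)"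
    using N_update[OF h(1), of "(A, [])"] h(3) t(2,6) A by (simp_all add: unit_tgt_def)
  have key: "cmp N ?e [\<phi>] = \<phi>\<lparr>htgt := (A, [])\<rparr>" if "\<phi> \<in> cells N" "htgt \<phi> = (A, [unit_mor A])" for \<phi>
  proof -
    have u: "unary \<phi>" "hat \<phi> = \<phi>" using that(2) hat_unary by (simp_all add: unary_def)
    have k: "\<phi> \<in> cells K" using N_ends(1)[OF that(1)] u by simp
    have "composable K (hat ?e) [\<phi>]" "cmp K (hat ?e) [\<phi>] = \<phi>"
      using composable_hidc[OF k] hidc_comp[OF k] that(2) e(2) by simp_all
    then show ?thesis using N_cmp_unaries(1)[OF e(1), of "[\<phi>]"] u(1) by simp
  qed
  have "\<exists>!\<phi>. \<phi> \<in> cells N \<and> hsrc \<phi> = hsrc \<chi> \<and> htgt \<phi> = (A, [unit_mor A]) \<and> vsrc \<phi> = vsrc \<chi> \<and> vtgt \<phi> = vtgt \<chi> \<and>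
      \<chi> = cmp N ?e [\<phi>]" if c: "\<chi> \<in> cells N" "htgt \<chi> = (A, [])" for \<chi>
  proof (rule ex1I[of _ "hat \<chi>"])
    note n = N_ends[OF c(1)]
    have T: "htgt (hat \<chi>) = (A, [unit_mor A])" using n(5) c(2) t(6) by (simp add: unit_tgt_def)
    have hN: "hat \<chi> \<in> cells N" using unary_N n by blast
    show "hat \<chi> \<in> cells N \<and> hsrc (hat \<chi>) = hsrc \<chi> \<and> htgt (hat \<chi>) = (A, [unit_mor A]) \<and>
        vsrc (hat \<chi>) = vsrc \<chi> \<and> vtgt (hat \<chi>) = vtgt \<chi> \<and> \<chi> = cmp N ?e [hat \<chi>]"
      using hN T key[OF hN T] hat_back[of \<chi>] c(2) by simp
  next
    fix \<phi> assume f: "\<phi> \<in> cells N \<and> hsrc \<phi> = hsrc \<chi> \<and> htgt \<phi> = (A, [unit_mor A]) \<and> vsrc \<phi> = vsrc \<chi> \<and>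
        vtgt \<phi> = vtgt \<chi> \<and> \<chi> = cmp N ?e [\<phi>]"
    then have "\<chi> = \<phi>\<lparr>htgt := (A, [])\<rparr>" using key by blast
    moreover have "hat (\<phi>\<lparr>htgt := (A, [])\<rparr>) = \<phi>"
      using hat_update[of \<phi> "(A, [])"] f t(6) by (simp add: unit_tgt_def)
    ultimately show "\<phi> = hat \<chi>" by simp
  qed
  moreover have "horizontal_cell N ?e" using h t A by (auto simp: horizontal_cell_def)
  ultimately have "cartesian_unit_cell N A (unit_mor A) ?e"
    using t h e by (simp add: cartesian_unit_cell_def)
  then show "\<exists>I \<epsilon>. cartesian_unit_cell N A I \<epsilon>" by blast
qed

end

section \<open>The 2-functor \<open>N\<close>\<close>

text \<open>For normal \<open>F\<close> the description at \<open>(C)\<close> determines a unique cell \<open>F I\<^sub>C \<Rightarrow> I\<^bsub>FC\<^esub>\<close>, because the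
  image of the chosen unit of \<open>C\<close> is cocartesian.\<close>

definition unit_comparison ::
  "(('o, 'v, 'h, 'c) avdc \<Rightarrow> 'o \<Rightarrow> ('o, 'v, 'h, 'c) cell) \<Rightarrow> ('o, 'v, 'h, 'c) avfun \<Rightarrow> ('o, 'h) path
    \<Rightarrow> ('o, 'v, 'h, 'c) cell" where
  "unit_comparison \<eta> F T = (if snd T = []
    then THE t. composable (fcod F) t [fcell F (\<eta> (fdom F) (fst T))] \<and>
      \<eta> (fcod F) (fobj F (fst T)) = cmp (fcod F) t [fcell F (\<eta> (fdom F) (fst T))]
    else hidc (fcod F) (fhor F (hd (snd T))))"

text \<open>The image of a cell into the chosen unit of \<open>C\<close> ends in the image of that
  unit; the comparison cell carries it on to the chosen unit of the image of \<open>C\<close>, where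
  it can be relabelled as nullary. At unary targets the comparison is an identity.\<close>

definition N_arr ::
  "(('o, 'v, 'h, 'c) avdc \<Rightarrow> 'o \<Rightarrow> ('o, 'v, 'h, 'c) cell) \<Rightarrow> ('o, 'v, 'h, 'c) avfun \<Rightarrow> ('o, 'v, 'h, 'c) avfun" where
  "N_arr \<eta> F = F\<lparr>fdom := N_obj (\<eta> (fdom F)) (fdom F), fcod := N_obj (\<eta> (fcod F)) (fcod F),
    fcell := (\<lambda>\<phi>\<in>cells (N_obj (\<eta> (fdom F)) (fdom F)).
      (cmp (fcod F) (unit_comparison \<eta> F (htgt \<phi>)) [fcell F (to_unit (\<eta> (fdom F)) \<phi>)])\<lparr>htgt := fpath F (htgt \<phi>)\<rparr>)\<rparr>"

text \<open>The components are vertical morphisms and unary cells, which \<open>N\<close> leaves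
  alone; the new content lies in naturality at nullary cells.\<close>

definition N_two ::
  "(('o, 'v, 'h, 'c) avdc \<Rightarrow> 'o \<Rightarrow> ('o, 'v, 'h, 'c) cell) \<Rightarrow> ('o, 'v, 'h, 'c) avtrans \<Rightarrow> ('o, 'v, 'h, 'c) avtrans" where
  "N_two \<eta> \<xi> = \<xi>\<lparr>tsrc := N_arr \<eta> (tsrc \<xi>), ttgt := N_arr \<eta> (ttgt \<xi>)\<rparr>"

lemma N_arr_simps [simp]:
  "fdom (N_arr \<eta> F) = N_obj (\<eta> (fdom F)) (fdom F)" "fcod (N_arr \<eta> F) = N_obj (\<eta> (fcod F)) (fcod F)"
  "fobj (N_arr \<eta> F) = fobj F" "fver (N_arr \<eta> F) = fver F" "fhor (N_arr \<eta> F) = fhor F"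
  by (simp_all add: N_arr_def)

lemma N_arr_fpath [simp]: "fpath (N_arr \<eta> F) = fpath F"
  by (intro ext) (simp add: fpath_def)

lemma N_two_simps [simp]:
  "tsrc (N_two \<eta> \<xi>) = N_arr \<eta> (tsrc \<xi>)" "ttgt (N_two \<eta> \<xi>) = N_arr \<eta> (ttgt \<xi>)"
  "tobj (N_two \<eta> \<xi>) = tobj \<xi>" "thor (N_two \<eta> \<xi>) = thor \<xi>"
  by (simp_all add: N_two_def)

lemma update_htgt [simp]: "htgt \<phi> = T \<Longrightarrow> \<phi>\<lparr>htgt := T\<rparr> = \<phi>"
  by (cases \<phi>) auto

section \<open>The functor \<open>N(F)\<close>\<close>

locale normal_functor = avfunctor F for F :: "('o, 'v, 'h, 'c) avfun" +
  fixes \<eta> :: "('o, 'v, 'h, 'c) avdc \<Rightarrow> 'o \<Rightarrow> ('o, 'v, 'h, 'c) cell"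
  assumes dom_unital: "unital_vdc (fdom F) (\<eta> (fdom F))"
    and cod_unital: "unital_vdc (fcod F) (\<eta> (fcod F))"
    and normal: "normal F"
begin

sublocale A: unital_vdc "fdom F" "\<eta> (fdom F)" by (rule dom_unital)
sublocale B: unital_vdc "fcod F" "\<eta> (fcod F)" by (rule cod_unital)

abbreviation "comparison \<equiv> unit_comparison \<eta> F"
abbreviation "eta \<equiv> \<eta> (fdom F)"
abbreviation "eta' \<equiv> \<eta> (fcod F)"
abbreviation "L \<equiv> fcod F"

lemma F_eta:
  assumes "C \<in> obj (fdom F)"
  shows "cocartesian_unit_cell L (fobj F C) (fhor F (A.unit_mor C)) (fcell F (eta C))"
  using normal assms A.eta_cocartesian[OF assms] by (auto simp: normal_def)

lemma F_unit_like:
  assumes "unit_like (fdom F) u"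
  shows "unit_like L (fcell F u)"
  using assms unfolding unit_like_def
proof
  assume "\<exists>J\<in>hmor (fdom F). u = hidc (fdom F) J"
  then show "(\<exists>J\<in>hmor L. fcell F u = hidc L J) \<or> (\<exists>A I. cocartesian_unit_cell L A I (fcell F u))"
    using fcell_hidc fhor_hom by blast
next
  assume "\<exists>A I. cocartesian_unit_cell (fdom F) A I u"
  then obtain A I where c: "cocartesian_unit_cell (fdom F) A I u" by blast
  then have "A \<in> obj (fdom F)" by (rule dom.cocartesian_vends)
  then show "(\<exists>J\<in>hmor L. fcell F u = hidc L J) \<or> (\<exists>A I. cocartesian_unit_cell L A I (fcell F u))"
    using c normal unfolding normal_def by blast
qed

text \<open>By normality the image of the chosen unit is cocartesian, so unary cells out of the
  image of \<open>I\<^sub>C\<close> may be compared after composing with it. Naturality of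
  transformations is checked in this way.\<close>

lemma factor_F_eta:
  assumes "C \<in> obj (fdom F)" "composable L t [fcell F (eta C)]" "composable L s [fcell F (eta C)]"
    "cmp L t [fcell F (eta C)] = cmp L s [fcell F (eta C)]" "unary t"
  shows "t = s"
proof -
  note c = cocartesian_ends[OF F_eta[OF assms(1)]] and v = cod.cocartesian_vends[OF F_eta[OF assms(1)]]
  have "cell_run L (vid L (fobj F C)) [fcell F (eta C)] (vid L (fobj F C))"
    using c v by (simp add: cod.vid_ends)
  then show ?thesis
    using F_eta[OF assms(1)] v assms
    by (intro cod.factor_units_unique[of "fobj F C" "[fcell F (eta C)]" "fobj F C" t s]) (auto simp: unit_like_def)
qed

lemma comparison_unit:
  assumes "C \<in> obj (fdom F)"
  shows "composable L (comparison (C, [])) [fcell F (eta C)]"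
    "cmp L (comparison (C, [])) [fcell F (eta C)] = eta' (fobj F C)"
    "\<And>t. composable L t [fcell F (eta C)] \<Longrightarrow> cmp L t [fcell F (eta C)] = eta' (fobj F C) \<Longrightarrow> t = comparison (C, [])"
    "comparison (C, []) \<in> cells L"
    "hsrc (comparison (C, [])) = (fobj F C, [fhor F (A.unit_mor C)])"
    "htgt (comparison (C, [])) = (fobj F C, [B.unit_mor (fobj F C)])"
    "vsrc (comparison (C, [])) = vid L (fobj F C)" "vtgt (comparison (C, [])) = vid L (fobj F C)"
proof -
  note c = cocartesian_ends[OF F_eta[OF assms]] and v = cod.cocartesian_vends[OF F_eta[OF assms]]
  note e = B.eta_ends[OF v(1)]
  have run: "cell_run L (vid L (fobj F C)) [fcell F (eta C)] (vid L (fobj F C))"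
    using c v by (simp add: cod.vid_ends)
  have ex: "\<exists>!t. composable L t [fcell F (eta C)] \<and> eta' (fobj F C) = cmp L t [fcell F (eta C)]"
    using c v e F_eta[OF assms] by (intro cod.factor_units[OF run]) (auto simp: unit_like_def unary_def)
  have d: "comparison (C, []) = (THE t. composable L t [fcell F (eta C)] \<and> eta' (fobj F C) = cmp L t [fcell F (eta C)])"
    by (simp add: unit_comparison_def)
  from theI'[OF ex] show *: "composable L (comparison (C, [])) [fcell F (eta C)]"
    "cmp L (comparison (C, [])) [fcell F (eta C)] = eta' (fobj F C)" unfolding d by simp_all
  show "t = comparison (C, [])" if "composable L t [fcell F (eta C)]" "cmp L t [fcell F (eta C)] = eta' (fobj F C)" for t
    using ex * that by metis
  note r = cod.cmp_run[OF *(1) run] cod.cmp_vid_run[OF *(1) run v(1) v(1)]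
  show "comparison (C, []) \<in> cells L" "hsrc (comparison (C, [])) = (fobj F C, [fhor F (A.unit_mor C)])"
    using *(1) c(7) by (auto simp: cod.composable_single)
  show "htgt (comparison (C, [])) = (fobj F C, [B.unit_mor (fobj F C)])"
    "vsrc (comparison (C, [])) = vid L (fobj F C)" "vtgt (comparison (C, [])) = vid L (fobj F C)"
    using r e unfolding *(2) by simp_all
qed

lemma comparison_unary: "comparison (C, [J]) = hidc L (fhor F J)"
  by (simp add: unit_comparison_def)

text \<open>The last clause is the defining equation of the comparison cell, extended to unary
  targets, where all cells involved are identities. The cells \<open>\<phi>\<close> and
  \<open>\<psi>\<close> enter through their targets only, as is the case for unit factors.\<close>

lemma comparison_ends:
  assumes "hpath (fdom F) (fst T) (snd T) E" "length (snd T) \<le> 1"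
  shows "comparison T \<in> cells L" "hsrc (comparison T) = fpath F (A.unit_tgt T)"
    "htgt (comparison T) = B.unit_tgt (fpath F T)" "vsrc (comparison T) = vid L (fobj F (fst T))"
    "vtgt (comparison T) = vid L (fobj F E)"
    "\<And>\<phi> \<psi>. htgt \<phi> = T \<Longrightarrow> htgt \<psi> = fpath F T \<Longrightarrow> composable L (comparison T) [fcell F (A.uf \<phi>)] \<and>
      cmp L (comparison T) [fcell F (A.uf \<phi>)] = B.uf \<psi>"
proof -
  obtain C Ks where T: "T = (C, Ks)" by fastforce
  have C: "C \<in> obj (fdom F)" using dom.path_ends[OF assms(1)] T by simp
  have "comparison T \<in> cells L \<and> hsrc (comparison T) = fpath F (A.unit_tgt T) \<and>
    htgt (comparison T) = B.unit_tgt (fpath F T) \<and> vsrc (comparison T) = vid L (fobj F (fst T)) \<and>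
    vtgt (comparison T) = vid L (fobj F E) \<and>
    (\<forall>\<phi> \<psi>. htgt \<phi> = T \<longrightarrow> htgt \<psi> = fpath F T \<longrightarrow> composable L (comparison T) [fcell F (A.uf \<phi>)] \<and>
      cmp L (comparison T) [fcell F (A.uf \<phi>)] = B.uf \<psi>)"
  proof (cases Ks)
    case Nil
    then show ?thesis using comparison_unit(1,2,4-8)[OF C] A.eta_ends[OF C] B.eta_ends[OF fobj_obj[OF C]] assms T
      by (auto simp: A.unit_tgt_def B.unit_tgt_def fpath_def unit_factor_def nullary_def)
  next
    case (Cons J Js)
    then have J: "Ks = [J]" "J \<in> hmor (fdom F)" "hdom (fdom F) J = C" "hcod (fdom F) J = E"
      using assms T by auto
    note h = cod.hidc_ends[of "fhor F J"]
    have "cmp L (hidc L (fhor F J)) [hidc L (fhor F J)] = hidc L (fhor F J)"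
      using cod.hidc_comp[of "hidc L (fhor F J)"] h fhor_hom[OF J(2)] by simp
    then show ?thesis using J T h fhor_hom[OF J(2)] fcell_hidc[OF J(2)]
      by (auto simp: A.unit_tgt_def B.unit_tgt_def fpath_def unit_factor_def nullary_def comparison_unary
          cod.composable_single)
  qed
  then show "comparison T \<in> cells L" "hsrc (comparison T) = fpath F (A.unit_tgt T)"
    "htgt (comparison T) = B.unit_tgt (fpath F T)" "vsrc (comparison T) = vid L (fobj F (fst T))"
    "vtgt (comparison T) = vid L (fobj F E)"
    "\<And>\<phi> \<psi>. htgt \<phi> = T \<Longrightarrow> htgt \<psi> = fpath F T \<Longrightarrow> composable L (comparison T) [fcell F (A.uf \<phi>)] \<and>
      cmp L (comparison T) [fcell F (A.uf \<phi>)] = B.uf \<psi>"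
    by blast+
qed

abbreviation "NF \<equiv> N_arr \<eta> F"

lemma NF_cell:
  assumes "\<phi> \<in> cells A.N"
  shows "fcell NF \<phi> = (cmp L (comparison (htgt \<phi>)) [fcell F (A.hat \<phi>)])\<lparr>htgt := fpath F (htgt \<phi>)\<rparr>"
    "fcell NF \<phi> \<in> cells B.N" "B.hat (fcell NF \<phi>) = cmp L (comparison (htgt \<phi>)) [fcell F (A.hat \<phi>)]"
    "hsrc (fcell NF \<phi>) = fpath F (hsrc \<phi>)" "htgt (fcell NF \<phi>) = fpath F (htgt \<phi>)"
    "vsrc (fcell NF \<phi>) = fver F (vsrc \<phi>)" "vtgt (fcell NF \<phi>) = fver F (vtgt \<phi>)"
    "composable L (comparison (htgt \<phi>)) [fcell F (A.hat \<phi>)]"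
proof -
  note n = A.N_ends[OF assms]
  note f = fcell_ends[OF n(1)] and d = dom.cell_ends[OF n(1)]
  have p: "hpath (fdom F) (fst (htgt \<phi>)) (snd (htgt \<phi>)) (vcod (fdom F) (vtgt \<phi>))" using n by simp
  note c = comparison_ends[OF p n(4)]
  show eq: "fcell NF \<phi> = (cmp L (comparison (htgt \<phi>)) [fcell F (A.hat \<phi>)])\<lparr>htgt := fpath F (htgt \<phi>)\<rparr>"
    using assms by (simp add: N_arr_def)
  have h: "hsrc (comparison (htgt \<phi>)) = htgt (fcell F (A.hat \<phi>))" using c f n by simp
  then show "composable L (comparison (htgt \<phi>)) [fcell F (A.hat \<phi>)]" using c f by (simp add: cod.composable_single)
  note s = cod.cmp_single[OF c(1) f(1) h]
  have "fst (fpath F (htgt \<phi>)) \<in> obj L" "length (snd (fpath F (htgt \<phi>))) \<le> 1"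
    using n fobj_obj by (simp_all add: fpath_def)
  then show "fcell NF \<phi> \<in> cells B.N" "B.hat (fcell NF \<phi>) = cmp L (comparison (htgt \<phi>)) [fcell F (A.hat \<phi>)]"
    unfolding eq using B.N_update[OF s(1)] s c by simp_all
  have "fver F (vsrc \<phi>) \<in> vmor L" "vcod L (fver F (vsrc \<phi>)) = fobj F (fst (htgt \<phi>))"
    "fver F (vtgt \<phi>) \<in> vmor L" "vcod L (fver F (vtgt \<phi>)) = fobj F (vcod (fdom F) (vtgt \<phi>))"
    using fver_ends d n by simp_all
  then show "hsrc (fcell NF \<phi>) = fpath F (hsrc \<phi>)" "htgt (fcell NF \<phi>) = fpath F (htgt \<phi>)"
    "vsrc (fcell NF \<phi>) = fver F (vsrc \<phi>)" "vtgt (fcell NF \<phi>) = fver F (vtgt \<phi>)"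
    unfolding eq using s f c cod.vid_neutral[of "fver F (vsrc \<phi>)"] cod.vid_neutral[of "fver F (vtgt \<phi>)"]
    by simp_all
qed

lemma NF_unary:
  assumes "\<phi> \<in> cells (fdom F)" "unary \<phi>"
  shows "fcell NF \<phi> = fcell F \<phi>"
proof -
  note h = A.hat_unary[OF assms(2)] and n = A.unary_N[OF assms] and f = fcell_ends[OF assms(1)]
  obtain C J where T: "htgt \<phi> = (C, [J])" using assms(2) by (cases "htgt \<phi>") (auto simp: unary_def length_Suc_conv)
  have "cmp L (comparison (htgt \<phi>)) [fcell F \<phi>] = fcell F \<phi>"
    using cod.hidc_comp[OF f(1)] T f(3) by (simp add: comparison_unary fpath_def)
  then show ?thesis using NF_cell(1)[OF n] h f by simp
qed

lemma NF_run:
  assumes "cell_run A.N f \<phi>s g"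
  shows "cell_run B.N (fver F f) (map (fcell NF) \<phi>s) (fver F g)"
    "htgts (map (fcell NF) \<phi>s) = map (fhor F) (htgts \<phi>s)"
  using assms by (induction \<phi>s arbitrary: f) (auto simp: NF_cell(2,4-7) fver_ends fpath_def)

text \<open>Let \<open>X\<close> factor \<open>hat \<psi>\<close> and let \<open>Z\<close> factor
  the hat of the image of \<open>\<psi>\<close>. Both \<open>Z\<close> after the comparison cells
  and the comparison at the target of \<open>\<psi>\<close> after \<open>F X\<close> give that hat
  when composed with the images of the unit factors, so they coincide by uniqueness. Composing this
  equality with the images of the hats gives the claim.\<close>

lemma NF_cmp:
  assumes "composable A.N \<psi> \<phi>s"
  shows "fcell NF (cmp A.N \<psi> \<phi>s) = cmp B.N (fcell NF \<psi>) (map (fcell NF) \<phi>s)"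
proof -
  obtain f g where r: "\<psi> \<in> cells A.N" "\<phi>s \<noteq> []" "cell_run A.N f \<phi>s g" "vcod (fdom F) f = vdom (fdom F) (vsrc \<psi>)"
    "snd (hsrc \<psi>) = htgts \<phi>s" "f \<in> vmor (fdom F)" "g \<in> vmor (fdom F)" using A.N_composable_run[OF assms] by metis
  obtain X where X: "composable (fdom F) X (map A.uf \<phi>s)" "A.hat \<psi> = cmp (fdom F) X (map A.uf \<phi>s)"
    using A.N_ext[OF assms] .
  note Xh = A.hats_composable[OF X(1) r(3)] and XN = A.N_cmp[OF r(3,1) X]
  have sub: "set \<phi>s \<subseteq> cells A.N" using r(3) A.N_run_iff by blast
  let ?c = "comparison (htgt \<psi>)"
  let ?Y = "cmp L ?c [fcell F X]"
  note P = NF_cell[OF r(1)] and n = A.N_ends[OF r(1)] and nr = NF_run[OF r(3)]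
  have vp: "vsrc \<psi> \<in> vmor (fdom F)" using dom.cell_ends(1)[OF n(1)] by simp
  have cX: "composable L ?c [fcell F X]"
    using P(8) fcell_ends[OF n(1)] fcell_ends[OF XN(11)] XN(10) by (simp add: cod.composable_single)
  have cN: "composable B.N (fcell NF \<psi>) (map (fcell NF) \<phi>s)"
    using r nr P vp by (intro B.N.composableI[OF _ _ nr(1)]) (simp_all add: fver_ends fpath_def)
  obtain Z where Z: "composable L Z (map B.uf (map (fcell NF) \<phi>s))" "B.hat (fcell NF \<psi>) = cmp L Z (map B.uf (map (fcell NF) \<phi>s))"
    using B.N_ext[OF cN] .
  note ZN = B.N_cmp[OF nr(1) P(2) Z]
  let ?cs = "map (\<lambda>\<phi>. comparison (htgt \<phi>)) \<phi>s"
    and ?u = "map (fcell F) (map A.uf \<phi>s)" and ?h = "map (fcell F) (map A.hat \<phi>s)"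
  have key: "composable L (comparison (htgt \<phi>)) [fcell F (A.uf \<phi>)]"
    "cmp L (comparison (htgt \<phi>)) [fcell F (A.uf \<phi>)] = B.uf (fcell NF \<phi>)"
    "htgt (comparison (htgt \<phi>)) = htgt (B.uf (fcell NF \<phi>))" if p: "\<phi> \<in> cells A.N" for \<phi>
  proof -
    note n = A.N_ends[OF p] and F = NF_cell[OF p]
    have q: "hpath (fdom F) (fst (htgt \<phi>)) (snd (htgt \<phi>)) (vcod (fdom F) (vtgt \<phi>))" using n by simp
    note c = comparison_ends[OF q n(4)]
    show "composable L (comparison (htgt \<phi>)) [fcell F (A.uf \<phi>)]"
      "cmp L (comparison (htgt \<phi>)) [fcell F (A.uf \<phi>)] = B.uf (fcell NF \<phi>)"
      using c(6)[OF refl F(5)] by blast+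
    show "htgt (comparison (htgt \<phi>)) = htgt (B.uf (fcell NF \<phi>))"
      using c(3) B.uf_ends(3)[OF F(2)] B.N_ends(5)[OF F(2)] F(5) by simp
  qed
  have cols: "map2 (\<lambda>z x. cmp L z [x]) ?cs ?u = map B.uf (map (fcell NF) \<phi>s)"
    "list_all2 (\<lambda>z x. composable L z [x]) ?cs ?u"
    "map2 (\<lambda>z x. cmp L z [x]) ?cs ?h = map B.hat (map (fcell NF) \<phi>s)"
    "list_all2 (\<lambda>z x. composable L z [x]) ?cs ?h"
    "htgts ?cs = htgts (map B.uf (map (fcell NF) \<phi>s))"
    using sub by (induction \<phi>s) (simp_all add: key NF_cell(3,8))
  have crun: "cell_run L (vid L (fobj F (vcod (fdom F) f))) ?cs (vid L (fobj F (vcod (fdom F) g)))"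
    using r(3)
  proof (induction \<phi>s arbitrary: f)
    case Nil
    then show ?case using dom.vmor_ends[of g] by (auto simp: cod.vid_ends fobj_obj)
  next
    case (Cons \<phi> \<phi>s)
    then have p: "\<phi> \<in> cells A.N" by simp
    note n = A.N_ends[OF p]
    have q: "hpath (fdom F) (fst (htgt \<phi>)) (snd (htgt \<phi>)) (vcod (fdom F) (vtgt \<phi>))" using n by simp
    show ?case using Cons comparison_ends[OF q n(4)] n by simp
  qed
  note urun = fcell_run[OF A.uf_run(1)[OF r(3)]]
  have uobj: "vcod (fdom F) f \<in> obj (fdom F)" "vcod (fdom F) g \<in> obj (fdom F)" using dom.vmor_ends r by blast+
  have urun': "cell_run L (vid L (fobj F (vcod (fdom F) f))) ?u (vid L (fobj F (vcod (fdom F) g)))"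
    using urun uobj by (simp add: fver_id)
  have hrun: "cell_run L (fver F f) ?h (fver F g)"
    using fcell_run r(3) A.N_run_iff by blast
  have Zc: "composable L Z ?cs"
    using cod.composable_run[OF Z(1) B.uf_run(1)[OF nr(1)]] cols(5) r(2) fver_ends(3)[OF r(6)]
      cod.vid_ends[OF fobj_obj[OF uobj(1)]]
    by (intro cod.composableI[OF _ _ crun]) simp_all
  note C1 = cod.cmp_cols[OF Zc cols(2) cell_run_cell_path[OF urun']]
    and C2 = cod.cmp_cols[OF Zc cols(4) cell_run_cell_path[OF hrun]]
  note Y1 = cod.cmp_single_assoc[OF cX fcell_composable[OF X(1)]]
    and Y2 = cod.cmp_single_assoc[OF cX fcell_composable[OF Xh]]
  have e1: "cmp L (cmp L Z ?cs) ?u = cmp L ?Y ?u"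
    using C1(1) cols(1) Z(2) P(3) X(2) fcell_cmp[OF X(1)] Y1(1) by simp
  have un: "unary (cmp L Z ?cs)"
    using cod.cmp_run(3)[OF Zc crun] ZN(10) B.N_ends(2)[OF P(2)] by (simp add: unary_def)
  \<comment> \<open>Normality enters here: the images of the unit factors are identities or
    cocartesian, so factors through this row are unique.\<close>
  have uls: "\<forall>u\<in>set ?u. unit_like L u"
    using A.uf_run(4)[OF r(3)] F_unit_like by auto
  have ZY: "cmp L Z ?cs = ?Y"
    by (rule cod.factor_units_unique[OF urun' _ _ uls C1(2) Y1(2) e1 un]) (use uobj fobj_obj in blast)+
  have "B.hat (cmp B.N (fcell NF \<psi>) (map (fcell NF) \<phi>s)) = cmp L Z (map B.hat (map (fcell NF) \<phi>s))"
    by (rule ZN(2))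
  also have "\<dots> = cmp L ?Y ?h" using C2(1) cols(3) ZY by simp
  also have "\<dots> = cmp L ?c [fcell F (cmp (fdom F) X (map A.hat \<phi>s))]"
    using Y2(1) fcell_cmp[OF Xh] by simp
  also have "\<dots> = B.hat (fcell NF (cmp A.N \<psi> \<phi>s))"
    using NF_cell(3)[OF XN(3)] XN(2,5) by simp
  finally have "B.hat (cmp B.N (fcell NF \<psi>) (map (fcell NF) \<phi>s)) = B.hat (fcell NF (cmp A.N \<psi> \<phi>s))" .
  moreover have "htgt (cmp B.N (fcell NF \<psi>) (map (fcell NF) \<phi>s)) = htgt (fcell NF (cmp A.N \<psi> \<phi>s))"
    using ZN(5) P(5) NF_cell(5)[OF XN(3)] XN(5) by simp
  ultimately show ?thesis using B.N_eqI by metis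
qed

lemma N_arr_functor: "avfunctor NF"
proof (rule avfunctor.intro)
  fix \<psi> \<phi>s assume "composable (fdom NF) \<psi> \<phi>s"
  then show "fcell NF (cmp (fdom NF) \<psi> \<phi>s) = cmp (fcod NF) (fcell NF \<psi>) (map (fcell NF) \<phi>s)"
    using NF_cmp by simp
next
  fix \<phi> assume "\<phi> \<in> cells (fdom NF)"
  then have "\<phi> \<in> cells A.N" by simp
  from NF_cell[OF this]
  show "fcell NF \<phi> \<in> cells (fcod NF) \<and> hsrc (fcell NF \<phi>) = fpath NF (hsrc \<phi>) \<and> htgt (fcell NF \<phi>) = fpath NF (htgt \<phi>) \<and>
      vsrc (fcell NF \<phi>) = fver NF (vsrc \<phi>) \<and> vtgt (fcell NF \<phi>) = fver NF (vtgt \<phi>)" by simp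
next
  fix J assume "J \<in> hmor (fdom NF)"
  then have J: "J \<in> hmor (fdom F)" by simp
  show "fcell NF (hidc (fdom NF) J) = hidc (fcod NF) (fhor NF J)"
    using NF_unary[of "hidc (fdom F) J"] dom.hidc_ends[OF J] fcell_hidc[OF J] by (simp add: unary_def)
next
  fix f assume "f \<in> vmor (fdom NF)"
  then have f: "f \<in> vmor (fdom F)" by simp
  have C: "vcod (fdom F) f \<in> obj (fdom F)" using dom.vmor_ends f by blast
  note v = A.N_vidc[OF f] and w = B.N_vidc[OF fver_ends(1)[OF f]] and c = comparison_unit(1,2)[OF C]
  \<comment> \<open>The vertical identity of \<open>N\<close> at \<open>f\<close> is a chosen unit
    whiskered with \<open>f\<close>, so its preservation is the defining equation of the comparison
    cell, whiskered with \<open>fver F f\<close>.\<close>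
  have "B.hat (fcell NF (vidc A.N f)) =
      cmp L (comparison (vcod (fdom F) f, [])) [fcell F (cmp (fdom F) (eta (vcod (fdom F) f)) [vidc (fdom F) f])]"
    using NF_cell(3)[OF v(1)] v by simp
  also have "fcell F (cmp (fdom F) (eta (vcod (fdom F) f)) [vidc (fdom F) f]) =
      cmp L (fcell F (eta (vcod (fdom F) f))) [vidc L (fver F f)]"
    using fcell_cmp[OF v(8)] fcell_vidc[OF f] by simp
  also have "cmp L (comparison (vcod (fdom F) f, [])) [\<dots>] = cmp L (eta' (fobj F (vcod (fdom F) f))) [vidc L (fver F f)]"
    using cod.cmp_single_assoc(1)[OF c(1), of "[vidc L (fver F f)]"] c(2) fcell_composable[OF v(8)] fcell_vidc[OF f]
    by simp
  finally have "B.hat (fcell NF (vidc A.N f)) = B.hat (vidc B.N (fver F f))"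
    using w(6) fver_ends[OF f] by simp
  moreover have "htgt (fcell NF (vidc A.N f)) = htgt (vidc B.N (fver F f))"
    using NF_cell(5)[OF v(1)] v(3) w(3) fver_ends[OF f] by (simp add: fpath_def)
  ultimately show "fcell NF (vidc (fdom NF) f) = vidc (fcod NF) (fver NF f)" using B.N_eqI by simp
next
  show "avdc (fdom NF)" "avdc (fcod NF)" using A.N_avdc B.N_avdc by simp_all
  show "fcell NF \<in> extensional (cells (fdom NF))" by (simp add: N_arr_def)
qed (use fobj_obj fver_hom fver_id fver_cmp fhor_hom fobj_ext fver_ext fhor_ext in simp_all)

end

section \<open>Compatibility of \<open>N\<close> with identity functors and composites\<close>

locale unit_choices =
  fixes \<eta> :: "('o, 'v, 'h, 'c) avdc \<Rightarrow> 'o \<Rightarrow> ('o, 'v, 'h, 'c) cell"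
  assumes choices: "\<And>K. vdc K \<Longrightarrow> has_units_virt K \<Longrightarrow> unit_choice K (\<eta> K)"
begin

lemma unital: "vdc K \<Longrightarrow> has_units_virt K \<Longrightarrow> unital_vdc K (\<eta> K)"
  by (simp add: unital_vdc_def unital_vdc_axioms_def choices)

lemma normal_functorI:
  assumes "avfunctor F" "vdc (fdom F)" "vdc (fcod F)" "has_units_virt (fdom F)" "has_units_virt (fcod F)" "normal F"
  shows "normal_functor F \<eta>"
  using assms unital by (simp add: normal_functor_def normal_functor_axioms_def)

end

lemma normal_functor_id:
  assumes "unital_vdc K (\<eta> K)"
  shows "normal_functor (id_avfun K) \<eta>"
proof -
  interpret unital_vdc K "\<eta> K" by fact
  show ?thesis
    by (intro normal_functor.intro normal_functor_axioms.intro id_avfun_functor normal_id) (simp_all add: assms)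
qed

lemma normal_functor_comp:
  assumes "normal_functor F \<eta>" "normal_functor G \<eta>" "fcod F = fdom G"
  shows "normal_functor (comp_avfun G F) \<eta>"
proof -
  interpret F: normal_functor F \<eta> by fact
  interpret G: normal_functor G \<eta> by fact
  show ?thesis
    by (intro normal_functor.intro normal_functor_axioms.intro comp_avfun_functor normal_comp)
      (simp_all add: F.avfunctor_axioms G.avfunctor_axioms F.normal G.normal F.dom_unital G.cod_unital assms(3))
qed

lemma N_arr_id:
  assumes "unital_vdc K (\<eta> K)"
  shows "N_arr \<eta> (id_avfun K) = id_avfun (N_obj (\<eta> K) K)"
proof -
  interpret unital_vdc K "\<eta> K" by fact
  interpret I: normal_functor "id_avfun K" \<eta> by (rule normal_functor_id[where \<eta> = \<eta>, OF assms])
  show ?thesis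
  proof (rule avfun_eqI)
    show "avfunctor (N_arr \<eta> (id_avfun K))" by (rule I.N_arr_functor)
    show "avfunctor (id_avfun (N_obj (\<eta> K) K))" by (rule N.id_avfun_functor)
  next
    fix \<phi> assume "\<phi> \<in> cells (fdom (N_arr \<eta> (id_avfun K)))"
    then have p: "\<phi> \<in> cells N" by simp
    note n = N_ends[OF p]
    obtain C Ks where T: "htgt \<phi> = (C, Ks)" by fastforce
    have C: "C \<in> obj K" "set Ks \<subseteq> hmor K" using n path_hmor[OF n(7)] T by auto
    have fp: "fpath (id_avfun K) (htgt \<phi>) = htgt \<phi>"
      using C T by (auto simp: fpath_def intro!: map_idI)
    note e = eta_ends[OF C(1)]
    have "cmp K (unit_comparison \<eta> (id_avfun K) (htgt \<phi>)) [hat \<phi>] = hat \<phi>"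
    proof (cases Ks)
      case Nil
      \<comment> \<open>The identity of the unit satisfies the equation that characterises the
        comparison cell of the identity functor.\<close>
      have "hidc K (unit_mor C) = unit_comparison \<eta> (id_avfun K) (C, [])"
        using I.comparison_unit(3)[of C "hidc K (unit_mor C)"] composable_hidc[OF e(4)] hidc_comp[OF e(4)] e C
        by simp
      then show ?thesis using hidc_comp[OF n(1)] n(5) T Nil e by (simp add: unit_tgt_def)
    next
      case (Cons J Js)
      then have "Js = []" using n(4) T by simp
      then show ?thesis using hidc_comp[OF n(1)] n(5) T Cons C I.comparison_unary[of C J] by (simp add: unit_tgt_def)
    qed
    then have "hat (fcell (N_arr \<eta> (id_avfun K)) \<phi>) = hat \<phi>"
      using I.NF_cell(3)[of \<phi>] p n(1) by simp
    moreover have "htgt (fcell (N_arr \<eta> (id_avfun K)) \<phi>) = htgt \<phi>" using I.NF_cell(5)[of \<phi>] p fp by simp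
    ultimately show "fcell (N_arr \<eta> (id_avfun K)) \<phi> = fcell (id_avfun (N_obj (\<eta> K) K)) \<phi>"
      using N_eqI p by simp
  qed simp_all
qed

lemma comp_avfun_fpath:
  assumes "fst T \<in> obj (fdom F)" "set (snd T) \<subseteq> hmor (fdom F)"
  shows "fpath (comp_avfun G F) T = fpath G (fpath F T)"
  using assms by (auto simp: fpath_def)

text \<open>The cocycle identity of comparison cells. At an empty path, composing the right-hand
  side with the image of the chosen unit under both functors yields the chosen unit of the target,
  which characterises the left-hand side. This makes \<open>N\<close> strictly functorial although
  units are chosen without regard to functors.\<close>

lemma unit_comparison_comp:
  assumes "normal_functor F \<eta>" "normal_functor G \<eta>" "fcod F = fdom G"
    "hpath (fdom F) (fst T) (snd T) E" "length (snd T) \<le> 1"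
  shows "unit_comparison \<eta> (comp_avfun G F) T =
      cmp (fcod G) (unit_comparison \<eta> G (fpath F T)) [fcell G (unit_comparison \<eta> F T)]"
    "composable (fcod G) (unit_comparison \<eta> G (fpath F T)) [fcell G (unit_comparison \<eta> F T)]"
proof -
  interpret F: normal_functor F \<eta> by fact
  interpret G: normal_functor G \<eta> by fact
  interpret GF: normal_functor "comp_avfun G F" \<eta> by (rule normal_functor_comp[OF assms(1-3)])
  note c = F.comparison_ends[OF assms(4,5)]
  have p: "hpath (fdom G) (fst (fpath F T)) (snd (fpath F T)) (fobj F E)" "length (snd (fpath F T)) \<le> 1"
    using F.fhor_path[OF assms(4)] assms(3,5) by (simp_all add: fpath_def)
  note d = G.comparison_ends[OF p]
  have cG: "unit_comparison \<eta> F T \<in> cells (fdom G)" using c(1) assms(3) by simp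
  show comp: "composable (fcod G) (unit_comparison \<eta> G (fpath F T)) [fcell G (unit_comparison \<eta> F T)]"
    using G.fcell_ends[OF cG] c(3) d assms(3) by (simp add: G.cod.composable_single)
  obtain C Ks where T: "T = (C, Ks)" by fastforce
  have C: "C \<in> obj (fdom F)" using F.dom.path_ends[OF assms(4)] T by simp
  have FC: "fobj F C \<in> obj (fdom G)" using F.fobj_obj[OF C] assms(3) by simp
  show "unit_comparison \<eta> (comp_avfun G F) T =
      cmp (fcod G) (unit_comparison \<eta> G (fpath F T)) [fcell G (unit_comparison \<eta> F T)]"
  proof (cases Ks)
    case Nil
    note f = F.comparison_unit(1,2)[OF C] and g = G.comparison_unit(1,2)[OF FC]
    have Tn: "fpath F (C, []) = (fobj F C, [])" "T = (C, [])" using T Nil by (simp_all add: fpath_def)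
    let ?u = "fcell G (fcell F (\<eta> (fdom F) C))"
    have Fc: "composable (fdom G) (unit_comparison \<eta> F (C, [])) [fcell F (\<eta> (fdom F) C)]" using f(1) assms(3) by simp
    have Gc: "composable (fcod G) (fcell G (unit_comparison \<eta> F (C, []))) [?u]"
      using G.fcell_composable[OF Fc] by simp
    note a = G.cod.cmp_single_assoc[OF comp[unfolded Tn] Gc]
    have "cmp (fcod G) (fcell G (unit_comparison \<eta> F (C, []))) [?u] = fcell G (\<eta> (fdom G) (fobj F C))"
      using G.fcell_cmp[OF Fc] f(2) assms(3) by simp
    then have "cmp (fcod G) (cmp (fcod G) (unit_comparison \<eta> G (fobj F C, [])) [fcell G (unit_comparison \<eta> F (C, []))]) [?u]
        = \<eta> (fcod G) (fobj G (fobj F C))"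
      using a(1) g(2) by simp
    then have "cmp (fcod G) (unit_comparison \<eta> G (fobj F C, [])) [fcell G (unit_comparison \<eta> F (C, []))] =
        unit_comparison \<eta> (comp_avfun G F) (C, [])"
      using GF.comparison_unit(3)[of C "cmp (fcod G) (unit_comparison \<eta> G (fobj F C, [])) [fcell G (unit_comparison \<eta> F (C, []))]"]
        a(2) C F.A.eta_ends(4)[OF C] by simp
    then show ?thesis by (simp add: Tn)
  next
    case (Cons J Js)
    then have J: "Ks = [J]" "J \<in> hmor (fdom F)" using assms(4,5) T by auto
    then have FJ: "fhor F J \<in> hmor (fdom G)" "fhor G (fhor F J) \<in> hmor (fcod G)"
      using F.fhor_hom G.fhor_hom assms(3) by auto
    note h = G.cod.hidc_ends[OF FJ(2)]
    have "cmp (fcod G) (hidc (fcod G) (fhor G (fhor F J))) [hidc (fcod G) (fhor G (fhor F J))] = hidc (fcod G) (fhor G (fhor F J))"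
      using G.cod.hidc_comp[OF h(1)] h(3) by simp
    then show ?thesis
      using J T G.fcell_hidc[OF FJ(1)] assms(3)
      by (simp add: fpath_def GF.comparison_unary G.comparison_unary F.comparison_unary)
  qed
qed

lemma N_arr_comp:
  assumes "normal_functor F \<eta>" "normal_functor G \<eta>" "fcod F = fdom G"
  shows "N_arr \<eta> (comp_avfun G F) = comp_avfun (N_arr \<eta> G) (N_arr \<eta> F)"
proof -
  interpret F: normal_functor F \<eta> by fact
  interpret G: normal_functor G \<eta> by fact
  interpret GF: normal_functor "comp_avfun G F" \<eta> by (rule normal_functor_comp[OF assms])
  have NGF: "fcod (N_arr \<eta> F) = fdom (N_arr \<eta> G)" using assms(3) by simp
  show ?thesis
  proof (rule avfun_eqI)
    show "avfunctor (N_arr \<eta> (comp_avfun G F))" by (rule GF.N_arr_functor)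
    show "avfunctor (comp_avfun (N_arr \<eta> G) (N_arr \<eta> F))"
      by (rule comp_avfun_functor[OF F.N_arr_functor G.N_arr_functor NGF])
  next
    fix \<phi> assume "\<phi> \<in> cells (fdom (N_arr \<eta> (comp_avfun G F)))"
    then have p: "\<phi> \<in> cells F.A.N" and p': "\<phi> \<in> cells GF.A.N" by simp_all
    note f = F.NF_cell[OF p] and n = F.A.N_ends[OF p]
    have q: "fcell (N_arr \<eta> F) \<phi> \<in> cells G.A.N" using f(2) assms(3) by simp
    note g = G.NF_cell[OF q] and gf = GF.NF_cell[OF p', simplified]
    have path: "hpath (fdom F) (fst (htgt \<phi>)) (snd (htgt \<phi>)) (vcod (fdom F) (vtgt \<phi>))" using n by simp
    note c = unit_comparison_comp[OF assms path n(4)]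
    have fc: "composable (fdom G) (unit_comparison \<eta> F (htgt \<phi>)) [fcell F (F.A.hat \<phi>)]" using f(8) assms(3) by simp
    let ?c = "unit_comparison \<eta> G (fpath F (htgt \<phi>))"
    have "G.B.hat (fcell (N_arr \<eta> G) (fcell (N_arr \<eta> F) \<phi>)) =
        cmp (fcod G) ?c [fcell G (cmp (fdom G) (unit_comparison \<eta> F (htgt \<phi>)) [fcell F (F.A.hat \<phi>)])]"
      using g(3) f(3,5) assms(3) by simp
    also have "\<dots> = cmp (fcod G) ?c [cmp (fcod G) (fcell G (unit_comparison \<eta> F (htgt \<phi>))) [fcell G (fcell F (F.A.hat \<phi>))]]"
      using G.fcell_cmp[OF fc] by simp
    also have "\<dots> = cmp (fcod G) (unit_comparison \<eta> (comp_avfun G F) (htgt \<phi>)) [fcell G (fcell F (F.A.hat \<phi>))]"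
      using G.cod.cmp_single_assoc(1)[OF c(2), of "[fcell G (fcell F (F.A.hat \<phi>))]"] G.fcell_composable[OF fc] c(1)
      by simp
    also have "\<dots> = G.B.hat (fcell (N_arr \<eta> (comp_avfun G F)) \<phi>)"
      using gf(3) n(1) by simp
    finally have h: "G.B.hat (fcell (N_arr \<eta> G) (fcell (N_arr \<eta> F) \<phi>)) = G.B.hat (fcell (N_arr \<eta> (comp_avfun G F)) \<phi>)" .
    have "fpath (comp_avfun G F) (htgt \<phi>) = fpath G (fpath F (htgt \<phi>))"
      using F.dom.path_hmor[OF path] n(3) by (intro comp_avfun_fpath) auto
    then have "htgt (fcell (N_arr \<eta> G) (fcell (N_arr \<eta> F) \<phi>)) = htgt (fcell (N_arr \<eta> (comp_avfun G F)) \<phi>)"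
      using g(5) f(5) gf(5) by simp
    from G.B.N_eqI[OF h this]
    show "fcell (N_arr \<eta> (comp_avfun G F)) \<phi> = fcell (comp_avfun (N_arr \<eta> G) (N_arr \<eta> F)) \<phi>"
      using p by simp
  qed (simp_all)
qed

text \<open>At a nullary cell with target \<open>C\<close> the point is that the comparison cells of
  source and target functor are compatible with \<open>\<xi>\<close>. Let \<open>X\<close> factor
  the hat of the vertical identity at \<open>tobj \<xi> C\<close> through the chosen unit. Then
  \<open>X\<close> after one comparison equals the other comparison after the component of
  \<open>\<xi>\<close> at the unit of \<open>C\<close>; composed with the image of the unit of
  \<open>C\<close>, this becomes naturality of \<open>\<xi>\<close> at that unit.\<close>

lemma N_two_transformation:
  assumes "avtransformation \<xi>" "normal_functor (tsrc \<xi>) \<eta>" "normal_functor (ttgt \<xi>) \<eta>"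
  shows "avtransformation (N_two \<eta> \<xi>)"
proof -
  interpret x: avtransformation \<xi> by fact
  interpret F: normal_functor "tsrc \<xi>" \<eta> by fact
  interpret G: normal_functor "ttgt \<xi>" \<eta> by fact
  let ?D = "fdom (tsrc \<xi>)" and ?L = "fcod (tsrc \<xi>)"
  note te = x.tgt_ends
  note Gcell = G.NF_cell[unfolded te]
  show ?thesis
  proof (rule avtransformation.intro)
    fix \<phi> assume "\<phi> \<in> cells (fdom (tsrc (N_two \<eta> \<xi>)))"
    then have p: "\<phi> \<in> cells F.A.N" by simp
    note n = F.A.N_ends[OF p] and k = x.F.dom.cell_ends[OF F.A.N_ends(1)[OF p]]
    note f = F.NF_cell[OF p] and g = Gcell[OF p]
    have path: "hpath ?D (fst (htgt \<phi>)) (snd (htgt \<phi>)) (vcod ?D (vtgt \<phi>))" using n by simp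
    note cF = F.comparison_ends[OF path n(4)] and cG = G.comparison_ends[unfolded te, OF path n(4)]
    obtain A Js where S: "hsrc \<phi> = (A, Js)" by fastforce
    have sp: "hpath ?D A Js (vdom ?D (vtgt \<phi>))" using k(3,5) S by simp
    have A: "A \<in> obj ?D" using x.F.dom.path_ends[OF sp] by blast
    note tr = x.tpath_composable[OF n(1), unfolded F.A.hat_simps] and tn = x.tcell_nat[OF n(1), unfolded F.A.hat_simps]
    note tc = x.tgt_tcell[OF n(1)]
    let ?cF = "unit_comparison \<eta> (tsrc \<xi>) (htgt \<phi>)" and ?cG = "unit_comparison \<eta> (ttgt \<xi>) (htgt \<phi>)"
    let ?Fh = "fcell (tsrc \<xi>) (F.A.hat \<phi>)" and ?Gh = "fcell (ttgt \<xi>) (F.A.hat \<phi>)"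
    let ?NF = "fcell (N_arr \<eta> (tsrc \<xi>)) \<phi>" and ?NG = "fcell (N_arr \<eta> (ttgt \<xi>)) \<phi>"
    let ?x = "x.tcell (htgt (F.A.hat \<phi>))"
    have Fh: "?Fh \<in> cells ?L" "htgt ?Fh = hsrc ?x" "htgt ?Gh = htgt ?x" "?Gh \<in> cells ?L"
      using tc x.F.fcell_ends[OF n(1)] x.G.fcell_ends[unfolded te, OF n(1)] by simp_all
    note ga = x.F.cod.cmp_single_assoc[OF g(8) tr]
    \<comment> \<open>The components at the source path are unary cells, or one vertical identity of
      \<open>N\<close> if the path is empty. In both cases the composite in \<open>N\<close> is the
      composite of the hat in \<open>K\<close>, with the components taken in
      \<open>K\<close>.\<close>
    have "F.B.hat (cmp F.B.N ?NG (tpath (N_two \<eta> \<xi>) (hsrc \<phi>))) = cmp ?L (F.B.hat ?NG) (tpath \<xi> (hsrc \<phi>)) \<and>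
        htgt (cmp F.B.N ?NG (tpath (N_two \<eta> \<xi>) (hsrc \<phi>))) = htgt ?NG"
    proof (cases "Js = []")
      case True
      note o = x.tobj_ends[OF A]
      have "hsrc ?NG = (vcod ?L (tobj \<xi> A), [])" using g(4) S True o by (simp add: fpath_def)
      from F.B.N_cmp_vidc[OF g(2) o(1) this] show ?thesis using S True by (simp add: tpath_def)
    next
      case False
      have "set Js \<subseteq> hmor ?D" using x.F.dom.path_hmor[OF sp] .
      then have "\<forall>\<phi>\<in>set (map (thor \<xi>) Js). unary \<phi>" by (auto simp: unary_def x.thor_ends)
      moreover have "composable ?L (F.B.hat ?NG) (map (thor \<xi>) Js)"
        using ga(2) g(3) S False by (simp add: tpath_def)
      ultimately show ?thesis using F.B.N_cmp_unaries[OF g(2), of "map (thor \<xi>) Js"] S False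
        by (simp add: tpath_def)
    qed
    then have lhs: "F.B.hat (cmp F.B.N ?NG (tpath (N_two \<eta> \<xi>) (hsrc \<phi>))) = cmp ?L ?cG [cmp ?L ?x [?Fh]]"
      "htgt (cmp F.B.N ?NG (tpath (N_two \<eta> \<xi>) (hsrc \<phi>))) = fpath (ttgt \<xi>) (htgt \<phi>)"
      using ga(1) tn g(3,5) by simp_all
    let ?y = "hd (tpath (N_two \<eta> \<xi>) (htgt \<phi>))"
    obtain C Ks where T: "htgt \<phi> = (C, Ks)" by fastforce
    have C: "C \<in> obj ?D" using n(3) T by simp
    have FC: "fobj (tsrc \<xi>) C \<in> obj ?L" "fobj (ttgt \<xi>) C \<in> obj ?L"
      using x.F.fobj_obj[OF C] x.G.fobj_obj[unfolded te, OF C] by blast+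
    \<comment> \<open>\<open>X\<close> is the factor of the component at the target of
      \<open>\<phi>\<close>. At a unary target it is the component of \<open>\<xi>\<close> itself
      and both comparisons are identities.\<close>
    have "\<exists>X. composable ?L X [F.B.uf ?NF] \<and> F.B.hat ?y = cmp ?L X [F.B.uf ?NF] \<and> ?y \<in> cells F.B.N \<and>
        composable ?L X [?cF] \<and> cmp ?L X [?cF] = cmp ?L ?cG [?x] \<and> hsrc ?y = htgt ?NF \<and> htgt ?y = fpath (ttgt \<xi>) (htgt \<phi>)"
    proof (cases Ks)
      case (Cons J Js')
      then have J: "Ks = [J]" "J \<in> hmor ?D" "hdom ?D J = C" using path n(4) T by auto
      note t = x.thor_ends[OF J(2)]
      have u: "unary (thor \<xi> J)" using t by (simp add: unary_def)
      have FJ: "fhor (tsrc \<xi>) J \<in> hmor ?L" "hdom ?L (fhor (tsrc \<xi>) J) = fobj (tsrc \<xi>) C"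
        using x.F.fhor_hom[OF J(2)] J(3) by auto
      have y: "?y = thor \<xi> J" using T J by (simp add: tpath_def)
      have uf: "F.B.uf ?NF = hidc ?L (fhor (tsrc \<xi>) J)"
        using f(5) T J by (simp add: unit_factor_def nullary_def fpath_def)
      have c: "?cF = hidc ?L (fhor (tsrc \<xi>) J)" "?cG = hidc ?L (fhor (ttgt \<xi>) J)"
        using F.comparison_unary[of C J] G.comparison_unary[of C J] te T J by simp_all
      have xx: "?x = thor \<xi> J" using n(5) T J by (simp add: x.tcell_def F.A.unit_tgt_def tpath_def)
      have 1: "cmp ?L (thor \<xi> J) [hidc ?L (fhor (tsrc \<xi>) J)] = thor \<xi> J"
        using x.F.cod.cmp_hidc_id[OF t(1,2)] by simp
      have 2: "cmp ?L (hidc ?L (fhor (ttgt \<xi>) J)) [thor \<xi> J] = thor \<xi> J"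
        using x.F.cod.hidc_comp[OF t(1)] t(3) by simp
      have 3: "composable ?L (thor \<xi> J) [hidc ?L (fhor (tsrc \<xi>) J)]"
        using t J(3) x.F.cod.hidc_ends[OF FJ(1)] FJ(2) by (simp add: x.F.cod.composable_single)
      show ?thesis
        unfolding y uf c xx
        by (rule exI[of _ "thor \<xi> J"])
          (use 1 2 3 t u J T f(5) F.B.unary_N[OF t(1) u] F.B.hat_unary[OF u] in \<open>simp add: fpath_def\<close>)
    next
      case Nil
      note o = x.tobj_ends[OF C]
      note v = F.B.N_vidc(1-8)[OF o(1)]
      have y: "?y = vidc F.B.N (tobj \<xi> C)" using T Nil by (simp add: tpath_def)
      have uf: "F.B.uf ?NF = F.eta' (fobj (tsrc \<xi>) C)"
        using f(5) T Nil by (simp add: unit_factor_def nullary_def fpath_def)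
      have yN: "hsrc ?y = htgt ?NF" "htgt ?y = fpath (ttgt \<xi>) (htgt \<phi>)" "?y \<in> cells F.B.N"
        unfolding y using v o f(5) T Nil by (simp_all add: fpath_def)
      then have "composable F.B.N ?y [?NF]" using f(2) by (simp add: F.B.N.composable_single)
      from F.B.N_ext[OF this] obtain X where X: "composable ?L X [F.B.uf ?NF]" "F.B.hat ?y = cmp ?L X [F.B.uf ?NF]"
        by auto
      let ?I = "F.A.unit_mor C" and ?e = "F.eta C"
      note ec = F.A.eta_ends[OF C]
      note cu = F.comparison_unit(1,2,4-8)[OF C] and cv = G.comparison_unit(1,2,4-8)[unfolded te, OF C]
      have cc: "?cF = unit_comparison \<eta> (tsrc \<xi>) (C, [])" "?cG = unit_comparison \<eta> (ttgt \<xi>) (C, [])"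
        using T Nil by simp_all
      have xx: "?x = thor \<xi> ?I" using n(5) T Nil ec(6) by (simp add: x.tcell_def F.A.unit_tgt_def tpath_def)
      note tI = x.thor_ends[OF ec(1)]
      have XN: "X \<in> cells ?L" "hsrc X = htgt (F.eta' (fobj (tsrc \<xi>) C))" 
        using X(1) uf by (simp_all add: x.F.cod.composable_single)
      have Xc: "composable ?L X [?cF]"
        using XN cu F.B.eta_ends(6)[OF FC(1)] cc by (simp add: x.F.cod.composable_single)
      have cx: "composable ?L ?cG [?x]"
        using cv tI ec cc xx by (simp add: x.F.cod.composable_single)
      have cFe: "composable ?L ?cF [fcell (tsrc \<xi>) ?e]" using cu cc by simp
      note a1 = x.F.cod.cmp_single_assoc[OF Xc cFe]
      have b0: "composable ?L ?x [fcell (tsrc \<xi>) ?e]"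
        using tI x.F.fcell_ends[OF ec(4)] ec xx by (simp add: x.F.cod.composable_single fpath_def)
      note b1 = x.F.cod.cmp_single_assoc[OF cx b0]
      have "cmp ?L (cmp ?L X [?cF]) [fcell (tsrc \<xi>) ?e] = cmp ?L X [F.eta' (fobj (tsrc \<xi>) C)]"
        using a1(1) cu(2) cc by simp
      also have "\<dots> = cmp ?L (F.eta' (fobj (ttgt \<xi>) C)) [vidc ?L (tobj \<xi> C)]"
        using X(2) uf y v(6) o(3) by simp
      also have "\<dots> = cmp ?L (cmp ?L ?cG [fcell (ttgt \<xi>) ?e]) [vidc ?L (tobj \<xi> C)]"
        using cv(2) cc by simp
      also have "\<dots> = cmp ?L ?cG [cmp ?L (fcell (ttgt \<xi>) ?e) [vidc ?L (tobj \<xi> C)]]"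
        using x.F.cod.cmp_single_assoc(1)[of ?cG "fcell (ttgt \<xi>) ?e" "[vidc ?L (tobj \<xi> C)]"]
          cv(1) cc x.tpath_composable[OF ec(4)] ec(5) by (simp add: tpath_def)
      also have "cmp ?L (fcell (ttgt \<xi>) ?e) [vidc ?L (tobj \<xi> C)] = cmp ?L ?x [fcell (tsrc \<xi>) ?e]"
        using x.tcell_nat[OF ec(4)] ec(5,6) xx by (simp add: tpath_def x.tcell_def)
      also have "cmp ?L ?cG [\<dots>] = cmp ?L (cmp ?L ?cG [?x]) [fcell (tsrc \<xi>) ?e]"
        using b1(1) by simp
      finally have "cmp ?L (cmp ?L X [?cF]) [fcell (tsrc \<xi>) ?e] = cmp ?L (cmp ?L ?cG [?x]) [fcell (tsrc \<xi>) ?e]" .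
      moreover have "unary (cmp ?L X [?cF])"
      proof -
        have "htgt (cmp ?L X [?cF]) = htgt X"
          using Xc x.F.cod.cmp_single(3)[of X ?cF] by (simp add: x.F.cod.composable_single)
        also have "htgt X = htgt (F.B.hat ?y)"
          using X x.F.cod.cmp_single(3)[of X "F.B.uf ?NF"] by (simp add: x.F.cod.composable_single)
        finally show ?thesis using F.B.N_ends(2)[OF yN(3)] by (simp add: unary_def)
      qed
      ultimately have "cmp ?L X [?cF] = cmp ?L ?cG [?x]"
        using F.factor_F_eta[OF C a1(2) b1(2)] by blast
      then show ?thesis using X Xc yN by blast
    qed
    then obtain X where X: "composable ?L X [F.B.uf ?NF]" "F.B.hat ?y = cmp ?L X [F.B.uf ?NF]" "?y \<in> cells F.B.N"
      "composable ?L X [?cF]" "cmp ?L X [?cF] = cmp ?L ?cG [?x]" "hsrc ?y = htgt ?NF" "htgt ?y = fpath (ttgt \<xi>) (htgt \<phi>)"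
      by blast
    have run: "cell_run F.B.N (vsrc ?NF) [?NF] (vtgt ?NF)" using f(2) F.B.N.cell_ends by auto
    have X12: "composable ?L X (map F.B.uf [?NF])" "F.B.hat ?y = cmp ?L X (map F.B.uf [?NF])"
      unfolding list.map using X(1,2) by blast+
    note R = F.B.N_cmp[OF run X(3) X12]
    have 1: "F.B.hat (cmp F.B.N ?y [?NF]) = cmp ?L X [cmp ?L ?cF [?Fh]]"
      unfolding R(2) list.map f(3) ..
    have 2: "cmp ?L X [cmp ?L ?cF [?Fh]] = cmp ?L (cmp ?L ?cG [?x]) [?Fh]"
      using x.F.cod.cmp_single_assoc(1)[OF X(4) f(8)] unfolding X(5) .
    have 3: "hsrc ?cG = htgt ?x"
      using g(8) unfolding x.F.cod.composable_single Fh(3) by blast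
    have 4: "cmp ?L (cmp ?L ?cG [?x]) [?Fh] = cmp ?L ?cG [cmp ?L ?x [?Fh]]"
      by (rule x.F.cod.single_assoc[symmetric, OF cG(1) tc(2) Fh(1) 3 Fh(2)[symmetric]])
    have 5: "F.B.hat (cmp F.B.N ?y [?NF]) = F.B.hat (cmp F.B.N ?NG (tpath (N_two \<eta> \<xi>) (hsrc \<phi>)))"
      by (rule trans[OF 1 trans[OF 2 trans[OF 4 lhs(1)[symmetric]]]])
    have 6: "htgt (cmp F.B.N ?y [?NF]) = htgt (cmp F.B.N ?NG (tpath (N_two \<eta> \<xi>) (hsrc \<phi>)))"
      by (rule trans[OF R(5) trans[OF X(7) lhs(2)[symmetric]]])
    have "cmp F.B.N ?NG (tpath (N_two \<eta> \<xi>) (hsrc \<phi>)) = cmp F.B.N ?y [?NF]"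
      by (rule F.B.N_eqI[OF 5 6, symmetric])
    then show "cmp (fcod (tsrc (N_two \<eta> \<xi>))) (fcell (ttgt (N_two \<eta> \<xi>)) \<phi>) (tpath (N_two \<eta> \<xi>) (hsrc \<phi>)) =
        cmp (fcod (tsrc (N_two \<eta> \<xi>))) (hd (tpath (N_two \<eta> \<xi>) (htgt \<phi>))) [fcell (tsrc (N_two \<eta> \<xi>)) \<phi>]"
      by simp
  next
    fix J assume "J \<in> hmor (fdom (tsrc (N_two \<eta> \<xi>)))"
    then have J: "J \<in> hmor ?D" by simp
    have "thor \<xi> J \<in> cells F.B.N" using x.thor_ends[OF J] by (intro F.B.unary_N) (simp_all add: unary_def)
    then show "thor (N_two \<eta> \<xi>) J \<in> cells (fcod (tsrc (N_two \<eta> \<xi>))) \<and>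
      hsrc (thor (N_two \<eta> \<xi>) J) = fpath (tsrc (N_two \<eta> \<xi>)) (hdom (fdom (tsrc (N_two \<eta> \<xi>))) J, [J]) \<and>
      htgt (thor (N_two \<eta> \<xi>) J) = fpath (ttgt (N_two \<eta> \<xi>)) (hdom (fdom (tsrc (N_two \<eta> \<xi>))) J, [J]) \<and>
      vsrc (thor (N_two \<eta> \<xi>) J) = tobj (N_two \<eta> \<xi>) (hdom (fdom (tsrc (N_two \<eta> \<xi>))) J) \<and>
      vtgt (thor (N_two \<eta> \<xi>) J) = tobj (N_two \<eta> \<xi>) (hcod (fdom (tsrc (N_two \<eta> \<xi>))) J)"
      using x.thor_cell[OF J] by simp
  qed (use F.N_arr_functor G.N_arr_functor x.tobj_hom x.tobj_natural x.tobj_ext x.thor_ext te in simp_all)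
qed

lemma N_two_id:
  assumes "normal_functor F \<eta>"
  shows "N_two \<eta> (id_avtrans F) = id_avtrans (N_arr \<eta> F)"
proof -
  interpret normal_functor F \<eta> by fact
  have "avtransformation (N_two \<eta> (id_avtrans F))"
    by (rule N_two_transformation) (simp_all add: id_avtrans_transformation assms)
  then show ?thesis
    by (rule avtrans_eqI) (simp_all add: avfunctor.id_avtrans_transformation[OF N_arr_functor])
qed

text \<open>The components at horizontal morphisms are unary, and for unary cells composition in
  \<open>N(K)\<close> is composition in \<open>K\<close>.\<close>

lemma N_two_vcomp:
  assumes "avtransformation \<xi>" "avtransformation \<zeta>" "ttgt \<xi> = tsrc \<zeta>" "normal_functor (tsrc \<xi>) \<eta>"
    "normal_functor (tsrc \<zeta>) \<eta>" "normal_functor (ttgt \<zeta>) \<eta>"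
  shows "N_two \<eta> (vcomp_avtrans \<zeta> \<xi>) = vcomp_avtrans (N_two \<eta> \<zeta>) (N_two \<eta> \<xi>)"
proof -
  interpret x: avtransformation \<xi> by fact
  interpret z: avtransformation \<zeta> by fact
  interpret F: normal_functor "tsrc \<xi>" \<eta> by fact
  have p: "fdom (tsrc \<zeta>) = x.D" "fcod (tsrc \<zeta>) = x.L" using assms(3)[symmetric] by simp_all
  show ?thesis
  proof (rule avtrans_eqI)
    show "avtransformation (N_two \<eta> (vcomp_avtrans \<zeta> \<xi>))"
      by (rule N_two_transformation[OF vcomp_avtrans_transformation[OF assms(1-3)]]) (simp_all add: assms)
    show "avtransformation (vcomp_avtrans (N_two \<eta> \<zeta>) (N_two \<eta> \<xi>))"
      using assms(3) by (intro vcomp_avtrans_transformation N_two_transformation) (simp_all add: assms)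
  next
    fix J assume "J \<in> hmor (fdom (tsrc (N_two \<eta> (vcomp_avtrans \<zeta> \<xi>))))"
    then have J: "J \<in> hmor x.D" by simp
    note t = x.thor_ends[OF J] and u = z.thor_ends[unfolded p, OF J]
    have un: "unary (thor \<zeta> J)" "unary (thor \<xi> J)" using t u by (simp_all add: unary_def)
    have "composable x.L (F.B.hat (thor \<zeta> J)) [thor \<xi> J]"
      using t u assms(3) F.B.hat_unary[OF un(1)] by (simp add: x.F.cod.composable_single)
    from F.B.N_cmp_unaries(1)[OF F.B.unary_N[OF u(1) un(1)] this]
    have "cmp F.B.N (thor \<zeta> J) [thor \<xi> J] = cmp x.L (thor \<zeta> J) [thor \<xi> J]"
      using un F.B.hat_unary[OF un(1)] x.F.cod.cmp_single(3)[of "thor \<zeta> J" "thor \<xi> J"] t u assms(3) by simp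
    then show "thor (N_two \<eta> (vcomp_avtrans \<zeta> \<xi>)) J = thor (vcomp_avtrans (N_two \<eta> \<zeta>) (N_two \<eta> \<xi>)) J"
      using J by simp
  qed simp_all
qed

lemma N_two_hcomp:
  assumes "avtransformation \<xi>" "avtransformation \<zeta>" "fcod (tsrc \<xi>) = fdom (tsrc \<zeta>)" "normal_functor (tsrc \<xi>) \<eta>"
    "normal_functor (ttgt \<xi>) \<eta>" "normal_functor (tsrc \<zeta>) \<eta>" "normal_functor (ttgt \<zeta>) \<eta>"
  shows "N_two \<eta> (hcomp_avtrans \<zeta> \<xi>) = hcomp_avtrans (N_two \<eta> \<zeta>) (N_two \<eta> \<xi>)"
proof -
  interpret x: avtransformation \<xi> by fact
  interpret z: avtransformation \<zeta> by fact
  interpret H: normal_functor "tsrc \<zeta>" \<eta> by fact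
  have q: "fcod (ttgt \<xi>) = fdom (ttgt \<zeta>)" using assms(3) by simp
  note Nc = N_arr_comp[OF assms(4,6,3)] N_arr_comp[OF assms(5,7) q]
  note nc = normal_functor_comp[OF assms(4,6,3)] normal_functor_comp[OF assms(5,7) q]
  have p: "fdom (tsrc \<zeta>) = x.L" using assms(3) by simp
  show ?thesis
  proof (rule avtrans_eqI)
    show "avtransformation (N_two \<eta> (hcomp_avtrans \<zeta> \<xi>))"
      by (rule N_two_transformation[OF hcomp_avtrans_transformation[OF assms(1-3)]]) (simp_all add: nc)
    show "avtransformation (hcomp_avtrans (N_two \<eta> \<zeta>) (N_two \<eta> \<xi>))"
      by (intro hcomp_avtrans_transformation N_two_transformation) (simp_all add: assms)
    show "tsrc (N_two \<eta> (hcomp_avtrans \<zeta> \<xi>)) = tsrc (hcomp_avtrans (N_two \<eta> \<zeta>) (N_two \<eta> \<xi>))"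
      "ttgt (N_two \<eta> (hcomp_avtrans \<zeta> \<xi>)) = ttgt (hcomp_avtrans (N_two \<eta> \<zeta>) (N_two \<eta> \<xi>))"
      using Nc by simp_all
  next
    fix J assume "J \<in> hmor (fdom (tsrc (N_two \<eta> (hcomp_avtrans \<zeta> \<xi>))))"
    then have J: "J \<in> hmor x.D" by simp
    note t = x.thor_ends[OF J]
    have GJ: "fhor (ttgt \<xi>) J \<in> hmor (fdom (tsrc \<zeta>))"
      "hdom (fdom (tsrc \<zeta>)) (fhor (ttgt \<xi>) J) = fobj (ttgt \<xi>) (hdom x.D J)"
      using x.G.fhor_hom[of J] J p by simp_all
    note u = z.thor_ends[OF GJ(1)]
    have un: "unary (thor \<zeta> (fhor (ttgt \<xi>) J))" "unary (thor \<xi> J)" using t u by (simp_all add: unary_def)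
    have tz: "thor \<xi> J \<in> cells (fdom (tsrc \<zeta>))" using t(1) p by simp
    note f = z.F.fcell_ends[OF tz]
    have fu: "unary (fcell (tsrc \<zeta>) (thor \<xi> J))" using f t by (simp add: unary_def fpath_def)
    have hs: "hsrc (thor \<zeta> (fhor (ttgt \<xi>) J)) = htgt (fcell (tsrc \<zeta>) (thor \<xi> J))"
      using u f t GJ(2) by (simp add: fpath_def)
    have "composable z.L (H.B.hat (thor \<zeta> (fhor (ttgt \<xi>) J))) [fcell (tsrc \<zeta>) (thor \<xi> J)]"
      using u(1) f(1) hs H.B.hat_unary[OF un(1)] by (simp add: z.F.cod.composable_single)
    from H.B.N_cmp_unaries(1)[OF H.B.unary_N[OF u(1) un(1)] this]
    have "cmp H.B.N (thor \<zeta> (fhor (ttgt \<xi>) J)) [fcell (tsrc \<zeta>) (thor \<xi> J)] =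
        cmp z.L (thor \<zeta> (fhor (ttgt \<xi>) J)) [fcell (tsrc \<zeta>) (thor \<xi> J)]"
      using fu H.B.hat_unary[OF un(1)] z.F.cod.cmp_single(3)[OF u(1) f(1) hs] by simp
    then show "thor (N_two \<eta> (hcomp_avtrans \<zeta> \<xi>)) J = thor (hcomp_avtrans (N_two \<eta> \<zeta>) (N_two \<eta> \<xi>)) J"
      using J H.NF_unary[OF tz un(2)] by simp
  qed simp_all
qed

definition N_fun :: "(('o, 'v, 'h, 'c) avdc \<Rightarrow> 'o \<Rightarrow> ('o, 'v, 'h, 'c) cell) \<Rightarrow> ('o, 'v, 'h, 'c) avdc_two_fun" where
  "N_fun \<eta> = \<lparr>on0 = (\<lambda>K. N_obj (\<eta> K) K), on1 = N_arr \<eta>, on2 = N_two \<eta>\<rparr>"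

context unit_choices
begin

lemma N_two_functor: "two_functor VirtDblCat_u AugVirtDblCat_u (N_fun \<eta>)"
proof (intro two_functor.intro two_category_aug two_category_virt two_functor_axioms.intro;
    unfold AugVirtDblCat_u_def VirtDblCat_u_def N_fun_def)
qed (auto simp: unital unital_vdc.N_avdc unital_vdc.N_has_units normal_functor.N_arr_functor normal_functorI
    N_arr_id N_arr_comp N_two_transformation N_two_id N_two_vcomp N_two_hcomp)

end

section \<open>Isomorphisms that are the identity on objects and morphisms\<close>

text \<open>Pointwise inverses of a 2-natural transformation are 2-natural: either naturality
  equation for \<open>\<tau>\<close> is that for \<open>\<sigma>\<close>, composed with
  \<open>\<tau>\<close> on both sides, where the composites of \<open>\<sigma>\<close> and
  \<open>\<tau>\<close> cancel.\<close>

lemma inverse_two_nat_trans: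
  assumes "two_nat_trans C D F G \<sigma>"
    and "\<And>A. A \<in> Ob C \<Longrightarrow> \<tau> A \<in> Arr D \<and> src1 D (\<tau> A) = on0 G A \<and> trg1 D (\<tau> A) = on0 F A"
    and inv: "\<And>A. A \<in> Ob C \<Longrightarrow> comp1 D (\<tau> A) (\<sigma> A) = id1 D (on0 F A) \<and> comp1 D (\<sigma> A) (\<tau> A) = id1 D (on0 G A)"
  shows "invertible_two_nat_trans C D F G \<sigma>"
proof -
  interpret two_nat_trans C D F G \<sigma> by fact
  note C = F.C.arr_ends F.C.two_ends
  note t = assms(2) and s = component
  have "two_nat_trans C D G F \<tau>"
  proof (unfold_locales, goal_cases)
    case (1 A)
    then show ?case by (rule t)
  next
    case (2 f)
    let ?A = "src1 C f" and ?B = "trg1 C f"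
    have AB: "?A \<in> Ob C" "?B \<in> Ob C" using C 2 by blast+
    note f = F.on1_arr[OF 2] and g = G.on1_arr[OF 2] and sA = s[OF AB(1)] and sB = s[OF AB(2)]
      and tA = t[OF AB(1)] and tB = t[OF AB(2)]
    have "comp1 D (on1 F f) (\<tau> ?A) = comp1 D (comp1 D (\<tau> ?B) (\<sigma> ?B)) (comp1 D (on1 F f) (\<tau> ?A))"
      using inv[OF AB(2)] F.D.comp1_id[of "comp1 D (on1 F f) (\<tau> ?A)"] F.D.comp1_arr[of "\<tau> ?A" "on1 F f"] f tA by simp
    also have "\<dots> = comp1 D (\<tau> ?B) (comp1 D (\<sigma> ?B) (comp1 D (on1 F f) (\<tau> ?A)))"
      using F.D.comp1_assoc[of "comp1 D (on1 F f) (\<tau> ?A)" "\<sigma> ?B" "\<tau> ?B"] F.D.comp1_arr[of "\<tau> ?A" "on1 F f"] f tA sB tB by simp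
    also have "comp1 D (\<sigma> ?B) (comp1 D (on1 F f) (\<tau> ?A)) = comp1 D (comp1 D (\<sigma> ?B) (on1 F f)) (\<tau> ?A)"
      using F.D.comp1_assoc[of "\<tau> ?A" "on1 F f" "\<sigma> ?B"] f tA sB by simp
    also have "comp1 D (\<sigma> ?B) (on1 F f) = comp1 D (on1 G f) (\<sigma> ?A)" using natural1[OF 2] by simp
    also have "comp1 D \<dots> (\<tau> ?A) = comp1 D (on1 G f) (comp1 D (\<sigma> ?A) (\<tau> ?A))"
      using F.D.comp1_assoc[of "\<tau> ?A" "\<sigma> ?A" "on1 G f"] g tA sA by simp
    also have "\<dots> = on1 G f" using inv[OF AB(1)] F.D.comp1_id[of "on1 G f"] g by simp
    finally show ?case .
  next
    case (3 a)
    let ?A = "src1 C (src2 C a)" and ?B = "trg1 C (src2 C a)"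
    note a = F.C.two_ends[OF 3]
    have AB: "?A \<in> Ob C" "?B \<in> Ob C" using C a by blast+
    note f = F.on1_arr[of "src2 C a"] F.on2_two[OF 3] and g = G.on1_arr[of "src2 C a"] G.on2_two[OF 3]
      and sA = s[OF AB(1)] and sB = s[OF AB(2)] and tA = t[OF AB(1)] and tB = t[OF AB(2)]
    let ?h = "hcomp2 D" and ?i = "\<lambda>x. id2 D x"
    have ii: "?i (\<sigma> ?A) \<in> Two D" "?i (\<sigma> ?B) \<in> Two D" "?i (\<tau> ?A) \<in> Two D" "?i (\<tau> ?B) \<in> Two D"
      "src2 D (?i (\<sigma> ?A)) = \<sigma> ?A" "src2 D (?i (\<sigma> ?B)) = \<sigma> ?B" "src2 D (?i (\<tau> ?A)) = \<tau> ?A" "src2 D (?i (\<tau> ?B)) = \<tau> ?B"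
      using F.D.id2_two sA sB tA tB by auto
    have ends: "on2 F a \<in> Two D" "src1 D (src2 D (on2 F a)) = on0 F ?A" "trg1 D (src2 D (on2 F a)) = on0 F ?B"
      "on2 G a \<in> Two D" "src1 D (src2 D (on2 G a)) = on0 G ?A" "trg1 D (src2 D (on2 G a)) = on0 G ?B"
      using f g a by auto
    have ft: "?h (on2 F a) (?i (\<tau> ?A)) \<in> Two D" "src1 D (src2 D (?h (on2 F a) (?i (\<tau> ?A)))) = on0 G ?A"
      "trg1 D (src2 D (?h (on2 F a) (?i (\<tau> ?A)))) = on0 F ?B"
      using F.D.hcomp2_two[of "?i (\<tau> ?A)" "on2 F a"] F.D.comp1_arr[of "\<tau> ?A" "src2 D (on2 F a)"] ii ends tA F.D.two_ends[OF ends(1)]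
      by auto
    have "?h (on2 F a) (?i (\<tau> ?A)) = ?h (?h (?i (\<tau> ?B)) (?i (\<sigma> ?B))) (?h (on2 F a) (?i (\<tau> ?A)))"
      using F.D.hcomp2_id[OF ft(1)] ft inv[OF AB(2)] F.D.hcomp2_id2[of "\<sigma> ?B" "\<tau> ?B"] sB tB by simp
    also have "\<dots> = ?h (?i (\<tau> ?B)) (?h (?i (\<sigma> ?B)) (?h (on2 F a) (?i (\<tau> ?A))))"
      using F.D.hcomp2_assoc[of "?h (on2 F a) (?i (\<tau> ?A))" "?i (\<sigma> ?B)" "?i (\<tau> ?B)"] ft ii sB tB by simp
    also have "?h (?i (\<sigma> ?B)) (?h (on2 F a) (?i (\<tau> ?A))) = ?h (?h (?i (\<sigma> ?B)) (on2 F a)) (?i (\<tau> ?A))"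
      using F.D.hcomp2_assoc[of "?i (\<tau> ?A)" "on2 F a" "?i (\<sigma> ?B)"] ends ii sB tA by simp
    also have "?h (?i (\<sigma> ?B)) (on2 F a) = ?h (on2 G a) (?i (\<sigma> ?A))" using natural2[OF 3] by simp
    also have "?h \<dots> (?i (\<tau> ?A)) = ?h (on2 G a) (?h (?i (\<sigma> ?A)) (?i (\<tau> ?A)))"
      using F.D.hcomp2_assoc[of "?i (\<tau> ?A)" "?i (\<sigma> ?A)" "on2 G a"] ends ii sA tA by simp
    also have "\<dots> = on2 G a"
      using F.D.hcomp2_id2[of "\<tau> ?A" "\<sigma> ?A"] sA tA inv[OF AB(1)] F.D.hcomp2_id[OF ends(4)] ends by simp
    finally show ?case .
  qed
  then show ?thesis
    unfolding invertible_two_nat_trans_def using assms(1) inv by blast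
qed

section \<open>Isomorphisms given by a bijection on cells\<close>

definition iso_avfun ::
  "('o, 'v, 'h, 'c) avdc \<Rightarrow> ('o, 'v, 'h, 'c) avdc \<Rightarrow> (('o, 'v, 'h, 'c) cell \<Rightarrow> ('o, 'v, 'h, 'c) cell)
    \<Rightarrow> ('o, 'v, 'h, 'c) avfun" where
  "iso_avfun K L p = \<lparr>fdom = K, fcod = L, fobj = (\<lambda>A\<in>obj K. A), fver = (\<lambda>f\<in>vmor K. f),
    fhor = (\<lambda>J\<in>hmor K. J), fcell = (\<lambda>\<phi>\<in>cells K. p \<phi>)\<rparr>"

lemma iso_avfun_simps [simp]:
  "fdom (iso_avfun K L p) = K" "fcod (iso_avfun K L p) = L"
  "A \<in> obj K \<Longrightarrow> fobj (iso_avfun K L p) A = A" "f \<in> vmor K \<Longrightarrow> fver (iso_avfun K L p) f = f"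
  "J \<in> hmor K \<Longrightarrow> fhor (iso_avfun K L p) J = J" "\<phi> \<in> cells K \<Longrightarrow> fcell (iso_avfun K L p) \<phi> = p \<phi>"
  by (auto simp: iso_avfun_def)

definition same_base :: "('o, 'v, 'h, 'c) avdc \<Rightarrow> ('o, 'v, 'h, 'c) avdc \<Rightarrow> bool" where
  "same_base K L \<longleftrightarrow> obj L = obj K \<and> vmor L = vmor K \<and> vdom L = vdom K \<and> vcod L = vcod K \<and> vid L = vid K \<and>
    vcmp L = vcmp K \<and> hmor L = hmor K \<and> hdom L = hdom K \<and> hcod L = hcod K"

text \<open>Compatibility with boundaries, composition and identities is imposed on \<open>p\<close>
  alone; for the inverse \<open>q\<close> it is derived by evaluating these conditions at images
  under \<open>q\<close>.\<close>

locale cell_iso = K: avdc K + L: avdc L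
  for K L :: "('o, 'v, 'h, 'c) avdc" +
  fixes p q :: "('o, 'v, 'h, 'c) cell \<Rightarrow> ('o, 'v, 'h, 'c) cell"
  assumes base: "same_base K L"
    and p_cell: "\<phi> \<in> cells K \<Longrightarrow> p \<phi> \<in> cells L \<and> hsrc (p \<phi>) = hsrc \<phi> \<and> htgt (p \<phi>) = htgt \<phi> \<and>
      vsrc (p \<phi>) = vsrc \<phi> \<and> vtgt (p \<phi>) = vtgt \<phi>"
    and q_cell: "\<phi> \<in> cells L \<Longrightarrow> q \<phi> \<in> cells K \<and> p (q \<phi>) = \<phi>"
    and q_p: "\<phi> \<in> cells K \<Longrightarrow> q (p \<phi>) = \<phi>"
    and p_cmp: "composable K \<psi> \<phi>s \<Longrightarrow> p (cmp K \<psi> \<phi>s) = cmp L (p \<psi>) (map p \<phi>s)"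
    and p_hidc: "J \<in> hmor K \<Longrightarrow> p (hidc K J) = hidc L J"
    and p_vidc: "f \<in> vmor K \<Longrightarrow> p (vidc K f) = vidc L f"

text \<open>Stated apart from \<open>cell_iso\<close>, since it is also applied while the
  assumptions of that locale are being verified.\<close>

lemma composable_map:
  assumes "composable K \<psi> \<phi>s"
    "\<And>\<phi>. \<phi> \<in> cells K \<Longrightarrow> p \<phi> \<in> cells L \<and> hsrc (p \<phi>) = hsrc \<phi> \<and> htgt (p \<phi>) = htgt \<phi> \<and>
      vsrc (p \<phi>) = vsrc \<phi> \<and> vtgt (p \<phi>) = vtgt \<phi>"
  shows "composable L (p \<psi>) (map p \<phi>s)"
proof -
  note c = assms(1)[unfolded composable_def]
  have m: "map (snd \<circ> htgt) (map p \<phi>s) = map (snd \<circ> htgt) \<phi>s" "htgt (hd (map p \<phi>s)) = htgt (hd \<phi>s)"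
    using c assms(2) by (auto simp: subset_iff hd_map)
  then have "concat_htgt (map p \<phi>s) = concat_htgt \<phi>s" unfolding concat_htgt_def by argo
  moreover have "cell_path (map p \<phi>s)"
    using c assms(2) by (auto simp: cell_path_def subset_iff)
  moreover have "set (map p \<phi>s) \<subseteq> cells L" using c assms(2) by auto
  ultimately show ?thesis using c assms(2)[of \<psi>] by (simp add: composable_def)
qed

context cell_iso
begin

lemma same [simp]:
  "obj L = obj K" "vmor L = vmor K" "vdom L = vdom K" "vcod L = vcod K" "vid L = vid K"
  "vcmp L = vcmp K" "hmor L = hmor K" "hdom L = hdom K" "hcod L = hcod K"
  using base by (auto simp: same_base_def)

lemma same_hpath [simp]: "hpath L = hpath K"
  by (rule hpath_cong) simp_all

lemma same_vhom [simp]: "vhom L = vhom K"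
  by (intro ext) (simp add: vhom_def)

lemma p_ends:
  assumes "\<phi> \<in> cells K"
  shows "p \<phi> \<in> cells L" "hsrc (p \<phi>) = hsrc \<phi>" "htgt (p \<phi>) = htgt \<phi>" "vsrc (p \<phi>) = vsrc \<phi>" "vtgt (p \<phi>) = vtgt \<phi>"
  using p_cell[OF assms] by auto

lemma q_ends:
  assumes "\<phi> \<in> cells L"
  shows "q \<phi> \<in> cells K" "p (q \<phi>) = \<phi>" "hsrc (q \<phi>) = hsrc \<phi>" "htgt (q \<phi>) = htgt \<phi>"
    "vsrc (q \<phi>) = vsrc \<phi>" "vtgt (q \<phi>) = vtgt \<phi>"
  using q_cell[OF assms] p_ends[of "q \<phi>"] by auto

lemma symmetric: "cell_iso L K q p"
proof (intro cell_iso.intro cell_iso_axioms.intro K.avdc_axioms L.avdc_axioms)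
  show "same_base L K" by (simp add: same_base_def)
next
  fix \<phi> assume "\<phi> \<in> cells L"
  from q_ends[OF this] show "q \<phi> \<in> cells K \<and> hsrc (q \<phi>) = hsrc \<phi> \<and> htgt (q \<phi>) = htgt \<phi> \<and>
    vsrc (q \<phi>) = vsrc \<phi> \<and> vtgt (q \<phi>) = vtgt \<phi>" "p (q \<phi>) = \<phi>" by simp_all
next
  fix \<phi> assume "\<phi> \<in> cells K"
  from p_ends(1)[OF this] q_p[OF this] show "p \<phi> \<in> cells L \<and> q (p \<phi>) = \<phi>" by simp
next
  fix \<psi> \<phi>s assume 5: "composable L \<psi> \<phi>s"
  have sub: "\<psi> \<in> cells L" "set \<phi>s \<subseteq> cells L" using 5 by (auto simp: composable_def)
  have c: "composable K (q \<psi>) (map q \<phi>s)"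
    by (rule composable_map[OF 5]) (simp add: q_ends)
  have "map p (map q \<phi>s) = \<phi>s" using sub q_ends(2) by (auto simp: subset_iff intro!: map_idI)
  then have "p (cmp K (q \<psi>) (map q \<phi>s)) = cmp L \<psi> \<phi>s" using p_cmp[OF c] q_ends(2)[OF sub(1)] by simp
  then show "q (cmp L \<psi> \<phi>s) = cmp K (q \<psi>) (map q \<phi>s)"
    using q_p[of "cmp K (q \<psi>) (map q \<phi>s)"] K.cmp_cell[OF c] by simp
next
  fix J assume "J \<in> hmor L"
  then have J: "J \<in> hmor K" by simp
  show "q (hidc L J) = hidc K J" using q_p[OF K.hidc_ends(1)[OF J]] p_hidc[OF J] by simp
next
  fix f assume "f \<in> vmor L"
  then have f: "f \<in> vmor K" by simp
  show "q (vidc L f) = vidc K f" using q_p[OF K.vidc_ends(1)[OF f]] p_vidc[OF f] by simp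
qed

lemma iso_fpath:
  assumes "hpath K (fst T) (snd T) B"
  shows "fpath (iso_avfun K L p) T = T"
  using K.path_hmor[OF assms] K.path_ends[OF assms] by (auto simp: fpath_def prod_eq_iff intro!: map_idI)

lemma iso_functor: "avfunctor (iso_avfun K L p)"
proof (rule avfunctor.intro)
  fix \<psi> \<phi>s assume "composable (fdom (iso_avfun K L p)) \<psi> \<phi>s"
  then have c: "composable K \<psi> \<phi>s" by simp
  then have m: "map (fcell (iso_avfun K L p)) \<phi>s = map p \<phi>s" and s: "\<psi> \<in> cells K" "cmp K \<psi> \<phi>s \<in> cells K"
    using K.cmp_cell[OF c] by (auto simp: composable_def)
  show "fcell (iso_avfun K L p) (cmp (fdom (iso_avfun K L p)) \<psi> \<phi>s) =
      cmp (fcod (iso_avfun K L p)) (fcell (iso_avfun K L p) \<psi>) (map (fcell (iso_avfun K L p)) \<phi>s)"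
    unfolding m using p_cmp[OF c] s by simp
next
  fix \<phi> assume "\<phi> \<in> cells (fdom (iso_avfun K L p))"
  then have c: "\<phi> \<in> cells K" by simp
  note e = K.cell_ends[OF c] and P = p_ends[OF c]
  have "fpath (iso_avfun K L p) (hsrc \<phi>) = hsrc \<phi>" "fpath (iso_avfun K L p) (htgt \<phi>) = htgt \<phi>"
    using iso_fpath[of "hsrc \<phi>"] iso_fpath[of "htgt \<phi>"] e by simp_all
  then show "fcell (iso_avfun K L p) \<phi> \<in> cells (fcod (iso_avfun K L p)) \<and>
      hsrc (fcell (iso_avfun K L p) \<phi>) = fpath (iso_avfun K L p) (hsrc \<phi>) \<and>
      htgt (fcell (iso_avfun K L p) \<phi>) = fpath (iso_avfun K L p) (htgt \<phi>) \<and>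
      vsrc (fcell (iso_avfun K L p) \<phi>) = fver (iso_avfun K L p) (vsrc \<phi>) \<and>
      vtgt (fcell (iso_avfun K L p) \<phi>) = fver (iso_avfun K L p) (vtgt \<phi>)"
    using c e P by simp
next
  show "avdc (fdom (iso_avfun K L p))" "avdc (fcod (iso_avfun K L p))"
    using K.avdc_axioms L.avdc_axioms by simp_all
qed (use K.vmor_ends K.hmor_ends K.vid_ends K.vcmp_ends K.hidc_ends K.vidc_ends p_hidc p_vidc in
    \<open>auto simp: vhom_iff iso_avfun_def\<close>)

lemma iso_comp: "comp_avfun (iso_avfun L K q) (iso_avfun K L p) = id_avfun K"
proof (rule avfun_eqI)
  show "avfunctor (comp_avfun (iso_avfun L K q) (iso_avfun K L p))"
    by (intro comp_avfun_functor iso_functor cell_iso.iso_functor[OF symmetric]) simp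
qed (simp_all add: K.id_avfun_functor p_ends q_p)

text \<open>A cell is factored by factoring its image under \<open>q\<close> and transporting the
  factor along \<open>p\<close>. This makes the components of the isomorphism between
  \<open>U(N(K))\<close> and \<open>K\<close> normal, as arrows of \<open>VirtDblCat_u\<close> have
  to be.\<close>

lemma iso_cocartesian:
  assumes "cocartesian_unit_cell K A I u"
  shows "cocartesian_unit_cell L A I (p u)"
proof -
  note c = cocartesian_ends[OF assms] and v = K.cocartesian_vends[OF assms]
  note P = p_ends[OF c(4)]
  have "\<exists>!\<phi>'. \<phi>' \<in> cells L \<and> hsrc \<phi>' = (X, Js @ [I] @ Hs) \<and> htgt \<phi>' = htgt \<phi> \<and> vsrc \<phi>' = vsrc \<phi> \<and> vtgt \<phi>' = vtgt \<phi> \<and>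
      \<phi> = cmp L \<phi>' (map (hidc L) Js @ [p u] @ map (hidc L) Hs)"
    if a: "\<phi> \<in> cells L" "unary \<phi>" "hpath K X Js A" "hpath K A Hs Y" "hsrc \<phi> = (X, Js @ Hs)" for \<phi> X Js Hs Y
  proof -
    note Q = q_ends[OF a(1)]
    have un: "unary (q \<phi>)" "hsrc (q \<phi>) = (X, Js @ Hs)" using Q a by (simp_all add: unary_def)
    from K.whisk_composable(1)[OF a(3,4) c(4) v(2,3)]
    have comp: "composable K \<chi> (K.whisk Js u Hs)" if "\<chi> \<in> cells K" "hsrc \<chi> = (X, Js @ [I] @ Hs)" for \<chi>
      using that c(7) by simp
    have "map p (K.whisk Js u Hs) = map (hidc L) Js @ [p u] @ map (hidc L) Hs"
      using K.path_hmor[OF a(3)] K.path_hmor[OF a(4)] p_hidc by auto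
    then have pc: "p (cmp K \<chi> (K.whisk Js u Hs)) = cmp L (p \<chi>) (map (hidc L) Js @ [p u] @ map (hidc L) Hs)"
      if "\<chi> \<in> cells K" "hsrc \<chi> = (X, Js @ [I] @ Hs)" for \<chi>
      using p_cmp[OF comp[OF that]] by argo
    from cocartesian_factor[OF assms Q(1) un(1) a(3,4) un(2)] obtain x where
      x: "x \<in> cells K" "hsrc x = (X, Js @ [I] @ Hs)" "htgt x = htgt (q \<phi>)" "vsrc x = vsrc (q \<phi>)" "vtgt x = vtgt (q \<phi>)"
        "q \<phi> = cmp K x (K.whisk Js u Hs)" and
      ux: "\<And>y. y \<in> cells K \<Longrightarrow> hsrc y = (X, Js @ [I] @ Hs) \<Longrightarrow> htgt y = htgt (q \<phi>) \<Longrightarrow> vsrc y = vsrc (q \<phi>) \<Longrightarrow>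
        vtgt y = vtgt (q \<phi>) \<Longrightarrow> q \<phi> = cmp K y (K.whisk Js u Hs) \<Longrightarrow> y = x"
      by (elim ex1E) blast
    show ?thesis
    proof (rule ex1I[of _ "p x"])
      show "p x \<in> cells L \<and> hsrc (p x) = (X, Js @ [I] @ Hs) \<and> htgt (p x) = htgt \<phi> \<and> vsrc (p x) = vsrc \<phi> \<and> vtgt (p x) = vtgt \<phi> \<and>
          \<phi> = cmp L (p x) (map (hidc L) Js @ [p u] @ map (hidc L) Hs)"
        using p_ends[OF x(1)] x Q pc[OF x(1,2)] by metis
    next
      fix y assume y: "y \<in> cells L \<and> hsrc y = (X, Js @ [I] @ Hs) \<and> htgt y = htgt \<phi> \<and> vsrc y = vsrc \<phi> \<and> vtgt y = vtgt \<phi> \<and>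
          \<phi> = cmp L y (map (hidc L) Js @ [p u] @ map (hidc L) Hs)"
      then have yL: "y \<in> cells L" by blast
      note R = q_ends[OF yL]
      have hy: "hsrc (q y) = (X, Js @ [I] @ Hs)" using R y by simp
      have "p (cmp K (q y) (K.whisk Js u Hs)) = \<phi>" using pc[OF R(1) hy] R(2) y by simp
      moreover have "cmp K (q y) (K.whisk Js u Hs) \<in> cells K" using K.cmp_cell[OF comp[OF R(1) hy]] by blast
      ultimately have "q \<phi> = cmp K (q y) (K.whisk Js u Hs)" using q_p by metis
      then have "q y = x" using ux[OF R(1) hy] R Q y by simp
      then show "y = p x" using R(2) by simp
    qed
  qed
  moreover have "horizontal_cell L (p u)" using c(5) P by (simp add: horizontal_cell_def)
  ultimately show ?thesis
    unfolding cocartesian_unit_cell_def using c P by (simp del: append_Cons append_Nil) blast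
qed

lemma iso_normal: "normal (iso_avfun K L p)"
  unfolding normal_def
proof (intro ballI allI impI)
  fix A I u assume "A \<in> obj (fdom (iso_avfun K L p))" "cocartesian_unit_cell (fdom (iso_avfun K L p)) A I u"
  then show "cocartesian_unit_cell (fcod (iso_avfun K L p)) (fobj (iso_avfun K L p) A) (fhor (iso_avfun K L p) I)
      (fcell (iso_avfun K L p) u)"
    using iso_cocartesian[of A I u] cocartesian_ends[of K A I u] by simp
qed

end

text \<open>The isomorphisms fix objects and morphisms, so there both sides are \<open>F\<close>;
  the content is the last premise, on cells.\<close>

lemma iso_natural1:
  assumes "cell_iso K K' p q" "cell_iso L L' p' q'" "avfunctor F" "avfunctor F'"
    "fdom F = K" "fcod F = L" "fdom F' = K'" "fcod F' = L'"
    "\<And>A. A \<in> obj K \<Longrightarrow> fobj F' A = fobj F A" "\<And>f. f \<in> vmor K \<Longrightarrow> fver F' f = fver F f"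
    "\<And>J. J \<in> hmor K \<Longrightarrow> fhor F' J = fhor F J" "\<And>\<phi>. \<phi> \<in> cells K \<Longrightarrow> fcell F' (p \<phi>) = p' (fcell F \<phi>)"
  shows "comp_avfun F' (iso_avfun K K' p) = comp_avfun (iso_avfun L L' p') F"
proof -
  interpret P: cell_iso K K' p q by fact
  interpret P': cell_iso L L' p' q' by fact
  interpret F: avfunctor F by fact
  show ?thesis
    by (rule avfun_eqI)
      (use assms(3-8) F.fobj_obj F.fver_ends F.fhor_hom F.fcell_ends in
        \<open>simp_all add: comp_avfun_functor P.iso_functor P'.iso_functor assms(9-12)\<close>)
qed

text \<open>The identity transformations contribute identity cells, which cancel; what remains at a
  horizontal morphism is the last premise.\<close>

lemma iso_natural2:
  assumes "cell_iso K K' p q" "cell_iso L L' p' q'" "avtransformation \<xi>" "avtransformation \<xi>'"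
    "fdom (tsrc \<xi>) = K" "fcod (tsrc \<xi>) = L" "fdom (tsrc \<xi>') = K'" "fcod (tsrc \<xi>') = L'"
    "comp_avfun (tsrc \<xi>') (iso_avfun K K' p) = comp_avfun (iso_avfun L L' p') (tsrc \<xi>)"
    "comp_avfun (ttgt \<xi>') (iso_avfun K K' p) = comp_avfun (iso_avfun L L' p') (ttgt \<xi>)"
    "\<And>A. A \<in> obj K \<Longrightarrow> tobj \<xi>' A = tobj \<xi> A" "\<And>J. J \<in> hmor K \<Longrightarrow> thor \<xi>' J = p' (thor \<xi> J)"
  shows "hcomp_avtrans \<xi>' (id_avtrans (iso_avfun K K' p)) = hcomp_avtrans (id_avtrans (iso_avfun L L' p')) \<xi>"
proof -
  interpret P: cell_iso K K' p q by fact
  interpret P': cell_iso L L' p' q' by fact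
  interpret x: avtransformation \<xi> by fact
  interpret y: avtransformation \<xi>' by fact
  show ?thesis
  proof (rule avtrans_eqI)
    show "avtransformation (hcomp_avtrans \<xi>' (id_avtrans (iso_avfun K K' p)))"
      using assms by (intro hcomp_avtrans_transformation avfunctor.id_avtrans_transformation P.iso_functor) simp_all
    show "avtransformation (hcomp_avtrans (id_avtrans (iso_avfun L L' p')) \<xi>)"
      using assms by (intro hcomp_avtrans_transformation avfunctor.id_avtrans_transformation P'.iso_functor) simp_all
  next
    fix A assume "A \<in> obj (fdom (tsrc (hcomp_avtrans \<xi>' (id_avtrans (iso_avfun K K' p)))))"
    then have A: "A \<in> obj K" "A \<in> obj K'" by simp_all
    note t = y.tobj_ends[unfolded assms(7,8), OF A(2)] and u = x.tobj_ends[unfolded assms(5,6), OF A(1)]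
    have G: "fobj (ttgt \<xi>) A \<in> obj L" using x.G.fobj_obj[of A] A assms(5,6) by simp
    have "vcmp L' (tobj \<xi>' A) (fver (tsrc \<xi>') (vid K' A)) = tobj \<xi>' A"
      using P'.L.vid_neutral[OF t(1)] t y.F.fver_id[of A] A assms(7,8) by simp
    moreover have "vcmp L' (vid L' (fobj (ttgt \<xi>) A)) (tobj \<xi> A) = tobj \<xi> A"
      using P'.K.vid_neutral[OF u(1)] u by simp
    ultimately show "tobj (hcomp_avtrans \<xi>' (id_avtrans (iso_avfun K K' p))) A =
        tobj (hcomp_avtrans (id_avtrans (iso_avfun L L' p')) \<xi>) A"
      using A assms(5-8) assms(11)[OF A(1)] u G by simp
  next
    fix J assume "J \<in> hmor (fdom (tsrc (hcomp_avtrans \<xi>' (id_avtrans (iso_avfun K K' p)))))"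
    then have J: "J \<in> hmor K" "J \<in> hmor K'" by simp_all
    note t = y.thor_ends[unfolded assms(7,8), OF J(2)] and u = x.thor_ends[unfolded assms(5,6), OF J(1)]
    have G: "fhor (ttgt \<xi>) J \<in> hmor L" using x.G.fhor_hom[of J] J assms(5,6) by simp
    have "cmp L' (thor \<xi>' J) [fcell (tsrc \<xi>') (hidc K' J)] = thor \<xi>' J"
      using P'.L.cmp_hidc_id[OF t(1,2)] y.F.fcell_hidc[of J] J assms(7,8) by simp
    moreover have "cmp L' (hidc L' (fhor (ttgt \<xi>) J)) [p' (thor \<xi> J)] = p' (thor \<xi> J)"
      using P'.L.hidc_comp[of "p' (thor \<xi> J)"] P'.p_ends[OF u(1)] u(3) by simp
    ultimately show "thor (hcomp_avtrans \<xi>' (id_avtrans (iso_avfun K K' p))) J =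
        thor (hcomp_avtrans (id_avtrans (iso_avfun L L' p')) \<xi>) J"
      using J assms(5-8) assms(12)[OF J(1)] u G by simp
  qed (simp_all add: assms)
qed

section \<open>The isomorphisms \<open>UN \<cong> id\<close> and \<open>id \<cong> NU\<close>\<close>

text \<open>Serves in both directions between \<open>U(N(K))\<close> and \<open>K\<close>. The
  nullary cells on either side are vertical identities, hence determined by their vertical
  source.\<close>

definition replace_nullary :: "('o, 'v, 'h, 'c) avdc \<Rightarrow> ('o, 'v, 'h, 'c) cell \<Rightarrow> ('o, 'v, 'h, 'c) cell" where
  "replace_nullary K \<phi> = (if unary \<phi> then \<phi> else vidc K (vsrc \<phi>))"

lemma (in avdc) not_unary_iff: "\<phi> \<in> cells K \<Longrightarrow> \<not> unary \<phi> \<longleftrightarrow> snd (htgt \<phi>) = []"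
  using cell_ends(7)[of \<phi>] by (auto simp: unary_def le_Suc_eq)

lemma (in avdc) replace_nullary_vidc:
  assumes "f \<in> vmor K"
  shows "replace_nullary L (vidc K f) = vidc L f" "\<not> unary (vidc K f)"
  using vidc_ends[OF assms] by (simp_all add: replace_nullary_def unary_def)

lemma (in vdc) cell_cases:
  assumes "\<phi> \<in> cells K"
  obtains "unary \<phi>" | f where "f \<in> vmor K" "\<phi> = vidc K f"
proof (cases "unary \<phi>")
  case False
  then have "nullary \<phi>" using not_unary_iff[OF assms] by (simp add: nullary_def)
  then show thesis using nullary_vidc[OF assms] that(2) by blast
qed (rule that(1))

context unital_vdc
begin

text \<open>For unary \<open>\<psi>\<close>, each \<open>\<phi>\<close> satisfies that
  \<open>hat \<phi>\<close> is \<open>uf \<phi>\<close> after the replacement of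
  \<open>\<phi>\<close>: trivially if \<open>\<phi>\<close> is unary, and by the form of vertical
  identities in \<open>N(K)\<close> otherwise. Hence the factor \<open>X\<close> after the hats is
  \<open>X\<close> after the unit factors after the replacements, that is, \<open>\<psi>\<close>
  after the replacements. For nullary \<open>\<psi>\<close> both composites are vertical
  identities.\<close>

lemma UN_iso: "cell_iso (U_obj N) K (replace_nullary K) (replace_nullary N)"
proof (intro cell_iso.intro cell_iso_axioms.intro N.U_avdc avdc_axioms)
  show "same_base (U_obj N) K" by (simp add: same_base_def)
  \<comment> \<open>Case distinction for cells of \<open>U(N(K))\<close>: unary cells, which are
    cells of \<open>K\<close>, and vertical identities of \<open>N(K)\<close>.\<close>
  have UN: thesis if "\<phi> \<in> cells (U_obj N)" "\<lbrakk>unary \<phi>; \<phi> \<in> cells K; hat \<phi> = \<phi>\<rbrakk> \<Longrightarrow> thesis"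
    "\<And>f. \<lbrakk>f \<in> vmor K; \<phi> = vidc N f\<rbrakk> \<Longrightarrow> thesis" for \<phi> thesis
  proof -
    from that(1) consider "\<phi> \<in> cells N" "unary \<phi>" | f where "f \<in> vmor K" "\<phi> = vidc N f" by auto
    then show thesis
    proof cases
      case 1
      then show thesis using that(2) hat_unary[OF 1(2)] N_ends(1)[OF 1(1)] by simp
    qed (rule that(3))
  qed
  have r: "replace_nullary K \<phi> \<in> cells K \<and> hsrc (replace_nullary K \<phi>) = hsrc \<phi> \<and>
      htgt (replace_nullary K \<phi>) = htgt \<phi> \<and> vsrc (replace_nullary K \<phi>) = vsrc \<phi> \<and> vtgt (replace_nullary K \<phi>) = vtgt \<phi>"
    if "\<phi> \<in> cells (U_obj N)" for \<phi>
    using that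
  proof (rule UN)
    assume "unary \<phi>" "\<phi> \<in> cells K"
    then show ?thesis by (simp add: replace_nullary_def)
  next
    fix f assume f: "f \<in> vmor K" "\<phi> = vidc N f"
    then show ?thesis using N.replace_nullary_vidc(1)[of f K] vidc_ends[OF f(1)] N_vidc(1-8)[OF f(1)] by simp
  qed
  then show "replace_nullary K \<phi> \<in> cells K \<and> hsrc (replace_nullary K \<phi>) = hsrc \<phi> \<and>
      htgt (replace_nullary K \<phi>) = htgt \<phi> \<and> vsrc (replace_nullary K \<phi>) = vsrc \<phi> \<and> vtgt (replace_nullary K \<phi>) = vtgt \<phi>"
    if "\<phi> \<in> cells (U_obj N)" for \<phi> using that .
  show "replace_nullary N \<phi> \<in> cells (U_obj N) \<and> replace_nullary K (replace_nullary N \<phi>) = \<phi>"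
    if "\<phi> \<in> cells K" for \<phi>
    using that
  proof (cases rule: cell_cases)
    case 1
    then show ?thesis using that unary_N by (simp add: replace_nullary_def)
  next
    case (2 f)
    then show ?thesis using replace_nullary_vidc(1)[of f N] N.replace_nullary_vidc(1)[of f K] by simp
  qed
  show "replace_nullary N (replace_nullary K \<phi>) = \<phi>" if "\<phi> \<in> cells (U_obj N)" for \<phi>
    using that
  proof (rule UN)
    assume "unary \<phi>"
    then show ?thesis by (simp add: replace_nullary_def)
  next
    fix f assume "f \<in> vmor K" "\<phi> = vidc N f"
    then show ?thesis using replace_nullary_vidc(1)[of f N] N.replace_nullary_vidc(1)[of f K] by simp
  qed
  show "replace_nullary K (hidc (U_obj N) J) = hidc K J" if "J \<in> hmor (U_obj N)" for J
    using hidc_ends[of J] that by (simp add: replace_nullary_def unary_def)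
  show "replace_nullary K (vidc (U_obj N) f) = vidc K f" if "f \<in> vmor (U_obj N)" for f
    using N.replace_nullary_vidc(1)[of f K] that by simp
  fix \<psi> \<phi>s assume c: "composable (U_obj N) \<psi> \<phi>s"
  have sub: "\<psi> \<in> cells (U_obj N)" "set \<phi>s \<subseteq> cells (U_obj N)" using c by (auto simp: composable_def)
  have cN: "composable N \<psi> \<phi>s" by (rule N.U_composable[OF c])
  have cK: "composable K (replace_nullary K \<psi>) (map (replace_nullary K) \<phi>s)"
    by (rule composable_map[OF c r])
  obtain f g where run: "\<psi> \<in> cells N" "cell_run N f \<phi>s g" using N_composable_run[OF cN] by metis
  note NC = N.cmp_run[OF cN run(2)]
  show "replace_nullary K (cmp (U_obj N) \<psi> \<phi>s) = cmp K (replace_nullary K \<psi>) (map (replace_nullary K) \<phi>s)"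
  proof (cases "unary \<psi>")
    case True
    then have u: "hat \<psi> = \<psi>" "unary (cmp N \<psi> \<phi>s)" using hat_unary NC(3) by (simp_all add: unary_def)
    obtain X where X: "composable K X (map uf \<phi>s)" "hat \<psi> = cmp K X (map uf \<phi>s)"
      "hat (cmp N \<psi> \<phi>s) = cmp K X (map hat \<phi>s)" using N_cmpE[OF cN run(2)] by metis
    have "composable K (uf \<phi>) [replace_nullary K \<phi>] \<and> cmp K (uf \<phi>) [replace_nullary K \<phi>] = hat \<phi>"
      if "\<phi> \<in> cells (U_obj N)" for \<phi>
      using that
    proof (rule UN)
      assume a: "unary \<phi>" "\<phi> \<in> cells K" "hat \<phi> = \<phi>"
      obtain J where J: "snd (htgt \<phi>) = [J]" using a(1) by (auto simp: unary_def length_Suc_conv)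
      then show ?thesis using composable_hidc[OF a(2) J] hidc_comp[OF a(2) J] a
        by (simp add: replace_nullary_def unit_factor_def nullary_def)
    next
      fix f assume f: "f \<in> vmor K" "\<phi> = vidc N f"
      then show ?thesis using N.replace_nullary_vidc(1)[of f K] N_vidc(6-8)[OF f(1)] by simp
    qed
    then have "map2 (\<lambda>z x. cmp K z [x]) (map uf \<phi>s) (map (replace_nullary K) \<phi>s) = map hat \<phi>s"
      "list_all2 (\<lambda>z x. composable K z [x]) (map uf \<phi>s) (map (replace_nullary K) \<phi>s)"
      using sub(2) by (induction \<phi>s) (simp_all del: U_obj_simps(10))
    moreover have "cell_path (map (replace_nullary K) \<phi>s)" using cK by (simp add: composable_def)
    ultimately have "cmp K X (map hat \<phi>s) = cmp K \<psi> (map (replace_nullary K) \<phi>s)"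
      using cmp_cols(1)[OF X(1), of "map (replace_nullary K) \<phi>s"] X(2) u(1) by simp
    then show ?thesis using X(3) u hat_unary[OF u(2)] True by (simp add: replace_nullary_def)
  next
    case False
    note KC = cmp_cell[OF cK]
    have n: "\<not> unary (cmp N \<psi> \<phi>s)" using False NC(3) by (simp add: unary_def)
    have "htgt (cmp K (replace_nullary K \<psi>) (map (replace_nullary K) \<phi>s)) = htgt \<psi>"
      using KC r[OF sub(1)] by simp
    then have "\<not> unary (cmp K (replace_nullary K \<psi>) (map (replace_nullary K) \<phi>s))"
      using False by (simp add: unary_def)
    then obtain h where h: "h \<in> vmor K" "cmp K (replace_nullary K \<psi>) (map (replace_nullary K) \<phi>s) = vidc K h"
      using cell_cases KC by metis
    have ne: "\<phi>s \<noteq> []" using cN by (simp add: composable_def)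
    then have "hd \<phi>s \<in> cells (U_obj N)" using sub(2) hd_in_set by blast
    from r[OF this] have "vsrc (replace_nullary K (hd \<phi>s)) = f"
      using cell_run_hd[OF run(2) ne] by simp
    then have "vsrc (cmp K (replace_nullary K \<psi>) (map (replace_nullary K) \<phi>s)) = vcmp K (vsrc \<psi>) f"
      using KC r[OF sub(1)] ne by (simp add: hd_map)
    \<comment> \<open>A vertical identity is determined by its vertical source, and the two
      composites have the same one.\<close>
    then have "h = vcmp K (vsrc \<psi>) f" using h vidc_ends[OF h(1)] by simp
    then show ?thesis using n NC(4) h(2) by (simp add: replace_nullary_def)
  qed
qed

end

text \<open>The unit laws of the structure cover a full row of horizontal identities or a single
  vertical one. In a mixed row the vertical identities are dropped; if there are no others, the
  first is kept, because the row must not become empty.\<close>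

lemma (in avdc) ids_neutral:
  assumes "composable K \<phi> us" "\<And>u. u \<in> set us \<Longrightarrow> (\<exists>J\<in>hmor K. u = hidc K J) \<or> (\<exists>A\<in>obj K. u = vidc K (vid K A))"
  shows "cmp K \<phi> us = \<phi>"
proof -
  let ?P = "\<lambda>u. u \<notin> vidc K ` vmor K"
  have us: "us \<noteq> []" using assms(1) by (simp add: composable_def)
  show ?thesis
  proof (cases "filter ?P us = []")
    case True
    then obtain u us' where u: "us = u # us'" "u \<in> vidc K ` vmor K" "filter ?P us' = []"
      using us by (cases us) (auto split: if_splits)
    then obtain A where A: "A \<in> obj K" "u = vidc K (vid K A)"
      using assms(2)[of u] hidc_not_vidc by (metis list.set_intros(1))
    have c: "composable K \<phi> [u]" "cmp K \<phi> us = cmp K \<phi> [u]"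
      using drop_vidcs[of \<phi> "[u]" us'] assms(1) u by auto
    then have "\<phi> \<in> cells K" "hsrc \<phi> = (A, [])"
      using A vidc_ends[OF vid_ends(1)[OF A(1)]] vid_ends[OF A(1)] by (simp_all add: composable_single)
    then show ?thesis using cmp_vidc_id c A by simp
  next
    case False
    have c: "composable K \<phi> (filter ?P us)" "cmp K \<phi> us = cmp K \<phi> (filter ?P us)"
      using drop_vidcs[of \<phi> "[]" us] assms(1) False by auto
    have "\<exists>Js. filter ?P us = map (hidc K) Js \<and> set Js \<subseteq> hmor K"
      using assms(2)
    proof (induction us)
      case (Cons u us)
      then obtain Js where Js: "filter ?P us = map (hidc K) Js" "set Js \<subseteq> hmor K" by auto
      show ?case
      proof (cases "?P u")
        case True
        then obtain J where "J \<in> hmor K" "u = hidc K J" using Cons.prems[of u] vid_ends(1) by auto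
        then show ?thesis using Js True by (intro exI[of _ "J # Js"]) simp
      qed (use Js in auto)
    qed simp
    then obtain Js where Js: "filter ?P us = map (hidc K) Js" "set Js \<subseteq> hmor K" by blast
    have f: "\<phi> \<in> cells K" "snd (hsrc \<phi>) = Js" "Js \<noteq> []"
      using c(1) Js htgts_hidcs[OF Js(2)] False composable_iff by auto
    then show ?thesis using c(2) Js cmp_hidc_id[OF f(1), of "fst (hsrc \<phi>)" Js] by (simp add: prod_eq_iff)
  qed
qed

text \<open>The choice is not vacuous: the cocartesian unit cells of \<open>U(K)\<close> are invertible in \<open>K\<close>.\<close>

definition unit_inverse ::
  "('o, 'v, 'h, 'c) avdc \<Rightarrow> ('o \<Rightarrow> ('o, 'v, 'h, 'c) cell) \<Rightarrow> 'o \<Rightarrow> ('o, 'v, 'h, 'c) cell" where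
  "unit_inverse K e C = (SOME \<epsilon>. unit_pair K C (hd (snd (htgt (e C)))) (e C) \<epsilon>)"

section \<open>The isomorphism from \<open>K\<close> to \<open>N(U(K))\<close>\<close>

definition to_NU ::
  "('o, 'v, 'h, 'c) avdc \<Rightarrow> ('o \<Rightarrow> ('o, 'v, 'h, 'c) cell) \<Rightarrow> ('o, 'v, 'h, 'c) cell \<Rightarrow> ('o, 'v, 'h, 'c) cell" where
  "to_NU K e \<phi> = (if unary \<phi> then \<phi> else (cmp K (e (fst (htgt \<phi>))) [\<phi>])\<lparr>htgt := htgt \<phi>\<rparr>)"

definition from_NU ::
  "('o, 'v, 'h, 'c) avdc \<Rightarrow> ('o \<Rightarrow> ('o, 'v, 'h, 'c) cell) \<Rightarrow> ('o, 'v, 'h, 'c) cell \<Rightarrow> ('o, 'v, 'h, 'c) cell" where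
  "from_NU K e \<phi> = (if unary \<phi> then \<phi> else cmp K (unit_inverse K e (fst (htgt \<phi>))) [to_unit e \<phi>])"

locale unital_avdc = avdc K for K :: "('o, 'v, 'h, 'c) avdc" +
  fixes e :: "'o \<Rightarrow> ('o, 'v, 'h, 'c) cell"
  assumes units: "has_units_aug K"
    and U_unit_choice: "unit_choice (U_obj K) e"
begin

sublocale V: unital_vdc "U_obj K" e
  by (intro unital_vdc.intro U_vdc unital_vdc_axioms.intro U_unit_choice)

abbreviation "eps C \<equiv> unit_inverse K e C"

lemma unit_pair_eps:
  assumes "C \<in> obj K"
  shows "unit_pair K C (V.unit_mor C) (e C) (eps C)"
proof -
  have C: "C \<in> obj (U_obj K)" using assms by simp
  obtain I \<epsilon>0 where "cartesian_unit_cell K C I \<epsilon>0" using units assms by (auto simp: has_units_aug_def)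
  then obtain \<eta>0 where "unit_pair K C I \<eta>0 \<epsilon>0" by (rule cartesian_unit_pair)
  from cocartesian_unit_pair[OF V.eta_cocartesian[OF C] this]
  obtain \<epsilon> where "unit_pair K C (V.unit_mor C) (e C) \<epsilon>" .
  then show ?thesis unfolding unit_inverse_def V.unit_mor_def by (rule someI)
qed

lemma nullary_comp:
  assumes "\<phi> \<in> cells K" "htgt \<phi> = (C, [])"
  shows "composable K (e C) [\<phi>]" "cmp K (e C) [\<phi>] \<in> cells K" "hsrc (cmp K (e C) [\<phi>]) = hsrc \<phi>"
    "htgt (cmp K (e C) [\<phi>]) = (C, [V.unit_mor C])" "vsrc (cmp K (e C) [\<phi>]) = vsrc \<phi>" "vtgt (cmp K (e C) [\<phi>]) = vtgt \<phi>"
    "C \<in> obj K" "cmp K (eps C) [cmp K (e C) [\<phi>]] = \<phi>" "composable K (eps C) [cmp K (e C) [\<phi>]]"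
proof -
  note k = cell_ends[OF assms(1)]
  show C: "C \<in> obj K" using k(4) assms(2) vmor_ends[OF k(1)] by simp
  note P = unit_pair_eps[OF C, unfolded unit_pair_def]
  have v: "vcod K (vsrc \<phi>) = C" "vcod K (vtgt \<phi>) = C" using k(4,6) assms(2) by auto
  note s = cmp_single[of "e C" \<phi>]
  show "composable K (e C) [\<phi>]" using P assms by (simp add: composable_single)
  show S: "cmp K (e C) [\<phi>] \<in> cells K" "hsrc (cmp K (e C) [\<phi>]) = hsrc \<phi>"
    "htgt (cmp K (e C) [\<phi>]) = (C, [V.unit_mor C])" "vsrc (cmp K (e C) [\<phi>]) = vsrc \<phi>" "vtgt (cmp K (e C) [\<phi>]) = vtgt \<phi>"
    using s P assms v vid_neutral(2)[OF k(1)] vid_neutral(2)[OF k(2)] by simp_all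
  show "composable K (eps C) [cmp K (e C) [\<phi>]]" using S P by (simp add: composable_single)
  show "cmp K (eps C) [cmp K (e C) [\<phi>]] = \<phi>"
    using single_assoc[of "eps C" "e C" \<phi>] P assms vidc_cmp[OF assms] by simp
qed

lemma unit_tgt_V: "C \<in> obj K \<Longrightarrow> V.unit_tgt (C, []) = (C, [V.unit_mor C])"
  using V.eta_ends(6)[of C] by (simp add: V.unit_tgt_def)

lemma nullary_tgt:
  assumes "\<phi> \<in> cells K" "\<not> unary \<phi>"
  shows "htgt \<phi> = (fst (htgt \<phi>), [])"
  using not_unary_iff[OF assms(1)] assms(2) by (simp add: prod_eq_iff)

lemma to_NU_cell:
  assumes "\<phi> \<in> cells K"
  shows "to_NU K e \<phi> \<in> cells V.N" "hsrc (to_NU K e \<phi>) = hsrc \<phi>" "htgt (to_NU K e \<phi>) = htgt \<phi>"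
    "vsrc (to_NU K e \<phi>) = vsrc \<phi>" "vtgt (to_NU K e \<phi>) = vtgt \<phi>"
    "V.hat (to_NU K e \<phi>) = (if unary \<phi> then \<phi> else cmp K (e (fst (htgt \<phi>))) [\<phi>])"
proof -
  have "to_NU K e \<phi> \<in> cells V.N \<and> hsrc (to_NU K e \<phi>) = hsrc \<phi> \<and> htgt (to_NU K e \<phi>) = htgt \<phi> \<and>
    vsrc (to_NU K e \<phi>) = vsrc \<phi> \<and> vtgt (to_NU K e \<phi>) = vtgt \<phi> \<and>
    V.hat (to_NU K e \<phi>) = (if unary \<phi> then \<phi> else cmp K (e (fst (htgt \<phi>))) [\<phi>])"
  proof (cases "unary \<phi>")
    case True
    then show ?thesis using V.unary_N[of \<phi>] V.hat_unary[of \<phi>] assms by (simp add: to_NU_def)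
  next
    case False
    define C where "C = fst (htgt \<phi>)"
    have T: "htgt \<phi> = (C, [])" using nullary_tgt[OF assms False] C_def by simp
    note n = nullary_comp[OF assms T]
    have U: "cmp K (e C) [\<phi>] \<in> cells (U_obj K)" using n(2,4) by (simp add: unary_def)
    note u = V.N_update[OF U, of "(C, [])"]
    show ?thesis using u n unit_tgt_V[OF n(7)] False T by (simp add: to_NU_def)
  qed
  then show "to_NU K e \<phi> \<in> cells V.N" "hsrc (to_NU K e \<phi>) = hsrc \<phi>" "htgt (to_NU K e \<phi>) = htgt \<phi>"
    "vsrc (to_NU K e \<phi>) = vsrc \<phi>" "vtgt (to_NU K e \<phi>) = vtgt \<phi>"
    "V.hat (to_NU K e \<phi>) = (if unary \<phi> then \<phi> else cmp K (e (fst (htgt \<phi>))) [\<phi>])"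
    by blast+
qed

text \<open>For composition, let \<open>?H\<close> be the hat of the image of \<open>\<psi>\<close>,
  and below it place \<open>?E \<phi>\<close>: the inverse of the unit if \<open>\<phi>\<close> is
  nullary, and a horizontal identity otherwise. Composed with the unit factors, the
  \<open>?E\<close> become identities, so \<open>?X\<close>, which is \<open>?H\<close> after them,
  is the factor of \<open>?H\<close>. Composed with the hats they give back \<open>\<phi>s\<close>,
  so the composite in \<open>N(U(K))\<close> has hat \<open>?H\<close> after \<open>\<phi>s\<close>,
  and this is the hat of the image of \<open>\<psi>\<close> after \<open>\<phi>s\<close>.\<close>

lemma NU_iso: "cell_iso K V.N (to_NU K e) (from_NU K e)"
proof (intro cell_iso.intro cell_iso_axioms.intro avdc_axioms V.N_avdc)
  show "same_base K V.N" by (simp add: same_base_def)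
  show "to_NU K e \<phi> \<in> cells V.N \<and> hsrc (to_NU K e \<phi>) = hsrc \<phi> \<and> htgt (to_NU K e \<phi>) = htgt \<phi> \<and>
    vsrc (to_NU K e \<phi>) = vsrc \<phi> \<and> vtgt (to_NU K e \<phi>) = vtgt \<phi>" if "\<phi> \<in> cells K" for \<phi>
    using to_NU_cell[OF that] by blast
  show "from_NU K e \<phi> \<in> cells K \<and> to_NU K e (from_NU K e \<phi>) = \<phi>" if "\<phi> \<in> cells V.N" for \<phi>
  proof (cases "unary \<phi>")
    case True
    then show ?thesis using V.hat_unary[OF True] U_cells[OF V.N_ends(1)[OF that]]
      by (simp add: from_NU_def to_NU_def)
  next
    case False
    note n = V.N_ends[OF that]
    define C where "C = fst (htgt \<phi>)"
    have T: "htgt \<phi> = (C, [])" using False n(4) C_def by (auto simp: prod_eq_iff unary_def le_Suc_eq)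
    have C: "C \<in> obj K" using n(3) C_def by simp
    note P = unit_pair_eps[OF C, unfolded unit_pair_def]
    have h: "V.hat \<phi> \<in> cells K" "htgt (V.hat \<phi>) = (C, [V.unit_mor C])"
      using U_cells[OF n(1)] n(5) T unit_tgt_V[OF C] by simp_all
    note s = cmp_single[of "eps C" "V.hat \<phi>"]
    have s1: "cmp K (eps C) [V.hat \<phi>] \<in> cells K" "htgt (cmp K (eps C) [V.hat \<phi>]) = (C, [])" using s P h by simp_all
    have "cmp K (e C) [cmp K (eps C) [V.hat \<phi>]] = V.hat \<phi>"
      using single_assoc[of "e C" "eps C" "V.hat \<phi>"] P h hidc_comp[OF h(1)] by simp
    moreover have "from_NU K e \<phi> = cmp K (eps C) [V.hat \<phi>]" using False C_def by (simp add: from_NU_def)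
    moreover have "\<not> unary (cmp K (eps C) [V.hat \<phi>])" using s1(2) by (simp add: unary_def)
    ultimately have "to_NU K e (from_NU K e \<phi>) = (V.hat \<phi>)\<lparr>htgt := htgt \<phi>\<rparr>"
      using s1 T by (simp add: to_NU_def)
    then show ?thesis using V.hat_back s1(1) \<open>from_NU K e \<phi> = cmp K (eps C) [V.hat \<phi>]\<close> by simp
  qed
  show "from_NU K e (to_NU K e \<phi>) = \<phi>" if "\<phi> \<in> cells K" for \<phi>
  proof (cases "unary \<phi>")
    case True
    then show ?thesis by (simp add: from_NU_def to_NU_def)
  next
    case False
    note c = to_NU_cell[OF that] and n = nullary_comp[OF that nullary_tgt[OF that False]]
    have "\<not> unary (to_NU K e \<phi>)" using False c(3) by (simp add: unary_def)
    then have "from_NU K e (to_NU K e \<phi>) = cmp K (eps (fst (htgt \<phi>))) [cmp K (e (fst (htgt \<phi>))) [\<phi>]]"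
      using c(3,6) False by (simp add: from_NU_def)
    then show ?thesis using n(8) by simp
  qed
  show "to_NU K e (hidc K J) = hidc V.N J" if "J \<in> hmor K" for J
    using hidc_ends[OF that] by (simp add: to_NU_def unary_def)
  show "to_NU K e (vidc K f) = vidc V.N f" if "f \<in> vmor K" for f
    using V.N_vidc(9)[of f] vidc_ends[OF that] that by (simp add: to_NU_def unary_def)
  fix \<psi> \<phi>s assume c: "composable K \<psi> \<phi>s"
  obtain f g where r: "cell_run K f \<phi>s g" "\<psi> \<in> cells K" "\<phi>s \<noteq> []" "vcod K f = vdom K (vsrc \<psi>)" "snd (hsrc \<psi>) = htgts \<phi>s"
    using composableE[OF c] by metis
  have sub: "set \<phi>s \<subseteq> cells K" using cell_run_cells[OF r(1)] .
  note pp = to_NU_cell[OF r(2)]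
  have cN: "composable V.N (to_NU K e \<psi>) (map (to_NU K e) \<phi>s)"
    by (rule composable_map[OF c]) (use to_NU_cell in blast)
  obtain f' g' where rN: "cell_run V.N f' (map (to_NU K e) \<phi>s) g'" using V.N_composable_run[OF cN] by metis
  let ?H = "V.hat (to_NU K e \<psi>)"
  let ?E = "\<lambda>\<phi>. if unary \<phi> then hidc K (hd (snd (htgt \<phi>))) else eps (fst (htgt \<phi>))"
    and ?id = "\<lambda>\<phi>. if unary \<phi> then hidc K (hd (snd (htgt \<phi>))) else vidc K (vid K (fst (htgt \<phi>)))"
    and ?u = "\<lambda>\<phi>. V.uf (to_NU K e \<phi>)" and ?h = "\<lambda>\<phi>. V.hat (to_NU K e \<phi>)"
  have E: "composable K (?E \<phi>) [?u \<phi>]" "cmp K (?E \<phi>) [?u \<phi>] = ?id \<phi>" "composable K (?E \<phi>) [?h \<phi>]"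
    "cmp K (?E \<phi>) [?h \<phi>] = \<phi>" "snd (htgt (?E \<phi>)) = snd (htgt \<phi>)" "?E \<phi> \<in> cells K"
    "vsrc (?E \<phi>) = vid K (vcod K (vsrc \<phi>))" "vtgt (?E \<phi>) = vid K (vcod K (vtgt \<phi>))"
    "(\<exists>J\<in>hmor K. ?id \<phi> = hidc K J) \<or> (\<exists>A\<in>obj K. ?id \<phi> = vidc K (vid K A))"
    if p: "\<phi> \<in> cells K" for \<phi>
  proof -
    note k = cell_ends[OF p] and t = to_NU_cell[OF p]
    have "composable K (?E \<phi>) [?u \<phi>] \<and> cmp K (?E \<phi>) [?u \<phi>] = ?id \<phi> \<and> composable K (?E \<phi>) [?h \<phi>] \<and>
      cmp K (?E \<phi>) [?h \<phi>] = \<phi> \<and> snd (htgt (?E \<phi>)) = snd (htgt \<phi>) \<and> ?E \<phi> \<in> cells K \<and>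
      vsrc (?E \<phi>) = vid K (vcod K (vsrc \<phi>)) \<and> vtgt (?E \<phi>) = vid K (vcod K (vtgt \<phi>)) \<and>
      ((\<exists>J\<in>hmor K. ?id \<phi> = hidc K J) \<or> (\<exists>A\<in>obj K. ?id \<phi> = vidc K (vid K A)))"
    proof (cases "unary \<phi>")
      case True
      then obtain J where J: "snd (htgt \<phi>) = [J]" by (auto simp: unary_def length_Suc_conv)
      then have j: "J \<in> hmor K" "hdom K J = vcod K (vsrc \<phi>)" "hcod K J = vcod K (vtgt \<phi>)" using k(6) by auto
      note h = hidc_ends[OF j(1)]
      have u: "?u \<phi> = hidc K J" using t(3) J by (simp add: unit_factor_def nullary_def)
      have "composable K (hidc K J) [hidc K J]" "cmp K (hidc K J) [hidc K J] = hidc K J"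
        using composable_hidc[OF h(1)] hidc_comp[OF h(1)] h(3) by simp_all
      then show ?thesis
        using True J j h u t(6) composable_hidc[OF p J] hidc_comp[OF p J] by auto
    next
      case False
      define C where "C = fst (htgt \<phi>)"
      have T: "htgt \<phi> = (C, [])" using nullary_tgt[OF p False] C_def by simp
      note n = nullary_comp[OF p T]
      note P = unit_pair_eps[OF n(7), unfolded unit_pair_def]
      have u: "?u \<phi> = e C" using t(3) T by (simp add: unit_factor_def nullary_def)
      have v: "vcod K (vsrc \<phi>) = C" "vcod K (vtgt \<phi>) = C" using k(4,6) T by auto
      have "composable K (eps C) [e C]" using P by (simp add: composable_single)
      then show ?thesis using False T u v n P t(6) by simp blast
    qed
    then show "composable K (?E \<phi>) [?u \<phi>]" "cmp K (?E \<phi>) [?u \<phi>] = ?id \<phi>" "composable K (?E \<phi>) [?h \<phi>]"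
      "cmp K (?E \<phi>) [?h \<phi>] = \<phi>" "snd (htgt (?E \<phi>)) = snd (htgt \<phi>)" "?E \<phi> \<in> cells K"
      "vsrc (?E \<phi>) = vid K (vcod K (vsrc \<phi>))" "vtgt (?E \<phi>) = vid K (vcod K (vtgt \<phi>))"
      "(\<exists>J\<in>hmor K. ?id \<phi> = hidc K J) \<or> (\<exists>A\<in>obj K. ?id \<phi> = vidc K (vid K A))"
      by blast+
  qed
  have cols: "map2 (\<lambda>z x. cmp K z [x]) (map ?E \<phi>s) (map ?u \<phi>s) = map ?id \<phi>s"
    "list_all2 (\<lambda>z x. composable K z [x]) (map ?E \<phi>s) (map ?u \<phi>s)"
    "map2 (\<lambda>z x. cmp K z [x]) (map ?E \<phi>s) (map ?h \<phi>s) = \<phi>s"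
    "list_all2 (\<lambda>z x. composable K z [x]) (map ?E \<phi>s) (map ?h \<phi>s)"
    "htgts (map ?E \<phi>s) = htgts \<phi>s"
    using sub E(1-5) by (induction \<phi>s) auto
  have Erun: "cell_run K (vid K (vcod K f)) (map ?E \<phi>s) (vid K (vcod K g))"
    using r(1)
  proof (induction \<phi>s arbitrary: f)
    case Nil
    then show ?case using vmor_ends[of g] by (auto simp: vid_ends)
  next
    case (Cons \<phi> \<phi>s)
    then show ?case using E(6-8)[of \<phi>] by simp
  qed
  have HU: "?H \<in> cells (U_obj K)" "unary ?H" using V.N_ends[OF pp(1)] by blast+
  have H: "?H \<in> cells K" "snd (hsrc ?H) = htgts \<phi>s" "vsrc ?H = vsrc \<psi>"
    using U_cells[OF HU(1)] pp(2,4) r(5) by simp_all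
  have fo: "vcod K f \<in> obj K" using run_ends[OF r(1)] vmor_ends by blast
  have HE: "composable K ?H (map ?E \<phi>s)"
    by (rule composableI[OF H(1) _ Erun]) (use r(3,4) H(2,3) cols(5) vid_ends(3)[OF fo] in simp_all)
  let ?X = "cmp K ?H (map ?E \<phi>s)"
  have cp: "cell_path (map ?u \<phi>s)" "cell_path (map ?h \<phi>s)"
    using cell_run_cell_path[OF V.uf_run(1)[OF rN]] rN V.N_run_iff[of f' "map (to_NU K e) \<phi>s" g'] 
      cell_run_cell_path[of "U_obj K" f' "map V.hat (map (to_NU K e) \<phi>s)" g']
    by (simp_all add: o_def)
  note C1 = cmp_cols[OF HE cols(2) cp(1)] and C2 = cmp_cols[OF HE cols(4) cp(2)]
  have "cmp K ?H (map ?id \<phi>s) = ?H"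
  proof (rule ids_neutral)
    show "composable K ?H (map ?id \<phi>s)" using C1(3) unfolding cols(1) .
    fix u assume "u \<in> set (map ?id \<phi>s)"
    then obtain \<phi> where "\<phi> \<in> cells K" "u = ?id \<phi>" unfolding set_map using sub by blast
    then show "(\<exists>J\<in>hmor K. u = hidc K J) \<or> (\<exists>A\<in>obj K. u = vidc K (vid K A))"
      using E(9) by blast
  qed
  then have X1: "?H = cmp K ?X (map ?u \<phi>s)" using C1(1) cols(1) by simp
  \<comment> \<open>The inverses \<open>eps\<close> are not cells of \<open>U(K)\<close>, but the
    factor is one, since its target is that of the unary cell \<open>?H\<close>.\<close>
  have XU: "?X \<in> cells (U_obj K)"
    using cmp_run[OF HE Erun] HU(2) by (simp add: unary_def)
  have uU: "set (map ?u \<phi>s) \<subseteq> cells (U_obj K)"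
    using V.uf_ends(1) to_NU_cell(1) sub by auto
  have "composable (U_obj K) ?X (map V.uf (map (to_NU K e) \<phi>s))"
    using C1(2) XU uU by (simp add: composable_def o_def del: U_obj_simps(10))
  moreover have "V.hat (to_NU K e \<psi>) = cmp (U_obj K) ?X (map V.uf (map (to_NU K e) \<phi>s))"
    using X1 by (simp add: o_def)
  ultimately have R: "V.hat (cmp V.N (to_NU K e \<psi>) (map (to_NU K e) \<phi>s)) = cmp K ?X (map ?h \<phi>s)"
    "htgt (cmp V.N (to_NU K e \<psi>) (map (to_NU K e) \<phi>s)) = htgt \<psi>"
    using V.N_cmp(2,5)[OF rN pp(1), of ?X] pp(3) by (simp_all add: o_def)
  note cc = cmp_run[OF c r(1)] and tc = to_NU_cell[OF cmp_run(1)[OF c r(1)]]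
  have "V.hat (to_NU K e (cmp K \<psi> \<phi>s)) = cmp K ?H \<phi>s"
  proof (cases "unary \<psi>")
    case True
    then show ?thesis using tc(6) pp(6) cc(3) by (simp add: unary_def)
  next
    case False
    note n = nullary_comp[OF r(2) nullary_tgt[OF r(2) False]]
    show ?thesis using tc(6) pp(6) cc(3) False cmp_single_assoc(1)[OF n(1) c] by (simp add: unary_def)
  qed
  then have "V.hat (to_NU K e (cmp K \<psi> \<phi>s)) = V.hat (cmp V.N (to_NU K e \<psi>) (map (to_NU K e) \<phi>s))"
    using R(1) C2(1) cols(3) by simp
  moreover have "htgt (to_NU K e (cmp K \<psi> \<phi>s)) = htgt (cmp V.N (to_NU K e \<psi>) (map (to_NU K e) \<phi>s))"
    using R(2) tc(3) cc(3) by simp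
  ultimately show "to_NU K e (cmp K \<psi> \<phi>s) = cmp V.N (to_NU K e \<psi>) (map (to_NU K e) \<phi>s)"
    by (rule V.N_eqI)
qed

end


section \<open>The 2-natural isomorphisms\<close>

lemma two_functor_comp:
  assumes "two_functor C D F" "two_functor D E G"
  shows "two_functor C E (comp_two_fun G F)"
proof -
  interpret F: two_functor C D F by fact
  interpret G: two_functor D E G by fact
  show ?thesis
    by unfold_locales
      (auto simp: comp_two_fun_def F.on0_ob F.on1_arr F.on2_two F.on1_id F.on1_comp F.on2_id F.on2_vcomp F.on2_hcomp
        G.on0_ob G.on1_arr G.on2_two G.on1_id G.on1_comp G.on2_id G.on2_vcomp G.on2_hcomp F.C.two_ends)
qed

lemma two_functor_id:
  assumes "two_category C"
  shows "two_functor C C id_two_fun"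
proof -
  interpret two_category C by fact
  show ?thesis by unfold_locales (auto simp: id_two_fun_def)
qed

context unit_choices
begin

abbreviation "\<sigma> K \<equiv> iso_avfun (U_obj (N_obj (\<eta> K) K)) K (replace_nullary K)"
abbreviation "\<tau> K \<equiv> iso_avfun K (N_obj (\<eta> (U_obj K)) (U_obj K)) (to_NU K (\<eta> (U_obj K)))"

text \<open>On unary cells \<open>N(F)\<close> agrees with \<open>F\<close>, and vertical identities
  are preserved by both functors and by the relabelling.\<close>

lemma \<sigma>_natural1:
  assumes "normal_functor F \<eta>"
  shows "comp_avfun F (\<sigma> (fdom F)) = comp_avfun (\<sigma> (fcod F)) (U_arr (N_arr \<eta> F))"
proof -
  interpret normal_functor F \<eta> by fact
  interpret NF: avfunctor NF by (rule N_arr_functor)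
  show ?thesis
  proof (rule iso_natural1[OF A.UN_iso B.UN_iso NF.U_arr_functor avfunctor_axioms])
    fix \<phi> assume p: "\<phi> \<in> cells (U_obj A.N)"
    then consider "\<phi> \<in> cells A.N" "unary \<phi>" | f where "f \<in> vmor (fdom F)" "\<phi> = vidc A.N f" by auto
    then show "fcell F (replace_nullary (fdom F) \<phi>) = replace_nullary (fcod F) (fcell (U_arr NF) \<phi>)"
    proof cases
      case 1
      have c: "\<phi> \<in> cells (fdom F)" using A.N_ends(1)[OF 1(1)] A.hat_unary[OF 1(2)] by simp
      have "unary (fcell F \<phi>)" using fcell_ends(3)[OF c] 1(2) by (simp add: unary_def fpath_def)
      then show ?thesis using NF_unary[OF c 1(2)] p 1(2) by (simp add: replace_nullary_def del: U_obj_simps(10))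
    next
      case 2
      have "fcell (U_arr NF) \<phi> = vidc B.N (fver F f)"
        using NF.fcell_vidc[of f] p 2 by (simp del: U_obj_simps(10))
      then show ?thesis
        using A.N.replace_nullary_vidc(1)[of f "fdom F"] B.N.replace_nullary_vidc(1)[of "fver F f" "fcod F"]
          2 fver_ends(1)[OF 2(1)] fcell_vidc[OF 2(1)] by simp
    qed
  qed simp_all
qed

lemma \<sigma>_natural2:
  assumes "avtransformation \<xi>" "normal_functor (tsrc \<xi>) \<eta>" "normal_functor (ttgt \<xi>) \<eta>"
  shows "hcomp_avtrans \<xi> (id_avtrans (\<sigma> (fdom (tsrc \<xi>)))) =
    hcomp_avtrans (id_avtrans (\<sigma> (fcod (tsrc \<xi>)))) (U_two (N_two \<eta> \<xi>))"
proof -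
  interpret x: avtransformation \<xi> by fact
  interpret F: normal_functor "tsrc \<xi>" \<eta> by fact
  show ?thesis
  proof (rule iso_natural2[OF F.A.UN_iso F.B.UN_iso
        avtransformation.U_two_transformation[OF N_two_transformation[OF assms]] assms(1)])
    fix J assume "J \<in> hmor (U_obj F.A.N)"
    then have "unary (thor \<xi> J)" using x.thor_ends(3)[of J] by (simp add: unary_def)
    then show "thor \<xi> J = replace_nullary x.L (thor (U_two (N_two \<eta> \<xi>)) J)"
      by (simp add: replace_nullary_def)
  qed (use \<sigma>_natural1[OF assms(2)] \<sigma>_natural1[OF assms(3)] in simp_all)
qed

lemma unital_avdc_U:
  assumes "avdc K" "has_units_aug K"
  shows "unital_avdc K (\<eta> (U_obj K))"
  using assms unital_vdc.unit_choice[OF unital[OF avdc.U_vdc avdc.U_has_units]]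
  by (simp add: unital_avdc_def unital_avdc_axioms_def)

lemma normal_functor_U:
  assumes "avfunctor F" "has_units_aug (fdom F)" "has_units_aug (fcod F)"
  shows "normal_functor (U_arr F) \<eta>"
proof -
  interpret avfunctor F by fact
  show ?thesis
    using assms by (intro normal_functorI U_arr_functor U_arr_normal)
      (simp_all add: dom.U_vdc cod.U_vdc dom.U_has_units cod.U_has_units)
qed

text \<open>At a nullary \<open>\<phi>\<close> with target \<open>C\<close>, the hat of the
  left-hand side is the comparison cell after the image of the unit of \<open>C\<close> after
  \<open>F \<phi>\<close>. The defining equation of the comparison turns this into the chosen unit
  of \<open>fobj F C\<close> after \<open>F \<phi>\<close>, the hat of the right-hand side.\<close>

lemma \<tau>_natural1:
  assumes "avfunctor F" "has_units_aug (fdom F)" "has_units_aug (fcod F)"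
  shows "comp_avfun (N_arr \<eta> (U_arr F)) (\<tau> (fdom F)) = comp_avfun (\<tau> (fcod F)) F"
proof -
  interpret avfunctor F by fact
  interpret A: unital_avdc "fdom F" "\<eta> (U_obj (fdom F))" by (rule unital_avdc_U[OF fdom_avdc assms(2)])
  interpret B: unital_avdc "fcod F" "\<eta> (U_obj (fcod F))" by (rule unital_avdc_U[OF fcod_avdc assms(3)])
  interpret U: normal_functor "U_arr F" \<eta> by (rule normal_functor_U[OF assms])
  let ?e = "\<eta> (U_obj (fdom F))" and ?e' = "\<eta> (U_obj (fcod F))"
  show ?thesis
  proof (rule iso_natural1[OF A.NU_iso B.NU_iso assms(1) U.N_arr_functor])
    fix \<phi> assume p: "\<phi> \<in> cells (fdom F)"
    note f = fcell_ends[OF p] and t = A.to_NU_cell[OF p] and s = B.to_NU_cell[OF fcell_ends(1)[OF p]]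
    show "fcell (N_arr \<eta> (U_arr F)) (to_NU (fdom F) ?e \<phi>) = to_NU (fcod F) ?e' (fcell F \<phi>)"
    proof (cases "unary \<phi>")
      case True
      then have "unary (fcell F \<phi>)" using f(3) by (simp add: unary_def fpath_def)
      moreover have "\<phi> \<in> cells (U_obj (fdom F))" using p True by simp
      ultimately show ?thesis using U.NF_unary[of \<phi>] True by (simp add: to_NU_def del: U_obj_simps(10))
    next
      case False
      define C where "C = fst (htgt \<phi>)"
      have T: "htgt \<phi> = (C, [])" using A.nullary_tgt[OF p False] C_def by simp
      have T': "htgt (fcell F \<phi>) = (fobj F C, [])" "\<not> unary (fcell F \<phi>)"
        using f(3) T by (simp_all add: fpath_def unary_def)
      note n = A.nullary_comp[OF p T]
      have C: "C \<in> obj (fdom (U_arr F))" using n(7) by simp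
      note c = U.comparison_unit(1,2,4)[OF C]
      have eU: "?e C \<in> cells (U_obj (fdom F))" using A.V.eta_ends(4)[of C] n(7) by (simp del: U_obj_simps(10))
      have nU: "cmp (fdom F) (?e C) [\<phi>] \<in> cells (U_obj (fdom F))" using n(2,4) by (simp add: unary_def)
      let ?c = "unit_comparison \<eta> (U_arr F) (C, [])"
      have c': "composable (fcod F) ?c [fcell F (?e C)]" "cmp (fcod F) ?c [fcell F (?e C)] = ?e' (fobj F C)"
        using cod.U_composable[of ?c "[fcell F (?e C)]"] c(1,2) eU by (simp_all del: U_obj_simps(10))
      have "to_unit ?e' (fcell (N_arr \<eta> (U_arr F)) (to_NU (fdom F) ?e \<phi>)) =
          cmp (fcod F) ?c [fcell F (cmp (fdom F) (?e C) [\<phi>])]"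
        using U.NF_cell(3)[of "to_NU (fdom F) ?e \<phi>"] t(1,3,6) False T nU by (simp del: U_obj_simps(10))
      also have "\<dots> = cmp (fcod F) ?c [cmp (fcod F) (fcell F (?e C)) [fcell F \<phi>]]"
        using fcell_cmp[OF n(1)] by simp
      also have "\<dots> = cmp (fcod F) (?e' (fobj F C)) [fcell F \<phi>]"
        using cod.cmp_single_assoc(1)[OF c'(1), of "[fcell F \<phi>]"] fcell_composable[OF n(1)] c'(2) by simp
      also have "\<dots> = to_unit ?e' (to_NU (fcod F) ?e' (fcell F \<phi>))" using s(6) T' by simp
      finally have "to_unit ?e' (fcell (N_arr \<eta> (U_arr F)) (to_NU (fdom F) ?e \<phi>)) =
        to_unit ?e' (to_NU (fcod F) ?e' (fcell F \<phi>))" .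
      moreover have "htgt (fcell (N_arr \<eta> (U_arr F)) (to_NU (fdom F) ?e \<phi>)) = htgt (to_NU (fcod F) ?e' (fcell F \<phi>))"
        using U.NF_cell(5)[of "to_NU (fdom F) ?e \<phi>"] t(1,3) s(3) f(3) by simp
      ultimately show ?thesis by (rule B.V.N_eqI)
    qed
  qed simp_all
qed

text \<open>The components at horizontal morphisms are unary, and \<open>to_NU\<close> leaves unary
  cells unchanged.\<close>

lemma \<tau>_natural2:
  assumes "avtransformation \<xi>" "has_units_aug (fdom (tsrc \<xi>))" "has_units_aug (fcod (tsrc \<xi>))"
  shows "hcomp_avtrans (N_two \<eta> (U_two \<xi>)) (id_avtrans (\<tau> (fdom (tsrc \<xi>)))) =
    hcomp_avtrans (id_avtrans (\<tau> (fcod (tsrc \<xi>)))) \<xi>"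
proof -
  interpret x: avtransformation \<xi> by fact
  interpret A: unital_avdc x.D "\<eta> (U_obj x.D)" by (rule unital_avdc_U[OF x.F.fdom_avdc assms(2)])
  interpret B: unital_avdc x.L "\<eta> (U_obj x.L)" by (rule unital_avdc_U[OF x.F.fcod_avdc assms(3)])
  have n: "normal_functor (U_arr (tsrc \<xi>)) \<eta>" "normal_functor (U_arr (ttgt \<xi>)) \<eta>"
    using normal_functor_U[OF x.F.avfunctor_axioms] normal_functor_U[OF x.G.avfunctor_axioms] assms(2,3) by simp_all
  have N: "avtransformation (N_two \<eta> (U_two \<xi>))"
    using n by (intro N_two_transformation x.U_two_transformation) simp_all
  show ?thesis
  proof (rule iso_natural2[OF A.NU_iso B.NU_iso assms(1) N])
    fix J assume "J \<in> hmor x.D"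
    then have "unary (thor \<xi> J)" using x.thor_ends(3)[of J] by (simp add: unary_def)
    then show "thor (N_two \<eta> (U_two \<xi>)) J = to_NU x.L (\<eta> (U_obj x.L)) (thor \<xi> J)"
      by (simp add: to_NU_def)
  qed (use \<tau>_natural1[OF x.F.avfunctor_axioms] \<tau>_natural1[OF x.G.avfunctor_axioms] assms(2,3) in simp_all)
qed

lemma \<sigma>_invertible:
  "invertible_two_nat_trans VirtDblCat_u VirtDblCat_u (comp_two_fun U_fun (N_fun \<eta>)) id_two_fun \<sigma>"
proof (rule inverse_two_nat_trans)
  let ?\<tau> = "\<lambda>K. iso_avfun K (U_obj (N_obj (\<eta> K) K)) (replace_nullary (N_obj (\<eta> K) K))"
  have on: "on0 (comp_two_fun U_fun (N_fun \<eta>)) = (\<lambda>K. U_obj (N_obj (\<eta> K) K))"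
    "on1 (comp_two_fun U_fun (N_fun \<eta>)) = (\<lambda>F. U_arr (N_arr \<eta> F))"
    "on2 (comp_two_fun U_fun (N_fun \<eta>)) = (\<lambda>\<xi>. U_two (N_two \<eta> \<xi>))"
    by (auto simp: comp_two_fun_def U_fun_def N_fun_def)
  have UN: "vdc (U_obj (N_obj (\<eta> K) K))" "has_units_virt (U_obj (N_obj (\<eta> K) K))"
    "cell_iso (U_obj (N_obj (\<eta> K) K)) K (replace_nullary K) (replace_nullary (N_obj (\<eta> K) K))"
    if "vdc K" "has_units_virt K" for K
  proof -
    interpret unital_vdc K "\<eta> K" by (rule unital[OF that])
    show "vdc (U_obj N)" "has_units_virt (U_obj N)" using N.U_vdc N.U_has_units[OF N_has_units] by blast+
    show "cell_iso (U_obj N) K (replace_nullary K) (replace_nullary N)" by (rule UN_iso)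
  qed
  show "two_nat_trans VirtDblCat_u VirtDblCat_u (comp_two_fun U_fun (N_fun \<eta>)) id_two_fun \<sigma>"
  proof (intro two_nat_trans.intro two_nat_trans_axioms.intro two_functor_comp[OF N_two_functor U_two_functor]
      two_functor_id two_category_virt)
    fix K :: "('o, 'v, 'h, 'c) avdc" assume "K \<in> Ob VirtDblCat_u"
    then have K: "vdc K" "has_units_virt K" by (simp_all add: VirtDblCat_u_def)
    show "\<sigma> K \<in> Arr VirtDblCat_u \<and> src1 VirtDblCat_u (\<sigma> K) = on0 (comp_two_fun U_fun (N_fun \<eta>)) K \<and>
        trg1 VirtDblCat_u (\<sigma> K) = on0 id_two_fun K"
      using UN[OF K] K cell_iso.iso_functor[OF UN(3)[OF K]] cell_iso.iso_normal[OF UN(3)[OF K]]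
      by (simp add: VirtDblCat_u_def on id_two_fun_def)
  next
    fix F :: "('o, 'v, 'h, 'c) avfun" assume "F \<in> Arr VirtDblCat_u"
    then have "normal_functor F \<eta>" by (intro normal_functorI) (simp_all add: VirtDblCat_u_def)
    from \<sigma>_natural1[OF this]
    show "comp1 VirtDblCat_u (on1 id_two_fun F) (\<sigma> (src1 VirtDblCat_u F)) =
        comp1 VirtDblCat_u (\<sigma> (trg1 VirtDblCat_u F)) (on1 (comp_two_fun U_fun (N_fun \<eta>)) F)"
      by (simp add: VirtDblCat_u_def on id_two_fun_def)
  next
    fix \<xi> :: "('o, 'v, 'h, 'c) avtrans" assume "\<xi> \<in> Two VirtDblCat_u"
    then have x: "avtransformation \<xi>" "normal_functor (tsrc \<xi>) \<eta>" "normal_functor (ttgt \<xi>) \<eta>"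
      by (auto simp: VirtDblCat_u_def intro!: normal_functorI)
    from \<sigma>_natural2[OF this]
    show "hcomp2 VirtDblCat_u (on2 id_two_fun \<xi>) (id2 VirtDblCat_u (\<sigma> (src1 VirtDblCat_u (src2 VirtDblCat_u \<xi>)))) =
        hcomp2 VirtDblCat_u (id2 VirtDblCat_u (\<sigma> (trg1 VirtDblCat_u (src2 VirtDblCat_u \<xi>))))
          (on2 (comp_two_fun U_fun (N_fun \<eta>)) \<xi>)"
      by (simp add: VirtDblCat_u_def on id_two_fun_def)
  qed
  fix K :: "('o, 'v, 'h, 'c) avdc" assume "K \<in> Ob VirtDblCat_u"
  then have K: "vdc K" "has_units_virt K" by (simp_all add: VirtDblCat_u_def)
  interpret i: cell_iso "U_obj (N_obj (\<eta> K) K)" K "replace_nullary K" "replace_nullary (N_obj (\<eta> K) K)"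
    by (rule UN(3)[OF K])
  interpret j: cell_iso K "U_obj (N_obj (\<eta> K) K)" "replace_nullary (N_obj (\<eta> K) K)" "replace_nullary K"
    by (rule i.symmetric)
  show "?\<tau> K \<in> Arr VirtDblCat_u \<and> src1 VirtDblCat_u (?\<tau> K) = on0 id_two_fun K \<and>
      trg1 VirtDblCat_u (?\<tau> K) = on0 (comp_two_fun U_fun (N_fun \<eta>)) K"
    using UN[OF K] K j.iso_functor j.iso_normal by (simp add: VirtDblCat_u_def on id_two_fun_def)
  show "comp1 VirtDblCat_u (?\<tau> K) (\<sigma> K) = id1 VirtDblCat_u (on0 (comp_two_fun U_fun (N_fun \<eta>)) K) \<and>
      comp1 VirtDblCat_u (\<sigma> K) (?\<tau> K) = id1 VirtDblCat_u (on0 id_two_fun K)"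
    using i.iso_comp j.iso_comp by (simp add: VirtDblCat_u_def on id_two_fun_def)
qed

lemma \<tau>_invertible:
  "invertible_two_nat_trans AugVirtDblCat_u AugVirtDblCat_u id_two_fun (comp_two_fun (N_fun \<eta>) U_fun) \<tau>"
proof (rule inverse_two_nat_trans)
  let ?\<rho> = "\<lambda>K. iso_avfun (N_obj (\<eta> (U_obj K)) (U_obj K)) K (from_NU K (\<eta> (U_obj K)))"
  have on: "on0 (comp_two_fun (N_fun \<eta>) U_fun) = (\<lambda>K. N_obj (\<eta> (U_obj K)) (U_obj K))"
    "on1 (comp_two_fun (N_fun \<eta>) U_fun) = (\<lambda>F. N_arr \<eta> (U_arr F))"
    "on2 (comp_two_fun (N_fun \<eta>) U_fun) = (\<lambda>\<xi>. N_two \<eta> (U_two \<xi>))"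
    by (auto simp: comp_two_fun_def U_fun_def N_fun_def)
  have NU: "has_units_aug (N_obj (\<eta> (U_obj K)) (U_obj K))"
    "cell_iso K (N_obj (\<eta> (U_obj K)) (U_obj K)) (to_NU K (\<eta> (U_obj K))) (from_NU K (\<eta> (U_obj K)))"
    if "avdc K" "has_units_aug K" for K
  proof -
    interpret unital_avdc K "\<eta> (U_obj K)" by (rule unital_avdc_U[OF that])
    show "has_units_aug V.N" by (rule V.N_has_units)
    show "cell_iso K V.N (to_NU K (\<eta> (U_obj K))) (from_NU K (\<eta> (U_obj K)))" by (rule NU_iso)
  qed
  show "two_nat_trans AugVirtDblCat_u AugVirtDblCat_u id_two_fun (comp_two_fun (N_fun \<eta>) U_fun) \<tau>"
  proof (intro two_nat_trans.intro two_nat_trans_axioms.intro two_functor_comp[OF U_two_functor N_two_functor]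
      two_functor_id two_category_aug)
    fix K :: "('o, 'v, 'h, 'c) avdc" assume "K \<in> Ob AugVirtDblCat_u"
    then have K: "avdc K" "has_units_aug K" by (simp_all add: AugVirtDblCat_u_def)
    show "\<tau> K \<in> Arr AugVirtDblCat_u \<and> src1 AugVirtDblCat_u (\<tau> K) = on0 id_two_fun K \<and>
        trg1 AugVirtDblCat_u (\<tau> K) = on0 (comp_two_fun (N_fun \<eta>) U_fun) K"
      using NU[OF K] K cell_iso.iso_functor[OF NU(2)[OF K]]
      by (simp add: AugVirtDblCat_u_def on id_two_fun_def)
  next
    fix F :: "('o, 'v, 'h, 'c) avfun" assume "F \<in> Arr AugVirtDblCat_u"
    then have "avfunctor F" "has_units_aug (fdom F)" "has_units_aug (fcod F)" by (simp_all add: AugVirtDblCat_u_def)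
    from \<tau>_natural1[OF this]
    show "comp1 AugVirtDblCat_u (on1 (comp_two_fun (N_fun \<eta>) U_fun) F) (\<tau> (src1 AugVirtDblCat_u F)) =
        comp1 AugVirtDblCat_u (\<tau> (trg1 AugVirtDblCat_u F)) (on1 id_two_fun F)"
      by (simp add: AugVirtDblCat_u_def on id_two_fun_def)
  next
    fix \<xi> :: "('o, 'v, 'h, 'c) avtrans" assume "\<xi> \<in> Two AugVirtDblCat_u"
    then have "avtransformation \<xi>" "has_units_aug (fdom (tsrc \<xi>))" "has_units_aug (fcod (tsrc \<xi>))"
      by (simp_all add: AugVirtDblCat_u_def)
    from \<tau>_natural2[OF this]
    show "hcomp2 AugVirtDblCat_u (on2 (comp_two_fun (N_fun \<eta>) U_fun) \<xi>)
          (id2 AugVirtDblCat_u (\<tau> (src1 AugVirtDblCat_u (src2 AugVirtDblCat_u \<xi>)))) =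
        hcomp2 AugVirtDblCat_u (id2 AugVirtDblCat_u (\<tau> (trg1 AugVirtDblCat_u (src2 AugVirtDblCat_u \<xi>))))
          (on2 id_two_fun \<xi>)"
      by (simp add: AugVirtDblCat_u_def on id_two_fun_def)
  qed
  fix K :: "('o, 'v, 'h, 'c) avdc" assume "K \<in> Ob AugVirtDblCat_u"
  then have K: "avdc K" "has_units_aug K" by (simp_all add: AugVirtDblCat_u_def)
  interpret i: cell_iso K "N_obj (\<eta> (U_obj K)) (U_obj K)" "to_NU K (\<eta> (U_obj K))" "from_NU K (\<eta> (U_obj K))"
    by (rule NU(2)[OF K])
  interpret j: cell_iso "N_obj (\<eta> (U_obj K)) (U_obj K)" K "from_NU K (\<eta> (U_obj K))" "to_NU K (\<eta> (U_obj K))"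
    by (rule i.symmetric)
  show "?\<rho> K \<in> Arr AugVirtDblCat_u \<and> src1 AugVirtDblCat_u (?\<rho> K) = on0 (comp_two_fun (N_fun \<eta>) U_fun) K \<and>
      trg1 AugVirtDblCat_u (?\<rho> K) = on0 id_two_fun K"
    using NU[OF K] K j.iso_functor by (simp add: AugVirtDblCat_u_def on id_two_fun_def)
  show "comp1 AugVirtDblCat_u (?\<rho> K) (\<tau> K) = id1 AugVirtDblCat_u (on0 id_two_fun K) \<and>
      comp1 AugVirtDblCat_u (\<tau> K) (?\<rho> K) = id1 AugVirtDblCat_u (on0 (comp_two_fun (N_fun \<eta>) U_fun) K)"
    using i.iso_comp j.iso_comp by (simp add: AugVirtDblCat_u_def on id_two_fun_def)
qed

end

theorem theorem10p1:
  fixes \<eta> :: "('o, 'v, 'h, 'c) avdc \<Rightarrow> 'o \<Rightarrow> ('o, 'v, 'h, 'c) cell"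
  assumes "\<And>K. K \<in> Ob VirtDblCat_u \<Longrightarrow> unit_choice K (\<eta> K)"
  shows "two_functor (AugVirtDblCat_u :: ('o, 'v, 'h, 'c) avdc_two_cat)
      (VirtDblCat_u :: ('o, 'v, 'h, 'c) avdc_two_cat) U_fun \<and>
    (\<exists>N :: ('o, 'v, 'h, 'c) avdc_two_fun.
      two_functor VirtDblCat_u AugVirtDblCat_u N \<and>
      (\<forall>K\<in>Ob VirtDblCat_u. on0 N K = N_obj (\<eta> K) K) \<and>
      (\<exists>\<sigma>. invertible_two_nat_trans VirtDblCat_u VirtDblCat_u
        (comp_two_fun U_fun N) id_two_fun \<sigma>) \<and>
      (\<exists>\<tau>. invertible_two_nat_trans AugVirtDblCat_u AugVirtDblCat_u
        id_two_fun (comp_two_fun N U_fun) \<tau>))"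
proof -
  interpret unit_choices \<eta>
    by unfold_locales (simp add: assms VirtDblCat_u_def)
  have "on0 (N_fun \<eta>) K = N_obj (\<eta> K) K" for K
    by (simp add: N_fun_def)
  then show ?thesis
    using U_two_functor N_two_functor \<sigma>_invertible \<tau>_invertible by blast
qed

end
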